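(* Let $d\ge1$, $q\in(0,1]$, $n=[dq^{-1}]+1$, and let $h_1,h_2\in\mathsf l^\infty(\mathsf L^2)(\mathbb R^d)$. Let $a=a(\mathbf x,\boldsymbol\xi)$ be a symbol on $\mathbb R^{2d}$. (1) Suppose that $F_{n,n}(\cdot;a)\in\mathsf l^q(\mathsf L^1)(\mathbb R^{2d})$. Then for any $t\in[0,1]$ $$\|h_1\,\mathrm{Op}_{1,t}(a)\,h_2\|_{\mathfrak S_q}\le C_q\,|\!|\!|h_1|\!|\!|_{2,\infty}\,|\!|\!|h_2|\!|\!|_{2,\infty}\,|\!|\!|F_{n,n}(a)|\!|\!|_{1,q}.$$ (2) Suppose that the distance between the supports of $h_1$ and $h_2$ is at least $r\ge1$. If $F^\circ_{n,m}(\cdot;a)\in\mathsf l^q(\mathsf L^1)(\mathbb R^{2d})$ for some $m\ge n$, then for any $t\in[0,1]$ $$\|h_1\,\mathrm{Op}_{1,t}(a)\,h_2\|_{\mathfrak S_q}\le C_{q,m}\,r^{\frac dq-m}\,|\!|\!|h_1|\!|\!|_{2,\infty}\,|\!|\!|h_2|\!|\!|_{2,\infty}\,|\!|\!|F^\circ_{n,m}(a)|\!|\!|_{1,q}.$$ The constants $C_q$ (depending only on $d,q$) and $C_{q,m}$ (depending only on $d,q,m$) are independent of $t\in[0,1]$, $h_1,h_2$, $a$ and $r$.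
   Context: $[\,\cdot\,]$ is the integer part. For $0<q<\infty$, $\mathfrak S_q$ is the set of compact operators $A$ on a Hilbert space (here $L^2(\mathbb R^d)$) with singular values $s_k(A)$ such that $\|A\|_{\mathfrak S_q}=(\sum_k s_k(A)^q)^{1/q}<\infty$. Lattice quasi-norms: let $\mathcal C_{\mathbf u}\subset\mathbb R^N$ be the (axis-parallel) unit cube centred at $\mathbf u\in\mathbb R^N$. For $h\in L^r_{\rm loc}(\mathbb R^N)$, $0<r<\infty$, put $|\!|\!|h|\!|\!|_{r,\delta}=\big[\sum_{\mathbf n\in\mathbb Z^N}\big(\int_{\mathcal C_{\mathbf n}}|h|^r\big)^{\delta/r}\big]^{1/\delta}$ for $0<\delta<\infty$, and $|\!|\!|h|\!|\!|_{r,\infty}=\sup_{\mathbf u\in\mathbb R^N}\big(\int_{\mathcal C_{\mathbf u}}|h|^r\big)^{1/r}$. Write $h\in\mathsf l^\delta(\mathsf L^r)(\mathbb R^N)$ if $|\!|\!|h|\!|\!|_{r,\delta}<\infty$. Operators: for $\alpha>0$, $t\in[0,1]$ and a symbol $a$, $(\mathrm{Op}_{\alpha,t}(a)u)(\mathbf x)=\big(\frac{\alpha}{2\pi}\big)^d\iint e^{i\alpha(\mathbf x-\mathbf y)\cdot\boldsymbol\xi}a((1-t)\mathbf x+t\mathbf y,\boldsymbol\xi)u(\mathbf y)\,d\mathbf y\,d\boldsymbol\xi$ for Schwartz $u$; when the $\boldsymbol\xi$-integral is not absolutely convergent it is understood as an oscillatory integral (distributional kernel). $h_1,h_2$ act by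 multiplication; $h_1\mathrm{Op}_{1,t}(a)h_2$ is the operator with kernel $h_1(\mathbf x)k(\mathbf x,\mathbf y)h_2(\mathbf y)$, $k$ being the kernel of $\mathrm{Op}_{1,t}(a)$. For $n,m=0,1,\dots$, $$F^\circ_{n,m}(\mathbf w,\boldsymbol\xi;a)=\sum_{k=0}^n|\nabla_{\mathbf w}^k\nabla_{\boldsymbol\xi}^m a(\mathbf w,\boldsymbol\xi)|,\qquad F_{n,m}(\mathbf w,\boldsymbol\xi;a)=\sum_{l=0}^m F^\circ_{n,l}(\mathbf w,\boldsymbol\xi;a),$$ where $\nabla^k$ is the tensor of all partial derivatives of order $k$. Symbols are complex-valued and smooth, in the sense that all derivatives that appear exist and are continuous. *)

theory Defs
  imports "HOL-Analysis.Analysis"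
begin

section \<open>The Hilbert space of square integrable complex functions\<close>

definition sq_integrable :: "('v::euclidean_space \<Rightarrow> complex) \<Rightarrow> bool" where
  "sq_integrable f \<longleftrightarrow>
     f \<in> borel_measurable lebesgue \<and> integrable lebesgue (\<lambda>x. (norm (f x))\<^sup>2)"

definition L2_rel :: "('v::euclidean_space \<Rightarrow> complex) \<Rightarrow> ('v \<Rightarrow> complex) \<Rightarrow> bool" where
  "L2_rel f g \<longleftrightarrow> sq_integrable f \<and> sq_integrable g \<and> (AE x in lebesgue. f x = g x)"

lemma sq_integrable_zero: "sq_integrable (\<lambda>x. 0)"
  by (simp add: sq_integrable_def)

lemma sq_integrable_scale:
  assumes "sq_integrable f"
  shows "sq_integrable (\<lambda>x. c * f x)"
proof -
  have m: "f \<in> borel_measurable lebesgue" and i: "integrable lebesgue (\<lambda>x. (norm (f x))\<^sup>2)"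
    using assms by (simp_all only: sq_integrable_def)
  have "(\<lambda>x. c * f x) \<in> borel_measurable lebesgue"
    by (rule borel_measurable_times[OF borel_measurable_const m])
  moreover have "integrable lebesgue (\<lambda>x. (norm c)\<^sup>2 * (norm (f x))\<^sup>2)"
    by (rule integrable_mult_right) (rule i)
  ultimately show ?thesis
    by (simp only: sq_integrable_def norm_mult power_mult_distrib simp_thms)
qed

lemma sq_integrable_add:
  assumes "sq_integrable f" "sq_integrable g"
  shows "sq_integrable (\<lambda>x. f x + g x)"
proof -
  have m[measurable]: "f \<in> borel_measurable lebesgue" "g \<in> borel_measurable lebesgue"
    using assms by (auto simp: sq_integrable_def)
  have bd: "norm ((norm (f x + g x))\<^sup>2) \<le> norm (2 * (norm (f x))\<^sup>2 + 2 * (norm (g x))\<^sup>2)" for x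
  proof -
    have "(norm (f x + g x))\<^sup>2 \<le> (norm (f x) + norm (g x))\<^sup>2"
      by (intro power_mono norm_triangle_ineq) auto
    also have "\<dots> \<le> 2 * (norm (f x))\<^sup>2 + 2 * (norm (g x))\<^sup>2"
      using sum_squares_bound[of "norm (f x)" "norm (g x)"]
      by (simp add: power2_sum)
    finally show ?thesis by simp
  qed
  have "integrable lebesgue (\<lambda>x. 2 * (norm (f x))\<^sup>2 + 2 * (norm (g x))\<^sup>2)"
    using assms by (simp add: sq_integrable_def)
  then have "integrable lebesgue (\<lambda>x. (norm (f x + g x))\<^sup>2)"
    by (rule Bochner_Integration.integrable_bound) (measurable, simp only: bd eventually_True)
  then show ?thesis by (simp add: sq_integrable_def)
qed

lemma integrable_inner_sq_integrable:
  assumes "sq_integrable f" "sq_integrable g"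
  shows "integrable lebesgue (\<lambda>x. f x \<bullet> g x)"
proof -
  have m[measurable]: "f \<in> borel_measurable lebesgue" "g \<in> borel_measurable lebesgue"
    using assms by (auto simp: sq_integrable_def)
  have bd: "norm (f x \<bullet> g x) \<le> norm ((norm (f x))\<^sup>2 + (norm (g x))\<^sup>2)" for x
  proof -
    have "norm (f x \<bullet> g x) \<le> norm (f x) * norm (g x)"
      by (simp add: Cauchy_Schwarz_ineq2)
    also have "\<dots> \<le> (norm (f x))\<^sup>2 + (norm (g x))\<^sup>2"
      using sum_squares_bound[of "norm (f x)" "norm (g x)"]
        mult_nonneg_nonneg[OF norm_ge_zero[of "f x"] norm_ge_zero[of "g x"]] by linarith
    finally show ?thesis by simp
  qed
  have "integrable lebesgue (\<lambda>x. (norm (f x))\<^sup>2 + (norm (g x))\<^sup>2)"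
    using assms by (simp add: sq_integrable_def)
  then show ?thesis
    by (rule Bochner_Integration.integrable_bound) (measurable, simp only: bd eventually_True)
qed

quotient_type (overloaded) 'v L2 = "'v::euclidean_space \<Rightarrow> complex" / partial: L2_rel
proof (rule part_equivpI)
  show "\<exists>f. L2_rel f f"
    by (rule exI[of _ "\<lambda>x. 0"]) (simp add: L2_rel_def sq_integrable_zero)
  show "symp L2_rel" by (auto simp: symp_def L2_rel_def)
  show "transp L2_rel" by (auto simp: transp_def L2_rel_def)
qed

lemma L2_relI:
  assumes "sq_integrable f" "sq_integrable g" "\<And>x. f x = g x"
  shows "L2_rel f g"
  using assms by (simp add: L2_rel_def)

lemma L2_rel_add:
  assumes "L2_rel f f'" "L2_rel g g'"
  shows "L2_rel (\<lambda>x. f x + g x) (\<lambda>x. f' x + g' x)"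
proof -
  have "AE x in lebesgue. f x = f' x" "AE x in lebesgue. g x = g' x"
    using assms by (simp_all add: L2_rel_def)
  then have "AE x in lebesgue. f x + g x = f' x + g' x"
    by eventually_elim simp
  with assms show ?thesis
    by (simp add: L2_rel_def sq_integrable_add)
qed

lemma L2_rel_scale:
  assumes "L2_rel f f'"
  shows "L2_rel (\<lambda>x. c * f x) (\<lambda>x. c * f' x)"
proof -
  have "AE x in lebesgue. f x = f' x"
    using assms by (simp add: L2_rel_def)
  then have "AE x in lebesgue. c * f x = c * f' x"
    by eventually_elim simp
  with assms show ?thesis
    by (simp add: L2_rel_def sq_integrable_scale)
qed

lemma L2_rel_sq_integrable: "L2_rel f g \<Longrightarrow> sq_integrable f"
  by (simp add: L2_rel_def)

lift_definition scaleC :: "complex \<Rightarrow> 'v::euclidean_space L2 \<Rightarrow> 'v L2"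
  is "\<lambda>c f x. c * f x"
  by (rule L2_rel_scale)

instantiation L2 :: (euclidean_space) real_inner
begin

lift_definition zero_L2 :: "'a L2" is "\<lambda>x. 0"
  by (simp add: L2_rel_def sq_integrable_zero)

lift_definition plus_L2 :: "'a L2 \<Rightarrow> 'a L2 \<Rightarrow> 'a L2" is "\<lambda>f g x. f x + g x"
  by (rule L2_rel_add)

definition uminus_L2 :: "'a L2 \<Rightarrow> 'a L2" where
  "uminus_L2 u = scaleC (- 1) u"

definition minus_L2 :: "'a L2 \<Rightarrow> 'a L2 \<Rightarrow> 'a L2" where
  "minus_L2 u v = u + (- v)"

definition scaleR_L2 :: "real \<Rightarrow> 'a L2 \<Rightarrow> 'a L2" where
  "scaleR_L2 c = scaleC (complex_of_real c)"

(* Since z \<bullet> w = Re (z * cnj w) on complex, this is the real part of the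
   Hermitian inner product; it induces the usual norm of L2. *)
lift_definition inner_L2 :: "'a L2 \<Rightarrow> 'a L2 \<Rightarrow> real"
  is "\<lambda>f g. \<integral>x. f x \<bullet> g x \<partial>lebesgue"
proof -
  fix f1 f2 g1 g2 :: "'a \<Rightarrow> complex"
  assume "L2_rel f1 f2" "L2_rel g1 g2"
  then have sq: "sq_integrable f1" "sq_integrable f2" "sq_integrable g1" "sq_integrable g2"
    and ae: "AE x in lebesgue. f1 x = f2 x" "AE x in lebesgue. g1 x = g2 x"
    by (simp_all add: L2_rel_def)
  from ae have eq: "AE x in lebesgue. f1 x \<bullet> g1 x = f2 x \<bullet> g2 x"
    by eventually_elim simp
  show "(\<integral>x. f1 x \<bullet> g1 x \<partial>lebesgue) = (\<integral>x. f2 x \<bullet> g2 x \<partial>lebesgue)"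
    using integrable_inner_sq_integrable[OF sq(1,3), THEN borel_measurable_integrable]
      integrable_inner_sq_integrable[OF sq(2,4), THEN borel_measurable_integrable] eq
    by (rule integral_cong_AE)
qed

definition norm_L2 :: "'a L2 \<Rightarrow> real" where
  "norm_L2 u = sqrt (u \<bullet> u)"

definition sgn_L2 :: "'a L2 \<Rightarrow> 'a L2" where
  "sgn_L2 u = inverse (norm u) *\<^sub>R u"

definition dist_L2 :: "'a L2 \<Rightarrow> 'a L2 \<Rightarrow> real" where
  "dist_L2 u v = norm (u - v)"

definition uniformity_L2 :: "('a L2 \<times> 'a L2) filter" where
  "uniformity_L2 = (INF e\<in>{0<..}. principal {(u, v). dist u v < e})"

definition open_L2 :: "'a L2 set \<Rightarrow> bool" where
  "open_L2 U \<longleftrightarrow> (\<forall>u\<in>U. eventually (\<lambda>(u', v). u' = u \<longrightarrow> v \<in> U) uniformity)"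

instance
proof
  fix u v w :: "'a L2" and r s :: real
  show "u + v + w = u + (v + w)"
    by transfer (rule L2_relI; simp add: L2_rel_def sq_integrable_add add.assoc)
  show "u + v = v + u"
    by transfer (rule L2_relI; simp add: L2_rel_def sq_integrable_add add.commute)
  show "0 + u = u" by transfer simp
  show "- u + u = 0"
    unfolding uminus_L2_def
    by transfer (simp add: L2_rel_def sq_integrable_zero)
  show "u - v = u + - v" by (simp add: minus_L2_def)
  show "r *\<^sub>R (u + v) = r *\<^sub>R u + r *\<^sub>R v"
    unfolding scaleR_L2_def
    by transfer (rule L2_relI;
        simp add: L2_rel_def sq_integrable_add sq_integrable_scale distrib_left)
  show "(r + s) *\<^sub>R u = r *\<^sub>R u + s *\<^sub>R u"
    unfolding scaleR_L2_def
    by transfer (rule L2_relI;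
        simp add: L2_rel_def sq_integrable_add sq_integrable_scale distrib_right)
  show "r *\<^sub>R s *\<^sub>R u = (r * s) *\<^sub>R u"
    unfolding scaleR_L2_def
    by transfer (rule L2_relI; simp add: L2_rel_def sq_integrable_scale)
  show "1 *\<^sub>R u = u"
    unfolding scaleR_L2_def by transfer simp
  show "sgn u = inverse (norm u) *\<^sub>R u" by (simp add: sgn_L2_def)
  show "dist u v = norm (u - v)" by (simp add: dist_L2_def)
  show "uniformity = (INF e\<in>{0<..}. principal {(u, v::'a L2). dist u v < e})"
    by (rule uniformity_L2_def)
  show "open U \<longleftrightarrow> (\<forall>u\<in>U. eventually (\<lambda>(u', v). u' = u \<longrightarrow> v \<in> U) uniformity)"
    for U :: "'a L2 set" by (rule open_L2_def)
  show "norm u = sqrt (u \<bullet> u)" by (rule norm_L2_def)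
  show "u \<bullet> v = v \<bullet> u" by transfer (simp add: inner_commute)
  show "(u + v) \<bullet> w = u \<bullet> w + v \<bullet> w"
    by transfer (simp add: inner_add_left L2_rel_sq_integrable integrable_inner_sq_integrable)
  show "(r *\<^sub>R u) \<bullet> v = r * (u \<bullet> v)"
    unfolding scaleR_L2_def
    by transfer (simp add: scaleR_conv_of_real[symmetric])
  show "0 \<le> u \<bullet> u" by transfer simp
  show "u \<bullet> u = 0 \<longleftrightarrow> u = 0"
  proof transfer
    fix f :: "'a \<Rightarrow> complex"
    assume "L2_rel f f"
    then have sq: "sq_integrable f" by (rule L2_rel_sq_integrable)
    have "(\<integral>x. f x \<bullet> f x \<partial>lebesgue) = 0 \<longleftrightarrow> (AE x in lebesgue. f x \<bullet> f x = 0)"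
      using integrable_inner_sq_integrable[OF sq sq]
      by (rule integral_nonneg_eq_0_iff_AE) simp
    then show "(\<integral>x. f x \<bullet> f x \<partial>lebesgue) = 0 \<longleftrightarrow> L2_rel f (\<lambda>x. 0)"
      by (simp add: L2_rel_def sq_integrable_zero sq)
  qed
qed

end

interpretation L2: vector_space scaleC
proof
  fix a b :: complex and u v :: "'a L2"
  show "scaleC a (u + v) = scaleC a u + scaleC a v"
    by transfer (rule L2_relI;
        simp add: L2_rel_def sq_integrable_add sq_integrable_scale distrib_left)
  show "scaleC (a + b) u = scaleC a u + scaleC b u"
    by transfer (rule L2_relI;
        simp add: L2_rel_def sq_integrable_add sq_integrable_scale distrib_right)
  show "scaleC a (scaleC b u) = scaleC (a * b) u"
    by transfer (rule L2_relI; simp add: L2_rel_def sq_integrable_scale)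
  show "scaleC 1 u = u" by transfer simp
qed


section \<open>Singular values and Schatten classes\<close>

definition compact_operator :: "('v::euclidean_space L2 \<Rightarrow> 'v L2) \<Rightarrow> bool" where
  "compact_operator A \<longleftrightarrow>
     Vector_Spaces.linear scaleC scaleC A \<and> compact (closure (A ` cball 0 1))"

(* Complex dimension of ker (A* A - s^2), i.e. for s > 0 the multiplicity of s as an
   eigenvalue of (A* A)^(1/2). The library adjoint refers to the real inner product Re <.,.>;
   for complex linear A it coincides with the Hilbert space adjoint. *)
definition singular_mult :: "('v::euclidean_space L2 \<Rightarrow> 'v L2) \<Rightarrow> real \<Rightarrow> nat" where
  "singular_mult A s = L2.dim {u. adjoint A (A u) = s\<^sup>2 *\<^sub>R u}"

(* Nonincreasing enumeration (from index 0) of the eigenvalues of (A* A)^(1/2), counted with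
   multiplicity; padded by 0 if A has finite rank. Meaningful for compact A. *)
definition singular_value :: "('v::euclidean_space L2 \<Rightarrow> 'v L2) \<Rightarrow> nat \<Rightarrow> real" where
  "singular_value A =
     (THE s. decseq s \<and> (\<forall>k. 0 \<le> s k) \<and>
        (\<forall>\<sigma>>0. finite {k. s k = \<sigma>} \<and> card {k. s k = \<sigma>} = singular_mult A \<sigma>))"

definition schatten_class :: "real \<Rightarrow> ('v::euclidean_space L2 \<Rightarrow> 'v L2) set" where
  "schatten_class q =
     {A. compact_operator A \<and> summable (\<lambda>k. singular_value A k powr q)}"

definition schatten_norm :: "real \<Rightarrow> ('v::euclidean_space L2 \<Rightarrow> 'v L2) \<Rightarrow> real" where
  "schatten_norm q A = (\<Sum>k. singular_value A k powr q) powr (1 / q)"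


section \<open>Lattice quasi-norms\<close>

definition unit_cube :: "'v::euclidean_space \<Rightarrow> 'v set" where
  "unit_cube u = cbox (u - (1/2) *\<^sub>R One) (u + (1/2) *\<^sub>R One)"

definition int_lattice :: "'v::euclidean_space set" where
  "int_lattice = {n. \<forall>b\<in>Basis. n \<bullet> b \<in> \<int>}"

definition loc_Lp :: "real \<Rightarrow> ('v::euclidean_space \<Rightarrow> 'b::real_normed_vector) \<Rightarrow> bool" where
  "loc_Lp r h \<longleftrightarrow> h \<in> borel_measurable lebesgue \<and>
     (\<forall>u. set_integrable lebesgue (unit_cube u) (\<lambda>x. norm (h x) powr r))"

definition cube_norm :: "real \<Rightarrow> ('v::euclidean_space \<Rightarrow> 'b::real_normed_vector) \<Rightarrow> 'v \<Rightarrow> real" where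
  "cube_norm r h u = (LINT x:unit_cube u|lebesgue. norm (h x) powr r) powr (1 / r)"

definition in_lattice_space ::
    "real \<Rightarrow> real \<Rightarrow> ('v::euclidean_space \<Rightarrow> 'b::real_normed_vector) \<Rightarrow> bool" where
  "in_lattice_space r \<delta> h \<longleftrightarrow>
     loc_Lp r h \<and> (\<lambda>n. cube_norm r h n powr \<delta>) summable_on int_lattice"

definition lattice_norm ::
    "real \<Rightarrow> real \<Rightarrow> ('v::euclidean_space \<Rightarrow> 'b::real_normed_vector) \<Rightarrow> real" where
  "lattice_norm r \<delta> h = (\<Sum>\<^sub>\<infinity>n\<in>int_lattice. cube_norm r h n powr \<delta>) powr (1 / \<delta>)"

definition in_lattice_space_inf ::
    "real \<Rightarrow> ('v::euclidean_space \<Rightarrow> 'b::real_normed_vector) \<Rightarrow> bool" where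
  "in_lattice_space_inf r h \<longleftrightarrow> loc_Lp r h \<and> bdd_above (range (cube_norm r h))"

definition lattice_norm_inf ::
    "real \<Rightarrow> ('v::euclidean_space \<Rightarrow> 'b::real_normed_vector) \<Rightarrow> real" where
  "lattice_norm_inf r h = (SUP u. cube_norm r h u)"


section \<open>Partial derivatives of symbols\<close>

definition dir_deriv ::
    "'v::real_normed_vector \<Rightarrow> ('v \<Rightarrow> complex) \<Rightarrow> 'v \<Rightarrow> complex" where
  "dir_deriv b f p = vector_derivative (\<lambda>s. f (p + s *\<^sub>R b)) (at 0)"

(* The last direction in the list is differentiated first. *)
definition iter_deriv ::
    "'v::real_normed_vector list \<Rightarrow> ('v \<Rightarrow> complex) \<Rightarrow> 'v \<Rightarrow> complex" where
  "iter_deriv bs f = foldr dir_deriv bs f"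

fun iter_deriv_exists :: "'v::real_normed_vector list \<Rightarrow> ('v \<Rightarrow> complex) \<Rightarrow> bool" where
  "iter_deriv_exists [] f = True"
| "iter_deriv_exists (b # bs) f =
     (iter_deriv_exists bs f \<and>
      (\<forall>p. (\<lambda>s::real. iter_deriv bs f (p + s *\<^sub>R b)) differentiable (at 0)))"

definition cont_deriv :: "'v::real_normed_vector list \<Rightarrow> ('v \<Rightarrow> complex) \<Rightarrow> bool" where
  "cont_deriv bs f \<longleftrightarrow> iter_deriv_exists bs f \<and> continuous_on UNIV (iter_deriv bs f)"

definition basis_lists :: "nat \<Rightarrow> 'v::euclidean_space list set" where
  "basis_lists k = {bs. length bs = k \<and> set bs \<subseteq> Basis}"

(* k derivatives in w taken after l derivatives in \<xi>. *)
definition mixed_dirs :: "'v::euclidean_space list \<Rightarrow> 'v list \<Rightarrow> ('v \<times> 'v) list" where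
  "mixed_dirs bs cs = map (\<lambda>b. (b, 0)) bs @ map (\<lambda>c. (0, c)) cs"

definition symbol_cont_derivs ::
    "nat \<Rightarrow> nat \<Rightarrow> ('v::euclidean_space \<times> 'v \<Rightarrow> complex) \<Rightarrow> bool" where
  "symbol_cont_derivs k l a \<longleftrightarrow>
     (\<forall>bs\<in>basis_lists k. \<forall>cs\<in>basis_lists l. cont_deriv (mixed_dirs bs cs) a)"

(* Euclidean norm of the tensor of all partial derivatives, indexed by {1..d}^k x {1..d}^l. *)
definition mixed_deriv_norm ::
    "nat \<Rightarrow> nat \<Rightarrow> ('v::euclidean_space \<times> 'v \<Rightarrow> complex) \<Rightarrow> 'v \<times> 'v \<Rightarrow> real" where
  "mixed_deriv_norm k l a p =
     sqrt (\<Sum>bs\<in>basis_lists k. \<Sum>cs\<in>basis_lists l. (norm (iter_deriv (mixed_dirs bs cs) a p))\<^sup>2)"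

definition F_circ ::
    "nat \<Rightarrow> nat \<Rightarrow> ('v::euclidean_space \<times> 'v \<Rightarrow> complex) \<Rightarrow> 'v \<times> 'v \<Rightarrow> real" where
  "F_circ n m a p = (\<Sum>k\<le>n. mixed_deriv_norm k m a p)"

definition F_full ::
    "nat \<Rightarrow> nat \<Rightarrow> ('v::euclidean_space \<times> 'v \<Rightarrow> complex) \<Rightarrow> 'v \<times> 'v \<Rightarrow> real" where
  "F_full n m a p = (\<Sum>l\<le>m. F_circ n l a p)"


section \<open>Pseudo-differential operators and their kernels\<close>

definition test_function ::
    "'v::euclidean_space set \<Rightarrow> ('v \<Rightarrow> complex) \<Rightarrow> bool" where
  "test_function U \<phi> \<longleftrightarrow>
     (\<forall>bs. set bs \<subseteq> Basis \<longrightarrow> cont_deriv bs \<phi>) \<and>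
     (\<exists>K. compact K \<and> K \<subseteq> U \<and> (\<forall>p. p \<notin> K \<longrightarrow> \<phi> p = 0))"

definition Op_phase_integral ::
    "real \<Rightarrow> real \<Rightarrow> ('v::euclidean_space \<times> 'v \<Rightarrow> complex) \<Rightarrow> ('v \<times> 'v \<Rightarrow> complex) \<Rightarrow> 'v \<Rightarrow> complex"
  where
  "Op_phase_integral \<alpha> t a \<phi> \<xi> =
     (\<integral>p. cis (\<alpha> * ((fst p - snd p) \<bullet> \<xi>)) * a ((1 - t) *\<^sub>R fst p + t *\<^sub>R snd p, \<xi>) * \<phi> p
        \<partial>lebesgue)"

(* The distributional kernel of Op_{alpha,t}(a) applied to a test function phi(x,y) (for
   phi(x,y) = v(x) u(y) this is the pairing of Op_{alpha,t}(a) u with v). As usual for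
   oscillatory integrals the xi-integration comes last, so that it converges even if
   a(w,.) is not integrable. *)
definition Op_pairing ::
    "real \<Rightarrow> real \<Rightarrow> ('v::euclidean_space \<times> 'v \<Rightarrow> complex) \<Rightarrow> ('v \<times> 'v \<Rightarrow> complex) \<Rightarrow> complex"
  where
  "Op_pairing \<alpha> t a \<phi> =
     complex_of_real ((\<alpha> / (2 * pi)) ^ DIM('v)) * (\<integral>\<xi>. Op_phase_integral \<alpha> t a \<phi> \<xi> \<partial>lebesgue)"

(* On the open set U the distributional kernel is the continuous function k. *)
definition Op_kernel_on ::
    "('v::euclidean_space \<times> 'v) set \<Rightarrow> real \<Rightarrow> real \<Rightarrow> ('v \<times> 'v \<Rightarrow> complex) \<Rightarrow>
     ('v \<times> 'v \<Rightarrow> complex) \<Rightarrow> bool"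
  where
  "Op_kernel_on U \<alpha> t a k \<longleftrightarrow>
     continuous_on U k \<and>
     (\<forall>\<phi>. test_function U \<phi> \<longrightarrow>
        integrable lebesgue (Op_phase_integral \<alpha> t a \<phi>) \<and>
        Op_pairing \<alpha> t a \<phi> = (\<integral>p. k p * \<phi> p \<partial>lebesgue))"

(* Consistency with the defining formula: if the xi-integral converges absolutely (locally
   dominated on U), then it is the kernel. *)
lemma Op_kernel_on_absolutely_convergent:
  fixes a :: "'v::euclidean_space \<times> 'v \<Rightarrow> complex"
  assumes a: "continuous_on UNIV a" and g: "integrable lborel g"
    and dom: "\<And>x y \<xi>. (x, y) \<in> U \<Longrightarrow> norm (a ((1 - t) *\<^sub>R x + t *\<^sub>R y, \<xi>)) \<le> g \<xi>"
  shows "Op_kernel_on U \<alpha> t a (\<lambda>(x, y). complex_of_real ((\<alpha> / (2 * pi)) ^ DIM('v)) *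
     (\<integral>\<xi>. cis (\<alpha> * ((x - y) \<bullet> \<xi>)) * a ((1 - t) *\<^sub>R x + t *\<^sub>R y, \<xi>) \<partial>lebesgue))"
proof -
  define f where "f = (\<lambda>p \<xi>. cis (\<alpha> * ((fst p - snd p) \<bullet> \<xi>)) *
    a ((1 - t) *\<^sub>R fst p + t *\<^sub>R snd p, \<xi>))"
  have f_cont: "continuous_on UNIV (\<lambda>z. f (fst z) (snd z))"
    unfolding f_def
    by (intro continuous_intros continuous_on_compose2[OF continuous_on_cis[OF continuous_on_id]]
        continuous_on_compose2[OF a]) auto
  have f_cont_p: "continuous_on UNIV (\<lambda>p. f p \<xi>)" for \<xi>
    by (rule continuous_on_compose2[OF f_cont, of UNIV "\<lambda>p. (p, \<xi>)", simplified])
      (intro continuous_intros)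
  have f_cont_xi: "continuous_on UNIV (f p)" for p
    by (rule continuous_on_compose2[OF f_cont, of UNIV "\<lambda>\<xi>. (p, \<xi>)", simplified])
      (intro continuous_intros)
  have f_meas: "f p \<in> borel_measurable lborel" for p
    using borel_measurable_continuous_onI[OF f_cont_xi] by simp
  have f_dom: "norm (f p \<xi>) \<le> g \<xi>" if "p \<in> U" for p \<xi>
    using dom[of "fst p" "snd p" \<xi>] that by (simp add: f_def norm_mult)
  define k where "k = (\<lambda>p. complex_of_real ((\<alpha> / (2 * pi)) ^ DIM('v)) * (\<integral>\<xi>. f p \<xi> \<partial>lborel))"
  have "continuous_on U (\<lambda>p. \<integral>\<xi>. f p \<xi> \<partial>lborel)"
    unfolding continuous_on_sequentially
  proof (intro allI ballI impI, elim conjE)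
    fix s p assume p: "p \<in> U" and s: "\<forall>n. s n \<in> U" "s \<longlonglongrightarrow> p"
    have lim: "(\<lambda>n. f (s n) \<xi>) \<longlonglongrightarrow> f p \<xi>" for \<xi>
      by (rule continuous_on_tendsto_compose[OF f_cont_p s(2)]) auto
    have "(\<lambda>n. \<integral>\<xi>. f (s n) \<xi> \<partial>lborel) \<longlonglongrightarrow> (\<integral>\<xi>. f p \<xi> \<partial>lborel)"
      by (rule integral_dominated_convergence[OF f_meas f_meas g])
        (use lim f_dom s(1) in \<open>auto intro!: AE_I2\<close>)
    then show "((\<lambda>p. \<integral>\<xi>. f p \<xi> \<partial>lborel) \<circ> s) \<longlonglongrightarrow> (\<integral>\<xi>. f p \<xi> \<partial>lborel)"
      by (simp add: o_def)
  qed
  then have k_cont: "continuous_on U k"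
    unfolding k_def by (intro continuous_intros)
  have main: "integrable lebesgue (Op_phase_integral \<alpha> t a \<phi>) \<and>
      Op_pairing \<alpha> t a \<phi> = (\<integral>p. k p * \<phi> p \<partial>lebesgue)" if \<phi>: "test_function U \<phi>" for \<phi>
  proof -
    have "cont_deriv [] \<phi>" using \<phi> unfolding test_function_def by (metis empty_subsetI list.set(1))
    then have \<phi>_cont: "continuous_on UNIV \<phi>" by (simp add: cont_deriv_def iter_deriv_def)
    obtain K where K: "compact K" "K \<subseteq> U" "\<And>p. p \<notin> K \<Longrightarrow> \<phi> p = 0"
      using \<phi> unfolding test_function_def by blast
    have \<phi>_int: "integrable lborel \<phi>"
    proof -
      have "set_integrable lborel K \<phi>"
        using borel_integrable_compact[OF K(1) continuous_on_subset[OF \<phi>_cont subset_UNIV]]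
        unfolding set_integrable_def by (rule back_subst) (simp add: indicator_scaleR_eq_if)
      moreover have "(\<lambda>p. indicator K p *\<^sub>R \<phi> p) = \<phi>"
        using K(3) by (auto simp: indicator_def fun_eq_iff)
      ultimately show ?thesis by (simp add: set_integrable_def)
    qed
    have bd: "norm (f p \<xi> * \<phi> p) \<le> g \<xi> * norm (\<phi> p)" for p \<xi>
    proof (cases "p \<in> K")
      case True
      then have "norm (f p \<xi>) \<le> g \<xi>" using f_dom K(2) by blast
      then show ?thesis by (simp add: norm_mult mult_right_mono)
    qed (simp add: K(3))
    have f\<phi>_cont: "continuous_on UNIV (\<lambda>z. f (fst z) (snd z) * \<phi> (fst z))"
      by (intro continuous_intros f_cont continuous_on_compose2[OF \<phi>_cont]) auto
    have "integrable (lborel \<Otimes>\<^sub>M lborel) (\<lambda>(p, \<xi>). f p \<xi> * \<phi> p)"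
    proof (rule lborel_pair.Fubini_integrable)
      show "(\<lambda>(p, \<xi>). f p \<xi> * \<phi> p) \<in> borel_measurable (lborel \<Otimes>\<^sub>M lborel)"
        using borel_measurable_continuous_onI[OF f\<phi>_cont]
        by (simp add: lborel_prod case_prod_beta')
      have ifx: "integrable lborel (\<lambda>\<xi>. f p \<xi> * \<phi> p)" for p
        by (rule Bochner_Integration.integrable_bound[OF integrable_mult_left[OF g, of "norm (\<phi> p)"]])
          (use f_meas bd in \<open>auto intro!: AE_I2 order_trans[OF bd]\<close>)
      show "AE p in lborel. integrable lborel (\<lambda>\<xi>. case (p, \<xi>) of (p, \<xi>) \<Rightarrow> f p \<xi> * \<phi> p)"
        using ifx by simp
      have "norm (\<integral>\<xi>. norm (f p \<xi> * \<phi> p) \<partial>lborel) \<le> norm ((\<integral>\<xi>. g \<xi> \<partial>lborel) * norm (\<phi> p))" for p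
      proof -
        have "(\<integral>\<xi>. norm (f p \<xi> * \<phi> p) \<partial>lborel) \<le> (\<integral>\<xi>. g \<xi> * norm (\<phi> p) \<partial>lborel)"
          by (rule integral_mono[OF integrable_norm[OF ifx] integrable_mult_left[OF g] bd])
        moreover have "0 \<le> (\<integral>\<xi>. norm (f p \<xi> * \<phi> p) \<partial>lborel)" by simp
        ultimately show ?thesis by simp
      qed
      moreover have "(\<lambda>p. \<integral>\<xi>. norm (f p \<xi> * \<phi> p) \<partial>lborel) \<in> borel_measurable lborel"
      proof (rule lborel.borel_measurable_lebesgue_integral)
        show "(\<lambda>(p, \<xi>). norm (f p \<xi> * \<phi> p)) \<in> borel_measurable (lborel \<Otimes>\<^sub>M lborel)"
          using borel_measurable_continuous_onI[OF continuous_on_norm[OF f\<phi>_cont]]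
          by (simp add: lborel_prod case_prod_beta')
      qed
      ultimately show "integrable lborel (\<lambda>p. \<integral>\<xi>. norm (case (p, \<xi>) of (p, \<xi>) \<Rightarrow> f p \<xi> * \<phi> p) \<partial>lborel)"
        by (intro Bochner_Integration.integrable_bound[OF integrable_mult_right[OF integrable_norm[OF \<phi>_int], of "\<integral>\<xi>. g \<xi> \<partial>lborel"]])
          (auto intro!: AE_I2)
    qed
    note fub = this
    have ph: "Op_phase_integral \<alpha> t a \<phi> = (\<lambda>\<xi>. \<integral>p. f p \<xi> * \<phi> p \<partial>lborel)"
    proof
      fix \<xi>
      have "(\<lambda>p. f p \<xi> * \<phi> p) \<in> borel_measurable lborel"
        using borel_measurable_continuous_onI[OF continuous_on_mult[OF f_cont_p[of \<xi>] \<phi>_cont]] by simp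
      then show "Op_phase_integral \<alpha> t a \<phi> \<xi> = (\<integral>p. f p \<xi> * \<phi> p \<partial>lborel)"
        unfolding Op_phase_integral_def f_def by (rule integral_completion)
    qed
    have i2: "integrable lborel (\<lambda>\<xi>. \<integral>p. f p \<xi> * \<phi> p \<partial>lborel)"
      using lborel_pair.integrable_snd[OF fub] by simp
    have k_meas: "(\<lambda>p. k p * \<phi> p) \<in> borel_measurable lborel"
    proof -
      have "(\<lambda>p. \<integral>\<xi>. f p \<xi> \<partial>lborel) \<in> borel_measurable lborel"
      proof (rule lborel.borel_measurable_lebesgue_integral)
        show "(\<lambda>(p, \<xi>). f p \<xi>) \<in> borel_measurable (lborel \<Otimes>\<^sub>M lborel)"
          using borel_measurable_continuous_onI[OF f_cont]
          by (simp add: lborel_prod case_prod_beta')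
      qed
      then show ?thesis
        using borel_measurable_continuous_onI[OF \<phi>_cont] unfolding k_def by simp
    qed
    have "Op_pairing \<alpha> t a \<phi> =
        complex_of_real ((\<alpha> / (2 * pi)) ^ DIM('v)) * (\<integral>\<xi>. \<integral>p. f p \<xi> * \<phi> p \<partial>lborel \<partial>lborel)"
      unfolding Op_pairing_def ph
      by (subst integral_completion) (use i2 in auto)
    also have "(\<integral>\<xi>. \<integral>p. f p \<xi> * \<phi> p \<partial>lborel \<partial>lborel) = (\<integral>p. \<integral>\<xi>. f p \<xi> * \<phi> p \<partial>lborel \<partial>lborel)"
      by (rule lborel_pair.Fubini_integral[OF fub])
    also have "complex_of_real ((\<alpha> / (2 * pi)) ^ DIM('v)) * \<dots> = (\<integral>p. k p * \<phi> p \<partial>lborel)"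
      unfolding k_def by (simp add: mult.assoc)
    also have "\<dots> = (\<integral>p. k p * \<phi> p \<partial>lebesgue)"
      by (rule integral_completion[symmetric]) (rule k_meas)
    finally show ?thesis
      using i2 unfolding ph by (simp add: integrable_completion borel_measurable_integrable)
  qed
  have "(\<lambda>(x, y). complex_of_real ((\<alpha> / (2 * pi)) ^ DIM('v)) *
     (\<integral>\<xi>. cis (\<alpha> * ((x - y) \<bullet> \<xi>)) * a ((1 - t) *\<^sub>R x + t *\<^sub>R y, \<xi>) \<partial>lebesgue)) = k"
  proof
    fix p :: "'v \<times> 'v"
    have "(\<integral>\<xi>. f p \<xi> \<partial>lebesgue) = (\<integral>\<xi>. f p \<xi> \<partial>lborel)"
      by (rule integral_completion) (rule f_meas)
    then show "(\<lambda>(x, y). complex_of_real ((\<alpha> / (2 * pi)) ^ DIM('v)) *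
     (\<integral>\<xi>. cis (\<alpha> * ((x - y) \<bullet> \<xi>)) * a ((1 - t) *\<^sub>R x + t *\<^sub>R y, \<xi>) \<partial>lebesgue)) p = k p"
      by (simp add: k_def f_def case_prod_beta)
  qed
  then show ?thesis
    using k_cont main by (simp add: Op_kernel_on_def)
qed

definition ess_support :: "('v::euclidean_space \<Rightarrow> complex) \<Rightarrow> 'v set" where
  "ess_support h = - \<Union>{V. open V \<and> (AE x\<in>V in lebesgue. h x = 0)}"

definition is_integral_operator ::
    "('v::euclidean_space \<Rightarrow> 'v \<Rightarrow> complex) \<Rightarrow> ('v L2 \<Rightarrow> 'v L2) \<Rightarrow> bool" where
  "is_integral_operator K T \<longleftrightarrow>
     (\<forall>u. AE x in lebesgue.
        integrable lebesgue (\<lambda>y. K x y * rep_L2 u y) \<and>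
        rep_L2 (T u) x = (\<integral>y. K x y * rep_L2 u y \<partial>lebesgue))"

(* T = h1 Op_{alpha,t}(a) h2. Only the restriction of the distributional kernel of
   Op_{alpha,t}(a) to a neighbourhood U of supp h1 x supp h2 matters, and only there is it
   required to be a function k; outside of U the values of k are irrelevant, because
   h1(x) h2(y) vanishes there almost everywhere. Hence T is uniquely determined. *)
definition is_weighted_Op ::
    "real \<Rightarrow> real \<Rightarrow> ('v::euclidean_space \<Rightarrow> complex) \<Rightarrow> ('v \<times> 'v \<Rightarrow> complex) \<Rightarrow>
     ('v \<Rightarrow> complex) \<Rightarrow> ('v L2 \<Rightarrow> 'v L2) \<Rightarrow> bool"
  where
  "is_weighted_Op \<alpha> t h\<^sub>1 a h\<^sub>2 T \<longleftrightarrow>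
     (\<exists>U k. open U \<and> ess_support h\<^sub>1 \<times> ess_support h\<^sub>2 \<subseteq> U \<and>
        Op_kernel_on U \<alpha> t a k \<and>
        is_integral_operator (\<lambda>x y. h\<^sub>1 x * k (x, y) * h\<^sub>2 y) T)"

end

theory Submission
  imports Defs
begin

text \<open>
 Why the theorem holds. Cut the space of pairs \<open>(x, y)\<close> into products of small cubes of side \<open>eps\<close>, labelled
 by lattice points \<open>(s + V, s)\<close>, and the frequency space into unit cubes. On one cell the kernel
 \<open>\<integral> e^(i(x - y)xi) b((1 - t)x + ty, xi) dxi\<close> depends on \<open>x\<close> and \<open>y\<close> only through \<open>x - y\<close> and
 \<open>w = (1 - t)x + ty\<close>. Expanding \<open>b\<close> in a Fourier series in \<open>w\<close> and the phase in a Fourier series in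
 \<open>x - y\<close> (\<open>fourier_expansion\<close>) makes it a sum of products \<open>f(x) g(y)\<close> of unimodular exponentials, with
 coefficients bounded by \<open>(1 + |mu|)^(-n) (1 + |nu|)^(-n)\<close> times the integral of \<open>F\<close> over the cell
 (\<open>coef_expansion\<close>, \<open>norm_coef_le\<close>); \<open>n > d/q\<close> makes \<open>q\<close>-th powers of these weights summable.
 So \<open>h1 Op(a) h2\<close> is a series of rank one operators whose norms have a finite sum of \<open>q\<close>-th powers. For
 \<open>q <= 1\<close> this sum controls the sum of \<open>q\<close>-th powers of the singular values up to a factor \<open>2\<close>
 (\<open>nuc_schatten\<close>), and each cell meets boundedly many unit cubes of the lattice, which produces the lattice
 quasi-norm of \<open>F\<close> (\<open>sum_mass_powr_le\<close>).

 Decay in \<open>V\<close> is needed to sum over all pairs of cells. If \<open>V\<close> is large, integration by parts in the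
 component \<open>xi_j\<close> for which \<open>|V_j|\<close> is maximal replaces \<open>b = a\<close> by \<open>b = D_j^m a\<close> and gains
 \<open>(i / (x - y)_j)^m\<close>, which is \<open>(i / (eps V_j))^m\<close> times the smooth factor \<open>(1 + rho z_j)^(-m)\<close> with
 \<open>z = x - y - eps V\<close> and \<open>rho = 1 / (eps V_j)\<close>; this factor is put into the phase (\<open>kernel_far\<close>,
 \<open>phase_expansion\<close>). In the first part the remaining near cells are treated directly with \<open>b = a\<close>; in the
 second part they do not meet the supports of \<open>h1\<close> and \<open>h2\<close>, and summing \<open>|V|^(-mq)\<close> over the far cells
 gives the power \<open>r^(d/q - m)\<close>.

 The operator is defined through a distributional kernel, so the kernel has to be identified with these
 functions. Near the diagonal in the first part, \<open>a\<close> is locally dominated by an integrable function of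
 \<open>xi\<close> (Sobolev embedding in \<open>w\<close>, \<open>dominated_of_w_chain\<close>) and the kernel is an absolutely convergent
 integral. In general only \<open>D_j^m a\<close> is dominated. Pairing with test functions and integrating by parts
 gives \<open>(x - y)_j^m k = i^m k_j\<close> for every kernel \<open>k\<close> of \<open>a\<close> and the kernel \<open>k_j\<close> of \<open>D_j^m a\<close>
 (\<open>kernel_division\<close>, by the du Bois-Reymond lemma), and conversely these equations define a kernel off the
 diagonal (\<open>Op_kernel_on_off_diagonal\<close>). The boundary terms vanish because lower order derivatives of \<open>a\<close> grow
 at most polynomially in the mean (\<open>growth_antideriv\<close>) while the phase integrals of test functions decay
 faster than any power (\<open>Phi_decay\<close>).
\<close>


section \<open>Orthonormal systems in inner product spaces\<close>

definition orthonormal_on :: "'i set => ('i => 'a::real_inner) => bool" where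
 "orthonormal_on I f \<longleftrightarrow> finite I & (\<forall>i\<in>I. \<forall>j\<in>I. f i \<bullet> f j = (if i = j then 1 else 0))"

lemma orthonormal_on_sum_inner:
 assumes "orthonormal_on I f" "k \<in> I"
 shows "(\<Sum>i\<in>I. c i *\<^sub>R f i) \<bullet> f k = c k"
proof -
 have "(\<Sum>i\<in>I. c i *\<^sub>R f i) \<bullet> f k = (\<Sum>i\<in>I. if i = k then c i else 0)"
  unfolding inner_sum_left using assms by (intro sum.cong) (auto simp: orthonormal_on_def)
 then show ?thesis using assms by (simp add: orthonormal_on_def)
qed

lemma orthonormal_on_norm_sum:
 assumes "orthonormal_on I f"
 shows "(norm (\<Sum>i\<in>I. c i *\<^sub>R f i))\<^sup>2 = (\<Sum>i\<in>I. (c i)\<^sup>2)"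
proof -
 have "(\<Sum>i\<in>I. c i *\<^sub>R f i) \<bullet> (\<Sum>k\<in>I. c k *\<^sub>R f k) = (\<Sum>k\<in>I. c k * c k)"
  unfolding inner_sum_right[of _ _ I]
  by (intro sum.cong refl) (simp add: orthonormal_on_sum_inner[OF assms])
 then show ?thesis unfolding power2_norm_eq_inner by (simp add: power2_eq_square)
qed

lemma bessel:
 assumes "orthonormal_on I f"
 shows "(\<Sum>i\<in>I. (x \<bullet> f i)\<^sup>2) <= (norm x)\<^sup>2"
proof -
 define y where "y = (\<Sum>i\<in>I. (x \<bullet> f i) *\<^sub>R f i)"
 have yy: "y \<bullet> y = (\<Sum>i\<in>I. (x \<bullet> f i)\<^sup>2)"
  using orthonormal_on_norm_sum[OF assms, of "%i. x \<bullet> f i"] by (simp add: y_def power2_norm_eq_inner)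
 have xy: "x \<bullet> y = (\<Sum>i\<in>I. (x \<bullet> f i)\<^sup>2)"
  by (simp add: y_def inner_sum_right power2_eq_square)
 have "0 <= (x - y) \<bullet> (x - y)" by simp
 also have "... = x \<bullet> x - (\<Sum>i\<in>I. (x \<bullet> f i)\<^sup>2)"
  using xy yy by (simp add: inner_diff_left inner_diff_right inner_commute)
 finally show ?thesis by (simp add: power2_norm_eq_inner)
qed

lemma orthonormal_on_span:
 assumes "orthonormal_on I f" "u \<in> span (f ` I)"
 shows "u = (\<Sum>i\<in>I. (u \<bullet> f i) *\<^sub>R f i)"
proof -
 have inj: "inj_on f I"
  using assms(1) unfolding orthonormal_on_def inj_on_def by (metis zero_neq_one)
 have "finite I" using assms(1) by (simp add: orthonormal_on_def)
 then obtain c where "u = (\<Sum>v\<in>f ` I. c v *\<^sub>R v)"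
  using assms(2) span_finite[of "f ` I"] by auto
 then have u: "u = (\<Sum>i\<in>I. c (f i) *\<^sub>R f i)" by (simp add: sum.reindex[OF inj])
 have "u \<bullet> f i = c (f i)" if "i \<in> I" for i
  unfolding u by (rule orthonormal_on_sum_inner[OF assms(1) that])
 then show ?thesis by (subst u) (auto intro!: sum.cong)
qed

text \<open>Imposing one linear condition lowers the dimension of a span by at most one: divide the condition out
 with a vector that violates it.\<close>

lemma independent_orthogonal_to_vector:
 fixes y :: "'a::real_inner"
 assumes "finite B" "independent B"
 obtains B' where "finite B'" "independent B'" "B' \<subseteq> span B" "card B <= card B' + 1"
  "!!b. b \<in> B' ==> y \<bullet> b = 0"
proof (cases "\<forall>b\<in>B. y \<bullet> b = 0")
 case True
 then show ?thesis using assms that[of B] span_superset by auto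
next
 case False
 then obtain b0 where b0: "b0 \<in> B" "y \<bullet> b0 ~= 0" by blast
 define C where "C = (%b. b - ((y \<bullet> b) / (y \<bullet> b0)) *\<^sub>R b0) ` B"
 have C: "C \<subseteq> span B" unfolding C_def
  using b0(1) by (intro image_subsetI span_diff span_scale span_base)
 have y: "y \<bullet> c = 0" if "c \<in> C" for c
  using that b0 by (auto simp: C_def inner_diff_right)
 obtain B' where B': "B' \<subseteq> C" "independent B'" "C \<subseteq> span B'"
  by (metis maximal_independent_subset)
 have fin: "finite B'" using B'(1) assms(1) finite_subset unfolding C_def by blast
 have "B \<subseteq> span (insert b0 B')"
 proof
  fix b assume b: "b \<in> B"
  have "b - ((y \<bullet> b) / (y \<bullet> b0)) *\<^sub>R b0 \<in> span (insert b0 B')"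
   using b B'(3) span_mono[of B' "insert b0 B'"] by (auto simp: C_def)
  moreover have "((y \<bullet> b) / (y \<bullet> b0)) *\<^sub>R b0 \<in> span (insert b0 B')"
   by (intro span_scale span_base) simp
  ultimately have "(b - ((y \<bullet> b) / (y \<bullet> b0)) *\<^sub>R b0) + ((y \<bullet> b) / (y \<bullet> b0)) *\<^sub>R b0 \<in> span (insert b0 B')"
   by (rule span_add)
  then show "b \<in> span (insert b0 B')" by simp
 qed
 then have "card B <= card (insert b0 B')"
  using independent_span_bound[of "insert b0 B'" B] fin assms(2) by simp
 also have "... <= card B' + 1" using card_insert_le_m1 by (simp add: card_insert_if fin)
 finally show ?thesis using that[of B'] fin B' C y by blast
qed

lemma independent_orthogonal_to_finite:
 fixes y :: "'j => 'a::real_inner"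
 assumes "finite J" "finite B" "independent B"
 shows "\<exists>B'. finite B' & independent B' & B' \<subseteq> span B & card B <= card B' + card J &
  (\<forall>j\<in>J. \<forall>b\<in>B'. y j \<bullet> b = 0)"
 using assms(1)
proof (induction J)
 case empty
 then show ?case using assms(2,3) span_superset by (intro exI[of _ B]) auto
next
 case (insert k J)
 then obtain C where C: "finite C" "independent C" "C \<subseteq> span B" "card B <= card C + card J"
  "\<forall>j\<in>J. \<forall>b\<in>C. y j \<bullet> b = 0" by blast
 obtain B' where B': "finite B'" "independent B'" "B' \<subseteq> span C" "card C <= card B' + 1"
  "!!b. b \<in> B' ==> y k \<bullet> b = 0"
  using independent_orthogonal_to_vector[OF C(1,2), of "y k"] by blast
 have "y j \<bullet> b = 0" if "j \<in> J" "b \<in> B'" for j b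
 proof -
  have "span C \<subseteq> {b. y j \<bullet> b = 0}"
   using C(5) that(1) by (intro span_minimal) (auto simp: subspace_def inner_add_right)
  then show ?thesis using that(2) B'(3) by auto
 qed
 moreover have "B' \<subseteq> span B"
  using B'(3) C(3) span_mono[OF C(3)] by (simp add: span_span subset_trans)
 moreover have "card B <= card B' + card (insert k J)"
  using insert B'(4) C(4) by simp
 ultimately show ?case using B' by (intro exI[of _ B']) auto
qed

lemma orthonormalize:
 fixes B :: "'a::real_inner set"
 assumes "finite B" "independent B"
 obtains G where "orthonormal_on G (%g. g)" "G \<subseteq> span B" "card G = card B"
proof -
 obtain C where C: "finite C" "card C <= card B" "span C = span B" "pairwise orthogonal C"
  using basis_orthogonal[OF assms(1)] by blast
 define G where "G = sgn ` (C - {0})"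
 have on: "orthonormal_on G (%g. g)"
  unfolding orthonormal_on_def
 proof (intro conjI ballI)
  show "finite G" using C(1) by (simp add: G_def)
  fix g h assume "g \<in> G" "h \<in> G"
  then obtain b c where bc: "b \<in> C" "b ~= 0" "c \<in> C" "c ~= 0" and gh: "g = sgn b" "h = sgn c"
   by (auto simp: G_def)
  show "g \<bullet> h = (if g = h then 1 else 0)"
  proof (cases "g = h")
   case True
   have "g \<bullet> g = (norm g)\<^sup>2" by (simp add: power2_norm_eq_inner)
   also have "... = 1" using bc by (simp add: gh norm_sgn)
   finally show ?thesis using True by simp
  next
   case False
   then have "b \<bullet> c = 0" using C(4) bc gh by (auto simp: pairwise_def orthogonal_def)
   then show ?thesis using False by (simp add: gh sgn_div_norm)
  qed
 qed
 have sub: "G \<subseteq> span B"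
  unfolding G_def C(3)[symmetric] sgn_div_norm by (intro image_subsetI span_scale span_base) simp
 have "C \<subseteq> span G"
 proof
  fix c assume c: "c \<in> C"
  show "c \<in> span G"
  proof (cases "c = 0")
   case False
   then have "norm c *\<^sub>R sgn c \<in> span G" using c by (intro span_scale span_base) (auto simp: G_def)
   then show ?thesis using False by (simp add: sgn_div_norm)
  qed (simp add: span_zero)
 qed
 then have "span C \<subseteq> span G" by (metis span_mono span_span)
 then have "B \<subseteq> span G" unfolding C(3) by (rule subset_trans[OF span_superset])
 then have "card B <= card G"
  using independent_span_bound[of G B] assms(2) on by (simp add: orthonormal_on_def)
 moreover have "card G <= card C"
  unfolding G_def using C(1) by (meson card_image_le card_Diff1_le finite_Diff le_trans)
 ultimately show ?thesis using that[OF on sub] C(2) by simp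
qed

text \<open>A trace argument. Let \<open>J\<close> be the finite set of terms with \<open>c j > tau\<close>. At most \<open>2 card J\<close>
 dimensions of the span of the \<open>e i\<close> are lost by passing to the subspace orthogonal to all \<open>y j\<close>, \<open>y' j\<close> with
 \<open>j \<in> J\<close>, and they contribute at most \<open>tau\<close> each. On that subspace only terms with \<open>j ~: J\<close> survive, and the trace
 of \<open>Z \<circ> T\<close>, for a contraction \<open>Z\<close> that truncates the singular values at \<open>tau\<close>, is bounded by \<open>2 (\<Sum>j~:J. c j)\<close> by Cauchy-Schwarz and Bessel. Two rank one
 terms per index are allowed because a complex rank one operator has real rank two.\<close>

lemma sum_min_singular_values_le:
 fixes T :: "'a::real_inner => 'a"
 assumes rep: "!!u. (%j::nat. (y j \<bullet> u) *\<^sub>R x j + (y' j \<bullet> u) *\<^sub>R x' j) sums T u"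
  and c: "!!j. norm (x j) * norm (y j) <= c j" "!!j. norm (x' j) * norm (y' j) <= c j"
  and sc: "summable c"
  and e: "orthonormal_on I e"
  and Te: "!!i k. i \<in> I ==> k \<in> I ==> T (e i) \<bullet> T (e k) = (if i = k then (s i)\<^sup>2 else 0)"
  and s: "!!i. i \<in> I ==> 0 < s i" and tau: "0 < tau"
 shows "(\<Sum>i\<in>I. min (s i) tau) <= 2 * (\<Sum>j. min (c j) tau)"
proof -
 have c0: "0 <= c j" for j using c(1)[of j] by (meson mult_nonneg_nonneg norm_ge_zero order_trans)
 have finI: "finite I" using e by (simp add: orthonormal_on_def)
 define J where "J = {j. tau < c j}"
 have "eventually (%j. c j < tau) sequentially"
  using summable_LIMSEQ_zero[OF sc] tau by (rule order_tendstoD)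
 then obtain N where "!!j. j \<ge> N ==> c j < tau" by (auto simp: eventually_sequentially)
 then have "J \<subseteq> {..<N}" by (force simp: J_def not_less[symmetric])
 then have finJ: "finite J" by (rule finite_subset) simp
 have inje: "inj_on e I"
  using e unfolding orthonormal_on_def inj_on_def by (metis zero_neq_one)
 have inde: "independent (e ` I)"
 proof (rule pairwise_orthogonal_independent)
  show "pairwise orthogonal (e ` I)" "0 ~: e ` I"
   using e unfolding pairwise_def orthogonal_def orthonormal_on_def by (auto, metis inner_zero_left zero_neq_one)
 qed
 \<comment> \<open>\<open>G\<close> below is an orthonormal basis of a subspace orthogonal to all \<open>y j\<close>, \<open>y' j\<close> with \<open>j \<in> J\<close>.\<close>
 obtain B1 where B1: "finite B1" "independent B1" "B1 \<subseteq> span (e ` I)" "card (e ` I) <= card B1 + card J"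
  "\<forall>j\<in>J. \<forall>b\<in>B1. y j \<bullet> b = 0"
  using independent_orthogonal_to_finite[OF finJ _ inde] finI by (metis finite_imageI)
 obtain B2 where B2: "finite B2" "independent B2" "B2 \<subseteq> span B1" "card B1 <= card B2 + card J"
  "\<forall>j\<in>J. \<forall>b\<in>B2. y' j \<bullet> b = 0"
  using independent_orthogonal_to_finite[OF finJ B1(1,2)] by metis
 obtain G where G: "orthonormal_on G (%g. g)" "G \<subseteq> span B2" "card G = card B2"
  by (rule orthonormalize[OF B2(1,2)])
 have finG: "finite G" using G(1) by (simp add: orthonormal_on_def)
 have GB1: "G \<subseteq> span B1" using G(2) span_mono[OF B2(3)] by (simp add: span_span)
 have GE: "G \<subseteq> span (e ` I)" using GB1 span_mono[OF B1(3)] by (simp add: span_span)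
 have y0: "y j \<bullet> g = 0" if "j \<in> J" "g \<in> G" for j g
 proof -
  have "span B1 \<subseteq> {b. y j \<bullet> b = 0}"
   using B1(5) that(1) by (intro span_minimal) (auto simp: subspace_def inner_add_right)
  then show ?thesis using that(2) GB1 by auto
 qed
 have y'0: "y' j \<bullet> g = 0" if "j \<in> J" "g \<in> G" for j g
 proof -
  have "span B2 \<subseteq> {b. y' j \<bullet> b = 0}"
   using B2(5) that(1) by (intro span_minimal) (auto simp: subspace_def inner_add_right)
  then show ?thesis using that(2) G(2) by auto
 qed
 define m where "m i = min (s i) tau" for i
 define z where "z i = m i / s i" for i
 have z: "0 <= z i" "z i <= 1" "z i * s i = m i" if "i \<in> I" for i
  using s[OF that] tau by (auto simp: z_def m_def)
 define f where "f i = (1 / s i) *\<^sub>R T (e i)" for i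
 have f: "orthonormal_on I f"
  unfolding orthonormal_on_def f_def using finI s by (auto simp: Te power2_eq_square) fastforce
 have Tef: "T (e i) = s i *\<^sub>R f i" if "i \<in> I" for i using s[OF that] by (simp add: f_def)
 \<comment> \<open>A contraction with \<open>Z (T (e i)) = min (s i) tau *\<^sub>R e i\<close>.\<close>
 define Z where "Z v = (\<Sum>i\<in>I. (z i * (v \<bullet> f i)) *\<^sub>R e i)" for v
 have Zn: "norm (Z v) <= norm v" for v
 proof -
  have "(norm (Z v))\<^sup>2 = (\<Sum>i\<in>I. (z i * (v \<bullet> f i))\<^sup>2)"
   unfolding Z_def by (rule orthonormal_on_norm_sum[OF e])
  also have "... <= (\<Sum>i\<in>I. (v \<bullet> f i)\<^sup>2)"
  proof (rule sum_mono)
   fix i assume "i \<in> I"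
   then have "(z i)\<^sup>2 <= 1" using z by (simp add: power_le_one)
   then show "(z i * (v \<bullet> f i))\<^sup>2 <= (v \<bullet> f i)\<^sup>2"
    by (simp add: power_mult_distrib mult_left_le_one_le)
  qed
  also have "... <= (norm v)\<^sup>2" by (rule bessel[OF f])
  finally show ?thesis by (rule power2_le_imp_le) simp
 qed
 have linT: "bounded_linear (%u. u \<bullet> v)" for v :: 'a by (rule bounded_linear_inner_left)
 have Tadd: "T (u + v) = T u + T v" for u v
 proof -
  have "(%j. ((y j \<bullet> u) *\<^sub>R x j + (y' j \<bullet> u) *\<^sub>R x' j) + ((y j \<bullet> v) *\<^sub>R x j + (y' j \<bullet> v) *\<^sub>R x' j)) sums (T u + T v)"
   by (intro sums_add rep)
  moreover have "(%j. ((y j \<bullet> u) *\<^sub>R x j + (y' j \<bullet> u) *\<^sub>R x' j) + ((y j \<bullet> v) *\<^sub>R x j + (y' j \<bullet> v) *\<^sub>R x' j))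
   = (%j. (y j \<bullet> (u + v)) *\<^sub>R x j + (y' j \<bullet> (u + v)) *\<^sub>R x' j)"
   by (auto simp: inner_add_right scaleR_add_left)
  ultimately show ?thesis by (intro sums_unique2[OF rep]) (simp only:)
 qed
 have Tscale: "T (r *\<^sub>R u) = r *\<^sub>R T u" for r u
 proof -
  have "(%j. r *\<^sub>R ((y j \<bullet> u) *\<^sub>R x j + (y' j \<bullet> u) *\<^sub>R x' j)) sums (r *\<^sub>R T u)"
   by (intro sums_scaleR_right rep)
  moreover have "(%j. r *\<^sub>R ((y j \<bullet> u) *\<^sub>R x j + (y' j \<bullet> u) *\<^sub>R x' j))
   = (%j. (y j \<bullet> (r *\<^sub>R u)) *\<^sub>R x j + (y' j \<bullet> (r *\<^sub>R u)) *\<^sub>R x' j)"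
   by (auto simp: scaleR_add_right)
  ultimately show ?thesis by (intro sums_unique2[OF rep]) (simp only:)
 qed
 have lin: "linear T" using Tadd Tscale by (rule linearI)
 have Tsum: "T (\<Sum>i\<in>I. a i *\<^sub>R e i) = (\<Sum>i\<in>I. (a i * s i) *\<^sub>R f i)" for a
  by (simp add: linear_sum[OF lin] Tscale Tef)
 \<comment> \<open>\<open>Q g\<close> is the diagonal entry at \<open>g\<close> of the truncated diagonal matrix \<open>diag (m i)\<close>.\<close>
 have Q: "Z (T g) \<bullet> g = (\<Sum>i\<in>I. m i * (g \<bullet> e i)\<^sup>2)" if "g \<in> G" for g
 proof -
  have g: "g = (\<Sum>i\<in>I. (g \<bullet> e i) *\<^sub>R e i)"
   using orthonormal_on_span[OF e] GE that by blast
  have Tg: "T g = (\<Sum>i\<in>I. ((g \<bullet> e i) * s i) *\<^sub>R f i)"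
   by (subst g) (rule Tsum)
  have "Z (T g) = (\<Sum>i\<in>I. (z i * ((g \<bullet> e i) * s i)) *\<^sub>R e i)"
   unfolding Z_def Tg by (intro sum.cong refl) (simp add: orthonormal_on_sum_inner[OF f])
  then have "Z (T g) \<bullet> g = (\<Sum>i\<in>I. z i * ((g \<bullet> e i) * s i) * (e i \<bullet> g))"
   by (simp add: inner_sum_left)
  also have "... = (\<Sum>i\<in>I. m i * (g \<bullet> e i)\<^sup>2)"
   using z(3) by (intro sum.cong refl) (simp add: inner_commute power2_eq_square algebra_simps flip: z(3))
  finally show ?thesis .
 qed
 define h where "h = (%j. \<Sum>g\<in>G. (y j \<bullet> g) * (Z (x j) \<bullet> g) + (y' j \<bullet> g) * (Z (x' j) \<bullet> g))"
 have hsum: "h sums (\<Sum>g\<in>G. Z (T g) \<bullet> g)"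
  unfolding h_def
 proof (rule sums_sum)
  fix g
  have Zin: "Z v \<bullet> g = v \<bullet> (\<Sum>i\<in>I. (z i * (e i \<bullet> g)) *\<^sub>R f i)" for v
   by (simp add: Z_def inner_sum_left inner_sum_right mult_ac)
  have "(%j. ((y j \<bullet> g) *\<^sub>R x j + (y' j \<bullet> g) *\<^sub>R x' j) \<bullet> (\<Sum>i\<in>I. (z i * (e i \<bullet> g)) *\<^sub>R f i))
   sums (T g \<bullet> (\<Sum>i\<in>I. (z i * (e i \<bullet> g)) *\<^sub>R f i))"
   by (rule bounded_linear.sums[OF linT rep])
  then show "(%j. (y j \<bullet> g) * (Z (x j) \<bullet> g) + (y' j \<bullet> g) * (Z (x' j) \<bullet> g)) sums (Z (T g) \<bullet> g)"
   unfolding Zin by (simp add: inner_add_left)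
 qed
 have CS: "(\<Sum>g\<in>G. (v \<bullet> g) * (w \<bullet> g)) <= norm v * norm w" for v w :: 'a
 proof -
  have "(\<Sum>g\<in>G. (v \<bullet> g) * (w \<bullet> g)) <= (\<Sum>g\<in>G. \<bar>(v \<bullet> g)\<bar> * \<bar>(w \<bullet> g)\<bar>)"
   by (intro sum_mono) (simp flip: abs_mult)
  also have "... <= L2_set (%g. v \<bullet> g) G * L2_set (%g. w \<bullet> g) G"
   by (rule L2_set_mult_ineq)
  also have "... <= norm v * norm w"
   unfolding L2_set_def using bessel[OF G(1)]
   by (intro mult_mono real_le_lsqrt) (auto intro: sum_nonneg)
  finally show ?thesis .
 qed
 have hle: "h j <= (if j \<in> J then 0 else 2 * c j)" for j
 proof (cases "j \<in> J")
  case True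
  then show ?thesis by (simp add: h_def y0 y'0)
 next
  case False
  have "h j <= norm (y j) * norm (Z (x j)) + norm (y' j) * norm (Z (x' j))"
   unfolding h_def sum.distrib by (intro add_mono CS)
  also have "... <= norm (y j) * norm (x j) + norm (y' j) * norm (x' j)"
   by (intro add_mono mult_left_mono Zn) auto
  also have "... <= 2 * c j" using c[of j] by (simp add: mult.commute)
  finally show ?thesis using False by simp
 qed
 have sm: "summable (%j. min (c j) tau)"
  by (rule summable_comparison_test'[OF sc]) (use c0 tau in auto)
 have sJ: "(%j. if j \<in> J then tau else 0) sums (card J * tau)"
  using sums_If_finite_set[OF finJ, of "%_. tau"] by simp
 have split: "2 * min (c j) tau = (if j \<in> J then 0 else 2 * c j) + 2 * (if j \<in> J then tau else 0)" for j
  by (auto simp: J_def)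
 have srest: "summable (%j. if j \<in> J then 0 else 2 * c j)"
  by (rule summable_comparison_test'[OF summable_mult[OF sc, of 2]]) (use c0 in auto)
 have decomp: "(\<Sum>i\<in>I. m i) = (\<Sum>i\<in>I. m i * (\<Sum>g\<in>G. (e i \<bullet> g)\<^sup>2)) + (\<Sum>i\<in>I. m i * (1 - (\<Sum>g\<in>G. (e i \<bullet> g)\<^sup>2)))"
  by (simp add: sum.distrib[symmetric] algebra_simps)
 have "(\<Sum>i\<in>I. m i * (\<Sum>g\<in>G. (e i \<bullet> g)\<^sup>2)) = (\<Sum>g\<in>G. Z (T g) \<bullet> g)"
  unfolding sum_distrib_left
  by (subst sum.swap) (auto simp: Q inner_commute[of "e _"] intro!: sum.cong)
 also have "... <= (\<Sum>j. if j \<in> J then 0 else 2 * c j)"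
  unfolding sums_unique[OF hsum] by (rule suminf_le[OF hle sums_summable[OF hsum] srest])
 finally have part1: "(\<Sum>i\<in>I. m i * (\<Sum>g\<in>G. (e i \<bullet> g)\<^sup>2)) <= (\<Sum>j. if j \<in> J then 0 else 2 * c j)" .
 have "(\<Sum>i\<in>I. m i * (1 - (\<Sum>g\<in>G. (e i \<bullet> g)\<^sup>2))) <= (\<Sum>i\<in>I. tau * (1 - (\<Sum>g\<in>G. (e i \<bullet> g)\<^sup>2)))"
 proof (intro sum_mono mult_right_mono)
  fix i assume i: "i \<in> I"
  show "m i <= tau" by (simp add: m_def)
  have "(\<Sum>g\<in>G. (e i \<bullet> g)\<^sup>2) <= (norm (e i))\<^sup>2" by (rule bessel[OF G(1)])
  also have "... = 1" using e i by (simp add: orthonormal_on_def power2_norm_eq_inner)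
  finally show "0 <= 1 - (\<Sum>g\<in>G. (e i \<bullet> g)\<^sup>2)" by simp
 qed
 also have "... = tau * (card I - (\<Sum>g\<in>G. \<Sum>i\<in>I. (g \<bullet> e i)\<^sup>2))"
  by (simp add: sum_distrib_left[symmetric] sum_subtractf inner_commute sum.swap[of _ I])
 also have "(\<Sum>g\<in>G. \<Sum>i\<in>I. (g \<bullet> e i)\<^sup>2) = (\<Sum>g\<in>G. 1)"
 proof (rule sum.cong)
  fix g assume g: "g \<in> G"
  have "(\<Sum>i\<in>I. (g \<bullet> e i)\<^sup>2) = (norm (\<Sum>i\<in>I. (g \<bullet> e i) *\<^sub>R e i))\<^sup>2"
   by (rule orthonormal_on_norm_sum[OF e, symmetric])
  also have "(\<Sum>i\<in>I. (g \<bullet> e i) *\<^sub>R e i) = g"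
   using orthonormal_on_span[OF e] GE g by (metis subsetD)
  also have "(norm g)\<^sup>2 = 1" using G(1) g by (simp add: orthonormal_on_def power2_norm_eq_inner)
  finally show "(\<Sum>i\<in>I. (g \<bullet> e i)\<^sup>2) = 1" .
 qed simp
 also have "tau * (real (card I) - (\<Sum>g\<in>G. 1)) <= tau * (2 * card J)"
 proof -
  have "card I <= card G + card J + card J"
   using B1(4) B2(4) G(3) card_image[OF inje] by linarith
  then show ?thesis using tau by (intro mult_left_mono) auto
 qed
 finally have part2: "(\<Sum>i\<in>I. m i * (1 - (\<Sum>g\<in>G. (e i \<bullet> g)\<^sup>2))) <= tau * (2 * card J)" .
 have "(\<Sum>i\<in>I. m i) <= (\<Sum>j. if j \<in> J then 0 else 2 * c j) + tau * (2 * card J)"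
  using decomp part1 part2 by linarith
 also have "(\<Sum>j. if j \<in> J then 0 else 2 * c j) + tau * (2 * card J) = (\<Sum>j. 2 * min (c j) tau)"
  unfolding split using suminf_add[OF srest summable_mult[OF sums_summable[OF sJ], of 2]]
   suminf_mult[OF sums_summable[OF sJ], of 2] sums_unique[OF sJ] by (simp add: algebra_simps)
 also have "... = 2 * (\<Sum>j. min (c j) tau)" by (rule suminf_mult[OF sm])
 finally show ?thesis by (simp add: m_def)
qed

section \<open>From truncated sums to sums of powers\<close>

lemma nn_integral_min_exp_finite:
 assumes "0 < q" "q < 1"
 shows "(\<integral>\<^sup>+v. ennreal (min 1 (exp v) * exp ((q - 1) * v)) \<partial>lborel) < \<infinity>"
proof -
 have half: "(\<integral>\<^sup>+v. ennreal (exp (- c * v)) * indicator {0..} v \<partial>lborel) < \<infinity>" if "0 < c" for c :: real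
 proof -
  have "(\<integral>\<^sup>+v. ennreal (exp (- c * v)) * indicator {0..} v \<partial>lborel) = ennreal (0 - (- exp (- c * 0) / c))"
  proof (rule nn_integral_FTC_atLeast)
   show "((%v. - exp (- c * v) / c) \<longlongrightarrow> 0) at_top"
    using that by real_asymp
  qed (use that in \<open>auto intro!: derivative_eq_intros\<close>)
  then show ?thesis by simp
 qed
 have "(\<integral>\<^sup>+v. ennreal (min 1 (exp v) * exp ((q - 1) * v)) \<partial>lborel)
  <= (\<integral>\<^sup>+v. ennreal (exp (- (1 - q) * v)) * indicator {0..} v
    + ennreal (exp (- q * (0 + (-1) * v))) * indicator {0..} (0 + (-1) * v) \<partial>lborel)"
 proof (rule nn_integral_mono)
  fix v :: real
  show "ennreal (min 1 (exp v) * exp ((q - 1) * v)) <=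
   ennreal (exp (- (1 - q) * v)) * indicator {0..} v
    + ennreal (exp (- q * (0 + (-1) * v))) * indicator {0..} (0 + (-1) * v)"
  proof (cases "0 <= v")
   case True
   have "min 1 (exp v) * exp ((q - 1) * v) <= 1 * exp ((q - 1) * v)"
    by (intro mult_right_mono) auto
   then have "ennreal (min 1 (exp v) * exp ((q - 1) * v)) <= ennreal (exp (- (1 - q) * v))"
    by (intro ennreal_leI) simp
   also have "... <= ennreal (exp (- (1 - q) * v)) * indicator {0..} v
    + ennreal (exp (- q * (0 + (-1) * v))) * indicator {0..} (0 + (-1) * v)"
    using True by simp
   finally show ?thesis .
  next
   case False
   have "min 1 (exp v) * exp ((q - 1) * v) <= exp v * exp ((q - 1) * v)"
    by (intro mult_right_mono) auto
   also have "... = exp (q * v)" by (simp add: mult_exp_exp algebra_simps)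
   finally show ?thesis using False by (simp add: ennreal_leI)
  qed
 qed
 also have "... = (\<integral>\<^sup>+v. ennreal (exp (- (1 - q) * v)) * indicator {0..} v \<partial>lborel)
   + (\<integral>\<^sup>+v. ennreal (exp (- q * (0 + (-1) * v))) * indicator {0..} (0 + (-1) * v) \<partial>lborel)"
  by (rule nn_integral_add) auto
 also have "(\<integral>\<^sup>+v. ennreal (exp (- q * (0 + (-1) * v))) * indicator {0..} (0 + (-1) * v) \<partial>lborel)
  = (\<integral>\<^sup>+v. ennreal (exp (- q * v)) * indicator {0..} v \<partial>lborel)"
  by (subst nn_integral_real_affine[of "%v. ennreal (exp (- q * v)) * indicator {0..} v" "-1" 0]) auto
 finally show ?thesis
  by (rule le_less_trans) (use half[of "1 - q"] half[of q] assms in simp)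
qed

text \<open>Layer cake: up to a constant, \<open>s powr q\<close> is the integral of \<open>min s tau * tau powr (q - 2)\<close> over \<open>tau > 0\<close>,
 written with \<open>tau = exp v\<close>.\<close>

lemma nn_integral_min_exp:
 assumes "0 < q" "q < 1" "0 <= s"
 shows "(\<integral>\<^sup>+v. ennreal (min s (exp v) * exp ((q - 1) * v)) \<partial>lborel)
  = ennreal (s powr q) * (\<integral>\<^sup>+v. ennreal (min 1 (exp v) * exp ((q - 1) * v)) \<partial>lborel)"
proof (cases "s = 0")
 case False
 then have s: "s > 0" using assms by simp
 have eq: "min s (exp (ln s + 1 * v)) * exp ((q - 1) * (ln s + 1 * v))
   = s powr q * (min 1 (exp v) * exp ((q - 1) * v))" for v
 proof -
  have 1: "min s (exp (ln s + 1 * v)) = s * min 1 (exp v)"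
   using s by (simp add: exp_add min_def)
  have "s powr q = s * exp ((q - 1) * ln s)"
   using s by (simp add: powr_def exp_diff left_diff_distrib)
  then show ?thesis unfolding 1 by (simp add: distrib_left exp_add)
 qed
 have "(\<integral>\<^sup>+v. ennreal (min s (exp v) * exp ((q - 1) * v)) \<partial>lborel)
  = (\<integral>\<^sup>+v. ennreal (s powr q * (min 1 (exp v) * exp ((q - 1) * v))) \<partial>lborel)"
  by (subst nn_integral_real_affine[of _ 1 "ln s"]) (auto simp: eq[simplified])
 also have "... = ennreal (s powr q) * (\<integral>\<^sup>+v. ennreal (min 1 (exp v) * exp ((q - 1) * v)) \<partial>lborel)"
  by (simp add: ennreal_mult nn_integral_cmult)
 finally show ?thesis .
qed (simp add: min_def)

lemma summable_of_summable_powr: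
 fixes c :: "nat => real"
 assumes "0 < q" "q <= 1" "!!j. 0 <= c j" "summable (%j. c j powr q)"
 shows "summable c"
proof -
 have "eventually (%j. c j powr q < 1) sequentially"
  using summable_LIMSEQ_zero[OF assms(4)] by (rule order_tendstoD) simp
 then obtain N where N: "!!j. j \<ge> N ==> c j powr q < 1" by (auto simp: eventually_sequentially)
 show ?thesis
 proof (rule summable_comparison_test'[OF assms(4), of N])
  fix j assume "j \<ge> N"
  then have "c j < 1" using N[of j] assms(1) ge_one_powr_ge_zero[of "c j" q] by (meson not_le le_less_trans less_irrefl less_imp_le)
  then show "norm (c j) <= c j powr q"
   using assms(1,2) assms(3)[of j] powr_mono'[of q 1 "c j"] by (cases "c j = 0") (auto simp: less_le)
 qed
qed

text \<open>For \<open>q < 1\<close> integrate the hypothesis against \<open>tau powr (q - 2)\<close>; for \<open>q = 1\<close> choose \<open>tau \<ge> s i\<close> for all \<open>i\<close>.\<close>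

lemma sum_powr_le_of_sum_min_le:
 fixes s :: "'i => real" and c :: "nat => real"
 assumes q: "0 < q" "q <= 1" and I: "finite I" and s: "!!i. i \<in> I ==> 0 < s i"
  and c: "!!j. 0 <= c j" and sc: "summable (%j. c j powr q)"
  and le: "!!tau. 0 < tau ==> (\<Sum>i\<in>I. min (s i) tau) <= 2 * (\<Sum>j. min (c j) tau)"
 shows "(\<Sum>i\<in>I. s i powr q) <= 2 * (\<Sum>j. c j powr q)"
proof -
 have sumc: "summable c" by (rule summable_of_summable_powr[OF q c sc])
 have summin: "summable (%j. min (c j) tau)" if "0 < tau" for tau
  by (rule summable_comparison_test'[OF sumc]) (use c that in auto)
 show ?thesis
 proof (cases "q = 1")
  case True
  define tau where "tau = Max (insert 1 (s ` I))"
  have tau: "1 <= tau" "!!i. i \<in> I ==> s i <= tau" using I by (auto simp: tau_def)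
  have "(\<Sum>i\<in>I. s i powr q) = (\<Sum>i\<in>I. min (s i) tau)"
   using True tau s by (intro sum.cong) (auto simp: min_def less_imp_le)
  also have "... <= 2 * (\<Sum>j. min (c j) tau)" using tau by (intro le) auto
  also have "... <= 2 * (\<Sum>j. c j powr q)"
   using True c sc summin[of tau] tau(1) by (intro mult_left_mono suminf_le) auto
  finally show ?thesis .
 next
  case False
  then have q1: "q < 1" using q by simp
  define W where "W = (\<integral>\<^sup>+v. ennreal (min 1 (exp v) * exp ((q - 1) * v)) \<partial>lborel)"
  have Wfin: "W < \<infinity>" unfolding W_def by (rule nn_integral_min_exp_finite[OF q(1) q1])
  have "W ~= 0"
  proof
   assume "W = 0"
   then have "AE v in lborel. ennreal (min 1 (exp v) * exp ((q - 1) * v)) = 0"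
    unfolding W_def by (subst (asm) nn_integral_0_iff_AE) auto
   then have "AE v in (lborel :: real measure). False" by (rule AE_mp) (auto simp: min_def split: if_splits)
   then show False using AE_iff_measurable[of "UNIV::real set" lborel "%_. False"] by simp
  qed
  have scale: "ennreal (x powr q) * W = (\<integral>\<^sup>+v. ennreal (min x (exp v) * exp ((q - 1) * v)) \<partial>lborel)" if "0 <= x" for x
   unfolding W_def by (rule nn_integral_min_exp[OF q(1) q1 that, symmetric])
  have "ennreal (\<Sum>i\<in>I. s i powr q) * W = (\<Sum>i\<in>I. ennreal (s i powr q) * W)"
   by (simp add: sum_distrib_right flip: sum_ennreal)
  also have "... = (\<Sum>i\<in>I. \<integral>\<^sup>+v. ennreal (min (s i) (exp v) * exp ((q - 1) * v)) \<partial>lborel)"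
   using s by (intro sum.cong scale) (auto simp: less_imp_le)
  also have "... = (\<integral>\<^sup>+v. (\<Sum>i\<in>I. ennreal (min (s i) (exp v) * exp ((q - 1) * v))) \<partial>lborel)"
   by (rule nn_integral_sum[symmetric]) auto
  also have "... <= (\<integral>\<^sup>+v. 2 * (\<Sum>j. ennreal (min (c j) (exp v) * exp ((q - 1) * v))) \<partial>lborel)"
  proof (rule nn_integral_mono)
   fix v :: real
   have "(\<Sum>i\<in>I. ennreal (min (s i) (exp v) * exp ((q - 1) * v)))
    = ennreal ((\<Sum>i\<in>I. min (s i) (exp v)) * exp ((q - 1) * v))"
    using s by (simp add: sum_ennreal sum_distrib_right less_imp_le)
   also have "... <= ennreal ((2 * (\<Sum>j. min (c j) (exp v))) * exp ((q - 1) * v))"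
    by (intro ennreal_leI mult_right_mono le) auto
   also have "... = 2 * ennreal (\<Sum>j. min (c j) (exp v) * exp ((q - 1) * v))"
    using c summin[of "exp v"]
    by (simp add: ennreal_mult suminf_nonneg suminf_mult2[symmetric] mult.assoc summable_mult2)
   also have "ennreal (\<Sum>j. min (c j) (exp v) * exp ((q - 1) * v)) = (\<Sum>j. ennreal (min (c j) (exp v) * exp ((q - 1) * v)))"
    using c summin[of "exp v"] by (intro suminf_ennreal2[symmetric] summable_mult2) auto
   finally show "(\<Sum>i\<in>I. ennreal (min (s i) (exp v) * exp ((q - 1) * v)))
    <= 2 * (\<Sum>j. ennreal (min (c j) (exp v) * exp ((q - 1) * v)))" .
  qed
  also have "... = 2 * (\<Sum>j. \<integral>\<^sup>+v. ennreal (min (c j) (exp v) * exp ((q - 1) * v)) \<partial>lborel)"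
   by (simp add: nn_integral_cmult nn_integral_suminf)
  also have "... = 2 * (\<Sum>j. ennreal (c j powr q) * W)" by (simp add: scale c)
  also have "... = 2 * (\<Sum>j. ennreal (c j powr q)) * W" by (simp add: mult.assoc)
  also have "(\<Sum>j. ennreal (c j powr q)) = ennreal (\<Sum>j. c j powr q)"
   using sc by (intro suminf_ennreal2) auto
  also have "2 * ennreal (\<Sum>j. c j powr q) = ennreal (2 * (\<Sum>j. c j powr q))"
   using sc by (simp add: ennreal_mult suminf_nonneg)
  finally have "W * ennreal (\<Sum>i\<in>I. s i powr q) <= W * ennreal (2 * (\<Sum>j. c j powr q))"
   by (simp add: mult.commute)
  then have "ennreal (\<Sum>i\<in>I. s i powr q) <= ennreal (2 * (\<Sum>j. c j powr q))"
   using Wfin \<open>W ~= 0\<close> by (simp add: ennreal_mult_le_mult_iff)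
  then show ?thesis using sc by (simp add: suminf_nonneg)
 qed
qed

section \<open>Decreasing enumerations with multiplicity\<close>

text \<open>The property that characterizes \<open>singular_value A\<close> when \<open>m\<close> is \<open>singular_mult A\<close>.\<close>

definition enumerates :: "(real => nat) => (nat => real) => bool" where
 "enumerates m s \<longleftrightarrow> decseq s & (\<forall>k. 0 <= s k) &
   (\<forall>sg>0. finite {k. s k = sg} & card {k. s k = sg} = m sg)"

definition count_above :: "(real => nat) => real => nat" where
 "count_above m sg = (\<Sum>sg'\<in>{sg'. sg <= sg' & m sg' ~= 0}. m sg')"

text \<open>A decreasing enumeration is determined by its distribution function \<open>count_above\<close>; existence and
 uniqueness both follow from this form.\<close>

lemma enumerates_iff_less_count_above:
 assumes fin: "!!eps. 0 < eps ==> finite {sg. eps <= sg & m sg ~= 0}"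
 shows "enumerates m s \<longleftrightarrow> (\<forall>k. 0 <= s k) & (\<forall>k. \<forall>sg>0. sg <= s k \<longleftrightarrow> k < count_above m sg)"
proof
 assume s: "enumerates m s"
 have "sg <= s k \<longleftrightarrow> k < count_above m sg" if sg: "0 < sg" for k sg
 proof -
 define S where "S = {k. sg <= s k}"
 have S: "S = (\<Union>sg'\<in>{sg'. sg <= sg' & m sg' ~= 0}. {k. s k = sg'})"
 proof -
  have "m (s k) ~= 0" if "sg <= s k" for k
  proof -
   have "finite {l. s l = s k}" "card {l. s l = s k} = m (s k)"
    using s sg that by (auto simp: enumerates_def)
   moreover have "k \<in> {l. s l = s k}" by simp
   ultimately show ?thesis by (metis card_0_eq empty_iff)
  qed
  then show ?thesis by (auto simp: S_def)
 qed
 have fS: "finite S" unfolding S using fin[OF sg] s sg by (auto simp: enumerates_def)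
 have "card S = (\<Sum>sg'\<in>{sg'. sg <= sg' & m sg' ~= 0}. card {k. s k = sg'})"
  unfolding S using fin[OF sg] s sg by (intro card_UN_disjoint) (auto simp: enumerates_def)
 also have "... = count_above m sg"
  unfolding count_above_def using s sg by (intro sum.cong) (auto simp: enumerates_def)
 finally have cS: "card S = count_above m sg" .
 have down: "l \<in> S" if "k \<in> S" "l <= k" for k l
  using s that by (auto simp: S_def enumerates_def decseq_def intro: order_trans)
 have "S = {..<card S}"
 proof (cases "S = {}")
  case False
  have "S = {..Max S}" using down[OF Max_in[OF fS False]] fS by auto
  then show ?thesis by (metis card_atMost lessThan_Suc_atMost)
 qed simp
 then show ?thesis
  using cS by (metis S_def lessThan_iff mem_Collect_eq)
 qed
 then show "(\<forall>k. 0 <= s k) & (\<forall>k. \<forall>sg>0. sg <= s k \<longleftrightarrow> k < count_above m sg)"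
  using s by (simp add: enumerates_def)
next
 assume *: "(\<forall>k. 0 <= s k) & (\<forall>k. \<forall>sg>0. sg <= s k \<longleftrightarrow> k < count_above m sg)"
 then have nn: "0 <= s k" and iff: "0 < sg ==> sg <= s k \<longleftrightarrow> k < count_above m sg" for k sg by auto
 have dec: "s l <= s k" if "k <= l" for k l
  using nn[of k] nn[of l] iff[of "s l" l] iff[of "s l" k] that by (cases "s l = 0") (auto simp: less_le)
 have "finite {k. s k = sg} & card {k. s k = sg} = m sg" if sg: "0 < sg" for sg
 proof -
  define B where "B = {sg'. sg < sg' & m sg' ~= 0}"
  have fB: "finite B" by (rule finite_subset[OF _ fin[OF sg]]) (auto simp: B_def)
  define N' where "N' = (\<Sum>sg'\<in>B. m sg')"
  have gt: "sg < s k \<longleftrightarrow> k < N'" for k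
  proof
   assume "sg < s k"
   then have "k < count_above m (s k)" using iff[of "s k" k] sg by auto
   also have "... <= N'" unfolding count_above_def N'_def
    using \<open>sg < s k\<close> by (intro sum_mono2 fB) (auto simp: B_def)
   finally show "k < N'" .
  next
   assume "k < N'"
   then have "B ~= {}" by (auto simp: N'_def)
   then obtain b where mB: "b \<in> B" and le: "!!x. x \<in> B ==> b <= x"
    using Min_in[OF fB] Min_le[OF fB] by blast
   have "{sg'. b <= sg' & m sg' ~= 0} = B"
   proof (intro set_eqI iffI)
    fix x assume "x \<in> {sg'. b <= sg' & m sg' ~= 0}"
    then show "x \<in> B" using mB unfolding B_def by simp
   next
    fix x assume "x \<in> B"
    then show "x \<in> {sg'. b <= sg' & m sg' ~= 0}" using le[of x] unfolding B_def by simp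
   qed
   then have "count_above m b = N'" by (simp add: count_above_def N'_def)
   then have "b <= s k" using iff[of b k] mB sg \<open>k < N'\<close> by (simp add: B_def)
   then show "sg < s k" using mB by (simp add: B_def)
  qed
  have "count_above m sg = N' + m sg"
  proof (cases "m sg = 0")
   case True
   then have "{sg'. sg <= sg' & m sg' ~= 0} = B" by (auto simp: B_def le_less)
   then show ?thesis using True by (simp add: count_above_def N'_def)
  next
   case False
   then have "{sg'. sg <= sg' & m sg' ~= 0} = insert sg B" by (auto simp: B_def le_less)
   then show ?thesis using fB by (simp add: count_above_def N'_def B_def)
  qed
  moreover have "{k. s k = sg} = {N'..<count_above m sg}"
  proof (intro set_eqI)
   fix k show "k \<in> {k. s k = sg} \<longleftrightarrow> k \<in> {N'..<count_above m sg}"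
    using gt[of k] iff[OF sg, of k] by (cases "s k = sg") auto
  qed
  ultimately show ?thesis by simp
 qed
 then show "enumerates m s" using dec nn by (auto simp: enumerates_def decseq_def)
qed

lemma ex1_enumerates:
 assumes fin: "!!eps. 0 < eps ==> finite {sg. eps <= sg & m sg ~= 0}"
 shows "\<exists>!s. enumerates m s"
proof (rule ex_ex1I)
 define L where "L k = {sg. 0 < sg & m sg ~= 0 & k < count_above m sg}" for k
 define s where "s k = Sup (insert 0 (L k))" for k
 have anti: "count_above m sg' <= count_above m sg" if "0 < sg" "sg <= sg'" for sg sg'
  unfolding count_above_def using that by (intro sum_mono2 fin) auto
 have bdd: "bdd_above (insert 0 (L k))" for k
 proof -
  have "L k \<subseteq> {sg. 1 <= sg & m sg ~= 0} \<union> {..1}" by (auto simp: L_def)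
  moreover have "bdd_above ({sg. 1 <= sg & m sg ~= 0} \<union> {..1})"
   using fin[of 1] by (simp add: bdd_above_finite)
  ultimately show ?thesis by (metis bdd_above_insert bdd_above_mono)
 qed
 have "sg <= s k \<longleftrightarrow> k < count_above m sg" if sg: "0 < sg" for k sg
 proof
  assume k: "k < count_above m sg"
  define A where "A = {sg'. sg <= sg' & m sg' ~= 0}"
  have fA: "finite A" using fin[OF sg] by (simp add: A_def)
  have "A ~= {}" using k unfolding count_above_def A_def[symmetric] by fastforce
 then obtain b where mA: "b \<in> A" and le: "!!x. x \<in> A ==> b <= x"
   using Min_in[OF fA] Min_le[OF fA] by blast
  have "{sg'. b <= sg' & m sg' ~= 0} = A"
  proof (intro set_eqI iffI)
   fix x assume "x \<in> {sg'. b <= sg' & m sg' ~= 0}"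
   then show "x \<in> A" using mA unfolding A_def by simp
  next
   fix x assume "x \<in> A"
   then show "x \<in> {sg'. b <= sg' & m sg' ~= 0}" using le[of x] unfolding A_def by simp
  qed
  then have "count_above m b = count_above m sg" by (simp add: count_above_def A_def)
  then have "b \<in> L k" using k mA sg by (auto simp: L_def A_def)
  then have "b <= s k" unfolding s_def using bdd by (intro cSup_upper) auto
  then show "sg <= s k" using mA by (simp add: A_def)
 next
  assume le: "sg <= s k"
  show "k < count_above m sg"
  proof (rule ccontr)
   assume "\<not> k < count_above m sg"
   then have lt: "sg' < sg" if "sg' \<in> L k" for sg'
    using that anti[OF sg, of sg'] \<open>\<not> k < count_above m sg\<close>
    unfolding L_def by (cases "sg' < sg") auto
   define F where "F = insert (sg/2) {sg' \<in> L k. sg/2 <= sg'}"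
   have fF: "finite F" unfolding F_def
    by (rule finite.insertI[OF finite_subset[OF _ fin[of "sg/2"]]]) (use sg in \<open>auto simp: L_def\<close>)
   have "s k <= Max F" unfolding s_def
   proof (rule cSup_least)
    fix x assume x: "x \<in> insert 0 (L k)"
    show "x <= Max F"
    proof (cases "sg/2 <= x")
    case True
    then have "x \<in> F" using x sg by (auto simp: F_def)
    then show ?thesis using fF by simp
    next
    case False
    moreover have "sg/2 <= Max F" using fF by (intro Max_ge) (auto simp: F_def)
    ultimately show ?thesis by simp
    qed
   qed simp
   also have "Max F < sg" using fF lt sg by (auto simp: F_def)
   finally show False using le by simp
  qed
 qed
 moreover have "0 <= s k" for k unfolding s_def using bdd by (intro cSup_upper) auto
 ultimately show "\<exists>s. enumerates m s" using enumerates_iff_less_count_above[OF fin] by blast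
next
 fix s s' assume "enumerates m s" "enumerates m s'"
 then have "0 <= s k" "0 <= s' k" "0 < sg ==> sg <= s k \<longleftrightarrow> sg <= s' k" for k sg
  by (auto simp: enumerates_iff_less_count_above[OF fin])
 then have "s k = s' k" for k by (metis order_antisym order_le_less order_refl)
 then show "s = s'" by blast
qed

lemma enumerates_sum_powr_le:
 assumes s: "enumerates m s" and q: "0 < q"
  and B: "!!A. finite A ==> A \<subseteq> {0<..} ==> (\<Sum>sg\<in>A. real (m sg) * sg powr q) <= B"
 shows "(\<Sum>k<K. s k powr q) <= B"
proof -
 define D where "D = {k\<in>{..<K}. 0 < s k}"
 have D: "finite D" by (simp add: D_def)
 have "(\<Sum>k<K. s k powr q) = (\<Sum>k\<in>D. s k powr q)"
  unfolding D_def using s q by (intro sum.mono_neutral_right) (auto simp: enumerates_def not_less intro: order_antisym)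
 also have "... = (\<Sum>sg\<in>s ` D. \<Sum>k\<in>{k\<in>D. s k = sg}. s k powr q)"
  by (rule sum.image_gen[OF D])
 also have "... <= (\<Sum>sg\<in>s ` D. real (m sg) * sg powr q)"
 proof (rule sum_mono)
  fix sg assume "sg \<in> s ` D"
  then have "0 < sg" by (auto simp: D_def)
  then have f: "finite {k. s k = sg}" "card {k. s k = sg} = m sg"
   using s by (auto simp: enumerates_def)
  have "card {k\<in>D. s k = sg} <= card {k. s k = sg}"
   by (rule card_mono[OF f(1)]) auto
  then have "card {k\<in>D. s k = sg} <= m sg" using f(2) by simp
  then have "real (card {k\<in>D. s k = sg}) * sg powr q <= real (m sg) * sg powr q"
   by (intro mult_right_mono) auto
  then show "(\<Sum>k\<in>{k\<in>D. s k = sg}. s k powr q) <= real (m sg) * sg powr q" by simp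
 qed
 also have "... <= B" using D by (intro B) (auto simp: D_def)
 finally show ?thesis .
qed

section \<open>Calculus in the space of square integrable functions\<close>

lemma L2_rel_refl [simp]: "L2_rel f f \<longleftrightarrow> sq_integrable f"
 by (auto simp: L2_rel_def)

lemma rep_L2_rel: "L2_rel (rep_L2 u) (rep_L2 u)"
 by (metis Quotient_L2 Quotient_rep_reflp)

lemma sq_integrable_rep [simp]: "sq_integrable (rep_L2 u)"
 using rep_L2_rel[of u] by simp

lemma abs_L2_rep [simp]: "abs_L2 (rep_L2 u) = u"
 by (metis Quotient_L2 Quotient_abs_rep)

lemma rep_abs_L2:
 assumes "sq_integrable f"
 shows "AE x in lebesgue. rep_L2 (abs_L2 f) x = f x"
proof -
 have "L2_rel (rep_L2 (abs_L2 f)) f"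
  using Quotient_rep_abs[OF Quotient_L2] assms by (metis L2_rel_refl)
 then show ?thesis by (simp add: L2_rel_def)
qed

lemma abs_L2_eqI:
 assumes "sq_integrable f" "sq_integrable g" "AE x in lebesgue. f x = g x"
 shows "abs_L2 f = abs_L2 g"
 using assms Quotient_rel_abs[OF Quotient_L2, of f g] by (simp add: L2_rel_def)

lemma L2_eqI:
 assumes "AE x in lebesgue. rep_L2 u x = rep_L2 v x"
 shows "u = v"
 using abs_L2_eqI[OF sq_integrable_rep sq_integrable_rep assms] by simp

lemma borel_measurable_rep [measurable]: "rep_L2 u \<in> borel_measurable lebesgue"
 using sq_integrable_rep[of u] unfolding sq_integrable_def by blast

lemma abs_L2_add:
 assumes "sq_integrable f" "sq_integrable g"
 shows "abs_L2 f + abs_L2 g = abs_L2 (%x. f x + g x)"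
 using assms by (simp add: plus_L2.abs_eq)

lemma scaleC_abs_L2:
 assumes "sq_integrable f"
 shows "scaleC z (abs_L2 f) = abs_L2 (%x. z * f x)"
 using assms by (simp add: scaleC.abs_eq)

lemma sq_integrable_sum:
 assumes "!!j. j \<in> J ==> sq_integrable (f j)"
 shows "sq_integrable (%x. \<Sum>j\<in>J. f j x)"
 using assms by (induction J rule: infinite_finite_induct) (auto intro: sq_integrable_zero sq_integrable_add)

lemma abs_L2_sum:
 assumes "!!j. j \<in> J ==> sq_integrable (f j)"
 shows "(\<Sum>j\<in>J. abs_L2 (f j)) = abs_L2 (%x. \<Sum>j\<in>J. f j x)"
 using assms
proof (induction J rule: infinite_finite_induct)
 case (insert k J)
 then show ?case by (simp add: abs_L2_add sq_integrable_sum)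
qed (simp_all add: zero_L2.abs_eq)

lemma inner_abs_L2:
 assumes "sq_integrable f" "sq_integrable g"
 shows "abs_L2 f \<bullet> abs_L2 g = (\<integral>x. f x \<bullet> g x \<partial>lebesgue)"
 using assms by (simp add: inner_L2.abs_eq)

lemma norm_abs_L2:
 assumes "sq_integrable f"
 shows "(norm (abs_L2 f))\<^sup>2 = (\<integral>x. (norm (f x))\<^sup>2 \<partial>lebesgue)"
 using inner_abs_L2[OF assms assms] by (simp add: power2_norm_eq_inner)

lemma norm_scaleC [simp]: "norm (scaleC z (u::'v::euclidean_space L2)) = norm z * norm u"
proof -
 have "(norm (scaleC z (abs_L2 (rep_L2 u))))\<^sup>2 = (norm z * norm (abs_L2 (rep_L2 u)))\<^sup>2"
  unfolding scaleC_abs_L2[OF sq_integrable_rep] power_mult_distrib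
   norm_abs_L2[OF sq_integrable_scale[OF sq_integrable_rep]] norm_abs_L2[OF sq_integrable_rep]
  by (simp add: norm_mult power_mult_distrib)
 then show ?thesis by (simp add: power2_eq_iff_nonneg)
qed

lemma sq_integrable_cnj:
 assumes "sq_integrable f"
 shows "sq_integrable (%x. cnj (f x))"
proof -
 have "(%x. cnj (f x)) \<in> borel_measurable lebesgue"
  using assms unfolding sq_integrable_def
  by (intro borel_measurable_continuous_on[OF continuous_on_cnj[OF continuous_on_id]]) auto
 then show ?thesis using assms by (simp add: sq_integrable_def)
qed

lemma norm_abs_cnj: "sq_integrable f ==> norm (abs_L2 (%x. cnj (f x))) = norm (abs_L2 f)"
 by (rule power2_eq_imp_eq) (simp_all add: norm_abs_L2 sq_integrable_cnj)

text \<open>The bilinear (not sesquilinear) pairing, which is what integral kernels \<open>phi x * psi y\<close> produce.\<close>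

definition bil :: "('v::euclidean_space => complex) => 'v L2 => complex" where
 "bil psi u = (\<integral>x. psi x * rep_L2 u x \<partial>lebesgue)"

lemma integrable_mult_sq_integrable:
 assumes "sq_integrable f" "sq_integrable g"
 shows "integrable lebesgue (%x. f x * g x)"
proof -
 have m[measurable]: "f \<in> borel_measurable lebesgue" "g \<in> borel_measurable lebesgue"
  using assms by (auto simp: sq_integrable_def)
 have "integrable lebesgue (%x. (norm (f x))\<^sup>2 + (norm (g x))\<^sup>2)"
  using assms by (simp add: sq_integrable_def)
 then show ?thesis
 proof (rule Bochner_Integration.integrable_bound)
  show "AE x in lebesgue. norm (f x * g x) <= norm ((norm (f x))\<^sup>2 + (norm (g x))\<^sup>2)"
  proof (rule AE_I2)
   fix x
   have "norm (f x) * norm (g x) <= (norm (f x))\<^sup>2 + (norm (g x))\<^sup>2"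
    using sum_squares_bound[of "norm (f x)" "norm (g x)"]
    mult_nonneg_nonneg[OF norm_ge_zero[of "f x"] norm_ge_zero[of "g x"]] by linarith
   then show "norm (f x * g x) <= norm ((norm (f x))\<^sup>2 + (norm (g x))\<^sup>2)" by (simp add: norm_mult)
  qed
 qed measurable
qed

lemma bil_abs:
 assumes "sq_integrable psi" "sq_integrable f"
 shows "bil psi (abs_L2 f) = (\<integral>x. psi x * f x \<partial>lebesgue)"
 unfolding bil_def
proof (rule integral_cong_AE)
 show "AE x in lebesgue. psi x * rep_L2 (abs_L2 f) x = psi x * f x"
  using rep_abs_L2[OF assms(2)] by eventually_elim simp
 show "(%x. psi x * rep_L2 (abs_L2 f) x) \<in> borel_measurable lebesgue" "(%x. psi x * f x) \<in> borel_measurable lebesgue"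
  using integrable_mult_sq_integrable[OF assms] integrable_mult_sq_integrable[OF assms(1) sq_integrable_rep]
  by (blast intro: borel_measurable_integrable)+
qed

lemma Re_bil:
 assumes "sq_integrable psi"
 shows "Re (bil psi u) = abs_L2 (%x. cnj (psi x)) \<bullet> u"
proof -
 have "abs_L2 (%x. cnj (psi x)) \<bullet> abs_L2 (rep_L2 u) = (\<integral>x. Re (psi x * rep_L2 u x) \<partial>lebesgue)"
  by (subst inner_abs_L2[OF sq_integrable_cnj[OF assms] sq_integrable_rep]) (simp add: inner_complex_def)
 also have "... = Re (bil psi u)"
  unfolding bil_def by (rule integral_Re[OF integrable_mult_sq_integrable[OF assms sq_integrable_rep]])
 finally show ?thesis by simp
qed

lemma bil_mult: "bil (%x. z * psi x) u = z * bil psi u"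
 by (simp add: bil_def mult.assoc)

lemma Im_bil:
 assumes "sq_integrable psi"
 shows "Im (bil psi u) = abs_L2 (%x. cnj (- \<i> * psi x)) \<bullet> u"
 using Re_bil[OF sq_integrable_scale[OF assms, of "- \<i>"], of u] by (simp only: bil_mult) simp

lemma norm_bil_le:
 assumes "sq_integrable psi"
 shows "norm (bil psi u) <= norm (abs_L2 psi) * norm u"
proof (cases "bil psi u = 0")
 case False
 define z where "z = cnj (sgn (bil psi u))"
 have "norm (bil psi u) = Re (z * bil psi u)"
  using False by (simp add: z_def sgn_eq complex_norm_square[symmetric] complex_cnj_divide
    mult.commute[of "cnj _"] power2_eq_square flip: of_real_mult of_real_divide)
 also have "... = abs_L2 (%x. cnj (z * psi x)) \<bullet> u"
  by (subst Re_bil[OF sq_integrable_scale[OF assms], symmetric]) (simp add: bil_mult)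
 also have "... <= norm (abs_L2 (%x. cnj (z * psi x))) * norm u"
  by (rule norm_cauchy_schwarz)
 also have "norm (abs_L2 (%x. cnj (z * psi x))) = norm (abs_L2 psi)"
  using False norm_abs_cnj[OF sq_integrable_scale[OF assms, of z]] scaleC_abs_L2[OF assms, of z]
  by (metis complex_mod_cnj mult_1 norm_scaleC norm_sgn z_def)
 finally show ?thesis .
qed simp

lemma scaleC_eq_abs: "scaleC z u = abs_L2 (%x. z * rep_L2 u x)"
 using scaleC_abs_L2[OF sq_integrable_rep, of z u] by (simp only: abs_L2_rep)

lemma plus_eq_abs: "u + v = abs_L2 (%x. rep_L2 u x + rep_L2 v x)"
 using abs_L2_add[OF sq_integrable_rep sq_integrable_rep, of u v] by (simp only: abs_L2_rep)

lemma bil_scaleC: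
 assumes "sq_integrable psi"
 shows "bil psi (scaleC z u) = z * bil psi u"
 unfolding scaleC_eq_abs bil_abs[OF assms sq_integrable_scale[OF sq_integrable_rep]]
 by (simp add: bil_def mult.left_commute)

lemma bil_add:
 assumes "sq_integrable psi"
 shows "bil psi (u + v) = bil psi u + bil psi v"
 unfolding plus_eq_abs bil_abs[OF assms sq_integrable_add[OF sq_integrable_rep sq_integrable_rep]]
 by (simp add: bil_def distrib_left integrable_mult_sq_integrable[OF assms])

text \<open>Minkowski for series: the pointwise sum of the norms is square integrable by monotone convergence.\<close>

lemma L2_series_aux:
 fixes f :: "nat => 'v::euclidean_space => complex"
 assumes f: "!!j. sq_integrable (f j)" and s: "summable (%j. norm (abs_L2 (f j)))"
 shows "AE x in lebesgue. summable (%j. norm (f j x))"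
  and "sq_integrable (%x. \<Sum>j. f j x)"
  and "norm (abs_L2 (%x. \<Sum>j. f j x)) <= (\<Sum>j. norm (abs_L2 (f j)))"
proof -
 define A where "A = (\<Sum>j. norm (abs_L2 (f j)))"
 have A0: "0 <= A" unfolding A_def using s by (intro suminf_nonneg) auto
 have meas[measurable]: "f j \<in> borel_measurable lebesgue" for j using f[of j] by (simp add: sq_integrable_def)
 define g where "g N x = (\<Sum>j<N. norm (f j x))" for N x
 have nf: "sq_integrable (%x. complex_of_real (norm (f j x)))" for j
  using f[of j] by (simp add: sq_integrable_def)
 have nn: "norm (abs_L2 (%x. complex_of_real (norm (f j x)))) = norm (abs_L2 (f j))" for j
  by (rule power2_eq_imp_eq) (simp_all add: norm_abs_L2[OF nf] norm_abs_L2[OF f])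
 have sqg: "sq_integrable (%x. complex_of_real (g N x))" for N
  using sq_integrable_sum[of "{..<N}" "%j x. complex_of_real (norm (f j x))"] nf by (simp add: g_def)
 have "norm (abs_L2 (%x. complex_of_real (g N x))) <= A" for N
 proof -
  have "abs_L2 (%x. complex_of_real (g N x)) = (\<Sum>j<N. abs_L2 (%x. complex_of_real (norm (f j x))))"
   by (subst abs_L2_sum[OF nf]) (simp add: g_def)
  then have "norm (abs_L2 (%x. complex_of_real (g N x))) <= (\<Sum>j<N. norm (abs_L2 (f j)))"
   by (simp add: norm_sum nn order_trans[OF norm_sum])
  also have "... <= A" unfolding A_def using s by (intro sum_le_suminf) auto
  finally show ?thesis .
 qed
 then have nle: "(norm (abs_L2 (%x. complex_of_real (g N x))))\<^sup>2 <= A\<^sup>2" for N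
  by (intro power_mono) auto
 have gA: "(\<integral>x. (g N x)\<^sup>2 \<partial>lebesgue) <= A\<^sup>2" for N
  using nle[of N] norm_abs_L2[OF sqg, of N] by simp
 have gm[measurable]: "(%x. g N x) \<in> borel_measurable lebesgue" for N
  unfolding g_def by measurable
 have gint: "integrable lebesgue (%x. (g N x)\<^sup>2)" for N
  using sqg[of N] by (simp add: sq_integrable_def)
 define G where "G x = (SUP N. ennreal ((g N x)\<^sup>2))" for x
 have Gm[measurable]: "G \<in> borel_measurable lebesgue" unfolding G_def by measurable
 have gnn: "0 <= g N x" for N x by (simp add: g_def sum_nonneg)
 have gmono: "g N x <= g M x" if "N <= M" for N M x
  unfolding g_def using that by (intro sum_mono2) auto
 have GA: "(\<integral>\<^sup>+x. G x \<partial>lebesgue) <= ennreal (A\<^sup>2)"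
 proof -
  have "(\<integral>\<^sup>+x. G x \<partial>lebesgue) = (SUP N. \<integral>\<^sup>+x. ennreal ((g N x)\<^sup>2) \<partial>lebesgue)"
   unfolding G_def
  proof (rule nn_integral_monotone_convergence_SUP)
   show "incseq (%N x. ennreal ((g N x)\<^sup>2))"
    by (auto simp: incseq_def le_fun_def intro!: ennreal_leI power_mono gmono gnn)
   show "!!N. (%x. ennreal ((g N x)\<^sup>2)) \<in> borel_measurable lebesgue" by measurable
  qed
  also have "... <= ennreal (A\<^sup>2)"
   by (rule SUP_least) (simp add: nn_integral_eq_integral[OF gint] gA ennreal_leI)
  finally show ?thesis .
 qed
 have "AE x in lebesgue. G x ~= \<infinity>"
  by (rule nn_integral_noteq_infinite) (use GA in \<open>auto simp: top_unique\<close>)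
 then have AEs: "AE x in lebesgue. summable (%j. norm (f j x)) & ennreal ((norm (\<Sum>j. f j x))\<^sup>2) <= G x"
 proof eventually_elim
  case (elim x)
  then obtain r where r: "G x = ennreal r" "0 <= r" by (cases "G x") auto
  have gle: "g N x <= sqrt r" for N
  proof -
   have "ennreal ((g N x)\<^sup>2) <= ennreal r" unfolding r(1)[symmetric] G_def by (rule SUP_upper) simp
   then have "(g N x)\<^sup>2 <= r" using r(2) by simp
   then show ?thesis by (rule real_le_rsqrt)
  qed
  have sm: "summable (%j. norm (f j x))"
   by (rule summableI_nonneg_bounded[where x = "sqrt r"]) (use gle in \<open>auto simp: g_def\<close>)
  have "norm (\<Sum>j. f j x) <= (\<Sum>j. norm (f j x))" by (rule summable_norm[OF sm])
  also have "... <= sqrt r"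
   using gle by (intro suminf_le_const[OF sm]) (simp add: g_def)
  finally have "(norm (\<Sum>j. f j x))\<^sup>2 <= (sqrt r)\<^sup>2" by (intro power_mono) auto
  then show ?case using sm r by (simp add: ennreal_leI)
 qed
 then show "AE x in lebesgue. summable (%j. norm (f j x))" by eventually_elim simp
 have Sm[measurable]: "(%x. \<Sum>j. f j x) \<in> borel_measurable lebesgue" by measurable
 have le: "(\<integral>\<^sup>+x. ennreal ((norm (\<Sum>j. f j x))\<^sup>2) \<partial>lebesgue) <= ennreal (A\<^sup>2)"
 proof -
  have "(\<integral>\<^sup>+x. ennreal ((norm (\<Sum>j. f j x))\<^sup>2) \<partial>lebesgue) <= (\<integral>\<^sup>+x. G x \<partial>lebesgue)"
   by (rule nn_integral_mono_AE) (use AEs in eventually_elim, simp)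
  then show ?thesis using GA by simp
 qed
 have int: "integrable lebesgue (%x. (norm (\<Sum>j. f j x))\<^sup>2)"
  by (rule integrableI_bounded) (use le in \<open>auto simp: less_top[symmetric] top_unique\<close>)
 show sq: "sq_integrable (%x. \<Sum>j. f j x)" using int by (simp add: sq_integrable_def)
 have "(norm (abs_L2 (%x. \<Sum>j. f j x)))\<^sup>2 <= A\<^sup>2"
  unfolding norm_abs_L2[OF sq] using le by (simp add: nn_integral_eq_integral[OF int])
 then show "norm (abs_L2 (%x. \<Sum>j. f j x)) <= (\<Sum>j. norm (abs_L2 (f j)))"
  unfolding A_def[symmetric] using A0 by (rule power2_le_imp_le)
qed

lemma L2_series:
 fixes X :: "nat => 'v::euclidean_space L2"
 assumes s: "summable (%j. norm (X j))"
 shows "X sums suminf X"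
  and "AE x in lebesgue. summable (%j. norm (rep_L2 (X j) x)) & rep_L2 (suminf X) x = (\<Sum>j. rep_L2 (X j) x)"
  and "norm (suminf X - (\<Sum>j<N. X j)) <= (\<Sum>j. norm (X (j + N)))"
proof -
 define f where "f j = rep_L2 (X j)" for j
 have sN: "summable (%j. norm (abs_L2 (f (j + N))))" for N
  unfolding f_def abs_L2_rep using s by (rule summable_ignore_initial_segment)
 have sqf: "sq_integrable (f j)" for j by (simp add: f_def)
 have aux1: "AE x in lebesgue. summable (%j. norm (f (j + N) x))"
  and aux2: "sq_integrable (%x. \<Sum>j. f (j + N) x)"
  and aux3: "norm (abs_L2 (%x. \<Sum>j. f (j + N) x)) <= (\<Sum>j. norm (abs_L2 (f (j + N))))" for N
  by (rule L2_series_aux(1)[OF sqf sN], rule L2_series_aux(2)[OF sqf sN], rule L2_series_aux(3)[OF sqf sN])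
 have AEs: "AE x in lebesgue. summable (%j. norm (f j x))"
  using aux1[of 0] by simp
 define Y where "Y = abs_L2 (%x. \<Sum>j. f j x)"
 have sqY: "sq_integrable (%x. \<Sum>j. f j x)" using aux2[of 0] by simp
 have bd: "norm (Y - (\<Sum>j<N. X j)) <= (\<Sum>j. norm (X (j + N)))" for N
 proof -
  have sq1: "sq_integrable (%x. \<Sum>j. f (j + N) x)" by (rule aux2)
  have sq2: "sq_integrable (%x. \<Sum>j<N. f j x)" by (rule sq_integrable_sum[OF sqf])
  have "abs_L2 (%x. \<Sum>j. f (j + N) x) + (\<Sum>j<N. X j) = abs_L2 (%x. (\<Sum>j. f (j + N) x) + (\<Sum>j<N. f j x))"
   using abs_L2_sum[of "{..<N}" f] abs_L2_add[OF sq1 sq2] by (simp add: f_def)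
  also have "... = Y" unfolding Y_def
  proof (rule abs_L2_eqI[OF sq_integrable_add[OF sq1 sq2] sqY])
   show "AE x in lebesgue. (\<Sum>j. f (j + N) x) + (\<Sum>j<N. f j x) = (\<Sum>j. f j x)"
    using AEs
   proof eventually_elim
    case (elim x)
    then have "summable (%j. f j x)" by (rule summable_norm_cancel)
    then show ?case using suminf_split_initial_segment[of "%j. f j x" N] by simp
   qed
  qed
  finally have "Y - (\<Sum>j<N. X j) = abs_L2 (%x. \<Sum>j. f (j + N) x)" by (simp add: algebra_simps)
  then show ?thesis using aux3[of N] by (simp add: f_def)
 qed
 have "(%N. \<Sum>j. norm (X (j + N))) \<longlonglongrightarrow> 0"
 proof -
  have "(%N. (\<Sum>j. norm (X j)) - (\<Sum>j<N. norm (X j))) \<longlonglongrightarrow> (\<Sum>j. norm (X j)) - (\<Sum>j. norm (X j))"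
   by (intro tendsto_diff tendsto_const summable_LIMSEQ[OF s])
  then show ?thesis by (simp add: suminf_minus_initial_segment[OF s])
 qed
 then have "(%N. norm (Y - (\<Sum>j<N. X j))) \<longlonglongrightarrow> 0"
  by (rule tendsto_sandwich[OF _ _ tendsto_const, rotated 2]) (auto simp: bd)
 then have "(%N. Y - (\<Sum>j<N. X j)) \<longlonglongrightarrow> 0" by (rule tendsto_norm_zero_cancel)
 then have "(%N. Y - (Y - (\<Sum>j<N. X j))) \<longlonglongrightarrow> Y - 0" by (intro tendsto_diff tendsto_const)
 then have sums: "X sums Y" by (simp add: sums_def)
 then have Y: "suminf X = Y" by (simp add: sums_unique[symmetric])
 show "X sums suminf X" using sums Y by simp
 show "norm (suminf X - (\<Sum>j<N. X j)) <= (\<Sum>j. norm (X (j + N)))" using bd Y by simp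
 show "AE x in lebesgue. summable (%j. norm (rep_L2 (X j) x)) & rep_L2 (suminf X) x = (\<Sum>j. rep_L2 (X j) x)"
  using AEs rep_abs_L2[OF sqY] unfolding Y Y_def f_def by eventually_elim simp
qed

section \<open>Series of rank one operators\<close>

lemma L2_independent_imp_real_independent:
 assumes "L2.independent B"
 shows "independent B"
proof
 assume "dependent B"
 then obtain S u where S: "finite S" "S \<subseteq> B" "(\<Sum>v\<in>S. u v *\<^sub>R v) = 0" "\<exists>v\<in>S. u v ~= 0"
  unfolding real_vector.dependent_explicit by blast
 have "(\<Sum>v\<in>S. scaleC (complex_of_real (u v)) v) = 0" using S(3) by (simp add: scaleR_L2_def)
 moreover have "\<exists>v\<in>S. complex_of_real (u v) ~= 0" using S(4) by simp
 ultimately have "L2.dependent B"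
  unfolding L2.dependent_explicit using S(1,2) by (intro exI[of _ S] exI[of _ "%v. complex_of_real (u v)"]) auto
 then show False using assms by simp
qed

lemma measurable_lebesgue_cong_AE:
 fixes f g :: "'v::euclidean_space => 'b::topological_space"
 assumes f: "f \<in> borel_measurable lebesgue" and eq: "AE x in lebesgue. f x = g x"
 shows "g \<in> borel_measurable lebesgue"
proof (rule measurableI)
 fix S :: "'b set" assume S: "S \<in> sets borel"
 show "g -` S \<inter> space lebesgue \<in> sets lebesgue"
 proof (rule completion.in_sets_AE[of "f -` S \<inter> space lebesgue"])
  show "AE x in lebesgue. x \<in> f -` S \<inter> space lebesgue \<longleftrightarrow> x \<in> g -` S \<inter> space lebesgue"
   using eq by eventually_elim simp
  show "f -` S \<inter> space lebesgue \<in> sets lebesgue" by (rule measurable_sets[OF f S])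
 qed simp
qed simp

text \<open>The operator with kernel \<open>\<Sum>j. phi j x * psi j y\<close>.\<close>

definition nuc :: "(nat => 'v::euclidean_space => complex) => (nat => 'v => complex) => 'v L2 => 'v L2" where
 "nuc phi psi u = (\<Sum>j. scaleC (bil (psi j) u) (abs_L2 (phi j)))"

locale nuclear_family =
 fixes phi psi :: "nat => 'v::euclidean_space => complex"
 assumes sqphi: "!!j. sq_integrable (phi j)" and sqpsi: "!!j. sq_integrable (psi j)"
  and sm: "summable (%j. norm (abs_L2 (phi j)) * norm (abs_L2 (psi j)))"
begin

lemma summable_terms: "summable (%j. norm (scaleC (bil (psi j) u) (abs_L2 (phi j))))"
proof (rule summable_comparison_test'[OF summable_mult2[OF sm, of "norm u"]])
 fix j
 have "norm (bil (psi j) u) * norm (abs_L2 (phi j)) <= (norm (abs_L2 (psi j)) * norm u) * norm (abs_L2 (phi j))"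
  by (intro mult_right_mono norm_bil_le sqpsi) simp
 then show "norm (norm (scaleC (bil (psi j) u) (abs_L2 (phi j)))) <= norm (abs_L2 (phi j)) * norm (abs_L2 (psi j)) * norm u"
  by (simp add: mult_ac)
qed

lemma nuc_sums: "(%j. scaleC (bil (psi j) u) (abs_L2 (phi j))) sums nuc phi psi u"
 unfolding nuc_def by (rule L2_series(1)[OF summable_terms])

lemma nuc_linear: "Vector_Spaces.linear scaleC scaleC (nuc phi psi)"
proof (intro Vector_Spaces.linear_iff[THEN iffD2] conjI allI)
 show "vector_space (scaleC :: complex => 'v L2 => 'v L2)" by (rule L2.vector_space_axioms)
 then show "vector_space (scaleC :: complex => 'v L2 => 'v L2)" .
 fix u v :: "'v L2"
 have "(%j. scaleC (bil (psi j) u) (abs_L2 (phi j)) + scaleC (bil (psi j) v) (abs_L2 (phi j))) sums (nuc phi psi u + nuc phi psi v)"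
  by (intro sums_add nuc_sums)
 then have "(%j. scaleC (bil (psi j) (u + v)) (abs_L2 (phi j))) sums (nuc phi psi u + nuc phi psi v)"
  by (simp add: bil_add[OF sqpsi] L2.scale_left_distrib)
 then show "nuc phi psi (u + v) = nuc phi psi u + nuc phi psi v" by (rule sums_unique2[OF nuc_sums])
next
 fix c u
 have bl: "bounded_linear (scaleC c :: 'v L2 => 'v L2)"
  by (rule bounded_linear_intro[of _ "norm c"])
   (simp_all add: L2.scale_right_distrib scaleR_L2_def L2.scale_left_commute mult.commute)
 have "(%j. scaleC c (scaleC (bil (psi j) u) (abs_L2 (phi j)))) sums scaleC c (nuc phi psi u)"
  by (rule bounded_linear.sums[OF bl nuc_sums])
 then have "(%j. scaleC (bil (psi j) (scaleC c u)) (abs_L2 (phi j))) sums scaleC c (nuc phi psi u)"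
  by (simp add: bil_scaleC[OF sqpsi])
 then show "nuc phi psi (scaleC c u) = scaleC c (nuc phi psi u)" by (rule sums_unique2[OF nuc_sums])
qed

lemma nuc_integral_operator:
 assumes K: "AE x in lebesgue. AE y in lebesgue.
   summable (%j. norm (phi j x * psi j y)) & K x y = (\<Sum>j. phi j x * psi j y)"
 shows "is_integral_operator K (nuc phi psi)"
 unfolding is_integral_operator_def
proof
 fix u :: "'v L2"
 define c where "c j = complex_of_real (norm (abs_L2 (psi j)))" for j
 have s1: "summable (%j. norm (scaleC (c j) (abs_L2 (phi j))))"
  using sm by (simp add: c_def mult.commute)
 have ae1: "AE x in lebesgue. \<forall>j. rep_L2 (scaleC (c j) (abs_L2 (phi j))) x = c j * phi j x"
  unfolding AE_all_countable scaleC_abs_L2[OF sqphi] by (intro allI rep_abs_L2 sq_integrable_scale sqphi)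
 have ae2: "AE x in lebesgue. \<forall>j. rep_L2 (scaleC (bil (psi j) u) (abs_L2 (phi j))) x = bil (psi j) u * phi j x"
  unfolding AE_all_countable scaleC_abs_L2[OF sqphi] by (intro allI rep_abs_L2 sq_integrable_scale sqphi)
 show "AE x in lebesgue. integrable lebesgue (%y. K x y * rep_L2 u y) &
  rep_L2 (nuc phi psi u) x = (\<integral>y. K x y * rep_L2 u y \<partial>lebesgue)"
  using L2_series(2)[OF s1] L2_series(2)[OF summable_terms[of u]] ae1 ae2 K
 proof eventually_elim
  case (elim x)
  define f where "f j y = phi j x * (psi j y * rep_L2 u y)" for j y
  have fi: "integrable lebesgue (f j)" for j
   unfolding f_def by (intro integrable_mult_right integrable_mult_sq_integrable sqpsi sq_integrable_rep)
  have AEf: "AE y in lebesgue. summable (%j. norm (f j y)) & K x y * rep_L2 u y = (\<Sum>j. f j y)"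
   using elim(5)
  proof eventually_elim
   case (elim y)
   have "summable (%j. phi j x * psi j y)" using elim by (blast intro: summable_norm_cancel)
   then show ?case using elim summable_mult2[of "%j. norm (phi j x * psi j y)" "norm (rep_L2 u y)"]
    by (simp add: f_def suminf_mult2 norm_mult mult.assoc)
  qed
  have "summable (%j. \<integral>y. norm (f j y) \<partial>lebesgue)"
  proof (rule summable_comparison_test')
   show "summable (%j. norm (c j * phi j x) * norm u)"
    using elim(1,3) by (intro summable_mult2) simp
   fix j
   have a: "(\<integral>y. norm (f j y) \<partial>lebesgue) = norm (phi j x) * (\<integral>y. norm (psi j y) * norm (rep_L2 u y) \<partial>lebesgue)"
    by (simp add: f_def norm_mult)
   have nf: "sq_integrable (%y. complex_of_real (norm (g y)))" if "sq_integrable g" for g :: "'v => complex"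
    using that by (auto simp: sq_integrable_def intro!: borel_measurable_of_real borel_measurable_norm)
   have nn: "norm (abs_L2 (%y. complex_of_real (norm (g y)))) = norm (abs_L2 g)" if "sq_integrable g" for g :: "'v => complex"
    by (rule power2_eq_imp_eq) (simp_all add: norm_abs_L2[OF nf[OF that]] norm_abs_L2[OF that])
   have "(\<integral>y. norm (psi j y) * norm (rep_L2 u y) \<partial>lebesgue)
    = abs_L2 (%y. complex_of_real (norm (psi j y))) \<bullet> abs_L2 (%y. complex_of_real (norm (rep_L2 u y)))"
    by (subst inner_abs_L2) (simp_all add: nf sqpsi inner_complex_def)
   also have "... <= norm (abs_L2 (psi j)) * norm u"
    using norm_cauchy_schwarz[of "abs_L2 (%y. complex_of_real (norm (psi j y)))" "abs_L2 (%y. complex_of_real (norm (rep_L2 u y)))"]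
    by (simp add: nn sqpsi)
   finally have "norm (phi j x) * (\<integral>y. norm (psi j y) * norm (rep_L2 u y) \<partial>lebesgue) <= norm (phi j x) * (norm (abs_L2 (psi j)) * norm u)"
    by (rule mult_left_mono) simp
   then have "(\<integral>y. norm (f j y) \<partial>lebesgue) <= norm (c j * phi j x) * norm u"
    unfolding a by (simp add: norm_mult c_def mult_ac)
   then show "norm (\<integral>y. norm (f j y) \<partial>lebesgue) <= norm (c j * phi j x) * norm u" by simp
  qed
  note ser = fi _ this
  have AE1: "AE y in lebesgue. summable (%j. norm (f j y))" using AEf by eventually_elim simp
  have int: "integrable lebesgue (%y. \<Sum>j. f j y)" "(\<integral>y. (\<Sum>j. f j y) \<partial>lebesgue) = (\<Sum>j. integral\<^sup>L lebesgue (f j))"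
   using integrable_suminf[OF fi AE1 \<open>summable (%j. \<integral>y. norm (f j y) \<partial>lebesgue)\<close>]
    integral_suminf[OF fi AE1 \<open>summable (%j. \<integral>y. norm (f j y) \<partial>lebesgue)\<close>] by auto
  \<comment> \<open>Lebesgue measure is complete, so measurability passes to the almost everywhere equal kernel.\<close>
  have eq: "AE y in lebesgue. (\<Sum>j. f j y) = K x y * rep_L2 u y" using AEf by eventually_elim simp
  have measK: "(%y. K x y * rep_L2 u y) \<in> borel_measurable lebesgue"
   by (rule measurable_lebesgue_cong_AE[OF borel_measurable_integrable[OF int(1)] eq])
  have "integrable lebesgue (%y. K x y * rep_L2 u y)"
   using integrable_cong_AE[OF borel_measurable_integrable[OF int(1)] measK eq] int(1) by simp
  moreover have "(\<integral>y. K x y * rep_L2 u y \<partial>lebesgue) = (\<Sum>j. integral\<^sup>L lebesgue (f j))"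
   using integral_cong_AE[OF borel_measurable_integrable[OF int(1)] measK eq] int(2) by simp
  moreover have "integral\<^sup>L lebesgue (f j) = bil (psi j) u * phi j x" for j
   by (simp add: f_def[abs_def] bil_def mult.commute[of _ "phi j x"])
  ultimately show ?case using elim(2,4) by (simp add: nuc_def)
 qed
qed

text \<open>The image of the unit ball lies in the image of the compact product of discs
 \<open>\<Pi>\<^sub>j cball 0 \<parallel>psi j\<parallel>\<close> under the continuous map that sums the series.\<close>

lemma nuc_compact: "compact_operator (nuc phi psi)"
 unfolding compact_operator_def
proof (intro conjI nuc_linear)
 define D where "D = (\<Pi>\<^sub>E j\<in>(UNIV::nat set). cball (0::complex) (norm (abs_L2 (psi j))))"
 define F where "F z = (\<Sum>j. scaleC (z j) (abs_L2 (phi j)))" for z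
 have cD: "compact D"
 proof -
  have "compactin (product_topology (%_. euclidean) UNIV) D"
   unfolding D_def compactin_PiE by auto
  then show ?thesis by (simp add: euclidean_product_topology)
 qed
 have tail: "norm (scaleC (z j) (abs_L2 (phi j))) <= norm (abs_L2 (phi j)) * norm (abs_L2 (psi j))" if "z \<in> D" for z j
 proof -
  have "norm (z j) <= norm (abs_L2 (psi j))" using that by (simp add: D_def PiE_iff)
  then have "norm (z j) * norm (abs_L2 (phi j)) <= norm (abs_L2 (psi j)) * norm (abs_L2 (phi j))"
   by (rule mult_right_mono) simp
  then show ?thesis by (simp add: mult.commute[of "norm (abs_L2 (phi j))"])
 qed
 have sz: "summable (%j. norm (scaleC (z j) (abs_L2 (phi j))))" if "z \<in> D" for z
  by (rule summable_comparison_test'[OF sm]) (use tail[OF that] in simp)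
 have unif: "uniform_limit D (%N z. \<Sum>j<N. scaleC (z j) (abs_L2 (phi j))) F sequentially"
 proof (rule uniform_limitI)
  fix e :: real assume "e > 0"
  define c where "c j = norm (abs_L2 (phi j)) * norm (abs_L2 (psi j))" for j
  have sc: "summable c" using sm by (simp add: c_def[abs_def])
  have "(%N. suminf c - (\<Sum>j<N. c j)) \<longlonglongrightarrow> suminf c - suminf c"
   by (intro tendsto_diff tendsto_const summable_LIMSEQ[OF sc])
  then have "eventually (%N. suminf c - (\<Sum>j<N. c j) < e) sequentially"
   using \<open>e > 0\<close> by (intro order_tendstoD) auto
  then show "\<forall>\<^sub>F N in sequentially. \<forall>z\<in>D. dist (\<Sum>j<N. scaleC (z j) (abs_L2 (phi j))) (F z) < e"
  proof eventually_elim
   case (elim N)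
   show ?case
   proof
    fix z assume z: "z \<in> D"
    have "norm (F z - (\<Sum>j<N. scaleC (z j) (abs_L2 (phi j)))) <= (\<Sum>j. norm (scaleC (z (j + N)) (abs_L2 (phi (j + N)))))"
    unfolding F_def by (rule L2_series(3)[OF sz[OF z]])
    also have "... <= (\<Sum>j. c (j + N))"
    proof (rule suminf_le)
    show "norm (scaleC (z (j + N)) (abs_L2 (phi (j + N)))) <= c (j + N)" for j
    using tail[OF z, of "j + N"] by (simp add: c_def)
    show "summable (%j. norm (scaleC (z (j + N)) (abs_L2 (phi (j + N)))))"
    using sz[OF z] by (rule summable_ignore_initial_segment)
    show "summable (%j. c (j + N))" using sc by (rule summable_ignore_initial_segment)
    qed
    also have "... < e" using elim by (simp add: suminf_minus_initial_segment[OF sc])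
    finally show "dist (\<Sum>j<N. scaleC (z j) (abs_L2 (phi j))) (F z) < e"
    by (simp add: dist_commute dist_norm)
   qed
  qed
 qed
 have bl: "bounded_linear (%z. scaleC z x)" for x :: "'v L2"
  by (rule bounded_linear_intro[of _ "norm x"]) (simp_all add: L2.scale_left_distrib scaleR_L2_def scaleR_conv_of_real)
 have "continuous_on D (%z. scaleC (z j) (abs_L2 (phi j)))" for j
  by (rule bounded_linear.continuous_on[OF bl])
   (metis continuous_on_product_coordinates continuous_on_subset subset_UNIV)
 then have "continuous_on D F"
  by (intro uniform_limit_theorem[OF _ unif]) (auto intro!: always_eventually continuous_on_sum)
 then have cF: "compact (F ` D)" using cD by (rule compact_continuous_image)
 have "nuc phi psi ` cball 0 1 \<subseteq> F ` D"
 proof (rule image_subsetI)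
  fix u :: "'v L2" assume u: "u \<in> cball 0 1"
  have "norm (bil (psi j) u) <= norm (abs_L2 (psi j))" for j
   using norm_bil_le[OF sqpsi, of j u] u mult_left_le[of "norm u" "norm (abs_L2 (psi j))"] by simp
  then have "(%j. bil (psi j) u) \<in> D" by (auto simp: D_def PiE_iff)
  moreover have "nuc phi psi u = F (%j. bil (psi j) u)" by (simp add: nuc_def F_def)
  ultimately show "nuc phi psi u \<in> F ` D" by blast
 qed
 then have "closure (nuc phi psi ` cball 0 1) \<subseteq> F ` D"
  by (intro closure_minimal compact_imp_closed cF)
 then show "compact (closure (nuc phi psi ` cball 0 1))"
  using compact_Int_closed[OF cF closed_closure[of "nuc phi psi ` cball 0 1"]] by (simp add: Int_absorb1)
qed

lemma inner_scaleC_abs: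
 "scaleC z (abs_L2 (phi j)) \<bullet> v = Re (z * cnj (bil (%x. cnj (phi j x)) v))"
proof -
 have "scaleC z (abs_L2 (phi j)) \<bullet> abs_L2 (rep_L2 v) = (\<integral>x. Re (cnj z * (cnj (phi j x) * rep_L2 v x)) \<partial>lebesgue)"
  unfolding scaleC_abs_L2[OF sqphi] inner_abs_L2[OF sq_integrable_scale[OF sqphi] sq_integrable_rep]
  by (intro Bochner_Integration.integral_cong refl) (simp add: inner_complex_def algebra_simps)
 also have "... = Re (cnj z * bil (%x. cnj (phi j x)) v)"
  unfolding bil_def
  by (subst integral_Re)
   (simp_all del: Re_complex_div_gt_0 add: integrable_mult_sq_integrable[OF sq_integrable_cnj[OF sqphi] sq_integrable_rep])
 finally show ?thesis by simp
qed

lemma adjoint_family: "nuclear_family (%j x. cnj (psi j x)) (%j x. cnj (phi j x))"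
proof
 show "summable (%j. norm (abs_L2 (%x. cnj (psi j x))) * norm (abs_L2 (%x. cnj (phi j x))))"
  using sm by (simp add: norm_abs_cnj sqphi sqpsi mult.commute)
qed (simp_all add: sq_integrable_cnj sqphi sqpsi)

lemma nuc_adjoint: "adjoint (nuc phi psi) = nuc (%j x. cnj (psi j x)) (%j x. cnj (phi j x))"
proof (rule adjoint_unique, intro allI)
 fix u v :: "'v L2"
 interpret A: nuclear_family "%j x. cnj (psi j x)" "%j x. cnj (phi j x)" by (rule adjoint_family)
 have 1: "(%j. scaleC (bil (psi j) u) (abs_L2 (phi j)) \<bullet> v) sums (nuc phi psi u \<bullet> v)"
  by (rule bounded_linear.sums[OF bounded_linear_inner_left nuc_sums])
 have 2: "(%j. scaleC (bil (%x. cnj (phi j x)) v) (abs_L2 (%x. cnj (psi j x))) \<bullet> u) sums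
   (nuc (%j x. cnj (psi j x)) (%j x. cnj (phi j x)) v \<bullet> u)"
  by (rule bounded_linear.sums[OF bounded_linear_inner_left A.nuc_sums])
 have "scaleC (bil (psi j) u) (abs_L2 (phi j)) \<bullet> v
  = scaleC (bil (%x. cnj (phi j x)) v) (abs_L2 (%x. cnj (psi j x))) \<bullet> u" for j
  unfolding inner_scaleC_abs A.inner_scaleC_abs by (simp add: mult.commute)
 then show "nuc phi psi u \<bullet> v = u \<bullet> nuc (%j x. cnj (psi j x)) (%j x. cnj (phi j x)) v"
  using 1 2 sums_unique2 by (simp add: inner_commute)
qed

text \<open>A complex rank one operator as the sum of two real rank one operators, the form in which the real trace
 argument applies.\<close>

lemma nuc_real_representation:
 "(%j. (abs_L2 (%x. cnj (psi j x)) \<bullet> u) *\<^sub>R abs_L2 (phi j)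
   + (abs_L2 (%x. cnj (- \<i> * psi j x)) \<bullet> u) *\<^sub>R scaleC \<i> (abs_L2 (phi j))) sums nuc phi psi u"
proof -
 have "scaleC (bil (psi j) u) (abs_L2 (phi j)) =
  (abs_L2 (%x. cnj (psi j x)) \<bullet> u) *\<^sub>R abs_L2 (phi j)
   + (abs_L2 (%x. cnj (- \<i> * psi j x)) \<bullet> u) *\<^sub>R scaleC \<i> (abs_L2 (phi j))" for j
  unfolding Re_bil[OF sqpsi, symmetric] Im_bil[OF sqpsi, symmetric] scaleR_L2_def L2.scale_scale
   L2.scale_left_distrib[symmetric]
  by (rule arg_cong[of _ _ "%z. scaleC z (abs_L2 (phi j))"]) (simp add: complex_eq_iff)
 then show ?thesis using nuc_sums[of u] by simp
qed

text \<open>Choose in each eigenspace of \<open>T\<^sup>* T\<close> as many real orthonormal vectors as its complex dimension; the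
 images of these vectors are orthogonal with norms \<open>sg\<close>, so the trace argument applies.\<close>

lemma sum_singular_mult_le:
 assumes q: "0 < q" "q <= 1" and sc: "summable (%j. (norm (abs_L2 (phi j)) * norm (abs_L2 (psi j))) powr q)"
  and A: "finite A" "A \<subseteq> {0<..}"
 shows "(\<Sum>sg\<in>A. real (singular_mult (nuc phi psi) sg) * sg powr q)
  <= 2 * (\<Sum>j. (norm (abs_L2 (phi j)) * norm (abs_L2 (psi j))) powr q)"
proof -
 define T where "T = nuc phi psi"
 define E where "E sg = {u. adjoint T (T u) = sg\<^sup>2 *\<^sub>R u}" for sg
 interpret A: nuclear_family "%j x. cnj (psi j x)" "%j x. cnj (phi j x)" by (rule adjoint_family)
 have adj: "T u \<bullet> v = u \<bullet> adjoint T v" for u v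
 proof -
  have 1: "(%j. scaleC (bil (psi j) u) (abs_L2 (phi j)) \<bullet> v) sums (nuc phi psi u \<bullet> v)"
   by (rule bounded_linear.sums[OF bounded_linear_inner_left nuc_sums])
  have 2: "(%j. scaleC (bil (%x. cnj (phi j x)) v) (abs_L2 (%x. cnj (psi j x))) \<bullet> u) sums
    (nuc (%j x. cnj (psi j x)) (%j x. cnj (phi j x)) v \<bullet> u)"
   by (rule bounded_linear.sums[OF bounded_linear_inner_left A.nuc_sums])
  have "scaleC (bil (psi j) u) (abs_L2 (phi j)) \<bullet> v
   = scaleC (bil (%x. cnj (phi j x)) v) (abs_L2 (%x. cnj (psi j x))) \<bullet> u" for j
   unfolding inner_scaleC_abs A.inner_scaleC_abs by (simp add: mult.commute)
  then show ?thesis unfolding T_def nuc_adjoint using 1 2 sums_unique2 by (simp add: inner_commute)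
 qed
 have lin: "linear T" "linear (adjoint T)"
 proof -
  have "linear (nuc phi' psi')" if "nuclear_family phi' psi'" for phi' psi' :: "nat => 'v => complex"
  proof (rule linearI)
   note l = nuclear_family.nuc_linear[OF that, unfolded Vector_Spaces.linear_iff]
   show "nuc phi' psi' (u + v) = nuc phi' psi' u + nuc phi' psi' v" for u v using l by blast
   show "nuc phi' psi' (r *\<^sub>R u) = r *\<^sub>R nuc phi' psi' u" for r u using l by (simp add: scaleR_L2_def)
  qed
  then show "linear T" "linear (adjoint T)"
   unfolding T_def nuc_adjoint using nuclear_family_axioms adjoint_family by blast+
 qed
 have subE: "subspace (E sg)" for sg
  unfolding subspace_def E_def
  by (auto simp: linear_0[OF lin(1)] linear_0[OF lin(2)] linear_add[OF lin(1)] linear_add[OF lin(2)]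
    linear_scale[OF lin(1)] linear_scale[OF lin(2)] scaleR_add_right)
 have "\<exists>G. orthonormal_on G (%g. g) & G \<subseteq> E sg & card G = singular_mult T sg" for sg
 proof -
  obtain B where B: "B \<subseteq> E sg" "L2.independent B" "card B = L2.dim (E sg)"
   by (rule L2.basis_exists[of "E sg"])
  show ?thesis
  proof (cases "finite B")
   case True
   obtain G where "orthonormal_on G (%g. g)" "G \<subseteq> span B" "card G = card B"
    by (rule orthonormalize[OF True L2_independent_imp_real_independent[OF B(2)]])
   moreover have "span B \<subseteq> E sg" by (rule span_minimal[OF B(1) subE])
   ultimately show ?thesis using B(3) by (auto simp: singular_mult_def E_def)
  next
   case False
   then show ?thesis using B(3)
    by (intro exI[of _ "{}"]) (simp add: orthonormal_on_def singular_mult_def E_def)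
  qed
 qed
 then obtain G where G: "!!sg. orthonormal_on (G sg) (%g. g)" "!!sg. G sg \<subseteq> E sg"
  "!!sg. card (G sg) = singular_mult T sg" by metis
 define I where "I = Sigma A G"
 have finI: "finite I" using A(1) G(1) by (simp add: I_def orthonormal_on_def)
 have TT: "T u \<bullet> T v = tau\<^sup>2 * (u \<bullet> v)" if "v \<in> E tau" for u v tau
  using that by (simp add: adj E_def)
 have orth: "g \<bullet> g' = (if (sg, g) = (sg', g') then 1 else 0)" if "(sg, g) \<in> I" "(sg', g') \<in> I" for sg g sg' g'
 proof (cases "sg = sg'")
  case True
  then show ?thesis using that G(1)[of sg] by (auto simp: I_def orthonormal_on_def)
 next
  case False
  have "g \<in> E sg" "g' \<in> E sg'" using that G(2) by (auto simp: I_def)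
  then have "T g \<bullet> T g' = sg'\<^sup>2 * (g \<bullet> g')" "T g' \<bullet> T g = sg\<^sup>2 * (g' \<bullet> g)"
   by (auto intro: TT)
  then have "sg'\<^sup>2 * (g \<bullet> g') = sg\<^sup>2 * (g \<bullet> g')"
   by (metis inner_commute)
  moreover have "sg'\<^sup>2 ~= sg\<^sup>2"
  proof -
   have "0 < sg" "0 < sg'" using that A(2) by (auto simp: I_def)
   then show ?thesis using False by (simp add: power2_eq_iff_nonneg)
  qed
  ultimately show ?thesis using False by simp
 qed
 have on: "orthonormal_on I snd"
  unfolding orthonormal_on_def using finI orth by (metis prod.collapse)
 define c where "c j = norm (abs_L2 (phi j)) * norm (abs_L2 (psi j))" for j
 have c0: "0 <= c j" for j by (simp add: c_def)
 have "(\<Sum>i\<in>I. fst i powr q) <= 2 * (\<Sum>j. c j powr q)"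
 proof (rule sum_powr_le_of_sum_min_le[OF q finI _ c0])
  show pos: "0 < fst i" if "i \<in> I" for i using that A(2) by (auto simp: I_def)
  show "summable (%j. c j powr q)" using sc by (simp add: c_def)
  show "(\<Sum>i\<in>I. min (fst i) tau) <= 2 * (\<Sum>j. min (c j) tau)" if tau: "0 < tau" for tau
  proof (rule sum_min_singular_values_le[where T = T and e = snd and
    x = "%j. abs_L2 (phi j)" and y = "%j. abs_L2 (%x. cnj (psi j x))" and
    x' = "%j. scaleC \<i> (abs_L2 (phi j))" and y' = "%j. abs_L2 (%x. cnj (- \<i> * psi j x))"])
   show "(%j. (abs_L2 (%x. cnj (psi j x)) \<bullet> u) *\<^sub>R abs_L2 (phi j)
    + (abs_L2 (%x. cnj (- \<i> * psi j x)) \<bullet> u) *\<^sub>R scaleC \<i> (abs_L2 (phi j))) sums T u" for u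
    unfolding T_def by (rule nuc_real_representation)
   show "norm (abs_L2 (phi j)) * norm (abs_L2 (%x. cnj (psi j x))) <= c j" for j
    by (simp add: c_def norm_abs_cnj sqpsi)
   have "norm (abs_L2 (%x. cnj (- \<i> * psi j x))) = norm (abs_L2 (psi j))" for j
    unfolding norm_abs_cnj[OF sq_integrable_scale[OF sqpsi]] scaleC_abs_L2[OF sqpsi, symmetric] by simp
   then show "norm (scaleC \<i> (abs_L2 (phi j))) * norm (abs_L2 (%x. cnj (- \<i> * psi j x))) <= c j" for j
    by (simp add: c_def)
   show "summable c" using sm by (simp add: c_def[abs_def])
   show "T (snd i) \<bullet> T (snd k) = (if i = k then (fst i)\<^sup>2 else 0)" if "i \<in> I" "k \<in> I" for i k
   proof -
    have "snd k \<in> E (fst k)" using that(2) subsetD[OF G(2)] by (auto simp: I_def)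
    then have "T (snd i) \<bullet> T (snd k) = (fst k)\<^sup>2 * (snd i \<bullet> snd k)" by (rule TT)
    then show ?thesis using on that by (auto simp: orthonormal_on_def)
   qed
  qed (use on pos tau in auto)
 qed
 moreover have "(\<Sum>i\<in>I. fst i powr q) = (\<Sum>sg\<in>A. real (singular_mult T sg) * sg powr q)"
 proof -
  have "(\<Sum>i\<in>I. fst i powr q) = (\<Sum>(sg, g)\<in>Sigma A G. sg powr q)"
   unfolding I_def by (intro sum.cong) auto
  also have "... = (\<Sum>sg\<in>A. \<Sum>g\<in>G sg. sg powr q)"
   using A(1) G(1) by (intro sum.Sigma[symmetric]) (auto simp: orthonormal_on_def)
  finally show ?thesis using G(3) by simp
 qed
 ultimately show ?thesis unfolding T_def c_def by simp
qed

text \<open>The bounds on multiplicities show that the singular values accumulate only at \<open>0\<close>, hence that the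
 enumeration in the definition of \<open>singular_value\<close> exists.\<close>

theorem nuc_schatten:
 assumes q: "0 < q" "q <= 1" and sc: "summable (%j. (norm (abs_L2 (phi j)) * norm (abs_L2 (psi j))) powr q)"
 shows "nuc phi psi \<in> schatten_class q"
  and "schatten_norm q (nuc phi psi) <= (2 * (\<Sum>j. (norm (abs_L2 (phi j)) * norm (abs_L2 (psi j))) powr q)) powr (1 / q)"
proof -
 define B where "B = 2 * (\<Sum>j. (norm (abs_L2 (phi j)) * norm (abs_L2 (psi j))) powr q)"
 define m where "m = singular_mult (nuc phi psi)"
 have le: "(\<Sum>sg\<in>A. real (m sg) * sg powr q) <= B" if "finite A" "A \<subseteq> {0<..}" for A
  unfolding m_def B_def by (rule sum_singular_mult_le[OF q sc that])
 have "finite {sg. eps <= sg & m sg ~= 0}" if eps: "0 < eps" for eps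
 proof (rule ccontr)
  assume inf: "infinite {sg. eps <= sg & m sg ~= 0}"
  obtain N :: nat where N: "B / eps powr q < N" using reals_Archimedean2 by blast
  obtain A where A: "A \<subseteq> {sg. eps <= sg & m sg ~= 0}" "finite A" "card A = N"
   using infinite_arbitrarily_large[OF inf] by blast
  have "N * eps powr q = (\<Sum>sg\<in>A. 1 * eps powr q)" using A by simp
  also have "... <= (\<Sum>sg\<in>A. real (m sg) * sg powr q)"
   using A(1) eps q(1) by (intro sum_mono mult_mono powr_mono2) (auto simp: Suc_le_eq)
  also have "... <= B" using A eps by (intro le) auto
  finally show False using N eps by (simp add: divide_less_eq)
 qed
 note ex1 = ex1_enumerates[OF this]
 define s where "s = singular_value (nuc phi psi)"
 have "s = (THE s. enumerates m s)"
  by (simp add: s_def singular_value_def enumerates_def m_def)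
 then have en: "enumerates m s" using theI'[OF ex1] by simp
 have part: "(\<Sum>k<K. s k powr q) <= B" for K
  by (rule enumerates_sum_powr_le[OF en q(1) le])
 have sums: "summable (%k. s k powr q)"
  by (rule summableI_nonneg_bounded[where x = B]) (use part in auto)
 show "nuc phi psi \<in> schatten_class q"
  using sums nuc_compact by (simp add: schatten_class_def s_def)
 have "(\<Sum>k. s k powr q) <= B" by (rule suminf_le_const[OF sums part])
 then show "schatten_norm q (nuc phi psi) <= (2 * (\<Sum>j. (norm (abs_L2 (phi j)) * norm (abs_L2 (psi j))) powr q)) powr (1 / q)"
  unfolding schatten_norm_def s_def[symmetric] B_def[symmetric]
  using q sums by (intro powr_mono2) (auto intro: suminf_nonneg)
qed

end

lemma is_integral_operator_cong:
 assumes "is_integral_operator K T" "is_integral_operator K' T'"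
  and "AE x in lebesgue. AE y in lebesgue. K x y = K' x y"
 shows "T = T'"
proof
 fix u
 have "AE x in lebesgue. integrable lebesgue (%y. K x y * rep_L2 u y) & rep_L2 (T u) x = (\<integral>y. K x y * rep_L2 u y \<partial>lebesgue)"
  "AE x in lebesgue. integrable lebesgue (%y. K' x y * rep_L2 u y) & rep_L2 (T' u) x = (\<integral>y. K' x y * rep_L2 u y \<partial>lebesgue)"
  using assms(1,2) unfolding is_integral_operator_def by blast+
 then have "AE x in lebesgue. rep_L2 (T u) x = rep_L2 (T' u) x"
  using assms(3)
 proof eventually_elim
  case (elim x)
  have "AE y in lebesgue. K x y * rep_L2 u y = K' x y * rep_L2 u y"
   using elim(3) by eventually_elim simp
  then have "(\<integral>y. K x y * rep_L2 u y \<partial>lebesgue) = (\<integral>y. K' x y * rep_L2 u y \<partial>lebesgue)"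
   using elim(1,2) by (intro integral_cong_AE) (auto dest: borel_measurable_integrable)
  then show ?case using elim by simp
 qed
 then show "T u = T' u" by (rule L2_eqI)
qed

section \<open>Directional derivatives\<close>

text \<open>Derivative along every line in direction \<open>e\<close>, as an explicit function; unlike \<open>dir_deriv\<close> it asserts
 existence.\<close>

definition deriv_along :: "'v::real_normed_vector => ('v => complex) => ('v => complex) => bool" where
 "deriv_along e f g \<longleftrightarrow> (\<forall>p. ((%s. f (p + s *\<^sub>R e)) has_vector_derivative g p) (at 0))"

lemma deriv_along_at:
 assumes "deriv_along e f g"
 shows "((%s. f (p + s *\<^sub>R e)) has_vector_derivative g (p + s *\<^sub>R e)) (at s)"
proof -
 have 1: "((%r. f ((p + s *\<^sub>R e) + r *\<^sub>R e)) has_vector_derivative g (p + s *\<^sub>R e)) (at (s - s))"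
  using assms by (simp add: deriv_along_def)
 have 2: "((%r. r - s) has_vector_derivative 1) (at s)"
  by (auto intro!: derivative_eq_intros)
 have "((%r. f ((p + s *\<^sub>R e) + r *\<^sub>R e)) \<circ> (%r. r - s) has_vector_derivative 1 *\<^sub>R g (p + s *\<^sub>R e)) (at s)"
  by (rule vector_diff_chain_at[OF 2 1])
 moreover have "(%r. f ((p + s *\<^sub>R e) + r *\<^sub>R e)) \<circ> (%r. r - s) = (%r. f (p + r *\<^sub>R e))"
  by (simp add: o_def add.assoc scaleR_left_distrib[symmetric])
 ultimately show ?thesis by simp
qed

lemma deriv_along_dir_deriv: "deriv_along e f g ==> dir_deriv e f = g"
 unfolding deriv_along_def dir_deriv_def by (auto intro: vector_derivative_at)

lemma deriv_along_differentiable: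
 "deriv_along e f g ==> (%s. f (p + s *\<^sub>R e)) differentiable (at 0)"
 unfolding deriv_along_def by (metis differentiableI_vector)

lemma differentiable_deriv_along:
 assumes "!!p. (%s::real. f (p + s *\<^sub>R e)) differentiable (at 0)"
 shows "deriv_along e f (dir_deriv e f)"
 unfolding deriv_along_def dir_deriv_def using assms vector_derivative_works by blast

lemma deriv_along_add:
 "deriv_along e f f' ==> deriv_along e g g' ==> deriv_along e (%p. f p + g p) (%p. f' p + g' p)"
 unfolding deriv_along_def by (auto intro: has_vector_derivative_add)

lemma deriv_along_mult:
 assumes "deriv_along e f f'" "deriv_along e g g'"
 shows "deriv_along e (%p. f p * g p) (%p. f' p * g p + f p * g' p)"
 unfolding deriv_along_def
proof
 fix p
 show "((%s. f (p + s *\<^sub>R e) * g (p + s *\<^sub>R e)) has_vector_derivative f' p * g p + f p * g' p) (at 0)"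
  using has_vector_derivative_mult[of "%s. f (p + s *\<^sub>R e)" "f' p" 0 UNIV "%s. g (p + s *\<^sub>R e)" "g' p"] assms
  by (simp add: deriv_along_def add.commute)
qed

lemma deriv_along_const: "deriv_along e (%p. c) (%p. 0)"
 unfolding deriv_along_def by (auto intro: has_vector_derivative_const)

lemma deriv_along_cmult: "deriv_along e f f' ==> deriv_along e (%p. c * f p) (%p. c * f' p)"
 using deriv_along_mult[OF deriv_along_const] by fastforce

lemma deriv_along_scaleR_direction:
 assumes "deriv_along e f g"
 shows "deriv_along (c *\<^sub>R e) f (%p. of_real c * g p)"
 unfolding deriv_along_def
proof
 fix p
 have 2: "((%r. r * c) has_vector_derivative c) (at (0::real))"
  by (auto intro!: derivative_eq_intros simp: has_real_derivative_iff_has_vector_derivative[symmetric])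
 have "((%s. f (p + s *\<^sub>R e)) \<circ> (%r. r * c) has_vector_derivative c *\<^sub>R g (p + (0 * c) *\<^sub>R e)) (at 0)"
  by (rule vector_diff_chain_at[OF 2 deriv_along_at[OF assms]])
 then show "((%s. f (p + s *\<^sub>R c *\<^sub>R e)) has_vector_derivative of_real c * g p) (at 0)"
  by (simp add: o_def scaleR_conv_of_real)
qed

lemma deriv_along_line:
 assumes h: "!!x. (h has_vector_derivative h' x) (at x)" and l: "!!p s. l (p + s *\<^sub>R e) = l p + s * c"
 shows "deriv_along e (%p. h (l p)) (%p. of_real c * h' (l p))"
 unfolding deriv_along_def
proof
 fix p
 have 2: "((%r. l p + r * c) has_vector_derivative c) (at (0::real))"
  by (auto intro!: derivative_eq_intros simp: has_real_derivative_iff_has_vector_derivative[symmetric])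
 have "(h \<circ> (%r. l p + r * c) has_vector_derivative c *\<^sub>R h' (l p + 0 * c)) (at 0)"
  by (rule vector_diff_chain_at[OF 2 h])
 then show "((%s. h (l (p + s *\<^sub>R e))) has_vector_derivative of_real c * h' (l p)) (at 0)"
  by (simp add: o_def l scaleR_conv_of_real)
qed

text \<open>The partial derivatives along two directions determine the derivative along their sum,
 provided that one of them is continuous.\<close>

lemma deriv_along_add_direction:
 fixes f :: "'v::real_normed_vector => complex"
 assumes u: "deriv_along u f fu" and v: "deriv_along v f fv" and c: "continuous_on UNIV fv"
 shows "deriv_along (u + v) f (%p. fu p + fv p)"
 unfolding deriv_along_def
proof
 fix p
 define F where "F x y = f (p + x *\<^sub>R u + y *\<^sub>R v)" for x y :: real
 have "((%(x, y). F x y) has_derivative (%(tx, ty). (tx *\<^sub>R fu p) + blinfun_scaleR_left (fv (p + 0 *\<^sub>R u + 0 *\<^sub>R v)) ty))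
   (at (0, 0) within UNIV \<times> UNIV)"
 proof (rule has_derivative_partialsI[where fx = "%tx. tx *\<^sub>R fu p"
    and fy = "%x y. blinfun_scaleR_left (fv (p + x *\<^sub>R u + y *\<^sub>R v))"])
  show "((%x. F x 0) has_derivative (%tx. tx *\<^sub>R fu p)) (at 0)"
   using u by (simp add: F_def deriv_along_def has_vector_derivative_def)
  show "((%y. F x y) has_derivative blinfun_apply (blinfun_scaleR_left (fv (p + x *\<^sub>R u + y *\<^sub>R v)))) (at y)" for x y
   using deriv_along_at[OF v, of "p + x *\<^sub>R u" y]
   by (simp add: F_def has_vector_derivative_def)
  have bl: "bounded_linear (blinfun_scaleR_left :: complex => real \<Rightarrow>\<^sub>L complex)"
   by (rule bounded_linear_blinfun_scaleR_left)
  have "continuous_on UNIV (%z. fv (p + fst z *\<^sub>R u + snd z *\<^sub>R v))"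
   by (intro continuous_on_compose2[OF c] continuous_intros) auto
  then have "continuous_on UNIV (%z. blinfun_scaleR_left (fv (p + fst z *\<^sub>R u + snd z *\<^sub>R v)) :: real \<Rightarrow>\<^sub>L complex)"
   by (rule bounded_linear.continuous_on[OF bl])
  then show "continuous (at (0, 0) within UNIV \<times> UNIV)
    (%(x, y). blinfun_scaleR_left (fv (p + x *\<^sub>R u + y *\<^sub>R v)) :: real \<Rightarrow>\<^sub>L complex)"
   by (simp add: case_prod_beta' continuous_on_eq_continuous_at)
 qed auto
 then have D: "((%(x, y). F x y) has_derivative (%(tx, ty). tx *\<^sub>R fu p + ty *\<^sub>R fv p)) (at (0, 0))"
  by (simp add: case_prod_beta')
 have "((%s. (s, s)) has_derivative (%s. (s, s))) (at (0::real))"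
  by (auto intro!: derivative_eq_intros)
 then have "((%(x, y). F x y) \<circ> (%s. (s, s)) has_derivative (%(tx, ty). tx *\<^sub>R fu p + ty *\<^sub>R fv p) \<circ> (%s. (s, s))) (at 0)"
  using D by (intro diff_chain_at) auto
 then show "((%s. f (p + s *\<^sub>R (u + v))) has_vector_derivative fu p + fv p) (at 0)"
  by (simp add: has_vector_derivative_def F_def o_def scaleR_add_right add.assoc)
qed

lemma deriv_along_sum_direction:
 fixes f :: "'v::real_normed_vector => complex"
 assumes "finite B" and d: "!!b. b \<in> B ==> deriv_along b f (g b)" and c: "!!b. b \<in> B ==> continuous_on UNIV (g b)"
 shows "deriv_along (\<Sum>b\<in>B. r b *\<^sub>R b) f (%p. \<Sum>b\<in>B. of_real (r b) * g b p)"
 using assms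
proof (induction B)
 case empty
 then show ?case by (simp add: deriv_along_def has_vector_derivative_const)
next
 case (insert b B)
 have "deriv_along ((\<Sum>b\<in>B. r b *\<^sub>R b) + r b *\<^sub>R b) f (%p. (\<Sum>b\<in>B. of_real (r b) * g b p) + of_real (r b) * g b p)"
  using insert by (intro deriv_along_add_direction deriv_along_scaleR_direction continuous_intros) auto
 then show ?case using insert by (simp add: add.commute)
qed

section \<open>Smooth functions\<close>

primrec smooth_upto :: "nat => ('v::euclidean_space => complex) => bool" where
 "smooth_upto 0 f = continuous_on UNIV f"
| "smooth_upto (Suc N) f = (continuous_on UNIV f & (\<forall>b\<in>Basis. \<exists>g. deriv_along b f g & smooth_upto N g))"

definition smooth :: "('v::euclidean_space => complex) => bool" where
 "smooth f \<longleftrightarrow> (\<forall>N. smooth_upto N f)"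

lemma smooth_upto_cont: "smooth_upto N f ==> continuous_on UNIV f"
 by (cases N) auto

lemma smooth_upto_SucD: "smooth_upto (Suc N) f ==> smooth_upto N f"
proof (induction N arbitrary: f)
 case (Suc N)
 have f: "continuous_on UNIV f" "\<forall>b\<in>Basis. \<exists>g. deriv_along b f g & smooth_upto (Suc N) g"
  using Suc.prems unfolding smooth_upto.simps(2)[of "Suc N" f] by blast+
 show ?case unfolding smooth_upto.simps(2)[of N f] using f Suc.IH by blast
qed simp

lemma smooth_upto_const: "smooth_upto N (%p. c)"
proof (induction N arbitrary: c)
 case (Suc N)
 then show ?case using deriv_along_const by (auto simp: continuous_on_const)
qed (simp add: continuous_on_const)

lemma smooth_upto_add: "smooth_upto N f ==> smooth_upto N g ==> smooth_upto N (%p. f p + g p)"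
proof (induction N arbitrary: f g)
 case (Suc N)
 then show ?case
  by (auto intro!: continuous_on_add) (metis deriv_along_add)
qed (simp add: continuous_on_add)

lemma smooth_upto_mult: "smooth_upto N f ==> smooth_upto N g ==> smooth_upto N (%p. f p * g p)"
proof (induction N arbitrary: f g)
 case (Suc N)
 have c: "continuous_on UNIV (%p. f p * g p)"
  using Suc.prems by (intro continuous_on_mult) auto
 have "\<exists>h. deriv_along b (%p. f p * g p) h & smooth_upto N h" if b: "b \<in> Basis" for b
 proof -
  obtain f' g' where d: "deriv_along b f f'" "smooth_upto N f'" "deriv_along b g g'" "smooth_upto N g'"
   using Suc.prems b by (metis smooth_upto.simps(2))
  have "smooth_upto N (%p. f' p * g p + f p * g' p)"
   using Suc.prems d smooth_upto_SucD by (intro smooth_upto_add Suc.IH) blast+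
  then show ?thesis using deriv_along_mult[OF d(1,3)] by blast
 qed
 then show ?case using c by simp
qed (simp add: continuous_on_mult)

lemma smoothD: "smooth f ==> smooth_upto N f" by (simp add: smooth_def)
lemma smooth_continuous: "smooth f ==> continuous_on UNIV f" using smoothD smooth_upto_cont by blast
lemma smooth_const: "smooth (%p. c)" by (simp add: smooth_def smooth_upto_const)
lemma smooth_add: "smooth f ==> smooth g ==> smooth (%p. f p + g p)" by (simp add: smooth_def smooth_upto_add)
lemma smooth_mult: "smooth f ==> smooth g ==> smooth (%p. f p * g p)" by (simp add: smooth_def smooth_upto_mult)
lemma smooth_power: "smooth f ==> smooth (%p. f p ^ k)"
 by (induction k) (auto intro: smooth_mult smooth_const)
lemma smooth_sum: "(!!i. i \<in> I ==> smooth (f i)) ==> smooth (%p. \<Sum>i\<in>I. f i p)"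
 by (induction I rule: infinite_finite_induct) (auto intro: smooth_add smooth_const)
lemma smooth_prod: "(!!i. i \<in> I ==> smooth (f i)) ==> smooth (%p. \<Prod>i\<in>I. f i p)"
 by (induction I rule: infinite_finite_induct) (auto intro: smooth_mult smooth_const)

lemma smooth_deriv:
 assumes "smooth f" "b \<in> Basis"
 shows "deriv_along b f (dir_deriv b f)" "smooth (dir_deriv b f)"
proof -
 have "\<exists>g. deriv_along b f g & smooth_upto N g" for N
  using smoothD[OF assms(1), of "Suc N"] assms(2) by simp
 then show "deriv_along b f (dir_deriv b f)" "smooth (dir_deriv b f)"
  unfolding smooth_def using deriv_along_dir_deriv by metis+
qed

lemma iter_deriv_snoc: "iter_deriv (bs @ [b]) f = iter_deriv bs (dir_deriv b f)"
 by (simp add: iter_deriv_def)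

lemma iter_deriv_exists_snoc:
 "iter_deriv_exists (bs @ [b]) f \<longleftrightarrow>
  (\<forall>p. (%s::real. f (p + s *\<^sub>R b)) differentiable (at 0)) & iter_deriv_exists bs (dir_deriv b f)"
proof (induction bs)
 case Nil
 then show ?case by (simp add: iter_deriv_def)
next
 case (Cons c bs)
 then show ?case by (auto simp: iter_deriv_snoc)
qed

lemma cont_deriv_snoc:
 "cont_deriv (bs @ [b]) f \<longleftrightarrow> deriv_along b f (dir_deriv b f) & cont_deriv bs (dir_deriv b f)"
 unfolding cont_deriv_def iter_deriv_exists_snoc iter_deriv_snoc
 using differentiable_deriv_along deriv_along_differentiable by blast

lemma smooth_iff: "smooth f \<longleftrightarrow> (\<forall>bs. set bs \<subseteq> Basis --> cont_deriv bs f)"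
proof (intro iffI allI impI)
 fix bs :: "'a list" assume "smooth f" "set bs \<subseteq> Basis"
 then show "cont_deriv bs f"
 proof (induction bs arbitrary: f rule: rev_induct)
  case Nil
  then show ?case by (simp add: cont_deriv_def iter_deriv_def smooth_continuous)
 next
  case (snoc b bs)
  then show ?case using smooth_deriv[of f b] by (simp add: cont_deriv_snoc)
 qed
next
 assume f: "\<forall>bs. set bs \<subseteq> Basis --> cont_deriv bs f"
 have upto: "smooth_upto N f" if "\<forall>bs. set bs \<subseteq> Basis --> cont_deriv bs f" for N and f :: "'a => complex"
  using that
 proof (induction N arbitrary: f)
  case 0
  then have "cont_deriv [] f" by (metis empty_subsetI list.set(1))
  then show ?case by (simp add: cont_deriv_def iter_deriv_def)
 next
  case (Suc N)
  then have "cont_deriv [] f" by (metis empty_subsetI list.set(1))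
  then have c: "continuous_on UNIV f" by (simp add: cont_deriv_def iter_deriv_def)
  have "deriv_along b f (dir_deriv b f) & smooth_upto N (dir_deriv b f)" if b: "b \<in> Basis" for b
  proof -
   have *: "deriv_along b f (dir_deriv b f) & cont_deriv bs (dir_deriv b f)" if "set bs \<subseteq> Basis" for bs
    using Suc.prems b that unfolding cont_deriv_snoc[symmetric] by simp
   show ?thesis using *[of "[]"] Suc.IH[of "dir_deriv b f"] * by simp
  qed
  then show ?case using c by auto
 qed
 show "smooth f" using upto[OF f] by (simp add: smooth_def)
qed

lemma test_function_iff:
 "test_function U phi \<longleftrightarrow> smooth phi & (\<exists>K. compact K & K \<subseteq> U & (\<forall>p. p ~: K --> phi p = 0))"
 by (simp add: test_function_def smooth_iff)

lemma deriv_along_zero_outside: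
 assumes f: "deriv_along e f g" and K: "closed K" "!!p. p ~: K ==> f p = 0" and p: "p ~: K"
 shows "g p = 0"
proof -
 have "open ((%s. p + s *\<^sub>R e) -` (- K))"
  using K(1) by (intro open_vimage continuous_intros) auto
 moreover have "0 \<in> (%s. p + s *\<^sub>R e) -` (- K)" using p by simp
 ultimately have "((%s. f (p + s *\<^sub>R e)) has_vector_derivative 0) (at 0)"
  using has_vector_derivative_transform_within_open[of "%s. 0::complex" 0 0 "(%s. p + s *\<^sub>R e) -` (- K)" "%s. f (p + s *\<^sub>R e)"] K(2)
  by (auto simp: has_vector_derivative_const)
 then show ?thesis using f vector_derivative_unique_at unfolding deriv_along_def by blast
qed

lemma smooth_line:
 assumes "!!k. !!x. (h k has_vector_derivative h (Suc k) x) (at x)"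
 shows "smooth (%p::'v::euclidean_space. h 0 (c + v \<bullet> p))"
proof -
 have "smooth_upto N (%p. a * h k (c + v \<bullet> p))" for N k a
 proof (induction N arbitrary: k a)
  have cont: "continuous_on UNIV (h k)" for k
   using assms by (auto intro!: continuous_at_imp_continuous_on has_vector_derivative_continuous)
  {
   case 0
   show ?case by (auto intro!: continuous_intros continuous_on_compose2[OF cont])
  next
   case (Suc N)
   have "deriv_along b (%p. a * h k (c + v \<bullet> p)) (%p. a * (of_real (v \<bullet> b) * h (Suc k) (c + v \<bullet> p)))" for b
    by (intro deriv_along_cmult deriv_along_line assms) (simp add: inner_add_right)
   moreover have "smooth_upto N (%p. a * (of_real (v \<bullet> b) * h (Suc k) (c + v \<bullet> p)))" for b
    using Suc.IH[of "a * of_real (v \<bullet> b)" "Suc k"] by (simp add: mult.assoc)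
   ultimately show ?case
    by (auto intro!: continuous_intros continuous_on_compose2[OF cont])
  }
 qed
 from this[of _ 1 0] show ?thesis by (simp add: smooth_def)
qed

lemma smooth_inner: "smooth (%p::'v::euclidean_space. complex_of_real (c + v \<bullet> p))"
proof -
 define h where "h k x = (if k = 0 then complex_of_real x else if k = 1 then 1 else 0)" for k :: nat and x
 have "((h k) has_vector_derivative h (Suc k) x) (at x)" for k x
 proof (cases k)
  case 0
  have "(complex_of_real has_vector_derivative 1) (at x)"
   using has_vector_derivative_of_real[of "%x. x" 1 "at x"] by auto
  then show ?thesis using 0 by (simp add: h_def[abs_def])
 qed (simp add: h_def[abs_def] has_vector_derivative_const)
 from smooth_line[of h, OF this] show ?thesis by (simp add: h_def)
qed

text \<open>By induction on the order, all derivatives are sums of quotients \<open>psi / D ^ k\<close> with smooth \<open>psi\<close> supported in \<open>K\<close>.\<close>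

lemma smooth_divide:
 fixes psi D :: "'v::euclidean_space => complex"
 assumes psi: "smooth psi" and D: "smooth D" and K: "closed K" "!!p. p ~: K ==> psi p = 0" "!!p. p \<in> K ==> D p ~= 0"
 shows "smooth (%p. psi p / D p)"
proof -
 have Dcont: "continuous_on UNIV D" by (rule smooth_continuous[OF D])
 have oD: "open {p. D p ~= 0}" using Dcont by (simp add: open_Collect_neq)
 have cont: "continuous_on UNIV (%p. psi p / D p ^ k)" if "smooth psi" "!!p. p ~: K ==> psi p = 0" for psi k
 proof -
  have "continuous_on ({p. D p ~= 0} \<union> - K) (%p. psi p / D p ^ k)"
  proof (rule continuous_on_open_Un[OF oD])
   show "open (- K)" using K(1) by (rule open_Compl)
   show "continuous_on {p. D p ~= 0} (%p. psi p / D p ^ k)"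
    using smooth_continuous[OF that(1)] Dcont by (auto intro!: continuous_intros intro: continuous_on_subset)
   have "continuous_on (- K) (%p. 0::complex)" by (rule continuous_on_const)
   then show "continuous_on (- K) (%p. psi p / D p ^ k)"
    by (rule continuous_on_eq) (simp add: that(2))
  qed
  moreover have "{p. D p ~= 0} \<union> - K = UNIV" using K(3) by auto
  ultimately show ?thesis by simp
 qed
 have "smooth_upto N (%p. psi p / D p ^ k)" if "smooth psi" "!!p. p ~: K ==> psi p = 0" for N psi k
  using that
 proof (induction N arbitrary: psi k)
  case 0
  then show ?case using cont by simp
 next
  case (Suc N)
  note psi = Suc.prems
  have "\<exists>g. deriv_along b (%p. psi p / D p ^ k) g & smooth_upto N g" if b: "b \<in> Basis" for b
  proof (intro exI conjI)
   let ?d = "dir_deriv b psi" and ?D = "dir_deriv b D"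
   let ?g = "%p. ?d p / D p ^ k + (- of_nat k * psi p * ?D p) / D p ^ Suc k"
   have d0: "?d p = 0" if "p ~: K" for p
    by (rule deriv_along_zero_outside[OF smooth_deriv(1)[OF psi(1) b] K(1) psi(2) that])
   show "deriv_along b (%p. psi p / D p ^ k) ?g"
    unfolding deriv_along_def
   proof
    fix p
    show "((%s. psi (p + s *\<^sub>R b) / D (p + s *\<^sub>R b) ^ k) has_vector_derivative ?g p) (at 0)"
    proof (cases "p \<in> K")
    case True
    then have Dp: "D p ~= 0" by (rule K(3))
    have 1: "((%s. psi (p + s *\<^sub>R b)) has_vector_derivative ?d p) (at 0)"
    using smooth_deriv(1)[OF psi(1) b] by (simp add: deriv_along_def)
    have 2: "((%s. D (p + s *\<^sub>R b)) has_vector_derivative ?D p) (at 0)"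
    using smooth_deriv(1)[OF D b] by (simp add: deriv_along_def)
    have "((%z. inverse (z ^ k)) has_field_derivative (- of_nat k * inverse (D p ^ Suc k))) (at (D (p + 0 *\<^sub>R b)))"
    proof -
    have "((%z. z ^ k) has_field_derivative of_nat k * D p ^ k / D p) (at (D (p + 0 *\<^sub>R b)))"
    using DERIV_power_Suc[OF DERIV_ident, of "k - 1" "D p" UNIV] Dp by (cases k) auto
    then show ?thesis
    using Dp by (intro DERIV_cong[OF DERIV_inverse_fun]) (auto simp: field_simps)
    qed
    from field_vector_diff_chain_at[OF 2 this]
    have 3: "((%s. inverse (D (p + s *\<^sub>R b) ^ k)) has_vector_derivative ?D p * (- of_nat k * inverse (D p ^ Suc k))) (at 0)"
    by (simp add: o_def)
    show ?thesis
    using has_vector_derivative_mult[OF 1 3] by (simp add: divide_inverse algebra_simps)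
    next
    case False
    have "open ((%s. p + s *\<^sub>R b) -` (- K))"
    using K(1) by (intro open_vimage continuous_intros) auto
    moreover have "0 \<in> (%s. p + s *\<^sub>R b) -` (- K)" using False by simp
    ultimately have "((%s. psi (p + s *\<^sub>R b) / D (p + s *\<^sub>R b) ^ k) has_vector_derivative 0) (at 0)"
    using has_vector_derivative_transform_within_open[of "%s. 0::complex" 0 0 "(%s. p + s *\<^sub>R b) -` (- K)"
    "%s. psi (p + s *\<^sub>R b) / D (p + s *\<^sub>R b) ^ k"] psi(2)
    by (auto simp: has_vector_derivative_const)
    then show ?thesis using d0 False psi(2) by simp
    qed
   qed
   show "smooth_upto N ?g"
   proof (intro smooth_upto_add Suc.IH)
    show "smooth ?d" by (rule smooth_deriv[OF psi(1) b])
    show "smooth (%p. - of_nat k * psi p * ?D p)"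
    by (intro smooth_mult smooth_const psi smooth_deriv(2)[OF D b])
   qed (simp_all add: d0 psi(2))
  qed
  then show ?case using cont psi by simp
 qed
 from this[OF psi K(2), of _ 1] show ?thesis by (simp add: smooth_def)
qed

section \<open>Bump functions and the du Bois-Reymond lemma\<close>

text \<open>Derivatives of \<open>exp (- 1 / x)\<close> are combinations of these functions, so the family is closed under
 differentiation.\<close>

definition flat :: "nat => real => real" where
 "flat k x = (if 0 < x then exp (- 1 / x) / x ^ k else 0)"

lemma flat_tendsto_0: "((%x. flat k x) \<longlongrightarrow> 0) (at 0)"
proof -
 have "((%x. inverse x ^ k / exp (inverse x)) \<longlongrightarrow> (0::real)) (at_right 0)"
  by (rule filterlim_compose[OF tendsto_power_div_exp_0 filterlim_inverse_at_top_right])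
 then have "((%x. flat k x) \<longlongrightarrow> 0) (at_right 0)"
  by (rule Lim_transform_eventually)
   (auto simp: flat_def eventually_at_right_less exp_minus field_simps power_inverse intro!: eventually_at_rightI[of _ 1])
 moreover have "((%x. flat k x) \<longlongrightarrow> 0) (at_left 0)"
 proof (rule Lim_transform_eventually)
  show "((%x. 0::real) \<longlongrightarrow> 0) (at_left 0)" by simp
  show "\<forall>\<^sub>F x in at_left 0. 0 = flat k x"
   by (rule eventually_at_leftI[of "-1"]) (auto simp: flat_def)
 qed
 ultimately show ?thesis by (simp add: filterlim_at_split)
qed

lemma flat_deriv: "(flat k has_real_derivative flat (k + 2) x - of_nat k * flat (k + 1) x) (at x)"
proof -
 consider "0 < x" | "x < 0" | "x = 0" by linarith
 then show ?thesis
 proof cases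
  case 1
  have e: "((%x. exp (- 1 / x)) has_real_derivative exp (- 1 / x) / x\<^sup>2) (at x)"
   using 1 by (auto intro!: derivative_eq_intros simp: power2_eq_square)
  have p: "((%x. x ^ k) has_real_derivative of_nat k * x ^ k / x) (at x)"
   using DERIV_pow[of k x UNIV] 1 by (cases k) auto
  have "((%x. exp (- 1 / x) / x ^ k) has_real_derivative flat (k + 2) x - of_nat k * flat (k + 1) x) (at x)"
   using 1 by (intro DERIV_cong[OF DERIV_divide[OF e p]]) (auto simp: flat_def field_simps power2_eq_square)
  then show ?thesis
   by (rule has_field_derivative_transform_within_open[of _ _ _ "{0<..}"]) (use 1 in \<open>auto simp: flat_def\<close>)
 next
  case 2
  have "((%x. 0::real) has_real_derivative flat (k + 2) x - of_nat k * flat (k + 1) x) (at x)"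
   using 2 by (simp add: flat_def)
  then show ?thesis
   by (rule has_field_derivative_transform_within_open[of _ _ _ "{..<0}"]) (use 2 in \<open>auto simp: flat_def\<close>)
 next
  case 3
  have "((%y. (flat k y - flat k 0) / (y - 0)) \<longlongrightarrow> 0) (at 0)"
  proof (rule Lim_transform_eventually[OF flat_tendsto_0[of "k + 1"]])
   show "\<forall>\<^sub>F y in at 0. flat (k + 1) y = (flat k y - flat k 0) / (y - 0)"
    by (auto simp: flat_def eventually_at_filter)
  qed
  then show ?thesis using 3 by (simp add: has_field_derivative_iff flat_def)
 qed
qed

lemma smooth_flat: "smooth (%p::'v::euclidean_space. complex_of_real (flat 0 (c + v \<bullet> p)))"
proof -
 have fd: "((%x. complex_of_real (flat k x)) has_vector_derivative
   complex_of_real (flat (k + 2) x - of_nat k * flat (k + 1) x)) (at x)" for k x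
  using flat_deriv[of k x] by (intro has_vector_derivative_of_real) (simp add: has_real_derivative_iff_has_vector_derivative)
 have cont: "continuous_on UNIV (%x. complex_of_real (flat k x))" for k
  by (rule continuous_at_imp_continuous_on) (use has_vector_derivative_continuous[OF fd] in blast)
 have cont': "continuous_on UNIV (%p::'v. a * complex_of_real (flat k (c + v \<bullet> p)))" for a k
  by (intro continuous_on_mult continuous_on_const continuous_on_compose2[OF cont, of UNIV "%p. c + v \<bullet> p"] continuous_intros) auto
 have "smooth_upto N (%p::'v. a * complex_of_real (flat k (c + v \<bullet> p)))" for N k a
 proof (induction N arbitrary: k a)
  case 0
  show ?case using cont' by (simp only: smooth_upto.simps)
 next
  case (Suc N)
  define g where "g b p = a * (of_real (v \<bullet> b) *
    complex_of_real (flat (k + 2) (c + v \<bullet> p) - of_nat k * flat (k + 1) (c + v \<bullet> p)))" for b p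
  have "deriv_along b (%p. a * complex_of_real (flat k (c + v \<bullet> p))) (g b)" for b
   unfolding g_def by (intro deriv_along_cmult deriv_along_line fd) (simp add: inner_add_right)
  moreover have "smooth_upto N (g b)" for b
  proof -
   have "g b = (%p. (a * of_real (v \<bullet> b)) * complex_of_real (flat (k + 2) (c + v \<bullet> p))
    + (- a * of_real (v \<bullet> b) * of_nat k) * complex_of_real (flat (k + 1) (c + v \<bullet> p)))"
    by (auto simp: g_def algebra_simps)
   then show ?thesis using smooth_upto_add[OF Suc.IH[of "a * of_real (v \<bullet> b)" "k + 2"]
    Suc.IH[of "- a * of_real (v \<bullet> b) * of_nat k" "k + 1"]] by simp
  qed
  ultimately show ?case unfolding smooth_upto.simps using cont' by blast
 qed
 from this[of _ 1 0] show ?thesis by (simp add: smooth_def)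
qed

lemma flat_pos: "0 < x ==> 0 < flat 0 x" and flat_zero: "x <= 0 ==> flat 0 x = 0"
 by (simp_all add: flat_def)

lemma flat_nonneg: "0 <= flat 0 x" by (simp add: flat_def)

definition test_bump :: "real => 'v::euclidean_space => 'v => real" where
 "test_bump dlt c p = (\<Prod>b\<in>Basis. flat 0 (dlt - (p - c) \<bullet> b) * flat 0 (dlt + (p - c) \<bullet> b))"

lemma smooth_test_bump: "smooth (%p. complex_of_real (test_bump dlt c p))"
proof -
 have "smooth (%p. complex_of_real (flat 0 ((dlt + c \<bullet> b) + (- b) \<bullet> p)) * complex_of_real (flat 0 ((dlt - c \<bullet> b) + b \<bullet> p)))" for b
  by (intro smooth_mult smooth_flat)
 moreover have "(dlt + c \<bullet> b) + (- b) \<bullet> p = dlt - (p - c) \<bullet> b" "(dlt - c \<bullet> b) + b \<bullet> p = dlt + (p - c) \<bullet> b" for b p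
  by (simp_all add: inner_diff_left inner_commute[of b])
 ultimately have "smooth (%p. complex_of_real (flat 0 (dlt - (p - c) \<bullet> b)) * complex_of_real (flat 0 (dlt + (p - c) \<bullet> b)))" for b
  by (simp only:)
 then show ?thesis unfolding test_bump_def of_real_prod of_real_mult by (rule smooth_prod)
qed

lemma test_bump_nonneg: "0 <= test_bump dlt c p"
 by (auto simp: test_bump_def intro!: prod_nonneg mult_nonneg_nonneg flat_nonneg)

lemma test_bump_pos: "p \<in> box (c - dlt *\<^sub>R One) (c + dlt *\<^sub>R One) ==> 0 < test_bump dlt c p"
 unfolding test_bump_def
 by (intro prod_pos mult_pos_pos flat_pos) (auto simp: mem_box inner_diff_left inner_add_left)

lemma test_bump_zero:
 assumes "p ~: cbox (c - dlt *\<^sub>R One) (c + dlt *\<^sub>R One)"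
 shows "test_bump dlt c p = 0"
proof -
 obtain b where b: "b \<in> Basis" "\<not> ((c - dlt *\<^sub>R One) \<bullet> b <= p \<bullet> b & p \<bullet> b <= (c + dlt *\<^sub>R One) \<bullet> b)"
  using assms by (auto simp: mem_box)
 then have "flat 0 (dlt - (p - c) \<bullet> b) = 0 \<or> flat 0 (dlt + (p - c) \<bullet> b) = 0"
  by (auto simp: inner_diff_left inner_add_left intro!: flat_zero)
 then show ?thesis using b(1) unfolding test_bump_def by (intro prod_zero) auto
qed

lemma integrable_compact_support:
 fixes f :: "'v::euclidean_space => complex"
 assumes "compact K" "continuous_on K f" "!!p. p ~: K ==> f p = 0"
 shows "integrable lborel f" "integrable lebesgue f"
proof -
 have "integrable lborel (%x. indicator K x *\<^sub>R f x)"
  by (rule borel_integrable_compact[OF assms(1,2)])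
 moreover have "(%x. indicator K x *\<^sub>R f x) = f" using assms(3) by (auto simp: indicator_def)
 ultimately show "integrable lborel f" by simp
 then show "integrable lebesgue f"
  by (simp add: integrable_completion borel_measurable_integrable)
qed

text \<open>If \<open>k p0 ~= 0\<close>, then \<open>Re (cnj (k p0) * k)\<close> is positive on a small box, and a bump function supported
 there detects it.\<close>

lemma du_bois_reymond:
 fixes k :: "'v::euclidean_space => complex"
 assumes U: "open U" and k: "continuous_on U k"
  and int: "!!phi. test_function U phi ==> (\<integral>p. k p * phi p \<partial>lebesgue) = 0"
  and p0: "p0 \<in> U"
 shows "k p0 = 0"
proof (rule ccontr)
 assume k0: "k p0 ~= 0"
 define z where "z = cnj (k p0)"
 define V where "V = {p \<in> U. 0 < Re (z * k p)}"
 have "continuous_on U (%p. Re (z * k p))" by (intro continuous_intros k)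
 then have oV: "open V"
  unfolding V_def using continuous_open_preimage[OF _ U open_greaterThan[of 0], of "%p. Re (z * k p)"]
  by (simp add: Int_def vimage_def conj_commute)
 have "Re (z * k p0) = (norm (k p0))\<^sup>2"
  unfolding z_def by (metis Re_complex_of_real complex_norm_square mult.commute)
 then have "p0 \<in> V" using p0 k0 by (simp add: V_def del: times_complex.sel)
 then obtain a b where ab: "p0 \<in> box a b" "cbox a b \<subseteq> V"
  using oV open_contains_cbox by metis
 have "open (box a b)" by (rule open_box)
 then obtain r where r: "0 < r" "ball p0 r \<subseteq> box a b" using ab(1) open_contains_ball by blast
 define dlt where "dlt = r / (2 * DIM('v))"
 have dlt: "0 < dlt" using r by (simp add: dlt_def)
 define Q where "Q = cbox (p0 - dlt *\<^sub>R One) (p0 + dlt *\<^sub>R One)"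
 have "Q \<subseteq> ball p0 r"
 proof
  fix p assume p: "p \<in> Q"
  have "norm (p - p0) <= (\<Sum>b\<in>Basis. \<bar>(p - p0) \<bullet> b\<bar>)" by (rule norm_le_l1)
  also have "... <= (\<Sum>b\<in>(Basis::'v set). dlt)"
   using p by (intro sum_mono) (auto simp: Q_def mem_box inner_diff_left inner_add_left abs_le_iff algebra_simps)
  also have "... = r / 2" by (simp add: dlt_def)
  finally show "p \<in> ball p0 r" using r(1) by (simp add: dist_norm norm_minus_commute)
 qed
 then have QV: "Q \<subseteq> V" using r(2) ab(2) box_subset_cbox by blast
 have QU: "Q \<subseteq> U" using QV by (auto simp: V_def)
 have cQ: "compact Q" by (simp add: Q_def)
 let ?phi = "%p. complex_of_real (test_bump dlt p0 p)"
 have "test_function U ?phi"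
  unfolding test_function_iff
  by (intro conjI exI[of _ Q] allI impI smooth_test_bump cQ QU) (simp add: Q_def test_bump_zero)
 then have zero: "(\<integral>p. k p * ?phi p \<partial>lebesgue) = 0" by (rule int)
 have ci: "integrable lebesgue (%p. k p * ?phi p)"
 proof (rule integrable_compact_support(2)[OF cQ])
  show "continuous_on Q (%p. k p * ?phi p)"
   by (intro continuous_on_mult continuous_on_subset[OF k QU] continuous_on_subset[OF smooth_continuous[OF smooth_test_bump]]) auto
 qed (simp add: test_bump_zero Q_def)
 have "(\<integral>p. Re (z * (k p * ?phi p)) \<partial>lebesgue) = Re (z * (\<integral>p. k p * ?phi p \<partial>lebesgue))"
  using ci by (subst integral_Re) (simp_all del: Re_complex_div_gt_0 times_complex.sel)
 then have "(\<integral>p. Re (z * (k p * ?phi p)) \<partial>lebesgue) = 0" using zero by simp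
 moreover have eq: "Re (z * (k p * ?phi p)) = Re (z * k p) * test_bump dlt p0 p" for p
  by (simp add: algebra_simps)
 ultimately have int0: "(\<integral>p. Re (z * k p) * test_bump dlt p0 p \<partial>lebesgue) = 0" by simp
 have "integrable lebesgue (%p. Re (z * (k p * ?phi p)))"
  by (intro integrable_Re integrable_mult_right ci)
 then have ir: "integrable lebesgue (%p. Re (z * k p) * test_bump dlt p0 p)" unfolding eq .
 have nn: "0 <= Re (z * k p) * test_bump dlt p0 p" for p
 proof (cases "p \<in> Q")
  case True
  then have "0 < Re (z * k p)" using QV by (auto simp: V_def simp del: times_complex.sel)
  then show ?thesis using test_bump_nonneg[of dlt p0 p] by (intro mult_nonneg_nonneg) simp_all
 qed (simp add: test_bump_zero Q_def)
 have "AE p in lebesgue. Re (z * k p) * test_bump dlt p0 p = 0"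
  using integral_nonneg_eq_0_iff_AE[OF ir] nn int0 by simp
 then have "AE p in lebesgue. p ~: box (p0 - dlt *\<^sub>R One) (p0 + dlt *\<^sub>R One)"
 proof eventually_elim
  case (elim p)
  show ?case
  proof
   assume p: "p \<in> box (p0 - dlt *\<^sub>R One) (p0 + dlt *\<^sub>R One)"
   then have "p \<in> Q" using box_subset_cbox by (auto simp: Q_def)
   then have "0 < Re (z * k p)" using QV by (auto simp: V_def simp del: times_complex.sel)
   then show False using elim test_bump_pos[OF p] by simp
  qed
 qed
 then have "AE p in lborel. p ~: box (p0 - dlt *\<^sub>R One) (p0 + dlt *\<^sub>R One)"
  by (simp add: AE_completion_iff)
 then have "emeasure lborel (box (p0 - dlt *\<^sub>R One) (p0 + dlt *\<^sub>R One)) = 0"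
  by (subst (asm) AE_iff_measurable[OF _ refl]) auto
 moreover have "emeasure lborel (box (p0 - dlt *\<^sub>R One) (p0 + dlt *\<^sub>R One)) = ennreal (\<Prod>b\<in>(Basis::'v set). 2 * dlt)"
  using dlt by (subst emeasure_lborel_box) (auto simp: inner_diff_left inner_add_left intro!: prod.cong arg_cong[of _ _ ennreal])
 moreover have "0 < (\<Prod>b\<in>(Basis::'v set). 2 * dlt)" using dlt by (intro prod_pos) auto
 ultimately show False by (metis ennreal_eq_0_iff not_le)
qed

text \<open>A smooth step, glued from two flat functions.\<close>

definition step :: "real => real" where
 "step x = flat 0 x / (flat 0 x + flat 0 (1 - x))"

lemma step_denominator_pos: "0 < flat 0 x + flat 0 (1 - x)"
 using flat_pos[of x] flat_pos[of "1 - x"] flat_nonneg[of x] flat_nonneg[of "1 - x"] by (cases "0 < x") auto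

lemma step_simps: "x <= 0 ==> step x = 0" "1 <= x ==> step x = 1"
 using step_denominator_pos[of x] by (simp_all add: step_def flat_zero)

lemma smooth_step: "smooth (%p::'v::euclidean_space. complex_of_real (step (c + v \<bullet> p)))"
proof -
 have "smooth (%p. complex_of_real (flat 0 (c + v \<bullet> p)) /
  (complex_of_real (flat 0 (c + v \<bullet> p)) + complex_of_real (flat 0 ((1 - c) + (- v) \<bullet> p))))"
 proof (rule smooth_divide[where K = UNIV])
  show "complex_of_real (flat 0 (c + v \<bullet> p)) + complex_of_real (flat 0 ((1 - c) + (- v) \<bullet> p)) ~= 0" for p
  proof -
   have "flat 0 (c + v \<bullet> p) + flat 0 ((1 - c) + (- v) \<bullet> p) ~= 0"
    using step_denominator_pos[of "c + v \<bullet> p"] by (simp add: algebra_simps)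
   then show ?thesis by (metis of_real_add of_real_eq_0_iff)
  qed
  show "smooth (%p. complex_of_real (flat 0 (c + v \<bullet> p)))" by (rule smooth_flat)
  show "smooth (%p. complex_of_real (flat 0 (c + v \<bullet> p)) + complex_of_real (flat 0 ((1 - c) + (- v) \<bullet> p)))"
   by (intro smooth_add smooth_flat)
 qed simp_all
 then show ?thesis by (simp add: step_def algebra_simps)
qed

definition plateau :: "real => 'v::euclidean_space => real" where
 "plateau eps w = (\<Prod>b\<in>Basis. step (2 - (w \<bullet> b) / eps) * step (2 + (w \<bullet> b) / eps))"

lemma smooth_plateau: "smooth (%w. complex_of_real (plateau eps w))"
proof -
 have "smooth (%w. complex_of_real (step (2 + (- (1/eps) *\<^sub>R b) \<bullet> w)) * complex_of_real (step (2 + ((1/eps) *\<^sub>R b) \<bullet> w)))" for b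
  by (intro smooth_mult smooth_step)
 then have "smooth (%w::'a. \<Prod>b\<in>Basis. complex_of_real (step (2 + (- (1/eps) *\<^sub>R b) \<bullet> w)) * complex_of_real (step (2 + ((1/eps) *\<^sub>R b) \<bullet> w)))"
  by (rule smooth_prod)
 moreover have "2 + (- (1/eps) *\<^sub>R b) \<bullet> w = 2 - (w \<bullet> b) / eps" "2 + ((1/eps) *\<^sub>R b) \<bullet> w = 2 + (w \<bullet> b) / eps" for b w :: 'a
  by (simp_all add: inner_commute[of b])
 ultimately show ?thesis by (simp only: plateau_def of_real_prod of_real_mult)
qed

lemma plateau_one:
 assumes "0 < eps" "!!b. b \<in> Basis ==> \<bar>w \<bullet> b\<bar> <= eps"
 shows "plateau eps w = 1"
 unfolding plateau_def
proof (rule prod.neutral, rule ballI)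
 fix b :: 'a assume "b \<in> Basis"
 then have "- eps <= w \<bullet> b" "w \<bullet> b <= eps" using assms(2)[of b] by (auto simp: abs_le_iff)
 then have "- 1 <= (w \<bullet> b) / eps" "(w \<bullet> b) / eps <= 1" using assms(1) by (simp_all add: field_simps)
 then have "1 <= 2 - (w \<bullet> b) / eps" "1 <= 2 + (w \<bullet> b) / eps" by (auto simp: abs_le_iff)
 then show "step (2 - (w \<bullet> b) / eps) * step (2 + (w \<bullet> b) / eps) = 1" by (simp add: step_simps)
qed

lemma plateau_zero:
 assumes "0 < eps" "b \<in> Basis" "2 * eps <= \<bar>w \<bullet> b\<bar>"
 shows "plateau eps w = 0"
proof -
 have "2 <= \<bar>(w \<bullet> b) / eps\<bar>" using assms by (simp add: field_simps)
 then have "2 - (w \<bullet> b) / eps <= 0 \<or> 2 + (w \<bullet> b) / eps <= 0" by linarith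
 then have "step (2 - (w \<bullet> b) / eps) * step (2 + (w \<bullet> b) / eps) = 0" by (auto simp: step_simps)
 then show ?thesis unfolding plateau_def using assms(2) by (intro prod_zero) auto
qed

section \<open>Integration by parts\<close>

lemma lborel_integral_translate:
 fixes G :: "'v::euclidean_space => 'b::{banach, second_countable_topology}"
 assumes [measurable]: "G \<in> borel_measurable borel"
 shows "(\<integral>p. G (p + c) \<partial>lborel) = (\<integral>p. G p \<partial>lborel)"
  and "integrable lborel (%p. G (p + c)) \<longleftrightarrow> integrable lborel G"
proof -
 have "(\<integral>p. G p \<partial>lborel) = (\<integral>p. G p \<partial>distr lborel borel ((+) c))" by (simp add: lborel_distr_plus)
 also have "... = (\<integral>p. G (c + p) \<partial>lborel)" by (rule integral_distr) auto
 finally show "(\<integral>p. G (p + c) \<partial>lborel) = (\<integral>p. G p \<partial>lborel)" by (simp add: add.commute)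
 have "integrable lborel G \<longleftrightarrow> integrable (distr lborel borel ((+) c)) G" by (simp add: lborel_distr_plus)
 also have "... \<longleftrightarrow> integrable lborel (%p. G (c + p))" by (rule integrable_distr_eq) auto
 finally show "integrable lborel (%p. G (p + c)) \<longleftrightarrow> integrable lborel G" by (simp add: add.commute)
qed

text \<open>The integral of a derivative vanishes by translation invariance: averaging the increment
 \<open>G (p + e) - G p = \<integral>\<^sub>0\<^sup>1 G' (p + s e) ds\<close> over \<open>p\<close> gives \<open>0\<close> on the left and \<open>\<integral> G'\<close> on the right.\<close>

lemma integral_deriv_along_eq_0:
 fixes G G' :: "'v::euclidean_space => complex"
 assumes d: "deriv_along e G G'" and c: "continuous_on UNIV G'"
  and G: "integrable lborel G" and G': "integrable lborel G'"
 shows "(\<integral>p. G' p \<partial>lborel) = 0"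
proof -
 have mG[measurable]: "G \<in> borel_measurable borel" using borel_measurable_integrable[OF G] by simp
 have mG'[measurable]: "G' \<in> borel_measurable borel" using borel_measurable_integrable[OF G'] by simp
 define J where "J = (\<integral>p. G' p \<partial>lborel)"
 define H where "H s p = indicator {0..1::real} s *\<^sub>R G' (p + s *\<^sub>R e)" for s p
 have mH: "(%(s, p). H s p) \<in> borel_measurable (lborel \<Otimes>\<^sub>M lborel)"
  unfolding H_def case_prod_beta' by measurable
 have Hs: "integrable lborel (H s)" for s
  unfolding H_def using lborel_integral_translate(2)[OF mG', of "s *\<^sub>R e"] G' by (intro integrable_scaleR_right) simp
 have HJ: "(\<integral>p. H s p \<partial>lborel) = indicator {0..1} s *\<^sub>R J" for s
  unfolding H_def J_def using lborel_integral_translate(1)[OF mG', of "s *\<^sub>R e"] by simp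
 have nJ: "(\<integral>p. norm (H s p) \<partial>lborel) = indicator {0..1} s *\<^sub>R (\<integral>p. norm (G' p) \<partial>lborel)" for s
  unfolding H_def using lborel_integral_translate(1)[of "%p. norm (G' p)" "s *\<^sub>R e"] by simp
 have i01: "integrable lborel (%s. indicator {0..1::real} s *\<^sub>R r)" for r :: "'b::{banach, second_countable_topology}"
  by (intro integrable_scaleR_left) simp
 have fub: "integrable (lborel \<Otimes>\<^sub>M lborel) (%(s, p). H s p)"
 proof (rule lborel_pair.Fubini_integrable[OF mH])
  show "integrable lborel (%s. \<integral>p. norm (case (s, p) of (s, p) => H s p) \<partial>lborel)"
   using i01 by (simp add: nJ del: scaleR_scaleR)
  show "AE s in lborel. integrable lborel (%p. case (s, p) of (s, p) => H s p)" using Hs by simp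
 qed
 have inner: "(\<integral>s. H s p \<partial>lborel) = G (p + e) - G p" for p
 proof -
  have "(\<integral>s. indicator {0..1} s *\<^sub>R G' (p + s *\<^sub>R e) \<partial>lborel) = G (p + 1 *\<^sub>R e) - G (p + 0 *\<^sub>R e)"
  proof (rule integral_FTC_Icc)
   show "((%s. G (p + s *\<^sub>R e)) has_vector_derivative G' (p + s *\<^sub>R e)) (at s within {0..1})" for s
    by (rule has_vector_derivative_at_within[OF deriv_along_at[OF d]])
   show "continuous_on {0..1} (%s. G' (p + s *\<^sub>R e))"
    by (intro continuous_on_compose2[OF c] continuous_intros) auto
  qed simp
  then show ?thesis by (simp add: H_def)
 qed
 have "(\<integral>s. \<integral>p. H s p \<partial>lborel \<partial>lborel) = (\<integral>p. \<integral>s. H s p \<partial>lborel \<partial>lborel)"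
  using lborel_pair.Fubini_integral[OF fub] by simp
 also have "(\<integral>s. \<integral>p. H s p \<partial>lborel \<partial>lborel) = J"
  unfolding HJ by simp
 also have "(\<integral>p. \<integral>s. H s p \<partial>lborel \<partial>lborel) = (\<integral>p. G (p + e) \<partial>lborel) - (\<integral>p. G p \<partial>lborel)"
  unfolding inner using lborel_integral_translate(2)[OF mG, of e] G by simp
 also have "... = 0" by (simp add: lborel_integral_translate(1)[OF mG])
 finally show ?thesis by (simp add: J_def)
qed

section \<open>Multiple Fourier series\<close>

lemma lborel_integral_prod_Basis:
 fixes f :: "'v::euclidean_space => real => complex"
 assumes f: "!!b. b \<in> Basis ==> integrable lborel (f b)"
 shows "(\<integral>w. (\<Prod>b\<in>Basis. f b (w \<bullet> b)) \<partial>(lborel :: 'v measure)) = (\<Prod>b\<in>Basis. \<integral>x. f b x \<partial>lborel)"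
proof -
 interpret product_sigma_finite "%_::'v. lborel :: real measure" ..
 have fm[measurable]: "!!b. b \<in> Basis ==> f b \<in> borel_measurable borel"
  using f borel_measurable_integrable by fastforce
 have "(\<integral>w. (\<Prod>b\<in>Basis. f b (w \<bullet> b)) \<partial>(lborel :: 'v measure))
  = (\<integral>g. (\<Prod>b\<in>Basis. f b ((\<Sum>c\<in>Basis. g c *\<^sub>R c) \<bullet> b)) \<partial>(\<Pi>\<^sub>M b\<in>(Basis::'v set). lborel))"
 proof (subst lborel_eq, rule integral_distr)
  show "(%g. \<Sum>b\<in>Basis. g b *\<^sub>R b) \<in> measurable (\<Pi>\<^sub>M b\<in>(Basis::'v set). lborel) borel" by measurable
  show "(%w. \<Prod>b\<in>Basis. f b (w \<bullet> b)) \<in> borel_measurable borel"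
   by (intro borel_measurable_prod measurable_compose[OF _ fm]) auto
 qed
 also have "... = (\<integral>g. (\<Prod>b\<in>Basis. f b (g b)) \<partial>(\<Pi>\<^sub>M b\<in>(Basis::'v set). lborel))"
  by (intro Bochner_Integration.integral_cong prod.cong refl) simp
 also have "... = (\<Prod>b\<in>Basis. \<integral>x. f b x \<partial>lborel)"
  by (rule product_integral_prod[OF finite_Basis f])
 finally show ?thesis .
qed

definition char :: "real => 'v::euclidean_space => 'v => complex" where
 "char P mu w = cis (2 * pi / P * (mu \<bullet> w))"

abbreviation pbox :: "real => 'v::euclidean_space set" where
 "pbox P \<equiv> cbox (- ((P / 2) *\<^sub>R One)) ((P / 2) *\<^sub>R One)"

lemma norm_char [simp]: "norm (char P mu w) = 1" by (simp add: char_def)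
lemma char_0 [simp]: "char P 0 w = 1" by (simp add: char_def)
lemma char_mult: "char P mu w * char P nu w = char P (mu + nu) w"
 by (simp add: char_def cis_mult inner_add_left distrib_left)
lemma continuous_on_char: "continuous_on A (char P mu)"
 unfolding char_def by (intro continuous_intros continuous_on_compose2[OF continuous_on_cis[OF continuous_on_id]]) auto
lemma borel_measurable_char [measurable]: "char P mu \<in> borel_measurable borel"
 by (rule borel_measurable_continuous_onI[OF continuous_on_char])

lemma int_lattice_add: "mu \<in> int_lattice ==> nu \<in> int_lattice ==> mu + nu \<in> int_lattice"
 by (simp add: int_lattice_def inner_add_left)
lemma int_lattice_uminus: "mu \<in> int_lattice ==> - mu \<in> int_lattice"
 by (simp add: int_lattice_def)
lemma int_lattice_diff: "mu \<in> int_lattice ==> nu \<in> int_lattice ==> mu - nu \<in> int_lattice"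
 by (simp add: int_lattice_def inner_diff_left)
lemma int_lattice_0: "0 \<in> int_lattice" by (simp add: int_lattice_def)
lemma int_lattice_Basis: "b \<in> Basis ==> b \<in> int_lattice"
 by (auto simp: int_lattice_def inner_Basis)

lemma integral_cis_period:
 assumes P: "0 < P" and k: "k \<in> \<int>" "k ~= 0"
 shows "(\<integral>x. indicator {-(P/2)..P/2} x *\<^sub>R cis (2 * pi / P * (k * x)) \<partial>lborel) = 0"
proof -
 define a where "a = 2 * pi / P * k"
 have a: "a ~= 0" using P k by (simp add: a_def)
 have "(\<integral>x. indicator {-(P/2)..P/2} x *\<^sub>R cis (a * x) \<partial>lborel)
  = cis (a * (P/2)) / (\<i> * a) - cis (a * (-(P/2))) / (\<i> * a)"
 proof (rule integral_FTC_Icc)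
  fix x
  have "((%x. cis (a * x) / (\<i> * a)) has_vector_derivative cis (a * x)) (at x)"
  proof -
   have "((%z. exp (\<i> * (a * z)) / (\<i> * a)) has_field_derivative exp (\<i> * (a * complex_of_real x))) (at (complex_of_real x))"
    using a by (auto intro!: derivative_eq_intros simp: field_simps)
   from has_vector_derivative_real_field[OF this] show ?thesis by (simp add: cis_conv_exp)
  qed
  then show "((%x. cis (a * x) / (\<i> * a)) has_vector_derivative cis (a * x)) (at x within {-(P/2)..P/2})"
   by (rule has_vector_derivative_at_within)
  show "continuous_on {-(P/2)..P/2} (%x. cis (a * x))"
   by (intro continuous_intros continuous_on_compose2[OF continuous_on_cis[OF continuous_on_id]]) auto
 qed (use P in simp)
 also have "... = 0"
 proof -
  have "cis (a * (P/2)) = cis (a * (-(P/2)))"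
  proof -
   obtain j where "k = of_int j" using k(1) Ints_cases by blast
   then have "a * (P/2) = a * (-(P/2)) + 2 * pi * of_int j" using P by (simp add: a_def field_simps)
   then show ?thesis by (simp only: cis_mult[symmetric]) (simp add: cis_multiple_2pi)
  qed
  then show ?thesis by simp
 qed
 finally show ?thesis by (simp add: a_def mult.assoc)
qed

lemma indicator_pbox:
 "indicator (pbox P) w = (\<Prod>b\<in>Basis. indicator {-(P/2)..P/2} (w \<bullet> b) :: real)" for w :: "'v::euclidean_space"
proof (cases "w \<in> pbox P")
 case True
 then show ?thesis by (auto simp: mem_box intro!: prod.neutral[symmetric])
next
 case False
 then obtain b where "b \<in> Basis" "w \<bullet> b ~: {-(P/2)..P/2}" by (auto simp: mem_box)
 then have "(\<Prod>b\<in>Basis. indicator {-(P/2)..P/2} (w \<bullet> b) :: real) = 0"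
  by (intro prod_zero) (auto simp: indicator_def)
 then show ?thesis using False by simp
qed

lemma char_prod: "char P mu w = (\<Prod>b\<in>Basis. cis (2 * pi / P * ((mu \<bullet> b) * (w \<bullet> b))))"
proof -
 have c: "(\<Prod>b\<in>S. cis (f b)) = cis (\<Sum>b\<in>S. f b)" if "finite S" for S :: "'a set" and f
  using that by (induction S) (simp_all add: cis_mult)
 have "2 * pi / P * (mu \<bullet> w) = (\<Sum>b\<in>Basis. 2 * pi / P * ((mu \<bullet> b) * (w \<bullet> b)))"
  by (subst euclidean_inner) (rule sum_distrib_left)
 then show ?thesis by (simp only: char_def c[OF finite_Basis])
qed

lemma integral_char:
 fixes mu :: "'v::euclidean_space"
 assumes P: "0 < P" and mu: "mu \<in> int_lattice"
 shows "(\<integral>w. indicator (pbox P) w *\<^sub>R char P mu w \<partial>lborel) = (if mu = 0 then complex_of_real (P ^ DIM('v)) else 0)"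
proof -
 define f where "f b x = indicator {-(P/2)..P/2} x *\<^sub>R cis (2 * pi / P * ((mu \<bullet> b) * x))" for b x
 have fi: "integrable lborel (f b)" for b
  unfolding f_def atLeastAtMost_def[symmetric]
  by (rule borel_integrable_compact)
   (use P in \<open>auto intro!: continuous_intros continuous_on_compose2[OF continuous_on_cis[OF continuous_on_id]]\<close>)
 have "(\<integral>w. indicator (pbox P) w *\<^sub>R char P mu w \<partial>lborel) = (\<integral>w. (\<Prod>b\<in>Basis. f b (w \<bullet> b)) \<partial>lborel)"
  by (intro Bochner_Integration.integral_cong refl)
   (unfold indicator_pbox char_prod f_def, simp add: scaleR_conv_of_real prod.distrib)
 also have "... = (\<Prod>b\<in>Basis. \<integral>x. f b x \<partial>lborel)" by (rule lborel_integral_prod_Basis) (rule fi)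
 also have "... = (if mu = 0 then complex_of_real (P ^ DIM('v)) else 0)"
 proof (cases "mu = 0")
  case True
  have "(\<integral>x. f b x \<partial>lborel) = complex_of_real P" for b
   using P by (simp add: f_def True scaleR_conv_of_real)
  then show ?thesis using True by simp
 next
  case False
  then obtain b where b: "b \<in> Basis" "mu \<bullet> b ~= 0" by (metis euclidean_all_zero_iff)
  then have "(\<integral>x. f b x \<partial>lborel) = 0"
   unfolding f_def using mu by (intro integral_cis_period P) (auto simp: int_lattice_def)
  then show ?thesis using False b by (auto intro!: prod_zero)
 qed
 finally show ?thesis .
qed

lemma integrable_indicator_cbox: "integrable lborel (indicator (cbox a b) :: 'v::euclidean_space => real)"
 using borel_integrable_compact[OF compact_cbox, of a b "%_. 1::real"] by (simp add: continuous_on_const)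

lemma integrable_pbox_mult:
 fixes f :: "'v::euclidean_space => complex"
 assumes "continuous_on UNIV f"
 shows "integrable lborel (%w. indicator (pbox P) w *\<^sub>R f w)"
 by (rule borel_integrable_compact) (auto intro: continuous_on_subset[OF assms])

text \<open>A continuous function with vanishing Fourier coefficients vanishes: test it against the
 trigonometric polynomials \<open>\<Prod>\<^sub>b ((1 + cos (2 \<pi> (x - w) \<bullet> b / P)) / 2) ^ N\<close>, which concentrate at \<open>x\<close>.\<close>

lemma fourier_uniqueness:
 fixes F :: "'v::euclidean_space => complex"
 assumes P: "0 < P" and F: "continuous_on UNIV F"
  and zero: "!!mu. mu \<in> int_lattice ==> (\<integral>w. indicator (pbox P) w *\<^sub>R (F w * char P mu w) \<partial>lborel) = 0"
  and x: "!!b. b \<in> Basis ==> \<bar>x \<bullet> b\<bar> < P / 2"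
 shows "F x = 0"
proof (rule ccontr)
 assume F0: "F x ~= 0"
 define kap where "kap = 2 * pi / P"
 have kap: "0 < kap" using P by (simp add: kap_def)
 define T where "T p \<longleftrightarrow> continuous_on UNIV p &
  (\<forall>mu\<in>int_lattice. (\<integral>w. indicator (pbox P) w *\<^sub>R (F w * char P mu w * p w) \<partial>lborel) = 0)" for p :: "'v => complex"
 define \<theta> where "\<theta> b w = complex_of_real ((1 + cos (kap * ((x - w) \<bullet> b))) / 2)" for b w
 have \<theta>c: "continuous_on UNIV (\<theta> b)" for b
  unfolding \<theta>_def by (intro continuous_intros) auto
 have T1: "T (%w. 1)" using zero by (simp add: T_def)
 have Tstep: "T (%w. p w * \<theta> b w)" if p: "T p" and b: "b \<in> Basis" for p b
  unfolding T_def
 proof (intro conjI ballI)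
  show "continuous_on UNIV (%w. p w * \<theta> b w)"
   using p \<theta>c by (auto simp: T_def intro: continuous_on_mult)
  fix mu :: 'v assume mu: "mu \<in> int_lattice"
  define z where "z = cis (kap * (x \<bullet> b))"
  have \<theta>: "\<theta> b w = 1/2 + (z/4) * char P (- b) w + (cnj z/4) * char P b w" for w
  proof -
   have "complex_of_real (2 * cos t) = cis t + cis (- t)" for t
    by (simp add: complex_eq_iff)
   moreover have "cis (kap * ((x - w) \<bullet> b)) = z * char P (- b) w" "cis (- (kap * ((x - w) \<bullet> b))) = cnj z * char P b w"
    by (simp_all add: z_def char_def cis_mult cis_cnj kap_def inner_diff_left inner_commute[of b] algebra_simps diff_divide_distrib)
   ultimately have "complex_of_real (2 * cos (kap * ((x - w) \<bullet> b))) = z * char P (- b) w + cnj z * char P b w"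
    by simp
   moreover have "\<theta> b w = 1/2 + complex_of_real (2 * cos (kap * ((x - w) \<bullet> b))) / 4"
    by (simp add: \<theta>_def field_simps)
   ultimately show ?thesis by (simp add: field_simps)
  qed
  have i: "integrable lborel (%w. indicator (pbox P) w *\<^sub>R (F w * char P nu w * p w))" for nu
   using p by (intro integrable_pbox_mult continuous_on_mult F continuous_on_char) (simp add: T_def)
  have "(\<integral>w. indicator (pbox P) w *\<^sub>R (F w * char P mu w * (p w * \<theta> b w)) \<partial>lborel)
   = (\<integral>w. (1/2) * (indicator (pbox P) w *\<^sub>R (F w * char P mu w * p w))
    + (z/4) * (indicator (pbox P) w *\<^sub>R (F w * char P (mu - b) w * p w))
    + (cnj z/4) * (indicator (pbox P) w *\<^sub>R (F w * char P (mu + b) w * p w)) \<partial>lborel)"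
  proof (intro Bochner_Integration.integral_cong refl)
   fix w
   have "char P (mu - b) w = char P mu w * char P (- b) w" "char P (mu + b) w = char P mu w * char P b w"
    by (simp_all add: char_mult)
   then show "indicator (pbox P) w *\<^sub>R (F w * char P mu w * (p w * \<theta> b w)) =
    (1/2) * (indicator (pbox P) w *\<^sub>R (F w * char P mu w * p w))
    + (z/4) * (indicator (pbox P) w *\<^sub>R (F w * char P (mu - b) w * p w))
    + (cnj z/4) * (indicator (pbox P) w *\<^sub>R (F w * char P (mu + b) w * p w))"
    unfolding \<theta> by (simp add: scaleR_conv_of_real algebra_simps)
  qed
  also have "... = (1/2) * (\<integral>w. indicator (pbox P) w *\<^sub>R (F w * char P mu w * p w) \<partial>lborel)
    + (z/4) * (\<integral>w. indicator (pbox P) w *\<^sub>R (F w * char P (mu - b) w * p w) \<partial>lborel)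
    + (cnj z/4) * (\<integral>w. indicator (pbox P) w *\<^sub>R (F w * char P (mu + b) w * p w) \<partial>lborel)"
   by (simp only: Bochner_Integration.integral_add integrable_mult_right[OF i] Bochner_Integration.integrable_add
    Bochner_Integration.integral_mult_right[OF i])
  also have "... = 0"
   using p mu b by (simp add: T_def int_lattice_diff int_lattice_add int_lattice_Basis)
  finally show "(\<integral>w. indicator (pbox P) w *\<^sub>R (F w * char P mu w * (p w * \<theta> b w)) \<partial>lborel) = 0" .
 qed
 have Tpow: "T (%w. p w * \<theta> b w ^ N)" if "T p" "b \<in> Basis" for p b N
 proof (induction N)
  case 0
  then show ?case using that by simp
 next
  case (Suc N)
  from Tstep[OF this that(2)] show ?case by (simp add: mult_ac)
 qed
 have Tprod: "T (%w. \<Prod>b\<in>S. \<theta> b w ^ N)" if "finite S" "S \<subseteq> Basis" for S N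
  using that
 proof (induction S)
  case empty
  then show ?case using T1 by simp
 next
  case (insert b S)
  then have "T (%w. (\<Prod>b\<in>S. \<theta> b w ^ N) * \<theta> b w ^ N)" by (intro Tpow) auto
  then show ?case using insert by (simp add: mult.commute)
 qed
 define K where "K N w = (\<Prod>b\<in>Basis. ((1 + cos (kap * ((x - w) \<bullet> b))) / 2) ^ N)" for N and w :: 'v
 have K0: "0 <= K N w" for N w
 proof -
  have "0 <= (1 + cos t) / 2" for t :: real
   by (rule divide_nonneg_pos) (use cos_ge_minus_one[of t] in linarith, simp)
  then show ?thesis unfolding K_def by (intro prod_nonneg zero_le_power) blast
 qed
 have TK: "T (%w. complex_of_real (K N w))" for N
  using Tprod[of Basis N] by (simp add: K_def \<theta>_def)
 define z where "z = cnj (F x)"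
 define h where "h w = Re (z * F w)" for w
 have hc: "continuous_on UNIV h" unfolding h_def by (intro continuous_intros F)
 have hx: "h x = (norm (F x))\<^sup>2"
  unfolding h_def z_def by (metis Re_complex_of_real complex_norm_square mult.commute)
 define eta where "eta = (norm (F x))\<^sup>2 / 2"
 have eta: "0 < eta" "eta < h x" using F0 by (auto simp: eta_def hx)
 have hK: "(\<integral>w. indicator (pbox P) w * (h w * K N w) \<partial>lborel) = 0" for N
 proof -
  have c: "continuous_on UNIV (%w. complex_of_real (K N w))" using TK[of N] by (simp add: T_def)
  have i: "integrable lborel (%w. indicator (pbox P) w *\<^sub>R (F w * complex_of_real (K N w)))"
   by (intro integrable_pbox_mult continuous_on_mult F c)
  have z0: "(\<integral>w. indicator (pbox P) w *\<^sub>R (F w * complex_of_real (K N w)) \<partial>lborel) = 0"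
   using TK[of N] int_lattice_0 unfolding T_def by force
  have re: "Re (z * (indicator (pbox P) w *\<^sub>R (F w * complex_of_real (K N w)))) = indicator (pbox P) w * (h w * K N w)" for w
   by (simp add: h_def algebra_simps)
  have "(\<integral>w. indicator (pbox P) w * (h w * K N w) \<partial>lborel)
   = (\<integral>w. Re (z * (indicator (pbox P) w *\<^sub>R (F w * complex_of_real (K N w)))) \<partial>lborel)"
   by (simp only: re)
  also have "... = Re (z * (\<integral>w. indicator (pbox P) w *\<^sub>R (F w * complex_of_real (K N w)) \<partial>lborel))"
   unfolding integral_Re[OF integrable_mult_right[OF i]] by (simp only: integral_mult_right_zero)
  also have "... = 0" unfolding z0 by simp
  finally show ?thesis .
 qed
 have ihK: "integrable lborel (%w. indicator (pbox P) w * (h w * K N w))" for N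
 proof -
  have "continuous_on (pbox P) (%w. h w * K N w)"
   unfolding K_def by (intro continuous_intros continuous_on_subset[OF hc]) auto
  from borel_integrable_compact[OF compact_cbox this] show ?thesis by simp
 qed
 \<comment> \<open>Near \<open>x\<close> the function \<open>h\<close> is bounded below by \<open>eta\<close>.\<close>
 obtain rho where rho: "0 < rho" "!!w. dist w x < rho ==> eta < h w"
 proof -
  have "open {w. eta < h w}" using hc by (simp add: open_Collect_less continuous_on_const)
  then show ?thesis using eta(2) that unfolding open_dist by (metis mem_Collect_eq)
 qed
 define m where "m = Min ((%b. P / 2 - \<bar>x \<bullet> b\<bar>) ` (Basis::'v set))"
 have m: "0 < m" "!!b. b \<in> Basis ==> m <= P / 2 - \<bar>x \<bullet> b\<bar>"
  unfolding m_def using x by (auto intro: Min_le)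
 define dlt where "dlt = min (m / 2) (rho / (2 * DIM('v)))"
 have dlt: "0 < dlt" "dlt < m" "dlt * DIM('v) < rho"
 proof -
  show "0 < dlt" "dlt < m" using m(1) rho(1) by (auto simp: dlt_def)
  have "dlt * DIM('v) <= rho / (2 * DIM('v)) * DIM('v)" by (intro mult_right_mono) (auto simp: dlt_def)
  also have "... < rho" using rho(1) by simp
  finally show "dlt * DIM('v) < rho" .
 qed
 have kapdlt: "0 < kap * dlt" "kap * dlt < pi"
 proof -
  obtain b where "b \<in> (Basis::'v set)" using nonempty_Basis by blast
  then have "dlt < P / 2" using m(2)[of b] dlt(2) by simp
  then show "kap * dlt < pi" using P by (simp add: kap_def field_simps)
 qed (use kap dlt in simp)
 define r1 where "r1 = (1 + cos (kap * dlt)) / 2"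
 have r1: "0 <= r1" "r1 < 1"
 proof -
  have "0 <= 1 + cos (kap * dlt)" using cos_ge_minus_one[of "kap * dlt"] by linarith
  then show "0 <= r1" by (simp add: r1_def)
  show "r1 < 1" using cos_monotone_0_pi[of 0 "kap * dlt"] kapdlt by (simp add: r1_def)
 qed
 have "((%t. ((1 + cos (kap * t)) / 2) ^ DIM('v)) \<longlongrightarrow> ((1 + cos (kap * 0)) / 2) ^ DIM('v)) (at_right 0)"
  by (intro tendsto_intros) simp_all
 then have "eventually (%t. r1 < ((1 + cos (kap * t)) / 2) ^ DIM('v)) (at_right 0)"
  using r1 by (intro order_tendstoD) auto
 then obtain t0 where t0: "0 < t0" "!!t. 0 < t ==> t < t0 ==> r1 < ((1 + cos (kap * t)) / 2) ^ DIM('v)"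
  unfolding eventually_at_right_field by auto
 define gam where "gam = min dlt (t0 / 2)"
 have gam: "0 < gam" "gam <= dlt" "gam < t0" using t0(1) dlt(1) by (auto simp: gam_def)
 define r2 where "r2 = ((1 + cos (kap * gam)) / 2) ^ DIM('v)"
 have r12: "r1 < r2" using t0(2)[of gam] gam by (simp add: r2_def)
 define Q where "Q = cbox (x - gam *\<^sub>R One) (x + gam *\<^sub>R One)"
 have Qi: "\<bar>(x - w) \<bullet> b\<bar> <= gam" if "w \<in> Q" "b \<in> Basis" for w b
  using that by (auto simp: Q_def mem_box inner_diff_left inner_add_left abs_le_iff algebra_simps)
 have QP: "Q \<subseteq> pbox P"
 proof
  fix w assume w: "w \<in> Q"
  have "\<bar>w \<bullet> b\<bar> <= P / 2" if b: "b \<in> Basis" for b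
  proof -
   have "\<bar>x \<bullet> b - w \<bullet> b\<bar> <= gam" using Qi[OF w b] by (simp add: inner_diff_left)
   then show ?thesis using m(2)[OF b] gam(2) dlt(2) by linarith
  qed
  then have "- (P / 2) <= w \<bullet> b & w \<bullet> b <= P / 2" if "b \<in> Basis" for b
   using that abs_le_iff by force
  then show "w \<in> pbox P" by (simp add: mem_box)
 qed
 have KQ: "r2 ^ N <= K N w" if "w \<in> Q" for N w
 proof -
  have "(\<Prod>b\<in>(Basis::'v set). ((1 + cos (kap * gam)) / 2) ^ N) <= K N w"
   unfolding K_def
  proof (intro prod_mono conjI power_mono)
   fix b :: 'v assume b: "b \<in> Basis"
   have "cos (kap * gam) <= cos \<bar>kap * ((x - w) \<bullet> b)\<bar>"
   proof (rule cos_monotone_0_pi_le)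
    show "\<bar>kap * ((x - w) \<bullet> b)\<bar> <= kap * gam" using Qi[OF that b] kap by (simp add: abs_mult)
    show "kap * gam <= pi" using kapdlt gam(2) kap by (meson less_imp_le mult_left_mono order_trans)
   qed simp
   then show "(1 + cos (kap * gam)) / 2 <= (1 + cos (kap * ((x - w) \<bullet> b))) / 2" by simp
   have "0 <= 1 + cos (kap * gam)" using cos_ge_minus_one[of "kap * gam"] by linarith
   then show "0 <= (1 + cos (kap * gam)) / 2" "0 <= ((1 + cos (kap * gam)) / 2) ^ N" by simp_all
  qed
  then show ?thesis by (simp add: r2_def power_mult[symmetric] mult.commute)
 qed
 have Kout: "K N w <= r1 ^ N" if w: "w \<in> pbox P" and b: "b \<in> Basis" "dlt < \<bar>(x - w) \<bullet> b\<bar>" for N w b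
 proof -
  have "- (P / 2) <= w \<bullet> b" "w \<bullet> b <= P / 2" using w b(1) by (auto simp: mem_box)
  then have le: "\<bar>(x - w) \<bullet> b\<bar> <= P - dlt" using m(2)[OF b(1)] dlt(2)
   unfolding inner_diff_left by linarith
  define t where "t = kap * \<bar>(x - w) \<bullet> b\<bar>"
  have t: "kap * dlt <= t" "t <= 2 * pi - kap * dlt"
  proof -
   show "kap * dlt <= t" using b kap by (simp add: t_def)
   have "t <= kap * (P - dlt)" unfolding t_def using le kap by (intro mult_left_mono) auto
   then show "t <= 2 * pi - kap * dlt" using P by (simp add: kap_def right_diff_distrib)
  qed
  have "cos t <= cos (kap * dlt)"
  proof (cases "t <= pi")
   case True
   then show ?thesis using t kapdlt by (intro cos_monotone_0_pi_le) auto
  next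
   case False
   have "cos (2 * pi - t) <= cos (kap * dlt)" using t kapdlt False by (intro cos_monotone_0_pi_le) auto
   then show ?thesis by simp
  qed
  moreover have "cos t = cos (kap * ((x - w) \<bullet> b))"
   unfolding t_def using kap by (metis abs_mult abs_of_pos cos_abs_real)
  ultimately have fb: "(1 + cos (kap * ((x - w) \<bullet> b))) / 2 <= r1" by (simp add: r1_def)
  have nn: "0 <= (1 + cos s) / 2" "(1 + cos s) / 2 <= 1" for s :: real
  proof -
   show "0 <= (1 + cos s) / 2" by (rule divide_nonneg_pos) (use cos_ge_minus_one[of s] in linarith, simp)
   show "(1 + cos s) / 2 <= 1" using cos_le_one[of s] by simp
  qed
  have "K N w = ((1 + cos (kap * ((x - w) \<bullet> b))) / 2) ^ N * (\<Prod>c\<in>Basis - {b}. ((1 + cos (kap * ((x - w) \<bullet> c))) / 2) ^ N)"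
   unfolding K_def by (rule prod.remove) (use b in auto)
  also have "... <= r1 ^ N * 1"
   using nn fb by (intro mult_mono power_mono prod_le_1 prod_nonneg conjI zero_le_power power_le_one) (auto simp: r1)
  finally show ?thesis by simp
 qed
 have "compact (h ` pbox P)" using continuous_on_subset[OF hc] by (intro compact_continuous_image) auto
 then obtain M where M: "!!w. w \<in> pbox P ==> \<bar>h w\<bar> <= M" "0 < M"
  using bounded_pos compact_imp_bounded by (metis imageI real_norm_def)
 have pt: "eta * r2 ^ N * indicator Q w - M * r1 ^ N * indicator (pbox P) w <= indicator (pbox P) w * (h w * K N w)" for N w
 proof (cases "w \<in> pbox P")
  case True
  have near: "eta < h w" if "!!b. b \<in> Basis ==> \<bar>(x - w) \<bullet> b\<bar> <= dlt"
  proof (rule rho(2))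
   have "norm (x - w) <= (\<Sum>b\<in>Basis. \<bar>(x - w) \<bullet> b\<bar>)" by (rule norm_le_l1)
   also have "... <= (\<Sum>b\<in>(Basis::'v set). dlt)" using that by (rule sum_mono)
   also have "... < rho" using dlt(3) by (simp add: mult.commute)
   finally show "dist w x < rho" by (simp add: dist_norm norm_minus_commute)
  qed
  show ?thesis
  proof (cases "w \<in> Q")
   case True
   have "eta < h w" using near Qi[OF True] gam(2) by force
   then have "eta * r2 ^ N <= h w * K N w"
    using KQ[OF True] eta r1 r12 by (intro mult_mono) auto
   moreover have "0 <= M * r1 ^ N" using M r1 by simp
   ultimately show ?thesis using True QP by (auto simp: indicator_def)
  next
   case F: False
   have "- (M * r1 ^ N) <= h w * K N w"
   proof (cases "\<forall>b\<in>Basis. \<bar>(x - w) \<bullet> b\<bar> <= dlt")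
    case True
    then have "0 <= h w * K N w" using near eta K0 by (intro mult_nonneg_nonneg) force+
    moreover have "0 <= M * r1 ^ N" using M r1 by simp
    ultimately show ?thesis by linarith
   next
    case False
    then obtain b where "b \<in> Basis" "dlt < \<bar>(x - w) \<bullet> b\<bar>" by (auto simp: not_le)
    then have "K N w <= r1 ^ N" by (rule Kout[OF \<open>w \<in> pbox P\<close>])
    then have "\<bar>h w\<bar> * K N w <= M * r1 ^ N" using M(1)[OF \<open>w \<in> pbox P\<close>] M(2) K0 by (intro mult_mono) auto
    moreover have "- (\<bar>h w\<bar> * K N w) <= h w * K N w"
    using K0[of N w] by (metis abs_ge_minus_self abs_mult abs_of_nonneg minus_le_iff)
    ultimately show ?thesis by linarith
   qed
   then show ?thesis using F True by simp
  qed
 next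
  case False
  then have "w ~: Q" using QP by blast
  then show ?thesis using False by simp
 qed
 have vQ: "0 < measure lborel Q"
  unfolding Q_def using gam by (simp add: measure_lborel_cbox_eq inner_diff_left inner_add_left prod_pos)
 have le: "eta * r2 ^ N * measure lborel Q <= M * r1 ^ N * measure lborel (pbox P :: 'v set)" for N
 proof -
  have iq0: "integrable lborel (indicator (cbox a b) :: 'v => real)" for a b by (rule integrable_indicator_cbox)
  have iq: "integrable lborel (%w. c * indicator (cbox a b) w :: real)" for c and a b :: 'v
   by (intro integrable_mult_right integrable_indicator_cbox)
  have "(\<integral>w. eta * r2 ^ N * indicator Q w - M * r1 ^ N * indicator (pbox P) w \<partial>lborel) <= (\<integral>w. indicator (pbox P) w * (h w * K N w) \<partial>lborel)"
   by (rule integral_mono[OF _ ihK pt]) (auto simp: Q_def intro!: Bochner_Integration.integrable_diff iq)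
  also have "... = 0" by (rule hK)
  also have "(\<integral>w. eta * r2 ^ N * indicator Q w - M * r1 ^ N * indicator (pbox P) w \<partial>lborel)
   = eta * r2 ^ N * measure lborel Q - M * r1 ^ N * measure lborel (pbox P :: 'v set)"
   unfolding Q_def by (subst Bochner_Integration.integral_diff[OF iq iq]) simp
  finally show ?thesis by simp
 qed
 have "(%N. (r1 / r2) ^ N) \<longlonglongrightarrow> 0" using r1 r12 by (intro LIMSEQ_power_zero) simp
 then have lim: "(%N. M * measure lborel (pbox P :: 'v set) * (r1 / r2) ^ N) \<longlonglongrightarrow> M * measure lborel (pbox P :: 'v set) * 0"
  by (intro tendsto_mult tendsto_const)
 have "eta * measure lborel Q <= M * measure lborel (pbox P :: 'v set) * (r1 / r2) ^ N" for N
  using le[of N] r1 r12 by (simp add: power_divide field_simps)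
 then have "eta * measure lborel Q <= 0"
  using LIMSEQ_le_const[OF lim] by simp
 then show False using vQ eta by (simp add: mult_le_0_iff)
qed

lemma int_lattice_product:
 "bij_betw (%g. \<Sum>b\<in>Basis. g b *\<^sub>R b) (\<Pi>\<^sub>E b\<in>(Basis::'v::euclidean_space set). \<int>) int_lattice"
proof (rule bij_betwI[where g = "%mu. \<lambda>b\<in>Basis. mu \<bullet> b"])
 show "(%g. \<Sum>b\<in>Basis. g b *\<^sub>R b) \<in> (\<Pi>\<^sub>E b\<in>(Basis::'v set). \<int>) \<rightarrow> int_lattice"
  by (auto simp: int_lattice_def PiE_iff)
 show "(%mu. \<lambda>b\<in>Basis. mu \<bullet> b) \<in> (int_lattice :: 'v set) \<rightarrow> (\<Pi>\<^sub>E b\<in>Basis. \<int>)"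
  by (auto simp: int_lattice_def PiE_iff)
 show "(\<lambda>b\<in>Basis. (\<Sum>b\<in>Basis. g b *\<^sub>R b) \<bullet> b) = g" if "g \<in> (\<Pi>\<^sub>E b\<in>(Basis::'v set). \<int>)" for g
  using that by (auto simp: PiE_iff extensional_def fun_eq_iff)
 show "(\<Sum>b\<in>Basis. (\<lambda>b\<in>Basis. mu \<bullet> b) b *\<^sub>R b) = mu" for mu :: 'v
  by (simp add: euclidean_representation)
qed

lemma countable_int_lattice: "countable (int_lattice :: 'v::euclidean_space set)"
proof -
 have "countable (\<int> :: real set)" by (simp add: Ints_def)
 then have "countable (\<Pi>\<^sub>E b\<in>(Basis::'v set). (\<int> :: real set))" by (intro countable_PiE) auto
 then show ?thesis using countable_iff_bij[OF int_lattice_product] by blast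
qed

lemma infinite_int_lattice: "infinite (int_lattice :: 'v::euclidean_space set)"
proof -
 obtain b where b: "b \<in> (Basis :: 'v set)" using nonempty_Basis by blast
 have "inj (%n::nat. real n *\<^sub>R b)" using b by (auto simp: inj_on_def nonzero_Basis)
 then have "infinite (range (%n::nat. real n *\<^sub>R b))" by (simp add: finite_image_iff)
 moreover have "range (%n::nat. real n *\<^sub>R b) \<subseteq> int_lattice"
  using b by (auto simp: int_lattice_def inner_Basis)
 ultimately show ?thesis using finite_subset by blast
qed

lemma lborel_norm_integral_le:
 fixes f :: "'v::euclidean_space => complex"
 assumes "integrable lborel f" "integrable lborel g" "!!x. norm (f x) <= g x"
 shows "norm (\<integral>x. f x \<partial>lborel) <= (\<integral>x. g x \<partial>lborel)"
proof -
 have "norm (\<integral>x. f x \<partial>lborel) <= (\<integral>x. norm (f x) \<partial>lborel)" by (rule integral_norm_bound)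
 also have "... <= (\<integral>x. g x \<partial>lborel)"
  using assms by (intro integral_mono integrable_norm) auto
 finally show ?thesis .
qed

text \<open>The sum of the series is continuous and has the same coefficients as \<open>f\<close>, so uniqueness applies to the
 difference.\<close>

lemma fourier_inversion:
 fixes f :: "'v::euclidean_space => complex"
 assumes P: "0 < P" and f: "continuous_on UNIV f"
  and s: "(%mu. norm (c mu)) summable_on int_lattice"
  and c: "!!mu. mu \<in> int_lattice ==>
   (\<integral>w. indicator (pbox P) w *\<^sub>R (f w * char P (- mu) w) \<partial>lborel) = of_real (P ^ DIM('v)) * c mu"
  and x: "!!b. b \<in> Basis ==> \<bar>x \<bullet> b\<bar> < P / 2"
 shows "((%mu. c mu * char P mu x) has_sum f x) int_lattice"
proof -
 define g where "g w = (\<Sum>\<^sub>\<infinity>mu\<in>int_lattice. c mu * char P mu w)" for w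
 have unif: "uniform_limit UNIV (%Y w. \<Sum>mu\<in>Y. c mu * char P mu w) g (finite_subsets_at_top int_lattice)"
  unfolding g_def by (rule Weierstrass_m_test_general[OF _ s]) (simp add: norm_mult)
 have sums: "((%mu. c mu * char P mu w) has_sum g w) int_lattice" for w
  unfolding g_def
  by (rule has_sum_infsum, rule abs_summable_summable) (simp add: norm_mult s)
 have gc: "continuous_on UNIV g"
  by (rule uniform_limit_theorem[OF _ unif])
   (auto intro!: always_eventually continuous_on_sum continuous_on_mult continuous_on_const continuous_on_char)
 have gcoef: "(\<integral>w. indicator (pbox P) w *\<^sub>R (g w * char P (- nu) w) \<partial>lborel) = of_real (P ^ DIM('v)) * c nu"
  if nu: "nu \<in> int_lattice" for nu
 proof -
  define L where "L h = (\<integral>w. indicator (pbox P) w *\<^sub>R (h w * char P (- nu) w) \<partial>lborel)" for h :: "'v => complex"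
  have LY: "L (%w. \<Sum>mu\<in>Y. c mu * char P mu w) = (\<Sum>mu\<in>Y. if mu = nu then of_real (P ^ DIM('v)) * c nu else 0)"
   if Y: "finite Y" "Y \<subseteq> int_lattice" for Y
  proof -
   have cd: "char P (mu - nu) w = char P mu w * char P (- nu) w" for mu w
    by (simp add: char_mult)
   have "L (%w. \<Sum>mu\<in>Y. c mu * char P mu w) = (\<integral>w. (\<Sum>mu\<in>Y. c mu * (indicator (pbox P) w *\<^sub>R char P (mu - nu) w)) \<partial>lborel)"
    unfolding L_def
    by (intro Bochner_Integration.integral_cong refl)
    (simp add: cd sum_distrib_left sum_distrib_right mult_ac scaleR_conv_of_real)
   also have "... = (\<Sum>mu\<in>Y. c mu * (\<integral>w. indicator (pbox P) w *\<^sub>R char P (mu - nu) w \<partial>lborel))"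
   proof -
    have "(\<integral>w. (\<Sum>mu\<in>Y. c mu * (indicator (pbox P) w *\<^sub>R char P (mu - nu) w)) \<partial>lborel)
    = (\<Sum>mu\<in>Y. \<integral>w. c mu * (indicator (pbox P) w *\<^sub>R char P (mu - nu) w) \<partial>lborel)"
    by (rule Bochner_Integration.integral_sum) (intro integrable_mult_right integrable_pbox_mult continuous_on_char)
    then show ?thesis by (simp only: integral_mult_right_zero)
   qed
   also have "... = (\<Sum>mu\<in>Y. if mu = nu then of_real (P ^ DIM('v)) * c nu else 0)"
   proof (intro sum.cong refl)
    fix mu assume "mu \<in> Y"
    then have "mu - nu \<in> int_lattice" using Y nu by (auto intro: int_lattice_diff)
    then show "c mu * (\<integral>w. indicator (pbox P) w *\<^sub>R char P (mu - nu) w \<partial>lborel) = (if mu = nu then of_real (P ^ DIM('v)) * c nu else 0)"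
    by (subst integral_char[OF P]) auto
   qed
   finally show ?thesis .
  qed
  have "((%Y. L (%w. \<Sum>mu\<in>Y. c mu * char P mu w)) \<longlongrightarrow> L g) (finite_subsets_at_top int_lattice)"
  proof (rule tendstoI)
   fix e :: real assume e: "0 < e"
   define V where "V = measure lborel (pbox P :: 'v set)"
   have V: "0 <= V" by (simp add: V_def)
   have "eventually (%Y. \<forall>w\<in>UNIV. dist (\<Sum>mu\<in>Y. c mu * char P mu w) (g w) < e / (V + 1)) (finite_subsets_at_top int_lattice)"
    using uniform_limitD[OF unif, of "e / (V + 1)"] e V by simp
   then show "eventually (%Y. dist (L (%w. \<Sum>mu\<in>Y. c mu * char P mu w)) (L g) < e) (finite_subsets_at_top int_lattice)"
   proof eventually_elim
    case (elim Y)
    define h where "h w = (\<Sum>mu\<in>Y. c mu * char P mu w)" for w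
    have hc: "continuous_on UNIV h" unfolding h_def
    by (intro continuous_on_sum continuous_on_mult continuous_on_const continuous_on_char)
    have i: "integrable lborel (%w. indicator (pbox P) w *\<^sub>R (f w * char P (- nu) w))" if "continuous_on UNIV f" for f :: "'v => complex"
    by (intro integrable_pbox_mult continuous_on_mult continuous_on_char that)
    have Ldiff: "L h - L g = (\<integral>w. indicator (pbox P) w *\<^sub>R ((h w - g w) * char P (- nu) w) \<partial>lborel)"
    unfolding L_def by (subst Bochner_Integration.integral_diff[symmetric])
    (auto intro!: i hc gc Bochner_Integration.integral_cong simp: algebra_simps scaleR_diff_right)
    have "norm (L h - L g) <= (\<integral>w. e / (V + 1) * indicator (pbox P) w \<partial>(lborel :: 'v measure))"
    unfolding Ldiff
    proof (rule lborel_norm_integral_le)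
    show "integrable lborel (%w. indicator (pbox P) w *\<^sub>R ((h w - g w) * char P (- nu) w))"
    by (intro i continuous_on_diff hc gc)
    show "integrable lborel (%w. e / (V + 1) * indicator (pbox P :: 'v set) w)"
    by (intro integrable_mult_right integrable_indicator_cbox)
    fix w
    have "norm (h w - g w) <= e / (V + 1)" using elim by (simp add: h_def dist_norm less_imp_le)
    then show "norm (indicator (pbox P) w *\<^sub>R ((h w - g w) * char P (- nu) w)) <= e / (V + 1) * indicator (pbox P) w"
    by (simp add: norm_mult indicator_def)
    qed
    also have "... = e / (V + 1) * V" by (simp add: V_def)
    also have "... < e" using e V by (simp add: field_simps)
    finally show ?case by (simp add: dist_norm h_def[abs_def])
   qed
  qed
  moreover have "((%Y. L (%w. \<Sum>mu\<in>Y. c mu * char P mu w)) \<longlongrightarrow> of_real (P ^ DIM('v)) * c nu) (finite_subsets_at_top int_lattice)"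
  proof (rule tendsto_eventually)
   show "eventually (%Y. L (%w. \<Sum>mu\<in>Y. c mu * char P mu w) = of_real (P ^ DIM('v)) * c nu) (finite_subsets_at_top int_lattice)"
    unfolding eventually_finite_subsets_at_top
    using nu by (intro exI[of _ "{nu}"]) (auto simp: LY)
  qed
  ultimately have "L g = of_real (P ^ DIM('v)) * c nu"
   using tendsto_unique[OF finite_subsets_at_top_neq_bot] by blast
  then show ?thesis by (simp add: L_def)
 qed
 have "(%w. f w - g w) x = 0"
 proof (rule fourier_uniqueness[OF P _ _ x])
  show "continuous_on UNIV (%w. f w - g w)" by (intro continuous_on_diff f gc)
  fix mu :: 'v assume mu: "mu \<in> int_lattice"
  have i: "integrable lborel (%w. indicator (pbox P) w *\<^sub>R (f w * char P mu w))" if "continuous_on UNIV f" for f :: "'v => complex"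
   by (intro integrable_pbox_mult continuous_on_mult continuous_on_char that)
  have "(\<integral>w. indicator (pbox P) w *\<^sub>R ((f w - g w) * char P mu w) \<partial>lborel)
   = (\<integral>w. indicator (pbox P) w *\<^sub>R (f w * char P mu w) \<partial>lborel) - (\<integral>w. indicator (pbox P) w *\<^sub>R (g w * char P mu w) \<partial>lborel)"
   by (subst Bochner_Integration.integral_diff[symmetric])
    (intro i f gc Bochner_Integration.integral_cong refl; simp add: algebra_simps scaleR_diff_right)+
  also have "... = 0"
   using c[OF int_lattice_uminus[OF mu]] gcoef[OF int_lattice_uminus[OF mu]] by simp
  finally show "(\<integral>w. indicator (pbox P) w *\<^sub>R ((f w - g w) * char P mu w) \<partial>lborel) = 0" .
 qed
 then show ?thesis using sums[of x] by simp
qed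

section \<open>Decay of Fourier coefficients\<close>

lemma continuous_on_mult_cutoff:
 fixes X G :: "'v::euclidean_space => complex"
 assumes "compact K" "open O'" "K \<subseteq> O'" "continuous_on UNIV X" "!!p. p ~: K ==> X p = 0" "continuous_on O' G"
 shows "continuous_on UNIV (%p. X p * G p)"
proof -
 have "continuous_on (O' \<union> - K) (%p. X p * G p)"
 proof (rule continuous_on_open_Un)
  show "open (- K)" using assms(1) by (intro open_Compl compact_imp_closed)
  show "continuous_on O' (%p. X p * G p)"
   by (intro continuous_on_mult assms(6) continuous_on_subset[OF assms(4)]) auto
  have "continuous_on (- K) (%p. 0::complex)" by (rule continuous_on_const)
  then show "continuous_on (- K) (%p. X p * G p)"
   by (rule continuous_on_eq) (simp add: assms(5))
 qed (rule assms(2))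
 moreover have "O' \<union> - K = UNIV" using assms(3) by auto
 ultimately show ?thesis by simp
qed

lemma integrable_mult_cutoff:
 fixes X G E :: "'v::euclidean_space => complex"
 assumes "compact K" "open O'" "K \<subseteq> O'" "continuous_on UNIV X" "!!p. p ~: K ==> X p = 0" "continuous_on O' G"
  and E: "continuous_on UNIV E"
 shows "integrable lborel (%p. X p * G p * E p)"
 by (rule integrable_compact_support(1)[OF assms(1)])
  (auto simp: assms(5) intro!: continuous_on_subset[OF continuous_on_mult[OF continuous_on_mult_cutoff[OF assms(1-6)] E]])

lemma deriv_along_char:
 "deriv_along e (char P mu) (%p. \<i> * of_real (2 * pi / P * (mu \<bullet> e)) * char P mu p)"
proof -
 have "((%t. cis t) has_vector_derivative \<i> * cis t) (at t)" for t
 proof -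
  have "((%z. exp (\<i> * z)) has_field_derivative \<i> * exp (\<i> * complex_of_real t)) (at (complex_of_real t))"
   by (auto intro!: derivative_eq_intros)
  from has_vector_derivative_real_field[OF this] show ?thesis by (simp add: cis_conv_exp)
 qed
 then have "deriv_along e (%p. cis (2 * pi / P * (mu \<bullet> p))) (%p. of_real (2 * pi / P * (mu \<bullet> e)) * (\<i> * cis (2 * pi / P * (mu \<bullet> p))))"
  by (rule deriv_along_line) (simp add: inner_add_right distrib_left mult_ac)
 then show ?thesis by (simp add: char_def[abs_def] mult_ac)
qed

text \<open>Integration by parts \<open>n\<close> times. Only the product of \<open>G\<close> with a cutoff is globally defined, and the
 cutoff \<open>X\<close> runs through its own chain of derivatives, so the induction is over both chains.\<close>

lemma fourier_decay:
 fixes X G :: "nat => 'v::euclidean_space => complex"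
 assumes K: "compact K" "open O'" "K \<subseteq> O'"
  and Xc: "!!k. k <= n ==> continuous_on UNIV (X k)" and X0: "!!k p. k <= n ==> p ~: K ==> X k p = 0"
  and XM: "!!k p. k <= n ==> norm (X k p) <= M" and Xd: "!!k. k < n ==> deriv_along e (X k) (X (Suc k))"
  and Gc: "!!k. k <= n ==> continuous_on O' (G k)"
  and Gd: "!!k p. k < n ==> p \<in> O' ==> ((%s. G k (p + s *\<^sub>R e)) has_vector_derivative G (Suc k) p) (at 0)"
 shows "norm (\<integral>p. X 0 p * G 0 p * char P (- mu) p \<partial>lborel) * \<bar>2 * pi / P * (mu \<bullet> e)\<bar> ^ n
  <= 2 ^ n * M * (\<Sum>k\<le>n. \<integral>p. indicator K p * norm (G k p) \<partial>lborel)"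
 using Xc X0 XM Xd Gc Gd
proof (induction n arbitrary: X G)
 case 0
 have "norm (\<integral>p. X 0 p * G 0 p * char P (- mu) p \<partial>lborel) <= (\<integral>p. M * (indicator K p * norm (G 0 p)) \<partial>lborel)"
 proof (rule lborel_norm_integral_le)
  show "integrable lborel (%p. X 0 p * G 0 p * char P (- mu) p)"
   using 0 by (intro integrable_mult_cutoff[OF K] continuous_on_char) auto
  have "integrable lborel (%p. indicator K p *\<^sub>R norm (G 0 p))"
   using 0 K by (intro borel_integrable_compact continuous_on_norm) (auto intro: continuous_on_subset)
  then show "integrable lborel (%p. M * (indicator K p * norm (G 0 p)))" by (intro integrable_mult_right) simp
  fix p
  show "norm (X 0 p * G 0 p * char P (- mu) p) <= M * (indicator K p * norm (G 0 p))"
   using 0(2,3)[of 0 p] by (cases "p \<in> K") (auto simp: norm_mult intro: mult_right_mono)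
 qed
 then show ?case by simp
next
 case (Suc n)
 define a where "a = 2 * pi / P * (mu \<bullet> e)"
 define E where "E = char P (- mu)"
 define I where "I = (\<integral>p. X 0 p * G 0 p * E p \<partial>lborel)"
 define I1 where "I1 = (\<integral>p. X 1 p * G 0 p * E p \<partial>lborel)"
 define I2 where "I2 = (\<integral>p. X 0 p * G 1 p * E p \<partial>lborel)"
 define H where "H p = X 0 p * G 0 p * E p" for p
 define H' where "H' p = X 1 p * G 0 p * E p + X 0 p * G 1 p * E p + (- \<i> * of_real a) * (X 0 p * G 0 p * E p)" for p
 have Ec: "continuous_on UNIV E" unfolding E_def by (rule continuous_on_char)
 have i: "integrable lborel (%p. X k p * G l p * E p)" if "k <= Suc n" "l <= Suc n" for k l
  using that Suc.prems by (intro integrable_mult_cutoff[OF K] Ec) auto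
 have c: "continuous_on UNIV (%p. X k p * G l p * E p)" if "k <= Suc n" "l <= Suc n" for k l
  using that Suc.prems by (intro continuous_on_mult[OF continuous_on_mult_cutoff[OF K]] Ec) auto
 have dE: "deriv_along e E (%p. (- \<i> * of_real a) * E p)"
  using deriv_along_char[of e P "- mu"] by (simp add: E_def a_def)
 have "deriv_along e H H'"
  unfolding deriv_along_def
 proof
  fix p
  show "((%s. H (p + s *\<^sub>R e)) has_vector_derivative H' p) (at 0)"
  proof (cases "p \<in> O'")
   case True
   have x: "((%s. X 0 (p + s *\<^sub>R e)) has_vector_derivative X 1 p) (at 0)"
    using Suc.prems(4)[of 0] by (simp add: deriv_along_def)
   have g: "((%s. G 0 (p + s *\<^sub>R e)) has_vector_derivative G 1 p) (at 0)"
    using Suc.prems(6)[of 0 p] True by simp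
   have ee: "((%s. E (p + s *\<^sub>R e)) has_vector_derivative (- \<i> * of_real a) * E p) (at 0)"
    using dE by (simp add: deriv_along_def)
   show ?thesis
    using has_vector_derivative_mult[OF has_vector_derivative_mult[OF x g] ee]
    by (simp add: H_def H'_def algebra_simps)
  next
   case False
   then have pK: "p ~: K" using K(3) by auto
   have "open ((%s. p + s *\<^sub>R e) -` (- K))"
    using compact_imp_closed[OF K(1)] by (intro open_vimage open_Compl continuous_intros) auto
   moreover have "0 \<in> (%s. p + s *\<^sub>R e) -` (- K)" using pK by simp
   ultimately have "((%s. H (p + s *\<^sub>R e)) has_vector_derivative 0) (at 0)"
    using has_vector_derivative_transform_within_open[of "%s. 0::complex" 0 0 "(%s. p + s *\<^sub>R e) -` (- K)"
    "%s. H (p + s *\<^sub>R e)"] Suc.prems(2)[of 0]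
    by (auto simp: has_vector_derivative_const H_def)
   then show ?thesis using pK Suc.prems(2)[of 0 p] Suc.prems(2)[of 1 p] by (simp add: H'_def)
  qed
 qed
 then have "(\<integral>p. H' p \<partial>lborel) = 0"
 proof (rule integral_deriv_along_eq_0)
  show "continuous_on UNIV H'" unfolding H'_def by (intro continuous_on_add continuous_on_mult[OF continuous_on_const] c) auto
  show "integrable lborel H" unfolding H_def by (rule i) auto
  show "integrable lborel H'" unfolding H'_def by (intro Bochner_Integration.integrable_add integrable_mult_right i) auto
 qed
 moreover have "(\<integral>p. H' p \<partial>lborel) = I1 + I2 + (- \<i> * of_real a) * I"
 proof -
  have i1: "integrable lborel (%p. X 1 p * G 0 p * E p)" by (rule i) auto
  have i2: "integrable lborel (%p. X 0 p * G 1 p * E p)" by (rule i) auto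
  have i3: "integrable lborel (%p. (- \<i> * of_real a) * (X 0 p * G 0 p * E p))"
   by (intro integrable_mult_right i) auto
  show ?thesis
   unfolding H'_def I_def I1_def I2_def
    Bochner_Integration.integral_add[OF Bochner_Integration.integrable_add[OF i1 i2] i3]
    Bochner_Integration.integral_add[OF i1 i2]
   by (simp only: integral_mult_right_zero)
 qed
 ultimately have eq: "\<i> * of_real a * I = I1 + I2" by (simp add: algebra_simps)
 have "norm I * \<bar>a\<bar> = norm (\<i> * of_real a * I)" by (simp add: norm_mult)
 also have "... <= norm I1 + norm I2" unfolding eq by (rule norm_triangle_ineq)
 finally have "norm I * \<bar>a\<bar> * \<bar>a\<bar> ^ n <= (norm I1 + norm I2) * \<bar>a\<bar> ^ n" by (rule mult_right_mono) simp
 then have 1: "norm I * \<bar>a\<bar> ^ Suc n <= norm I1 * \<bar>a\<bar> ^ n + norm I2 * \<bar>a\<bar> ^ n" by (simp add: algebra_simps)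
 have M0: "0 <= M" using Suc.prems(3)[of 0] norm_ge_zero order_trans by blast
 define S where "S k = (\<integral>p. indicator K p * norm (G k p) \<partial>lborel)" for k
 have S0: "0 <= S k" for k by (simp add: S_def)
 have 2: "norm I1 * \<bar>a\<bar> ^ n <= 2 ^ n * M * (\<Sum>k\<le>n. S k)"
  using Suc.IH[of "%k. X (Suc k)" G] Suc.prems by (simp add: I1_def E_def a_def S_def)
 have 3: "norm I2 * \<bar>a\<bar> ^ n <= 2 ^ n * M * (\<Sum>k\<le>n. S (Suc k))"
  using Suc.IH[of X "%k. G (Suc k)"] Suc.prems by (simp add: I2_def E_def a_def S_def)
 have c0: "0 <= 2 ^ n * M" using M0 by simp
 have 4: "(\<Sum>k\<le>n. S k) <= (\<Sum>k\<le>Suc n. S k)" using S0 by simp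
 have 5: "(\<Sum>k\<le>n. S (Suc k)) <= (\<Sum>k\<le>Suc n. S k)" using S0[of 0] by (simp only: sum.atMost_Suc_shift)
 have "norm I * \<bar>a\<bar> ^ Suc n <= 2 ^ n * M * (\<Sum>k\<le>Suc n. S k) + 2 ^ n * M * (\<Sum>k\<le>Suc n. S k)"
  using 1 2 3 mult_left_mono[OF 4 c0] mult_left_mono[OF 5 c0] by linarith
 also have "... = 2 ^ Suc n * M * (\<Sum>k\<le>Suc n. S k)" by simp
 finally show ?case unfolding I_def E_def a_def S_def .
qed

section \<open>Sums over the integer lattice\<close>

lemma sum_powr_line_le:
 assumes a: "1 < a" and r: "0 < r"
 shows "(\<Sum>k\<le>N. (1 + real k / r) powr (- a)) <= 1 + r / (a - 1)"
proof -
 define f where "f x = (1 + x / r) powr (- (a - 1))" for x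
 have step: "(1 + real (Suc k) / r) powr (- a) <= r / (a - 1) * (f k - f (Suc k))" for k
 proof -
  have der: "(f has_real_derivative (- (a - 1)) * (1 + x / r) powr (- (a - 1) - 1) * (1 / r)) (at x)" if "0 <= x" for x
  proof -
   have "0 < 1 + x / r" using that r by (simp add: add_pos_nonneg)
   then show ?thesis unfolding f_def
    by (intro DERIV_cong[OF DERIV_fun_powr[of "%x. 1 + x / r" "1 / r"]]) (use r in \<open>auto intro!: derivative_eq_intros\<close>)
  qed
  obtain z where z: "real k < z" "z < real (Suc k)"
   "f (Suc k) - f k = (real (Suc k) - real k) * ((- (a - 1)) * (1 + z / r) powr (- (a - 1) - 1) * (1 / r))"
   using MVT2[of "real k" "real (Suc k)" f "%x. (- (a - 1)) * (1 + x / r) powr (- (a - 1) - 1) * (1 / r)"] der by auto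
  have "(1 + real (Suc k) / r) powr (- a) <= (1 + z / r) powr (- a)"
  proof (rule powr_mono2')
   have "0 < z" using z(1) of_nat_0_le_iff[of k] by linarith
   then show "0 < 1 + z / r" using r by (simp add: add_pos_nonneg)
   show "1 + z / r <= 1 + real (Suc k) / r" using z(2) r by (simp add: divide_right_mono)
  qed (use a in simp)
  also have "(1 + z / r) powr (- a) = r / (a - 1) * (f k - f (Suc k))"
   using z(3) a r by (simp add: field_simps)
  finally show ?thesis .
 qed
 have "(\<Sum>k\<le>N. (1 + real k / r) powr (- a)) <= 1 + r / (a - 1) * (f 0 - f N)"
 proof (induction N)
  case 0
  then show ?case by simp
 next
  case (Suc N)
  then show ?case using step[of N] by (simp add: algebra_simps)
 qed
 also have "... <= 1 + r / (a - 1) * 1"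
  using a r by (intro add_left_mono mult_left_mono) (auto simp: f_def)
 finally show ?thesis by simp
qed

lemma sum_powr_Ints_le:
 fixes F :: "real set"
 assumes a: "1 < a" and r: "0 < r" and F: "finite F" "F \<subseteq> \<int>"
 shows "(\<Sum>k\<in>F. (1 + \<bar>k\<bar> / r) powr (- a)) <= 2 * (1 + r / (a - 1))"
proof -
 define N where "N = nat \<lceil>Max (insert 0 (abs ` F))\<rceil>"
 have "F \<subseteq> real ` {..N} \<union> (%n. - real n) ` {..N}"
 proof
  fix k assume k: "k \<in> F"
  then obtain j where j: "k = of_int j" using F(2) Ints_cases by blast
  have "\<bar>k\<bar> <= Max (insert 0 (abs ` F))" using F(1) k by (intro Max_ge) auto
  then have "\<bar>j\<bar> <= \<lceil>Max (insert 0 (abs ` F))\<rceil>" unfolding j by linarith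
  then have jN: "nat \<bar>j\<bar> <= N" unfolding N_def by (rule nat_mono)
  show "k \<in> real ` {..N} \<union> (%n. - real n) ` {..N}"
  proof (cases "0 <= j")
   case True
   then have "k = real (nat \<bar>j\<bar>)" by (simp add: j)
   then show ?thesis using jN by blast
  next
   case False
   then have "k = - real (nat \<bar>j\<bar>)" by (simp add: j)
   then show ?thesis using jN by blast
  qed
 qed
 then have "(\<Sum>k\<in>F. (1 + \<bar>k\<bar> / r) powr (- a)) <= (\<Sum>k\<in>real ` {..N} \<union> (%n. - real n) ` {..N}. (1 + \<bar>k\<bar> / r) powr (- a))"
  by (intro sum_mono2) auto
 also have "... <= (\<Sum>k\<in>real ` {..N}. (1 + \<bar>k\<bar> / r) powr (- a)) + (\<Sum>k\<in>(%n. - real n) ` {..N}. (1 + \<bar>k\<bar> / r) powr (- a))"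
  by (subst sum.union_inter[symmetric]) (auto intro: sum_nonneg)
 also have "... = (\<Sum>k\<le>N. (1 + real k / r) powr (- a)) + (\<Sum>k\<le>N. (1 + real k / r) powr (- a))"
  by (subst (1 2) sum.reindex) (auto simp: inj_on_def)
 also have "... <= 2 * (1 + r / (a - 1))" using sum_powr_line_le[OF a r, of N] by simp
 finally show ?thesis .
qed

lemma component_le_infnorm': "b \<in> Basis ==> \<bar>x \<bullet> b\<bar> <= infnorm x"
 by (simp add: infnorm_Max)

lemma infnorm_attained: obtains b where "b \<in> Basis" "infnorm x = \<bar>x \<bullet> b\<bar>"
proof -
 have "infnorm x \<in> (%i. \<bar>x \<bullet> i\<bar>) ` Basis" unfolding infnorm_Max by (intro Max_in) auto
 then show ?thesis using that by blast
qed

lemma infnorm_leI: "(!!b. b \<in> Basis ==> \<bar>x \<bullet> b\<bar> <= c) ==> infnorm x <= c"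
 by (metis infnorm_attained)

text \<open>The weight is at most the product over the coordinates of the weights with exponent \<open>p / d > 1\<close>, and each
 one-dimensional sum is compared with an integral. The factor \<open>r ^ d\<close> counts the lattice points with
 \<open>infnorm mu <= r\<close>.\<close>

lemma finite_sum_lattice_weight_le:
 fixes F :: "'v::euclidean_space set"
 assumes p: "real DIM('v) < p" and r: "1 <= r" and F: "finite F" "F \<subseteq> int_lattice"
 shows "(\<Sum>mu\<in>F. (1 + infnorm mu / r) powr (- p)) <= (2 * (1 + 1 / (p / DIM('v) - 1))) ^ DIM('v) * r ^ DIM('v)"
proof -
 define a where "a = p / DIM('v)"
 have a: "1 < a" using p by (simp add: a_def)
 define g where "g k = (1 + \<bar>k\<bar> / r) powr (- a)" for k
 have pt: "(1 + infnorm mu / r) powr (- p) <= (\<Prod>b\<in>Basis. g (mu \<bullet> b))" for mu :: 'v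
 proof -
  have pos: "0 < 1 + infnorm mu / r" using infnorm_pos_le[of mu] r by (simp add: add_pos_nonneg)
  have "(1 + infnorm mu / r) powr (- p) = ((1 + infnorm mu / r) powr (- a)) ^ DIM('v)"
   using pos by (simp add: powr_power a_def)
  also have "... = (\<Prod>b\<in>(Basis::'v set). (1 + infnorm mu / r) powr (- a))" by simp
  also have "... <= (\<Prod>b\<in>Basis. g (mu \<bullet> b))"
  proof (rule prod_mono, intro conjI)
   fix b :: 'v assume b: "b \<in> Basis"
   show "(1 + infnorm mu / r) powr (- a) <= g (mu \<bullet> b)" unfolding g_def
    using a r component_le_infnorm'[OF b, of mu]
    by (intro powr_mono2') (auto intro!: divide_right_mono add_pos_nonneg)
  qed simp
  finally show ?thesis .
 qed
 define A where "A b = (%mu. mu \<bullet> b) ` F" for b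
 have A: "finite (A b)" for b using F(1) by (simp add: A_def)
 have AZ: "A b \<subseteq> \<int>" if "b \<in> Basis" for b using F(2) that by (auto simp: A_def int_lattice_def)
 define R where "R mu = (\<lambda>b\<in>Basis. mu \<bullet> b)" for mu :: 'v
 have inj: "inj_on R F"
  unfolding R_def inj_on_def by (metis euclidean_eqI restrict_apply')
 have "(\<Sum>mu\<in>F. (1 + infnorm mu / r) powr (- p)) <= (\<Sum>mu\<in>F. \<Prod>b\<in>Basis. g (R mu b))"
  using pt by (intro sum_mono) (simp add: R_def)
 also have "... = (\<Sum>h\<in>R ` F. \<Prod>b\<in>Basis. g (h b))" by (simp add: sum.reindex[OF inj])
 also have "... <= (\<Sum>h\<in>Pi\<^sub>E Basis A. \<Prod>b\<in>Basis. g (h b))"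
  using A by (intro sum_mono2 finite_PiE prod_nonneg) (auto simp: R_def A_def g_def)
 also have "... = (\<Prod>b\<in>Basis. \<Sum>k\<in>A b. g k)" using A by (intro prod_sum_PiE[symmetric]) auto
 also have "... <= (\<Prod>b\<in>(Basis::'v set). 2 * (1 + 1 / (a - 1)) * r)"
 proof (rule prod_mono, intro conjI)
  fix b :: 'v assume b: "b \<in> Basis"
  show "0 <= (\<Sum>k\<in>A b. g k)" by (intro sum_nonneg) (simp add: g_def)
  have "(\<Sum>k\<in>A b. g k) <= 2 * (1 + r / (a - 1))"
   unfolding g_def using a r A AZ[OF b] by (intro sum_powr_Ints_le) auto
  also have "... <= 2 * (r + r / (a - 1))" using r by simp
  finally show "(\<Sum>k\<in>A b. g k) <= 2 * (1 + 1 / (a - 1)) * r" by (simp add: algebra_simps)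
 qed
 finally show ?thesis by (simp add: power_mult_distrib a_def)
qed

lemma lattice_weight_summable:
 assumes p: "real DIM('v) < p" and r: "1 <= r"
 shows "(%mu::'v::euclidean_space. (1 + infnorm mu / r) powr (- p)) summable_on int_lattice"
 by (rule nonneg_bdd_above_summable_on)
  (auto intro!: bdd_aboveI2[OF finite_sum_lattice_weight_le[OF p r]])

section \<open>Local Fourier expansions\<close>

abbreviation kbox :: "real => 'v::euclidean_space set" where
 "kbox eps \<equiv> cbox (- ((2 * eps) *\<^sub>R One)) ((2 * eps) *\<^sub>R One)"

abbreviation obox :: "real => 'v::euclidean_space set" where
 "obox eps \<equiv> box (- ((3 * eps) *\<^sub>R One)) ((3 * eps) *\<^sub>R One)"

text \<open>Fourier coefficients, with period \<open>6 eps\<close>, of \<open>f\<close> cut off by a smooth function that is \<open>1\<close> on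
 the box of half side \<open>eps\<close> and \<open>0\<close> outside of \<open>kbox eps\<close>; so only values of \<open>f\<close> on \<open>kbox eps\<close> matter.\<close>

definition fcoef :: "real => ('v::euclidean_space => complex) => 'v => complex" where
 "fcoef eps f mu = (\<integral>w. complex_of_real (plateau eps w) * f w * char (6 * eps) (- mu) w \<partial>lborel) / of_real ((6 * eps) ^ DIM('v))"

text \<open>Pure derivatives in each coordinate direction suffice for the decay of the coefficients, because
 each frequency has a component of maximal size.\<close>

definition direction_chain :: "'v::euclidean_space set => nat => ('v => complex) => ('v => nat => 'v => complex) => bool" where
 "direction_chain O' n f G \<longleftrightarrow> (\<forall>b\<in>Basis. G b 0 = f & (\<forall>k\<le>n. continuous_on O' (G b k)) &
   (\<forall>k<n. \<forall>p\<in>O'. ((%s. G b k (p + s *\<^sub>R b)) has_vector_derivative G b (Suc k) p) (at 0)))"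

lemma fourier_expansion:
 assumes eps: "0 < eps" and n: "DIM('v) < n"
 shows "\<exists>C>0. \<forall>(f::'v::euclidean_space => complex) G. direction_chain (obox eps) n f G -->
  (\<forall>mu\<in>int_lattice. norm (fcoef eps f mu) <= C * (1 + infnorm mu) powr (- real n) *
    (\<Sum>b\<in>Basis. \<Sum>k\<le>n. \<integral>w. indicator (kbox eps) w * norm (G b k w) \<partial>lborel)) &
  (\<forall>w. (\<forall>b\<in>Basis. \<bar>w \<bullet> b\<bar> <= eps) --> ((%mu. fcoef eps f mu * char (6 * eps) mu w) has_sum f w) int_lattice)"
proof -
 define P where "P = 6 * eps"
 have P: "0 < P" using eps by (simp add: P_def)
 define om where "om w = complex_of_real (plateau eps w)" for w :: 'v
 have som: "smooth om" unfolding om_def by (rule smooth_plateau)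
 have om0: "om w = 0" if "w ~: kbox eps" for w
 proof -
  obtain b where "b \<in> Basis" "\<not> (- (2 * eps) <= w \<bullet> b & w \<bullet> b <= 2 * eps)" using \<open>w ~: kbox eps\<close> by (auto simp: mem_box)
  then show ?thesis unfolding om_def using eps by (subst plateau_zero[of eps b]) auto
 qed
 define X where "X b k = (dir_deriv b ^^ k) om" for b k
 have sX: "smooth (X b k)" if "b \<in> Basis" for b k
  by (induction k) (simp_all add: X_def som smooth_deriv(2) that)
 have dX: "deriv_along b (X b k) (X b (Suc k))" if "b \<in> Basis" for b k
  using smooth_deriv(1)[OF sX[OF that] that] by (simp add: X_def)
 have X0: "X b k w = 0" if "b \<in> Basis" "w ~: kbox eps" for b k w
  using that(2)
 proof (induction k arbitrary: w)
  case 0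
  then show ?case by (simp add: X_def om0)
 next
  case (Suc k)
  show ?case by (rule deriv_along_zero_outside[OF dX[OF that(1)] closed_cbox Suc.IH Suc.prems])
 qed
 have "\<exists>M. \<forall>w. norm (X b k w) <= M" if b: "b \<in> Basis" for b k
 proof -
  have "compact (X b k ` kbox eps)"
   using smooth_continuous[OF sX[OF b]] by (intro compact_continuous_image) (auto intro: continuous_on_subset)
  then obtain M where "0 < M" "!!w. w \<in> kbox eps ==> norm (X b k w) <= M"
   using bounded_pos compact_imp_bounded by (metis imageI)
  then have "norm (X b k w) <= M" for w using X0[OF b, of w k] by (cases "w \<in> kbox eps") auto
  then show ?thesis by blast
 qed
 then obtain M' where M': "!!b k w. b \<in> Basis ==> norm (X b k w) <= M' b k" by metis
 define M where "M = (\<Sum>b\<in>Basis. \<Sum>k\<le>n. M' b k)"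
 have M'0: "0 <= M' b k" if "b \<in> Basis" for b k using M'[OF that] norm_ge_zero order_trans by blast
 have M: "norm (X b k w) <= M" if b: "b \<in> Basis" "k <= n" for b k w
 proof -
  have "M' b k <= (\<Sum>k\<le>n. M' b k)" by (rule member_le_sum) (use b M'0 in auto)
  also have "... <= M" unfolding M_def by (rule member_le_sum) (use b M'0 in \<open>auto intro: sum_nonneg\<close>)
  finally show ?thesis using M'[OF b(1), of k w] by linarith
 qed
 have M0: "0 <= M" unfolding M_def using M'0 by (intro sum_nonneg) auto
 define C where "C = (1 + M) * (1 + (2 * P / pi) ^ n) * (1 / P ^ DIM('v))"
 have C: "0 < C" unfolding C_def using M0 P by (intro mult_pos_pos) (auto intro: add_pos_nonneg)
 have KO: "kbox eps \<subseteq> (obox eps :: 'v set)"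
 proof
  fix w :: 'v assume "w \<in> kbox eps"
  then have "!!b. b \<in> Basis ==> - (2 * eps) <= w \<bullet> b & w \<bullet> b <= 2 * eps" by (auto simp: mem_box)
  then show "w \<in> obox eps" using eps by (fastforce simp: mem_box)
 qed
 show ?thesis
 proof (intro exI[of _ C] conjI C allI impI)
  fix f :: "'v => complex" and G
  assume G: "direction_chain (obox eps) n f G"
  define S where "S = (\<Sum>b\<in>Basis. \<Sum>k\<le>n. \<integral>w. indicator (kbox eps) w * norm (G b k w) \<partial>lborel)"
  have S1: "(\<Sum>k\<le>n. \<integral>w. indicator (kbox eps) w * norm (G b k w) \<partial>lborel) <= S" if "b \<in> Basis" for b
   unfolding S_def by (rule member_le_sum) (use that in \<open>auto intro!: sum_nonneg\<close>)
  have fc: "continuous_on (obox eps) f"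
   using G nonempty_Basis unfolding direction_chain_def by (metis all_not_in_conv le0)
  define I where "I mu = (\<integral>w. om w * f w * char P (- mu) w \<partial>lborel)" for mu
  have fI: "fcoef eps f mu = I mu / of_real (P ^ DIM('v))" for mu
   by (simp add: fcoef_def I_def om_def P_def)
  have decay: "norm (I mu) * \<bar>2 * pi / P * (mu \<bullet> b)\<bar> ^ j <= 2 ^ j * M * S" if b: "b \<in> Basis" and j: "j <= n" for mu b j
  proof -
   have "norm (\<integral>p. X b 0 p * G b 0 p * char P (- mu) p \<partial>lborel) * \<bar>2 * pi / P * (mu \<bullet> b)\<bar> ^ j
    <= 2 ^ j * M * (\<Sum>k\<le>j. \<integral>p. indicator (kbox eps) p * norm (G b k p) \<partial>lborel)"
    by (rule fourier_decay[OF compact_cbox open_box KO])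
    (use b j G sX dX X0 M in \<open>auto simp: direction_chain_def smooth_continuous\<close>)
   also have "... <= 2 ^ j * M * (\<Sum>k\<le>n. \<integral>p. indicator (kbox eps) p * norm (G b k p) \<partial>lborel)"
    using M0 j by (intro mult_left_mono sum_mono2) auto
   also have "... <= 2 ^ j * M * S" using M0 S1[OF b] by (intro mult_left_mono) auto
   also have "X b 0 = om" by (simp add: X_def)
   also have "G b 0 = f" using G b by (simp add: direction_chain_def)
   finally show ?thesis by (simp add: I_def)
  qed
  have S0: "0 <= S" unfolding S_def by (intro sum_nonneg) auto
  have bound: "norm (fcoef eps f mu) <= C * (1 + infnorm mu) powr (- real n) * S" if mu: "mu \<in> int_lattice" for mu
  proof -
   obtain b where b: "b \<in> Basis" "infnorm mu = \<bar>mu \<bullet> b\<bar>" by (rule infnorm_attained)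
   have "norm (I mu) <= (1 + M) * (1 + (2 * P / pi) ^ n) * S * (1 + infnorm mu) powr (- real n)"
   proof (cases "infnorm mu = 0")
    case True
    have "norm (I mu) <= M * S" using decay[OF b(1), of 0 mu] by simp
    also have "... <= ((1 + M) * (1 + (2 * P / pi) ^ n)) * S"
    proof (rule mult_right_mono[OF _ S0])
    have "M * 1 <= (1 + M) * (1 + (2 * P / pi) ^ n)" using M0 P by (intro mult_mono) auto
    then show "M <= (1 + M) * (1 + (2 * P / pi) ^ n)" by simp
    qed
    finally show ?thesis using True by simp
   next
    case False
    have "mu \<bullet> b \<in> \<int>" using mu b(1) by (simp add: int_lattice_def)
    then have i1: "1 <= infnorm mu"
    using False b(2) by (metis Ints_nonzero_abs_ge1 abs_eq_0)
    define x where "x = infnorm mu"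
    have x: "1 <= x" using i1 by (simp add: x_def)
    have "norm (I mu) * (2 * pi / P * x) ^ n <= 2 ^ n * M * S"
    using decay[OF b(1) order_refl, of mu] b(2) P by (simp add: x_def abs_mult)
    moreover have "(2 * pi / P * x) ^ n = 2 ^ n * (pi / P * x) ^ n"
    unfolding power_mult_distrib[symmetric] by (rule arg_cong[of _ _ "%y. y ^ n"]) simp
    ultimately have "2 ^ n * (norm (I mu) * (pi / P * x) ^ n) <= 2 ^ n * (M * S)" by (simp add: mult_ac)
    then have "norm (I mu) * (pi / P * x) ^ n <= M * S" by simp
    then have "norm (I mu) <= M * S * (P / (pi * x)) ^ n"
    using P x by (simp add: power_mult_distrib power_divide field_simps)
    also have "... <= M * S * (2 * P / (pi * (1 + x))) ^ n"
    proof (intro mult_left_mono power_mono)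
    have "2 * P / (pi * (2 * x)) <= 2 * P / (pi * (1 + x))"
    using P x by (intro divide_left_mono mult_left_mono mult_pos_pos) auto
    then show "P / (pi * x) <= 2 * P / (pi * (1 + x))" by simp
    qed (use M0 S0 P x in auto)
    also have "... = M * (2 * P / pi) ^ n * S * (1 + x) powr (- real n)"
    proof -
    have "2 * P / (pi * (1 + x)) = (2 * P / pi) * (1 / (1 + x))" by simp
    moreover have "(1 / (1 + x)) ^ n = (1 + x) powr (- real n)"
    using x by (simp add: powr_minus powr_realpow power_one_over inverse_eq_divide)
    ultimately show ?thesis by (simp only: power_mult_distrib mult_ac)
    qed
    also have "... <= (1 + M) * (1 + (2 * P / pi) ^ n) * S * (1 + x) powr (- real n)"
    using M0 P S0 by (intro mult_right_mono mult_mono) auto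
    finally show ?thesis by (simp add: x_def)
   qed
   then have "norm (I mu) / P ^ DIM('v) <= (1 + M) * (1 + (2 * P / pi) ^ n) * S * (1 + infnorm mu) powr (- real n) / P ^ DIM('v)"
    using P by (intro divide_right_mono) auto
   then show ?thesis using P by (simp add: fI norm_divide norm_power C_def mult_ac)
  qed
  then show "\<forall>mu\<in>int_lattice. norm (fcoef eps f mu) <= C * (1 + infnorm mu) powr (- real n) *
    (\<Sum>b\<in>Basis. \<Sum>k\<le>n. \<integral>w. indicator (kbox eps) w * norm (G b k w) \<partial>lborel)"
   unfolding S_def by blast
  fix x :: 'v assume x: "\<forall>b\<in>Basis. \<bar>x \<bullet> b\<bar> <= eps"
  have "((%mu. fcoef eps f mu * char P mu x) has_sum (om x * f x)) int_lattice"
  proof (rule fourier_inversion[OF P])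
   show "continuous_on UNIV (%x. om x * f x)"
    using smooth_continuous[OF som] om0 by (intro continuous_on_mult_cutoff[OF compact_cbox open_box KO] fc) auto
   have "(%mu::'v. (1 + infnorm mu / 1) powr (- real n)) summable_on int_lattice"
    using n by (intro lattice_weight_summable) auto
   then have "(%mu::'v. (C * S) * (1 + infnorm mu) powr (- real n)) summable_on int_lattice"
    by (intro summable_on_cmult_right) simp
   then show "(%mu. norm (fcoef eps f mu)) summable_on int_lattice"
    by (rule summable_on_comparison_test) (use bound in \<open>auto simp: mult_ac\<close>)
   fix mu :: 'v
   have "(\<integral>w. indicator (pbox P) w *\<^sub>R (om w * f w * char P (- mu) w) \<partial>lborel) = I mu"
    unfolding I_def
   proof (intro Bochner_Integration.integral_cong refl)
    fix w :: 'v
    have "w \<in> pbox P" if "w \<in> kbox eps"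
    proof -
    have "!!b. b \<in> Basis ==> - (2 * eps) <= w \<bullet> b & w \<bullet> b <= 2 * eps" using that by (auto simp: mem_box)
    then show ?thesis using eps by (fastforce simp: mem_box P_def)
    qed
    then show "indicator (pbox P) w *\<^sub>R (om w * f w * char P (- mu) w) = om w * f w * char P (- mu) w"
    using om0[of w] by (cases "w \<in> kbox eps") auto
   qed
   then show "(\<integral>w. indicator (pbox P) w *\<^sub>R (om w * f w * char P (- mu) w) \<partial>lborel) = of_real (P ^ DIM('v)) * fcoef eps f mu"
    using P by (simp add: fI)
  next
   fix b :: 'v assume "b \<in> Basis"
   then show "\<bar>x \<bullet> b\<bar> < P / 2" using x eps by (force simp: P_def)
  qed
  moreover have "om x = 1" unfolding om_def using x plateau_one[OF eps, of x] by simp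
  ultimately show "((%mu. fcoef eps f mu * char (6 * eps) mu x) has_sum f x) int_lattice" by (simp add: P_def)
 qed
qed

section \<open>Integrals depending on a parameter\<close>

lemma integral_cbox_support:
 fixes f :: "'p::euclidean_space => 'b::euclidean_space"
 assumes "continuous_on (cbox A B) f" "!!p. p ~: cbox A B ==> f p = 0"
 shows "(\<integral>p. f p \<partial>lborel) = integral (cbox A B) f"
proof -
 have i: "set_integrable lborel (cbox A B) f"
  unfolding set_integrable_def by (rule borel_integrable_compact[OF compact_cbox assms(1)])
 have "(%p. indicator (cbox A B) p *\<^sub>R f p) = f" using assms(2) by (auto simp: indicator_def)
 then show ?thesis using set_borel_integral_eq_integral(2)[OF i] by (simp add: set_lebesgue_integral_def)
qed

lemma continuous_on_param_slice:
 assumes "continuous_on UNIV (%z. h (fst z) (snd z))"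
 shows "continuous_on S (h x)"
 by (rule continuous_on_compose2[OF assms, of S "%p. (x, p)", simplified]) (intro continuous_intros)

lemma continuous_on_integral_param:
 fixes h :: "'x::topological_space => 'p::euclidean_space => 'b::euclidean_space"
 assumes h: "continuous_on UNIV (%z. h (fst z) (snd z))" and z0: "!!x p. p ~: cbox A B ==> h x p = 0"
 shows "continuous_on UNIV (%x. \<integral>p. h x p \<partial>lborel)"
proof -
 have "continuous_on UNIV (%x. integral (cbox A B) (h x))"
  by (rule integral_continuous_on_param) (auto intro: continuous_on_subset[OF h] simp: case_prod_beta')
 then show ?thesis by (simp add: integral_cbox_support[OF continuous_on_param_slice[OF h] z0])
qed

lemma deriv_along_integral_param:
 fixes h h' :: "'x::real_normed_vector => 'p::euclidean_space => complex"
 assumes h: "continuous_on UNIV (%z. h (fst z) (snd z))" and z0: "!!x p. p ~: cbox A B ==> h x p = 0"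
  and h': "continuous_on UNIV (%z. h' (fst z) (snd z))" and z0': "!!x p. p ~: cbox A B ==> h' x p = 0"
  and d: "!!p. deriv_along e (%x. h x p) (%x. h' x p)"
 shows "deriv_along e (%x. \<integral>p. h x p \<partial>lborel) (%x. \<integral>p. h' x p \<partial>lborel)"
 unfolding deriv_along_def
proof
 fix x
 have "((%s. integral (cbox A B) (h (x + s *\<^sub>R e))) has_vector_derivative integral (cbox A B) (h' (x + 0 *\<^sub>R e))) (at 0 within UNIV)"
 proof (rule leibniz_rule_vector_derivative[where fx = "%s. h' (x + s *\<^sub>R e)"])
  show "((%s. h (x + s *\<^sub>R e) p) has_vector_derivative h' (x + s *\<^sub>R e) p) (at s within UNIV)" for s p
   using deriv_along_at[OF d] by simp
  show "h (x + s *\<^sub>R e) integrable_on cbox A B" for s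
   by (intro integrable_continuous continuous_on_param_slice[OF h])
  show "continuous_on (UNIV \<times> cbox A B) (%(s, p). h' (x + s *\<^sub>R e) p)"
   unfolding case_prod_beta'
   by (rule continuous_on_compose2[OF h', of _ "%z. (x + fst z *\<^sub>R e, snd z)", simplified]) (intro continuous_intros)
 qed auto
 then show "((%s. \<integral>p. h (x + s *\<^sub>R e) p \<partial>lborel) has_vector_derivative \<integral>p. h' x p \<partial>lborel) (at 0)"
  by (simp add: integral_cbox_support[OF continuous_on_param_slice[OF h] z0] integral_cbox_support[OF continuous_on_param_slice[OF h'] z0'])
qed

section \<open>Polynomial growth\<close>

lemma nn_integral_inverse_square_finite: "(\<integral>\<^sup>+x. ennreal (1 / (1 + \<bar>x\<bar>)\<^sup>2) \<partial>lborel) < \<infinity>"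
proof -
 have half: "(\<integral>\<^sup>+v. ennreal (1 / (1 + \<bar>v\<bar>)\<^sup>2) * indicator {0..} v \<partial>lborel) = ennreal (0 - (- (1 / (1 + 0))))"
 proof -
  have "(\<integral>\<^sup>+v. ennreal (1 / (1 + \<bar>v\<bar>)\<^sup>2) * indicator {0..} v \<partial>lborel) = (\<integral>\<^sup>+v. ennreal (1 / (1 + v)\<^sup>2) * indicator {0..} v \<partial>lborel)"
   by (intro nn_integral_cong) (simp add: indicator_def)
  also have "... = ennreal (0 - (- (1 / (1 + 0))))"
  proof (rule nn_integral_FTC_atLeast)
   show "((%v::real. - (1 / (1 + v))) \<longlongrightarrow> 0) at_top" by real_asymp
   show "((%v. - (1 / (1 + v))) has_real_derivative 1 / (1 + v)\<^sup>2) (at v)" if "0 <= v" for v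
    using that by (auto intro!: derivative_eq_intros simp: power2_eq_square field_simps)
  qed auto
  finally show ?thesis .
 qed
 have "(\<integral>\<^sup>+x. ennreal (1 / (1 + \<bar>x\<bar>)\<^sup>2) \<partial>lborel) <=
  (\<integral>\<^sup>+v. ennreal (1 / (1 + \<bar>v\<bar>)\<^sup>2) * indicator {0..} v
   + ennreal (1 / (1 + \<bar>0 + (-1) * v\<bar>)\<^sup>2) * indicator {0..} (0 + (-1) * v) \<partial>lborel)"
  by (intro nn_integral_mono) (simp add: indicator_def)
 also have "... = (\<integral>\<^sup>+v. ennreal (1 / (1 + \<bar>v\<bar>)\<^sup>2) * indicator {0..} v \<partial>lborel)
   + (\<integral>\<^sup>+v. ennreal (1 / (1 + \<bar>0 + (-1) * v\<bar>)\<^sup>2) * indicator {0..} (0 + (-1) * v) \<partial>lborel)"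
  by (rule nn_integral_add) auto
 also have "(\<integral>\<^sup>+v. ennreal (1 / (1 + \<bar>0 + (-1) * v\<bar>)\<^sup>2) * indicator {0..} (0 + (-1) * v) \<partial>lborel)
  = (\<integral>\<^sup>+v. ennreal (1 / (1 + \<bar>v\<bar>)\<^sup>2) * indicator {0..} v \<partial>lborel)"
  by (subst nn_integral_real_affine[of "%v. ennreal (1 / (1 + \<bar>v\<bar>)\<^sup>2) * indicator {0..} v" "-1" 0]) auto
 finally show ?thesis by (rule le_less_trans) (simp add: half)
qed

lemma integrable_polynomial_weight:
 "integrable lborel (%xi::'v::euclidean_space. 1 / (1 + norm xi) ^ (2 * DIM('v)))"
proof (rule integrableI_bounded)
 have "(\<integral>\<^sup>+xi. ennreal (norm (1 / (1 + norm xi) ^ (2 * DIM('v)))) \<partial>(lborel::'v measure))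
  <= (\<integral>\<^sup>+xi. (\<Prod>b\<in>Basis. ennreal (1 / (1 + \<bar>xi \<bullet> b\<bar>)\<^sup>2)) \<partial>(lborel::'v measure))"
 proof (rule nn_integral_mono)
  fix xi :: 'v
  have "1 / (1 + norm xi) ^ (2 * DIM('v)) = (\<Prod>b\<in>(Basis::'v set). 1 / (1 + norm xi)\<^sup>2)"
   by (simp add: power_mult power_divide)
  also have "... <= (\<Prod>b\<in>Basis. 1 / (1 + \<bar>xi \<bullet> b\<bar>)\<^sup>2)"
   by (intro prod_mono conjI divide_left_mono power_mono add_left_mono Basis_le_norm mult_pos_pos zero_less_power) (auto intro: add_pos_nonneg)
  finally show "ennreal (norm (1 / (1 + norm xi) ^ (2 * DIM('v)))) <= (\<Prod>b\<in>Basis. ennreal (1 / (1 + \<bar>xi \<bullet> b\<bar>)\<^sup>2))"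
   by (subst prod_ennreal) (auto intro: ennreal_leI)
 qed
 also have "... = (\<Prod>b\<in>(Basis::'v set). \<integral>\<^sup>+x. ennreal (1 / (1 + \<bar>x\<bar>)\<^sup>2) \<partial>lborel)"
  by (rule nn_integral_lborel_prod) auto
 also have "... < \<infinity>" using nn_integral_inverse_square_finite by (simp add: power_less_top_ennreal)
 finally show "(\<integral>\<^sup>+xi. ennreal (norm (1 / (1 + norm xi) ^ (2 * DIM('v)))) \<partial>(lborel::'v measure)) < \<infinity>" .
qed auto

text \<open>Polynomial growth in the mean, locally uniformly in the first variable. Symbols under consideration are
 integrable rather than bounded, so pointwise bounds are not available.\<close>

definition growth :: "('v::euclidean_space \<times> 'v => complex) => bool" where
 "growth a \<longleftrightarrow> (\<forall>K. compact K --> (\<exists>M N. continuous_on UNIV M & (\<forall>xi. 0 <= M xi) &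
   (\<forall>w\<in>K. \<forall>xi. norm (a (w, xi)) <= M xi) & integrable lborel (%xi. M xi / (1 + norm xi) ^ N)))"

lemma nn_integral_unit_interval:
 assumes "continuous_on {0..1} f" "!!s. s \<in> {0..1} ==> 0 <= f s"
 shows "(\<integral>\<^sup>+s. ennreal (f s) * indicator {0..1::real} s \<partial>lborel) = ennreal (integral {0..1} f)"
proof -
 have i: "set_integrable lborel {0..1} f"
  unfolding set_integrable_def by (rule borel_integrable_compact[OF compact_Icc assms(1)])
 have "(\<integral>\<^sup>+s. ennreal (f s) * indicator {0..1} s \<partial>lborel) = (\<integral>\<^sup>+s. ennreal (indicator {0..1} s *\<^sub>R f s) \<partial>lborel)"
  by (intro nn_integral_cong) (simp add: indicator_def)
 also have "... = ennreal (\<integral>s. indicator {0..1} s *\<^sub>R f s \<partial>lborel)"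
  using i assms(2) unfolding set_integrable_def by (intro nn_integral_eq_integral) (auto simp: indicator_def)
 finally show ?thesis using set_borel_integral_eq_integral(2)[OF i] by (simp add: set_lebesgue_integral_def)
qed

lemma nn_integral_lborel_scale:
 fixes g :: "'v::euclidean_space => ennreal"
 assumes [measurable]: "g \<in> borel_measurable borel" and s: "0 < s"
 shows "(\<integral>\<^sup>+x. g x \<partial>lborel) = ennreal (s ^ DIM('v)) * (\<integral>\<^sup>+x. g (s *\<^sub>R x) \<partial>lborel)"
proof -
 have m: "(%x. 0 + s *\<^sub>R x) \<in> lborel \<rightarrow>\<^sub>M (borel :: 'v measure)"
  using borel_measurable_continuous_onI[of "%x::'v. 0 + s *\<^sub>R x"] by (simp add: continuous_intros)
 have gm: "(%x. g (0 + s *\<^sub>R x)) \<in> borel_measurable lborel"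
  by (rule measurable_compose[OF m assms(1)])
 have gd: "(%x. ennreal (\<bar>s\<bar> ^ DIM('v)) * g x) \<in> borel_measurable borel"
  by (rule borel_measurable_times_ennreal[OF measurable_const assms(1)]) simp
 have "(\<integral>\<^sup>+x. g x \<partial>lborel) = (\<integral>\<^sup>+x. g x \<partial>density (distr lborel borel (%x. 0 + s *\<^sub>R x)) (%_::'v. \<bar>s\<bar> ^ DIM('v)))"
  by (rule arg_cong[of _ _ "%M. \<integral>\<^sup>+x. g x \<partial>M"]) (rule lborel_affine, use s in simp)
 also have "... = (\<integral>\<^sup>+x. ennreal (\<bar>s\<bar> ^ DIM('v)) * g x \<partial>distr lborel borel (%x. 0 + s *\<^sub>R x))"
  by (rule nn_integral_density) (simp_all add: assms(1))
 also have "... = (\<integral>\<^sup>+x. ennreal (\<bar>s\<bar> ^ DIM('v)) * g (0 + s *\<^sub>R x) \<partial>lborel)"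
  by (rule nn_integral_distr[OF m]) (simp only: measurable_distr_eq1 gd)
 also have "... = ennreal (\<bar>s\<bar> ^ DIM('v)) * (\<integral>\<^sup>+x. g (0 + s *\<^sub>R x) \<partial>lborel)"
  by (rule nn_integral_cmult[OF gm])
 finally have "(\<integral>\<^sup>+x. g x \<partial>lborel) = ennreal (\<bar>s\<bar> ^ DIM('v)) * (\<integral>\<^sup>+x. g (0 + s *\<^sub>R x) \<partial>lborel)" .
 then show ?thesis unfolding add_0_left abs_of_pos[OF s] .
qed

text \<open>Along the ray from \<open>0\<close> to \<open>xi\<close> one has \<open>|a (w, xi)| <= c0 + |xi| \<integral>\<^sub>0\<^sup>1 Q (s xi) ds\<close>. Scaling
 \<open>xi\<close> by \<open>1 / s\<close> costs a factor \<open>s ^ (- d)\<close>, which the surplus powers of \<open>1 + |xi|\<close> absorb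
 where \<open>|s xi| \<ge> 1\<close>; where \<open>|s xi| <= 1\<close> the function \<open>Q\<close> is bounded.\<close>

lemma growth_antideriv:
 fixes a :: "'v::euclidean_space \<times> 'v => complex"
 assumes a: "continuous_on UNIV a"
  and d: "!!i. i \<in> Basis ==> deriv_along (0, i) a (a' i)" and c: "!!i. i \<in> Basis ==> continuous_on UNIV (a' i)"
  and g: "!!i. i \<in> Basis ==> growth (a' i)"
 shows "growth a"
 unfolding growth_def
proof (intro allI impI)
 fix K :: "'v set" assume K: "compact K"
 define d where "d = DIM('v)"
 from g K have "\<forall>i\<in>Basis. \<exists>M N. continuous_on UNIV M & (\<forall>xi. 0 <= M xi) &
   (\<forall>w\<in>K. \<forall>xi. norm (a' i (w, xi)) <= M xi) & integrable lborel (%xi. M xi / (1 + norm xi) ^ N)"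
  unfolding growth_def by blast
 from bchoice[OF this] obtain M where "\<forall>i\<in>Basis. \<exists>N. continuous_on UNIV (M i) & (\<forall>xi. 0 <= M i xi) &
   (\<forall>w\<in>K. \<forall>xi. norm (a' i (w, xi)) <= M i xi) & integrable lborel (%xi. M i xi / (1 + norm xi) ^ N)" ..
 from bchoice[OF this] obtain N where MN0: "\<forall>i\<in>Basis. continuous_on UNIV (M i) & (\<forall>xi. 0 <= M i xi) &
   (\<forall>w\<in>K. \<forall>xi. norm (a' i (w, xi)) <= M i xi) & integrable lborel (%xi. M i xi / (1 + norm xi) ^ N i)" ..
 have MN: "!!i. i \<in> Basis ==> continuous_on UNIV (M i)" "!!i xi. i \<in> Basis ==> 0 <= M i xi"
  "!!i w xi. i \<in> Basis ==> w \<in> K ==> norm (a' i (w, xi)) <= M i xi"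
  "!!i. i \<in> Basis ==> integrable lborel (%xi. M i xi / (1 + norm xi) ^ N i)"
  using MN0 by simp_all
 define Q where "Q xi = (\<Sum>i\<in>Basis. M i xi)" for xi
 define n where "n = (\<Sum>i\<in>Basis. N i)"
 have Qc: "continuous_on UNIV Q" unfolding Q_def by (intro continuous_on_sum MN)
 have Q0: "0 <= Q xi" for xi unfolding Q_def by (intro sum_nonneg MN)
 have Qm[measurable]: "Q \<in> borel_measurable borel" by (rule borel_measurable_continuous_onI[OF Qc])
 have Qi: "integrable lborel (%xi. Q xi / (1 + norm xi) ^ n)"
  unfolding Q_def sum_divide_distrib
 proof (rule Bochner_Integration.integrable_sum)
  fix i :: 'v assume i: "i \<in> Basis"
  have [measurable]: "M i \<in> borel_measurable borel" by (rule borel_measurable_continuous_onI[OF MN(1)[OF i]])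
  show "integrable lborel (%xi. M i xi / (1 + norm xi) ^ n)"
  proof (rule Bochner_Integration.integrable_bound[OF MN(4)[OF i]])
   show "AE xi in lborel. norm (M i xi / (1 + norm xi) ^ n) <= norm (M i xi / (1 + norm xi) ^ N i)"
   proof (rule AE_I2)
    fix xi :: 'v
    have "N i <= n" unfolding n_def by (rule member_le_sum) (use i in auto)
    then have "(1 + norm xi) ^ N i <= (1 + norm xi) ^ n" by (intro power_increasing) auto
    then have "M i xi / (1 + norm xi) ^ n <= M i xi / (1 + norm xi) ^ N i"
    using MN(2)[OF i] by (intro divide_left_mono mult_pos_pos zero_less_power) (auto intro: add_pos_nonneg)
    then show "norm (M i xi / (1 + norm xi) ^ n) <= norm (M i xi / (1 + norm xi) ^ N i)"
    using MN(2)[OF i, of xi] by simp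
   qed
  qed measurable
 qed
 define R where "R xi = integral {0..1} (%s. Q (s *\<^sub>R xi))" for xi
 have Rc: "continuous_on UNIV R"
  unfolding R_def box_real[symmetric]
  by (rule integral_continuous_on_param) (auto simp: case_prod_beta' intro!: continuous_on_compose2[OF Qc] continuous_intros)
 have Qsc: "continuous_on {0..1} (%s. Q (s *\<^sub>R xi))" for xi
  by (intro continuous_on_compose2[OF Qc] continuous_intros) auto
 have R0: "0 <= R xi" for xi unfolding R_def by (intro integral_nonneg integrable_continuous_interval Qsc Q0)
 have "compact ((%w. a (w, 0)) ` K)"
  by (intro compact_continuous_image K continuous_on_compose2[OF a] continuous_intros) auto
 then obtain c0 where c0: "0 < c0" "!!w. w \<in> K ==> norm (a (w, 0)) <= c0"
  using bounded_pos compact_imp_bounded by (metis (no_types, lifting) imageI)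
 have bound: "norm (a (w, xi)) <= c0 + norm xi * R xi" if w: "w \<in> K" for w xi
 proof -
  define B where "B = (%i. (0::'v, i)) ` (Basis :: 'v set)"
  have inj: "inj_on (%i. (0::'v, i)) (Basis :: 'v set)" by (auto simp: inj_on_def)
  have "deriv_along (\<Sum>b\<in>B. (xi \<bullet> snd b) *\<^sub>R b) a (%p. \<Sum>b\<in>B. of_real (xi \<bullet> snd b) * a' (snd b) p)"
   by (rule deriv_along_sum_direction) (auto simp: B_def d c)
  moreover have "(\<Sum>b\<in>B. (xi \<bullet> snd b) *\<^sub>R b) = (0, xi)"
  proof -
   have "(\<Sum>b\<in>B. (xi \<bullet> snd b) *\<^sub>R b) = (\<Sum>i\<in>Basis. (0, (xi \<bullet> i) *\<^sub>R i))"
    unfolding B_def by (simp add: sum.reindex[OF inj])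
   also have "... = (0, \<Sum>i\<in>Basis. (xi \<bullet> i) *\<^sub>R i)" by (simp add: sum_prod)
   finally show ?thesis by (simp add: euclidean_representation)
  qed
  moreover have "(%p. \<Sum>b\<in>B. of_real (xi \<bullet> snd b) * a' (snd b) p) = (%p. \<Sum>i\<in>Basis. of_real (xi \<bullet> i) * a' i p)"
   unfolding B_def by (simp add: sum.reindex[OF inj])
  ultimately have da: "deriv_along (0, xi) a (%p. \<Sum>i\<in>Basis. of_real (xi \<bullet> i) * a' i p)" by simp
  define f where "f s = (\<Sum>i\<in>Basis. of_real (xi \<bullet> i) * a' i (w, s *\<^sub>R xi))" for s
  have "(f has_integral (a (w, 1 *\<^sub>R xi) - a (w, 0 *\<^sub>R xi))) {0..1}"
  proof (rule fundamental_theorem_of_calculus)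
   show "((%s. a (w, s *\<^sub>R xi)) has_vector_derivative f s) (at s within {0..1})" for s
    using deriv_along_at[OF da, of "(w, 0)" s] by (auto simp: f_def intro: has_vector_derivative_at_within)
  qed simp
  then have I: "f integrable_on {0..1}" "integral {0..1} f = a (w, xi) - a (w, 0)"
   by (auto simp: has_integral_iff)
  have "norm (integral {0..1} f) <= integral {0..1} (%s. norm xi * Q (s *\<^sub>R xi))"
  proof (rule Henstock_Kurzweil_Integration.integral_norm_bound_integral[OF I(1)])
   show "(%s. norm xi * Q (s *\<^sub>R xi)) integrable_on {0..1}"
    by (intro integrable_continuous_interval continuous_on_mult continuous_on_const Qsc)
   show "norm (f s) <= norm xi * Q (s *\<^sub>R xi)" for s
   proof -
    have "norm (f s) <= (\<Sum>i\<in>Basis. \<bar>xi \<bullet> i\<bar> * norm (a' i (w, s *\<^sub>R xi)))"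
    unfolding f_def by (rule order_trans[OF norm_sum]) (simp add: norm_mult)
    also have "... <= (\<Sum>i\<in>Basis. norm xi * M i (s *\<^sub>R xi))"
    by (intro sum_mono mult_mono Basis_le_norm MN(3) w) auto
    finally show ?thesis by (simp add: Q_def sum_distrib_left)
   qed
  qed
  also have "... = norm xi * R xi" by (simp add: R_def)
  finally have "norm (a (w, xi) - a (w, 0)) <= norm xi * R xi" by (simp add: I(2))
  then show ?thesis using c0(2)[OF w] norm_triangle_ineq2[of "a (w, xi)" "a (w, 0)"] by linarith
 qed
 define E where "E = n + 2 * d"
 have dE: "d <= E" "n <= E" "2 * d <= E" by (simp_all add: E_def)
 have "compact (Q ` cball 0 1)" by (intro compact_continuous_image continuous_on_subset[OF Qc]) auto
 then obtain M0 where M0: "0 < M0" "!!eta. norm eta <= 1 ==> \<bar>Q eta\<bar> <= M0"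
  using compact_imp_bounded[THEN iffD1[OF bounded_pos]] by force
 define A where "A = (\<integral>xi. Q xi / (1 + norm xi) ^ n \<partial>lborel)"
 define W where "W = (\<integral>xi. 1 / (1 + norm (xi::'v)) ^ (2 * d) \<partial>lborel)"
 have W: "(\<integral>\<^sup>+xi. ennreal (1 / (1 + norm (xi::'v)) ^ (2 * d)) \<partial>lborel) = ennreal W"
  unfolding W_def d_def by (intro nn_integral_eq_integral integrable_polynomial_weight) auto
 have A: "(\<integral>\<^sup>+xi. ennreal (Q xi / (1 + norm xi) ^ n) \<partial>lborel) = ennreal A"
  unfolding A_def by (intro nn_integral_eq_integral Qi) (auto simp: Q0)
 have pt: "Q (s *\<^sub>R xi) / (1 + norm xi) ^ E <= M0 * (1 / (1 + norm xi) ^ (2 * d)) + 2 ^ E * (s ^ d * (Q (s *\<^sub>R xi) / (1 + norm (s *\<^sub>R xi)) ^ n))"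
  if s: "0 < s" "s <= 1" for s xi
 proof (cases "norm (s *\<^sub>R xi) <= 1")
  case True
  have "Q (s *\<^sub>R xi) / (1 + norm xi) ^ E <= M0 / (1 + norm xi) ^ (2 * d)"
   using M0(2)[OF True] M0(1) dE(3) by (intro frac_le power_increasing) (auto intro!: zero_less_power add_pos_nonneg)
  moreover have "0 <= 2 ^ E * (s ^ d * (Q (s *\<^sub>R xi) / (1 + norm (s *\<^sub>R xi)) ^ n))"
   using s Q0 by simp
  ultimately show ?thesis by simp
 next
  case False
  define y where "y = norm (s *\<^sub>R xi)"
  have y: "1 < y" "norm xi = y / s" using False s by (auto simp: y_def)
  have "(1 + y) / 2 / s <= y / s" using y(1) s by (intro divide_right_mono) auto
  then have "(1 + y) / 2 / s <= 1 + norm xi" by (simp add: y(2))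
  then have "((1 + y) / 2 / s) ^ E <= (1 + norm xi) ^ E" using y(1) s by (intro power_mono) auto
  then have "((1 + y) / 2) ^ E / s ^ E <= (1 + norm xi) ^ E" by (simp add: power_divide)
  then have "Q (s *\<^sub>R xi) / (1 + norm xi) ^ E <= Q (s *\<^sub>R xi) / (((1 + y) / 2) ^ E / s ^ E)"
   using y s Q0 by (intro divide_left_mono mult_pos_pos zero_less_power divide_pos_pos) (auto intro: add_pos_nonneg)
  also have "... = 2 ^ E * (s ^ E * (Q (s *\<^sub>R xi) / (1 + y) ^ E))" by (simp add: power_divide)
  also have "... <= 2 ^ E * (s ^ d * (Q (s *\<^sub>R xi) / (1 + y) ^ n))"
   using s y Q0 dE by (intro mult_left_mono mult_mono power_decreasing divide_left_mono power_increasing mult_pos_pos zero_less_power) auto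
  finally show ?thesis using M0(1) by (simp add: y_def add_increasing)
 qed
 have inner: "(\<integral>\<^sup>+xi. ennreal (Q (s *\<^sub>R xi) / (1 + norm xi) ^ E) \<partial>lborel) <= ennreal (M0 * W + 2 ^ E * A)" if s: "0 < s" "s <= 1" for s
 proof -
  have "(\<integral>\<^sup>+xi. ennreal (Q (s *\<^sub>R xi) / (1 + norm xi) ^ E) \<partial>lborel)
   <= (\<integral>\<^sup>+xi. ennreal M0 * ennreal (1 / (1 + norm xi) ^ (2 * d)) + ennreal (2 ^ E) * (ennreal (s ^ d) * ennreal (Q (s *\<^sub>R xi) / (1 + norm (s *\<^sub>R xi)) ^ n)) \<partial>lborel)"
   using pt[OF s] M0 s Q0
   by (intro nn_integral_mono) (simp add: ennreal_mult[symmetric] ennreal_plus[symmetric] del: ennreal_plus)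
  also have "... = ennreal M0 * ennreal W + ennreal (2 ^ E) * (ennreal (s ^ d) * (\<integral>\<^sup>+xi. ennreal (Q (s *\<^sub>R xi) / (1 + norm (s *\<^sub>R xi)) ^ n) \<partial>lborel))"
   by (subst nn_integral_add) (simp_all add: nn_integral_cmult W)
  also have "ennreal (s ^ d) * (\<integral>\<^sup>+xi. ennreal (Q (s *\<^sub>R xi) / (1 + norm (s *\<^sub>R xi)) ^ n) \<partial>lborel) = ennreal A"
   unfolding d_def A[symmetric] by (rule nn_integral_lborel_scale[symmetric, OF _ s(1)]) measurable
  finally show ?thesis
   using M0 by (simp add: ennreal_mult[symmetric] ennreal_plus[symmetric] W_def A_def Q0 del: ennreal_plus)
 qed
 define M' where "M' xi = c0 + norm xi * R xi" for xi
 have M'c: "continuous_on UNIV M'" unfolding M'_def by (intro continuous_intros Rc)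
 have M'0: "0 <= M' xi" for xi using c0(1) R0 by (simp add: M'_def)
 have M'm[measurable]: "M' \<in> borel_measurable borel" by (rule borel_measurable_continuous_onI[OF M'c])
 have "integrable lborel (%xi. M' xi / (1 + norm xi) ^ Suc E)"
 proof (rule integrableI_bounded)
  have m2: "(%(xi, s). ennreal (Q (s *\<^sub>R xi) / (1 + norm xi) ^ E) * indicator {0..1::real} s) \<in> borel_measurable (lborel \<Otimes>\<^sub>M lborel)"
   unfolding case_prod_beta' by measurable
  have "(\<integral>\<^sup>+xi. ennreal (norm (M' xi / (1 + norm xi) ^ Suc E)) \<partial>lborel)
   <= (\<integral>\<^sup>+xi. ennreal c0 * ennreal (1 / (1 + norm xi) ^ (2 * d))
    + (\<integral>\<^sup>+s. ennreal (Q (s *\<^sub>R xi) / (1 + norm xi) ^ E) * indicator {0..1::real} s \<partial>lborel) \<partial>lborel)"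
  proof (rule nn_integral_mono)
   fix xi :: 'v
   have p: "0 < (1 + norm xi) ^ k" for k by (intro zero_less_power add_pos_nonneg) auto
   have "c0 / (1 + norm xi) ^ Suc E <= c0 / (1 + norm xi) ^ (2 * d)"
    using c0(1) dE(3) by (intro divide_left_mono power_increasing mult_pos_pos p) auto
   moreover have "norm xi * R xi / (1 + norm xi) ^ Suc E <= R xi / (1 + norm xi) ^ E"
   proof -
    have "norm xi * R xi / (1 + norm xi) ^ Suc E <= (1 + norm xi) * R xi / (1 + norm xi) ^ Suc E"
    using R0[of xi] p[of "Suc E"] by (intro divide_right_mono mult_right_mono) auto
    also have "... = R xi / (1 + norm xi) ^ E"
    using p[of 1] by simp
    finally show ?thesis .
   qed
   ultimately have "M' xi / (1 + norm xi) ^ Suc E <= c0 * (1 / (1 + norm xi) ^ (2 * d)) + R xi / (1 + norm xi) ^ E"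
    unfolding M'_def add_divide_distrib by simp
   moreover have "ennreal (R xi / (1 + norm xi) ^ E) = (\<integral>\<^sup>+s. ennreal (Q (s *\<^sub>R xi) / (1 + norm xi) ^ E) * indicator {0..1} s \<partial>lborel)"
   proof -
    have "(\<integral>\<^sup>+s. ennreal (Q (s *\<^sub>R xi) / (1 + norm xi) ^ E) * indicator {0..1} s \<partial>lborel) = ennreal (integral {0..1} (%s. Q (s *\<^sub>R xi) / (1 + norm xi) ^ E))"
    using p[of E] p[of 1] by (intro nn_integral_unit_interval continuous_on_divide Qsc continuous_on_const) (auto intro!: divide_nonneg_pos Q0)
    then show ?thesis by (simp add: R_def)
   qed
   ultimately have "ennreal (M' xi / (1 + norm xi) ^ Suc E) <= ennreal (c0 * (1 / (1 + norm xi) ^ (2 * d)) + R xi / (1 + norm xi) ^ E)"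
    by (intro ennreal_leI)
   also have "... = ennreal c0 * ennreal (1 / (1 + norm xi) ^ (2 * d)) + ennreal (R xi / (1 + norm xi) ^ E)"
    using c0(1) R0[of xi] by (simp add: ennreal_mult[symmetric])
   finally show "ennreal (norm (M' xi / (1 + norm xi) ^ Suc E)) <= ennreal c0 * ennreal (1 / (1 + norm xi) ^ (2 * d))
    + (\<integral>\<^sup>+s. ennreal (Q (s *\<^sub>R xi) / (1 + norm xi) ^ E) * indicator {0..1::real} s \<partial>lborel)"
    using M'0[of xi] \<open>ennreal (R xi / (1 + norm xi) ^ E) = _\<close> by simp
  qed
  also have "... = ennreal c0 * ennreal W + (\<integral>\<^sup>+xi. (\<integral>\<^sup>+s. ennreal (Q (s *\<^sub>R xi) / (1 + norm xi) ^ E) * indicator {0..1::real} s \<partial>lborel) \<partial>lborel)"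
  proof -
   have "(%xi. \<integral>\<^sup>+s. ennreal (Q (s *\<^sub>R xi) / (1 + norm xi) ^ E) * indicator {0..1::real} s \<partial>lborel) \<in> borel_measurable lborel"
    using lborel.borel_measurable_nn_integral[OF m2] by simp
   then show ?thesis by (subst nn_integral_add) (simp_all add: nn_integral_cmult W)
  qed
  also have "(\<integral>\<^sup>+xi. (\<integral>\<^sup>+s. ennreal (Q (s *\<^sub>R xi) / (1 + norm xi) ^ E) * indicator {0..1::real} s \<partial>lborel) \<partial>lborel)
   = (\<integral>\<^sup>+s. (\<integral>\<^sup>+xi. ennreal (Q (s *\<^sub>R xi) / (1 + norm xi) ^ E) * indicator {0..1::real} s \<partial>lborel) \<partial>lborel)"
   using lborel_pair.Fubini'[OF m2] by simp
  also have "... <= (\<integral>\<^sup>+s. ennreal (M0 * W + 2 ^ E * A) * indicator {0..1::real} s \<partial>lborel)"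
  proof (rule nn_integral_mono_AE)
   have "AE s in lborel. s ~= (0::real)" by (rule AE_lborel_singleton)
   then show "AE s in lborel. (\<integral>\<^sup>+xi. ennreal (Q (s *\<^sub>R xi) / (1 + norm xi) ^ E) * indicator {0..1::real} s \<partial>lborel)
    <= ennreal (M0 * W + 2 ^ E * A) * indicator {0..1} s"
   proof eventually_elim
    case (elim s)
    then show ?case using inner[of s] by (cases "s \<in> {0..1}") auto
   qed
  qed
  also have "... = ennreal (M0 * W + 2 ^ E * A)" by (simp add: nn_integral_cmult)
  finally have "(\<integral>\<^sup>+xi. ennreal (norm (M' xi / (1 + norm xi) ^ Suc E)) \<partial>lborel) <= ennreal c0 * ennreal W + ennreal (M0 * W + 2 ^ E * A)"
   by (simp add: add_left_mono)
  moreover have "ennreal c0 * ennreal W + ennreal (M0 * W + 2 ^ E * A) < \<infinity>"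
   unfolding infinity_ennreal_def by (simp add: ennreal_mult_less_top)
  ultimately show "(\<integral>\<^sup>+xi. ennreal (norm (M' xi / (1 + norm xi) ^ Suc E)) \<partial>lborel) < \<infinity>"
   by (rule le_less_trans)
 qed measurable
 then show "\<exists>M N. continuous_on UNIV M & (\<forall>xi. 0 <= M xi) &
   (\<forall>w\<in>K. \<forall>xi. norm (a (w, xi)) <= M xi) & integrable lborel (%xi. M xi / (1 + norm xi) ^ N)"
  using M'c M'0 bound unfolding M'_def by blast
qed

section \<open>Phase integrals\<close>

definition Phi :: "real => ('v::euclidean_space \<times> 'v => complex) => ('v \<times> 'v => complex) => 'v => complex" where
 "Phi t a phi xi = (\<integral>p. cis ((fst p - snd p) \<bullet> xi) * a ((1 - t) *\<^sub>R fst p + t *\<^sub>R snd p, xi) * phi p \<partial>lborel)"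

lemma continuous_on_phase:
 assumes "continuous_on UNIV (a :: 'v::euclidean_space \<times> 'v => complex)" "continuous_on UNIV phi"
 shows "continuous_on UNIV (%z. cis ((fst (snd z) - snd (snd z)) \<bullet> fst z) *
   a ((1 - t) *\<^sub>R fst (snd z) + t *\<^sub>R snd (snd z), fst z) * phi (snd z))"
 by (intro continuous_on_mult continuous_on_compose2[OF continuous_on_cis[OF continuous_on_id]]
   continuous_on_compose2[OF assms(1)] continuous_on_compose2[OF assms(2)] continuous_intros) auto

lemma continuous_on_phase_slice:
 assumes "continuous_on UNIV (a :: 'v::euclidean_space \<times> 'v => complex)" "continuous_on UNIV phi"
 shows "continuous_on S (%p. cis ((fst p - snd p) \<bullet> xi) * a ((1 - t) *\<^sub>R fst p + t *\<^sub>R snd p, xi) * phi p)"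
 by (intro continuous_on_mult continuous_on_compose2[OF continuous_on_cis[OF continuous_on_id]]
   continuous_on_compose2[OF assms(1)] continuous_on_compose2[OF assms(2)] continuous_intros) auto

lemma integrable_phase:
 assumes "continuous_on UNIV (a :: 'v::euclidean_space \<times> 'v => complex)" "continuous_on UNIV phi"
  and "!!p. p ~: cbox A B ==> phi p = 0"
 shows "integrable lborel (%p. cis ((fst p - snd p) \<bullet> xi) * a ((1 - t) *\<^sub>R fst p + t *\<^sub>R snd p, xi) * phi p)"
 by (rule integrable_compact_support(1)[OF compact_cbox[of A B] continuous_on_phase_slice[OF assms(1,2)]]) (simp add: assms(3))

lemma continuous_on_Phi:
 assumes "continuous_on UNIV a" "continuous_on UNIV phi" "!!p. p ~: cbox A B ==> phi p = 0"
 shows "continuous_on UNIV (Phi t a phi)"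
 unfolding Phi_def
 by (rule continuous_on_integral_param[OF continuous_on_phase[OF assms(1,2)], of A B]) (simp add: assms(3))

lemma Op_phase_integral_eq_Phi:
 assumes "continuous_on UNIV a" "continuous_on UNIV phi"
 shows "Op_phase_integral 1 t a phi = Phi t a phi"
proof
 fix xi
 have "(%p. cis ((fst p - snd p) \<bullet> xi) * a ((1 - t) *\<^sub>R fst p + t *\<^sub>R snd p, xi) * phi p) \<in> borel_measurable lborel"
  using borel_measurable_continuous_onI[OF continuous_on_phase_slice[OF assms]] by simp
 then show "Op_phase_integral 1 t a phi xi = Phi t a phi xi"
  unfolding Op_phase_integral_def Phi_def by (simp add: integral_completion)
qed

lemma Phi_sum:
 assumes a: "continuous_on UNIV a" and c: "!!i. i \<in> I ==> continuous_on UNIV (phi i)"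
  and z: "!!i p. i \<in> I ==> p ~: cbox A B ==> phi i p = 0"
 shows "Phi t a (%p. \<Sum>i\<in>I. phi i p) xi = (\<Sum>i\<in>I. Phi t a (phi i) xi)"
 unfolding Phi_def sum_distrib_left
 by (rule Bochner_Integration.integral_sum) (rule integrable_phase[OF a c z])

text \<open>Derivative in the direction \<open>(t i, - (1 - t) i)\<close>, which leaves \<open>(1 - t) x + t y\<close> fixed and moves
 \<open>x - y\<close> by \<open>i\<close>.\<close>

definition v_deriv :: "real => 'v::euclidean_space => ('v \<times> 'v => complex) => 'v \<times> 'v => complex" where
 "v_deriv t i phi p = of_real t * dir_deriv (i, 0) phi p + of_real (- (1 - t)) * dir_deriv (0, i) phi p"

lemma pair_Basis: "i \<in> Basis ==> (i, 0) \<in> Basis" "i \<in> Basis ==> (0, i) \<in> Basis"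
 by (simp_all add: Basis_prod_def)

lemma smooth_v_deriv:
 assumes "smooth phi" "i \<in> Basis"
 shows "smooth (v_deriv t i phi)"
  and "deriv_along (t *\<^sub>R (i, 0) + (- (1 - t)) *\<^sub>R (0, i)) phi (v_deriv t i phi)"
proof -
 note b = pair_Basis[OF assms(2)]
 show "smooth (v_deriv t i phi)" unfolding v_deriv_def
  by (intro smooth_add smooth_mult smooth_const smooth_deriv(2)[OF assms(1)] b)
 show "deriv_along (t *\<^sub>R (i, 0) + (- (1 - t)) *\<^sub>R (0, i)) phi (v_deriv t i phi)"
  unfolding v_deriv_def
  by (intro deriv_along_add_direction deriv_along_scaleR_direction smooth_deriv(1)[OF assms(1)] b
    continuous_on_mult continuous_on_const smooth_continuous smooth_deriv(2)[OF assms(1)])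
qed

text \<open>The direction of \<open>v_deriv\<close> does not see the symbol, so derivatives of the phase fall on the test function
 alone.\<close>

lemma Phi_v_parts:
 fixes a :: "'v::euclidean_space \<times> 'v => complex"
 assumes a: "continuous_on UNIV a" and phi: "smooth phi" and z: "!!p. p ~: cbox A B ==> phi p = 0" and i: "i \<in> Basis"
 shows "\<i> * of_real (xi \<bullet> i) * Phi t a phi xi = - Phi t a (v_deriv t i phi) xi"
proof -
 define u where "u = t *\<^sub>R (i, 0) + (- (1 - t)) *\<^sub>R (0::'v, i)"
 define e where "e p = cis ((fst p - snd p) \<bullet> xi) * a ((1 - t) *\<^sub>R fst p + t *\<^sub>R snd p, xi)" for p
 define psi where "psi = v_deriv t i phi"
 have psi: "smooth psi" "deriv_along u phi psi"
  unfolding psi_def u_def by (rule smooth_v_deriv[OF phi i])+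
 have zpsi: "psi p = 0" if "p ~: cbox A B" for p
  by (rule deriv_along_zero_outside[OF psi(2) closed_cbox z that])
 have de: "deriv_along u e (%p. \<i> * of_real (xi \<bullet> i) * e p)"
  unfolding deriv_along_def
 proof
  fix p
  have eq: "e (p + s *\<^sub>R u) = cis ((fst p - snd p) \<bullet> xi + s * (xi \<bullet> i)) * a ((1 - t) *\<^sub>R fst p + t *\<^sub>R snd p, xi)" for s
  proof -
   have "fst (p + s *\<^sub>R u) - snd (p + s *\<^sub>R u) = fst p - snd p + s *\<^sub>R i"
    by (simp add: u_def algebra_simps)
   moreover have "(1 - t) *\<^sub>R fst (p + s *\<^sub>R u) + t *\<^sub>R snd (p + s *\<^sub>R u) = (1 - t) *\<^sub>R fst p + t *\<^sub>R snd p"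
    by (simp add: u_def algebra_simps)
   ultimately show ?thesis unfolding e_def by (simp only: inner_add_left inner_scaleR_left inner_commute[of i])
  qed
  have "((%s. exp (\<i> * of_real ((fst p - snd p) \<bullet> xi) + \<i> * (of_real (xi \<bullet> i) * s)) * a ((1 - t) *\<^sub>R fst p + t *\<^sub>R snd p, xi))
    has_field_derivative \<i> * of_real (xi \<bullet> i) * e p) (at (of_real 0))"
   by (auto intro!: derivative_eq_intros simp: e_def cis_conv_exp)
  from has_vector_derivative_real_field[OF this]
  show "((%s. e (p + s *\<^sub>R u)) has_vector_derivative \<i> * of_real (xi \<bullet> i) * e p) (at 0)"
   unfolding eq by (simp add: cis_conv_exp distrib_left mult_ac)
 qed
 have cphi: "continuous_on UNIV phi" and cpsi: "continuous_on UNIV psi" using phi psi by (auto intro: smooth_continuous)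
 have "(\<integral>p. (\<i> * of_real (xi \<bullet> i) * e p) * phi p + e p * psi p \<partial>lborel) = 0"
 proof (rule integral_deriv_along_eq_0)
  show "deriv_along u (%p. e p * phi p) (%p. (\<i> * of_real (xi \<bullet> i) * e p) * phi p + e p * psi p)"
   by (rule deriv_along_mult[OF de psi(2)])
  have "continuous_on UNIV (%p. (\<i> * of_real (xi \<bullet> i)) * (e p * phi p) + e p * psi p)"
   unfolding e_def by (intro continuous_on_add continuous_on_mult[OF continuous_on_const] continuous_on_phase_slice a cphi cpsi)
  then show "continuous_on UNIV (%p. (\<i> * of_real (xi \<bullet> i) * e p) * phi p + e p * psi p)" by (simp add: mult.assoc)
  show "integrable lborel (%p. e p * phi p)" unfolding e_def by (rule integrable_phase[OF a cphi z])
  have "integrable lborel (%p. (\<i> * of_real (xi \<bullet> i)) * (e p * phi p) + e p * psi p)"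
   unfolding e_def by (intro Bochner_Integration.integrable_add integrable_mult_right integrable_phase[OF a cphi z] integrable_phase[OF a cpsi zpsi])
  then show "integrable lborel (%p. (\<i> * of_real (xi \<bullet> i) * e p) * phi p + e p * psi p)" by (simp add: mult.assoc)
 qed
 moreover have "(\<integral>p. (\<i> * of_real (xi \<bullet> i) * e p) * phi p + e p * psi p \<partial>lborel)
   = \<i> * of_real (xi \<bullet> i) * Phi t a phi xi + Phi t a psi xi"
 proof -
  have i1: "integrable lborel (%p. e p * phi p)" unfolding e_def by (rule integrable_phase[OF a cphi z])
  have i2: "integrable lborel (%p. e p * psi p)" unfolding e_def by (rule integrable_phase[OF a cpsi zpsi])
  have "(\<integral>p. (\<i> * of_real (xi \<bullet> i) * e p) * phi p + e p * psi p \<partial>lborel)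
    = (\<integral>p. (\<i> * of_real (xi \<bullet> i)) * (e p * phi p) + e p * psi p \<partial>lborel)" by (simp only: mult.assoc)
  also have "... = (\<i> * of_real (xi \<bullet> i)) * (\<integral>p. e p * phi p \<partial>lborel) + (\<integral>p. e p * psi p \<partial>lborel)"
   by (simp only: Bochner_Integration.integral_add[OF integrable_mult_right[OF i1] i2] integral_mult_right_zero)
  finally show ?thesis by (simp add: Phi_def e_def)
 qed
 ultimately show ?thesis by (simp add: psi_def eq_neg_iff_add_eq_0)
qed

definition w_image :: "real => ('v::euclidean_space \<times> 'v) set => 'v set" where
 "w_image t S = (%p. (1 - t) *\<^sub>R fst p + t *\<^sub>R snd p) ` S"

lemma compact_w_image: "compact S ==> compact (w_image t S)"
 unfolding w_image_def by (intro compact_continuous_image continuous_intros)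

lemma Phi_bound:
 assumes a: "continuous_on UNIV a" and phi: "continuous_on UNIV phi" and z: "!!p. p ~: cbox A B ==> phi p = 0"
  and M: "!!w. w \<in> w_image t (cbox A B) ==> norm (a (w, xi)) <= M"
 shows "norm (Phi t a phi xi) <= (\<integral>p. norm (phi p) \<partial>lborel) * M"
proof -
 have iphi: "integrable lborel phi"
  by (rule integrable_compact_support(1)[OF compact_cbox continuous_on_subset[OF phi subset_UNIV] z])
 have "norm (Phi t a phi xi) <= (\<integral>p. norm (phi p) * M \<partial>lborel)"
  unfolding Phi_def
 proof (rule lborel_norm_integral_le[OF integrable_phase[OF a phi z]])
  show "integrable lborel (%p. norm (phi p) * M)" by (intro integrable_mult_left integrable_norm iphi)
  fix p
  show "norm (cis ((fst p - snd p) \<bullet> xi) * a ((1 - t) *\<^sub>R fst p + t *\<^sub>R snd p, xi) * phi p) <= norm (phi p) * M"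
  proof (cases "p \<in> cbox A B")
   case True
   then have "norm (a ((1 - t) *\<^sub>R fst p + t *\<^sub>R snd p, xi)) <= M" by (intro M) (auto simp: w_image_def)
   then have "norm (phi p) * norm (a ((1 - t) *\<^sub>R fst p + t *\<^sub>R snd p, xi)) <= norm (phi p) * M" by (rule mult_left_mono) simp
   then show ?thesis by (simp add: norm_mult mult.commute)
  qed (simp add: z)
 qed
 then show ?thesis by simp
qed

lemma Phi_decay:
 assumes a: "continuous_on UNIV a" and phi: "smooth phi" and z: "!!p. p ~: cbox A B ==> phi p = 0" and i: "i \<in> Basis"
  and M: "!!w xi. w \<in> w_image t (cbox A B) ==> norm (a (w, xi)) <= M xi"
 shows "\<exists>C\<ge>0. \<forall>xi. \<bar>xi \<bullet> i\<bar> ^ N * norm (Phi t a phi xi) <= C * M xi"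
 using phi z
proof (induction N arbitrary: phi)
 case 0
 show ?case
  using Phi_bound[OF a smooth_continuous[OF 0(1)] 0(2) M]
  by (intro exI[of _ "\<integral>p. norm (phi p) \<partial>lborel"]) auto
next
 case (Suc N)
 have z': "v_deriv t i phi p = 0" if "p ~: cbox A B" for p
  by (rule deriv_along_zero_outside[OF smooth_v_deriv(2)[OF Suc.prems(1) i] closed_cbox Suc.prems(2) that])
 obtain C where C: "0 <= C" "!!xi. \<bar>xi \<bullet> i\<bar> ^ N * norm (Phi t a (v_deriv t i phi) xi) <= C * M xi"
  using Suc.IH[OF smooth_v_deriv(1)[OF Suc.prems(1) i] z'] by blast
 have "\<bar>xi \<bullet> i\<bar> ^ Suc N * norm (Phi t a phi xi) <= C * M xi" for xi
 proof -
  have "\<bar>xi \<bullet> i\<bar> * norm (Phi t a phi xi) = norm (\<i> * of_real (xi \<bullet> i) * Phi t a phi xi)" by (simp add: norm_mult)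
  also have "... = norm (Phi t a (v_deriv t i phi) xi)"
   by (simp only: Phi_v_parts[OF a Suc.prems i] norm_minus_cancel)
  finally have "\<bar>xi \<bullet> i\<bar> ^ Suc N * norm (Phi t a phi xi) = \<bar>xi \<bullet> i\<bar> ^ N * norm (Phi t a (v_deriv t i phi) xi)"
   by (simp only: power_Suc2 mult.assoc)
  then show ?thesis using C(2)[of xi] by (simp only:)
 qed
 then show ?case using C(1) by blast
qed

lemma integrable_Phi:
 assumes a: "continuous_on UNIV a" and g: "growth a"
  and phi: "smooth phi" and z: "!!p. p ~: cbox A B ==> phi p = 0"
 shows "integrable lborel (Phi t (a :: 'v::euclidean_space \<times> 'v => complex) phi)"
proof -
 obtain M N where M: "continuous_on UNIV M" "!!xi. 0 <= M xi"
  "!!w xi. w \<in> w_image t (cbox A B) ==> norm (a (w, xi)) <= M xi" and Mi: "integrable lborel (%xi. M xi / (1 + norm xi) ^ N)"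
  using g compact_w_image[OF compact_cbox] unfolding growth_def by metis
 have "\<forall>i\<in>Basis. \<exists>C\<ge>0. \<forall>xi. \<bar>xi \<bullet> i\<bar> ^ N * norm (Phi t a phi xi) <= C * M xi"
  using Phi_decay[OF a phi z _ M(3)] by blast
 then obtain C where C: "!!i. i \<in> Basis ==> 0 <= C i" "!!i xi. i \<in> Basis ==> \<bar>xi \<bullet> i\<bar> ^ N * norm (Phi t a phi xi) <= C i * M xi"
  by metis
 define C0 where "C0 = (\<integral>p. norm (phi p) \<partial>lborel)"
 have C0: "0 <= C0" "norm (Phi t a phi xi) <= C0 * M xi" for xi
  using Phi_bound[OF a smooth_continuous[OF phi] z M(3)] by (auto simp: C0_def)
 define d where "d = real DIM('v)"
 define R where "R = (1 + d) ^ N * (C0 + (\<Sum>i\<in>Basis. C i))"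
 have bound: "norm (Phi t a phi xi) <= R * (M xi / (1 + norm xi) ^ N)" for xi
 proof -
  obtain b where b: "b \<in> Basis" "infnorm xi = \<bar>xi \<bullet> b\<bar>" by (rule infnorm_attained)
  define y where "y = max 1 (infnorm xi)"
  have "norm xi <= (\<Sum>i\<in>Basis. \<bar>xi \<bullet> i\<bar>)" by (rule norm_le_l1)
  also have "... <= (\<Sum>i\<in>(Basis::'v set). infnorm xi)" by (intro sum_mono component_le_infnorm')
  also have "... = d * infnorm xi" by (simp add: d_def)
  also have "... <= d * y" by (intro mult_left_mono) (auto simp: d_def y_def)
  finally have "1 + norm xi <= (1 + d) * y" by (simp add: y_def distrib_right)
  then have "(1 + norm xi) ^ N <= ((1 + d) * y) ^ N" by (intro power_mono) auto
  then have 1: "(1 + norm xi) ^ N * norm (Phi t a phi xi) <= (1 + d) ^ N * (y ^ N * norm (Phi t a phi xi))"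
   by (simp add: power_mult_distrib mult.assoc mult_right_mono flip: mult.assoc)
  have Cb: "C b <= (\<Sum>i\<in>Basis. C i)" by (rule member_le_sum) (use b C in auto)
  have Cs: "0 <= (\<Sum>i\<in>Basis. C i)" by (intro sum_nonneg C)
  have "y ^ N * norm (Phi t a phi xi) <= (C0 + (\<Sum>i\<in>Basis. C i)) * M xi"
  proof (cases "infnorm xi <= 1")
   case True
   then have "y ^ N * norm (Phi t a phi xi) <= C0 * M xi" using C0 by (simp add: y_def)
   also have "... <= (C0 + (\<Sum>i\<in>Basis. C i)) * M xi" using Cs M(2) by (intro mult_right_mono) auto
   finally show ?thesis .
  next
   case False
   then have "y ^ N * norm (Phi t a phi xi) <= C b * M xi" using C(2)[OF b(1), of xi] b(2) by (simp add: y_def max_def)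
   also have "... <= (C0 + (\<Sum>i\<in>Basis. C i)) * M xi" using Cb C0(1) M(2) by (intro mult_right_mono) auto
   finally show ?thesis .
  qed
  then have "(1 + d) ^ N * (y ^ N * norm (Phi t a phi xi)) <= (1 + d) ^ N * ((C0 + (\<Sum>i\<in>Basis. C i)) * M xi)"
   by (intro mult_left_mono) (auto simp: d_def)
  with 1 have "(1 + norm xi) ^ N * norm (Phi t a phi xi) <= R * M xi" by (simp add: R_def mult.assoc)
  moreover have "0 < (1 + norm xi) ^ N" by (intro zero_less_power add_pos_nonneg) auto
  ultimately show ?thesis by (simp add: pos_le_divide_eq mult.commute)
 qed
 show ?thesis
 proof (rule Bochner_Integration.integrable_bound[OF integrable_mult_right[OF Mi, of R]])
  show "Phi t a phi \<in> borel_measurable lborel"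
   using borel_measurable_continuous_onI[OF continuous_on_Phi[OF a smooth_continuous[OF phi] z]] by simp
  show "AE xi in lborel. norm (Phi t a phi xi) <= norm (R * (M xi / (1 + norm xi) ^ N))"
   using bound by (intro AE_I2) (metis abs_ge_self order_trans real_norm_def)
 qed
qed

definition vcoord :: "'v::euclidean_space => 'v \<times> 'v => complex" where
 "vcoord i p = of_real ((fst p - snd p) \<bullet> i)"

lemma smooth_vcoord: "smooth (vcoord i)"
proof -
 have "smooth (%p. complex_of_real (0 + (i, - i) \<bullet> p))" by (rule smooth_inner)
 then show ?thesis by (simp add: vcoord_def[abs_def] inner_prod_def inner_diff_left inner_diff_right inner_commute)
qed

text \<open>Integrate the \<open>xi\<close>-derivative of \<open>Phi\<close>: it vanishes since \<open>Phi\<close> and its derivative are integrable.\<close>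

lemma Phi_xi_parts:
 fixes a :: "'v::euclidean_space \<times> 'v => complex"
 assumes a: "continuous_on UNIV a" "growth a" and a': "continuous_on UNIV a'" "growth a'"
  and d: "deriv_along (0, i) a a'"
  and phi: "smooth phi" and z: "!!p. p ~: cbox A B ==> phi p = 0"
 shows "(\<integral>xi. Phi t a (%p. vcoord i p * phi p) xi \<partial>lborel) = \<i> * (\<integral>xi. Phi t a' phi xi \<partial>lborel)"
proof -
 define e where "e xi p = cis ((fst p - snd p) \<bullet> xi)" for xi :: 'v and p :: "'v \<times> 'v"
 define W where "W p = (1 - t) *\<^sub>R fst p + t *\<^sub>R snd p" for p :: "'v \<times> 'v"
 define h where "h xi p = e xi p * a (W p, xi) * phi p" for xi p
 define psi where "psi p = vcoord i p * phi p" for p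
 define h' where "h' xi p = \<i> * (e xi p * a (W p, xi) * psi p) + e xi p * a' (W p, xi) * phi p" for xi p
 have psi: "smooth psi" unfolding psi_def by (intro smooth_mult smooth_vcoord phi)
 have zpsi: "psi p = 0" if "p ~: cbox A B" for p using z[OF that] by (simp add: psi_def)
 have cphi: "continuous_on UNIV phi" and cpsi: "continuous_on UNIV psi" using phi psi by (auto intro: smooth_continuous)
 have dh: "deriv_along i (%xi. h xi p) (%xi. h' xi p)" for p
 proof -
  have 1: "deriv_along i (%xi. e xi p) (%xi. \<i> * vcoord i p * e xi p)"
   unfolding deriv_along_def
  proof
   fix xi
   have "((%s. exp (\<i> * of_real ((fst p - snd p) \<bullet> xi) + \<i> * (vcoord i p * s))) has_field_derivative \<i> * vcoord i p * e xi p) (at (of_real 0))"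
    by (auto intro!: derivative_eq_intros simp: e_def cis_conv_exp)
   from has_vector_derivative_real_field[OF this]
   show "((%s. e (xi + s *\<^sub>R i) p) has_vector_derivative \<i> * vcoord i p * e xi p) (at 0)"
    by (simp add: e_def cis_conv_exp inner_add_right distrib_left vcoord_def mult_ac)
  qed
  have 2: "deriv_along i (%xi. a (W p, xi)) (%xi. a' (W p, xi))"
   using d unfolding deriv_along_def by (auto dest: spec[of _ "(W p, _)"])
  have "deriv_along i (%xi. e xi p * a (W p, xi) * phi p)
   (%xi. ((\<i> * vcoord i p * e xi p) * a (W p, xi) + e xi p * a' (W p, xi)) * phi p + e xi p * a (W p, xi) * 0)"
   by (intro deriv_along_mult 1 2 deriv_along_const)
  moreover have "((\<i> * vcoord i p * e xi p) * a (W p, xi) + e xi p * a' (W p, xi)) * phi p + e xi p * a (W p, xi) * 0 = h' xi p" for xi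
   by (simp add: h'_def psi_def algebra_simps)
  ultimately show ?thesis by (simp add: h_def)
 qed
 have ch: "continuous_on UNIV (%z. h (fst z) (snd z))"
  unfolding h_def e_def W_def by (rule continuous_on_phase[OF a(1) cphi])
 have ch': "continuous_on UNIV (%z. h' (fst z) (snd z))"
  unfolding h'_def e_def W_def
  by (intro continuous_on_add continuous_on_mult[OF continuous_on_const] continuous_on_phase a(1) a'(1) cphi cpsi)
 have G': "(\<integral>p. h' xi p \<partial>lborel) = \<i> * Phi t a psi xi + Phi t a' phi xi" for xi
 proof -
  have i1: "integrable lborel (%p. e xi p * a (W p, xi) * psi p)" unfolding e_def W_def by (rule integrable_phase[OF a(1) cpsi zpsi])
  have i2: "integrable lborel (%p. e xi p * a' (W p, xi) * phi p)" unfolding e_def W_def by (rule integrable_phase[OF a'(1) cphi z])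
  show ?thesis
   unfolding h'_def Bochner_Integration.integral_add[OF integrable_mult_right[OF i1] i2]
   by (simp only: integral_mult_right_zero) (simp add: Phi_def e_def W_def)
 qed
 have dG: "deriv_along i (Phi t a phi) (%xi. \<i> * Phi t a psi xi + Phi t a' phi xi)"
 proof -
  have "deriv_along i (%xi. \<integral>p. h xi p \<partial>lborel) (%xi. \<integral>p. h' xi p \<partial>lborel)"
   by (rule deriv_along_integral_param[OF ch _ ch' _ dh, of A B]) (simp_all add: h_def h'_def z zpsi)
  moreover have "(\<integral>p. h xi p \<partial>lborel) = Phi t a phi xi" for xi by (simp add: h_def Phi_def e_def W_def)
  ultimately show ?thesis by (simp add: G')
 qed
 have I1: "integrable lborel (Phi t a psi)" by (rule integrable_Phi[OF a psi zpsi])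
 have I2: "integrable lborel (Phi t a' phi)" by (rule integrable_Phi[OF a' phi z])
 have "(\<integral>xi. \<i> * Phi t a psi xi + Phi t a' phi xi \<partial>lborel) = 0"
 proof (rule integral_deriv_along_eq_0[OF dG])
  show "continuous_on UNIV (%xi. \<i> * Phi t a psi xi + Phi t a' phi xi)"
   by (intro continuous_on_add continuous_on_mult continuous_on_const continuous_on_Phi[OF a(1) cpsi zpsi] continuous_on_Phi[OF a'(1) cphi z])
  show "integrable lborel (Phi t a phi)" by (rule integrable_Phi[OF a phi z])
  show "integrable lborel (%xi. \<i> * Phi t a psi xi + Phi t a' phi xi)"
   by (intro Bochner_Integration.integrable_add integrable_mult_right I1 I2)
 qed
 then have "\<i> * (\<integral>xi. Phi t a psi xi \<partial>lborel) + (\<integral>xi. Phi t a' phi xi \<partial>lborel) = 0"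
  by (simp only: Bochner_Integration.integral_add[OF integrable_mult_right[OF I1] I2] integral_mult_right_zero)
 then have "\<i> * (\<i> * (\<integral>xi. Phi t a psi xi \<partial>lborel) + (\<integral>xi. Phi t a' phi xi \<partial>lborel)) = 0" by simp
 then show ?thesis unfolding psi_def[symmetric, abs_def] by (simp add: distrib_left)
qed

text \<open>Iterated derivatives \<open>al l\<close> in the direction \<open>i\<close> of the frequency variable, all of polynomial growth.\<close>

definition xi_chain :: "nat => 'v::euclidean_space => (nat => 'v \<times> 'v => complex) => bool" where
 "xi_chain m i al \<longleftrightarrow> (\<forall>l\<le>m. continuous_on UNIV (al l) & growth (al l)) & (\<forall>l<m. deriv_along (0, i) (al l) (al (Suc l)))"

lemma Phi_xi_parts_iterated:
 assumes "xi_chain m i al" "smooth phi" "!!p. p ~: cbox A B ==> phi p = 0"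
 shows "(\<integral>xi. Phi t (al 0) (%p. vcoord i p ^ m * phi p) xi \<partial>lborel) = \<i> ^ m * (\<integral>xi. Phi t (al m) phi xi \<partial>lborel)"
 using assms
proof (induction m arbitrary: phi)
 case (Suc m)
 have ch: "xi_chain m i al" using Suc.prems(1) by (simp add: xi_chain_def)
 have s: "smooth (%p. vcoord i p * phi p)" by (intro smooth_mult smooth_vcoord Suc.prems)
 have "(\<integral>xi. Phi t (al 0) (%p. vcoord i p ^ Suc m * phi p) xi \<partial>lborel) = (\<integral>xi. Phi t (al 0) (%p. vcoord i p ^ m * (vcoord i p * phi p)) xi \<partial>lborel)"
  by (simp add: mult_ac)
 also have "... = \<i> ^ m * (\<integral>xi. Phi t (al m) (%p. vcoord i p * phi p) xi \<partial>lborel)"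
  by (rule Suc.IH[OF ch s]) (simp add: Suc.prems(3))
 also have "(\<integral>xi. Phi t (al m) (%p. vcoord i p * phi p) xi \<partial>lborel) = \<i> * (\<integral>xi. Phi t (al (Suc m)) phi xi \<partial>lborel)"
  using Suc.prems(1) by (intro Phi_xi_parts[OF _ _ _ _ _ Suc.prems(2,3)]) (auto simp: xi_chain_def)
 finally show ?case by (simp add: mult_ac)
qed simp

section \<open>Kernels and division by powers of x - y\<close>

definition abs_kernel :: "real => ('v::euclidean_space \<times> 'v => complex) => 'v \<times> 'v => complex" where
 "abs_kernel t b p = of_real ((1 / (2 * pi)) ^ DIM('v)) *
   (\<integral>xi. cis ((fst p - snd p) \<bullet> xi) * b ((1 - t) *\<^sub>R fst p + t *\<^sub>R snd p, xi) \<partial>lborel)"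

text \<open>The bound has to be local in \<open>w\<close>: on a null set of frequencies the supremum over all \<open>w\<close> may be
 infinite.\<close>

definition dominated :: "('v::euclidean_space \<times> 'v => complex) => bool" where
 "dominated b \<longleftrightarrow> continuous_on UNIV b & (\<forall>K. compact K --> (\<exists>M. continuous_on UNIV M & (\<forall>xi. 0 <= M xi) &
   (\<forall>w\<in>K. \<forall>xi. norm (b (w, xi)) <= M xi) & integrable lborel M))"

lemma dominated_growth: "dominated b ==> growth b"
 unfolding dominated_def growth_def
proof (elim conjE, intro allI impI)
 fix K :: "'a set"
 assume "\<forall>K. compact K --> (\<exists>M. continuous_on UNIV M & (\<forall>xi. 0 <= M xi) &
   (\<forall>w\<in>K. \<forall>xi. norm (b (w, xi)) <= M xi) & integrable lborel M)" "compact K"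
 then obtain M where "continuous_on UNIV M" "\<forall>xi. 0 <= M xi" "\<forall>w\<in>K. \<forall>xi. norm (b (w, xi)) <= M xi" "integrable lborel M"
  by blast
 then show "\<exists>M N. continuous_on UNIV M & (\<forall>xi. 0 <= M xi) &
   (\<forall>w\<in>K. \<forall>xi. norm (b (w, xi)) <= M xi) & integrable lborel (%xi. M xi / (1 + norm xi) ^ N)"
  by (intro exI[of _ M] exI[of _ 0]) simp
qed

lemma test_functionE:
 assumes "test_function U (phi :: 'v::euclidean_space => complex)"
 obtains K A B where "smooth phi" "compact K" "K \<subseteq> U" "!!p. p ~: K ==> phi p = 0" "!!p. p ~: cbox A B ==> phi p = 0"
proof -
 obtain K where K: "smooth phi" "compact K" "K \<subseteq> U" "!!p. p ~: K ==> phi p = 0"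
  using assms unfolding test_function_iff by blast
 obtain A where "K \<subseteq> cbox (- A) A" using bounded_subset_cbox_symmetric[OF compact_imp_bounded[OF K(2)]] by blast
 with K that[of K "- A" A] show thesis by blast
qed

lemma Op_kernel_on_abs_kernel:
 assumes "dominated (b :: 'v::euclidean_space \<times> 'v => complex)"
 shows "Op_kernel_on UNIV 1 t b (abs_kernel t b)"
proof -
 have b: "continuous_on UNIV b" using assms unfolding dominated_def by blast
 have meas: "(%xi. cis ((fst p - snd p) \<bullet> xi) * b ((1 - t) *\<^sub>R fst p + t *\<^sub>R snd p, xi)) \<in> borel_measurable lborel" for p :: "'v \<times> 'v"
 proof -
  have "continuous_on UNIV (%xi. cis ((fst p - snd p) \<bullet> xi) * b ((1 - t) *\<^sub>R fst p + t *\<^sub>R snd p, xi))"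
   by (intro continuous_on_mult continuous_on_compose2[OF continuous_on_cis[OF continuous_on_id]]
    continuous_on_compose2[OF b] continuous_intros) auto
  from borel_measurable_continuous_onI[OF this] show ?thesis by simp
 qed
 have eq: "(%(x, y). complex_of_real ((1 / (2 * pi)) ^ DIM('v)) *
   (\<integral>xi. cis (1 * ((x - y) \<bullet> xi)) * b ((1 - t) *\<^sub>R x + t *\<^sub>R y, xi) \<partial>lebesgue)) = abs_kernel t b"
  by (rule ext) (simp only: case_prod_beta abs_kernel_def mult_1_left integral_completion[OF meas])
 have loc: "Op_kernel_on (ball 0 R) 1 t b (abs_kernel t b)" for R
 proof -
  have "compact (w_image t (cball 0 R))" by (rule compact_w_image[OF compact_cball])
  then obtain M where M: "integrable lborel M" "!!w xi. w \<in> w_image t (cball 0 R) ==> norm (b (w, xi)) <= M xi"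
   using assms unfolding dominated_def by metis
  have bd: "norm (b ((1 - t) *\<^sub>R x + t *\<^sub>R y, xi)) <= M xi" if "(x, y) \<in> ball 0 R" for x y xi
  proof (rule M(2))
   have "(x, y) \<in> cball 0 R" using that by simp
   then show "(1 - t) *\<^sub>R x + t *\<^sub>R y \<in> w_image t (cball 0 R)" unfolding w_image_def by (rule rev_image_eqI) simp
  qed
  show ?thesis using Op_kernel_on_absolutely_convergent[OF b M(1) bd, of "ball 0 R" 1] unfolding eq by simp
 qed
 show ?thesis
  unfolding Op_kernel_on_def
 proof (intro conjI allI impI)
  have "continuous_on (\<Union>R\<in>UNIV. ball 0 R) (abs_kernel t b)"
   using loc by (intro continuous_on_open_UN) (auto simp: Op_kernel_on_def)
  moreover have "(\<Union>R\<in>UNIV. ball (0::'v \<times> 'v) R) = UNIV" by (auto intro: gt_ex)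
  ultimately show "continuous_on UNIV (abs_kernel t b)" by simp
  fix phi :: "'v \<times> 'v => complex" assume "test_function UNIV phi"
  then obtain K A B where K: "smooth phi" "compact K" "!!p. p ~: K ==> phi p = 0" using test_functionE by metis
  obtain R where "K \<subseteq> ball 0 R" using bounded_subset_ballD[OF compact_imp_bounded[OF K(2)]] by blast
  then have phi: "test_function (ball 0 R) phi" unfolding test_function_iff using K by blast
  show "integrable lebesgue (Op_phase_integral 1 t b phi)" "Op_pairing 1 t b phi = (\<integral>p. abs_kernel t b p * phi p \<partial>lebesgue)"
   using loc[of R] phi by (simp_all add: Op_kernel_on_def)
 qed
qed

lemma continuous_on_abs_kernel: "dominated b ==> continuous_on UNIV (abs_kernel t b)"
 using Op_kernel_on_abs_kernel unfolding Op_kernel_on_def by blast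

lemma Op_pairing_eq_integral_Phi:
 assumes a: "continuous_on UNIV (a :: 'v::euclidean_space \<times> 'v => complex)" and phi: "test_function U phi"
 shows "Op_pairing 1 t a phi = of_real ((1 / (2 * pi)) ^ DIM('v)) * (\<integral>xi. Phi t a phi xi \<partial>lborel)"
proof -
 obtain K A B where "smooth phi" and z: "!!p. p ~: cbox A B ==> phi p = 0" using test_functionE[OF phi] by metis
 then have c: "continuous_on UNIV phi" by (simp add: smooth_continuous)
 have "Phi t a phi \<in> borel_measurable lborel"
  using borel_measurable_continuous_onI[OF continuous_on_Phi[OF a c z]] by simp
 then show ?thesis
  unfolding Op_pairing_def Op_phase_integral_eq_Phi[OF a c] by (simp only: integral_completion)
qed

lemma test_function_vcoord_power:
 assumes "test_function U phi"
 shows "test_function U (%p. vcoord i p ^ m * phi p)"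
proof -
 obtain K A B where "smooth phi" "compact K" "K \<subseteq> U" "!!p. p ~: K ==> phi p = 0" using test_functionE[OF assms] by metis
 then show ?thesis
  unfolding test_function_iff by (auto intro!: smooth_mult smooth_power smooth_vcoord exI[of _ K])
qed

lemma test_function_mono: "test_function U phi ==> U \<subseteq> V ==> test_function V phi"
 unfolding test_function_def by blast

lemma Op_pairing_vcoord_power:
 assumes ch: "xi_chain m i al" and b: "dominated (al m)" and phi: "test_function UNIV phi"
 shows "Op_pairing 1 t (al 0) (%p. vcoord i p ^ m * phi p) = \<i> ^ m * (\<integral>p. abs_kernel t (al m) p * phi p \<partial>lebesgue)"
proof -
 have c: "continuous_on UNIV (al 0)" "continuous_on UNIV (al m)" using ch by (auto simp: xi_chain_def)
 obtain K A B where s: "smooth phi" and z: "!!p. p ~: cbox A B ==> phi p = 0" using test_functionE[OF phi] by metis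
 have "Op_pairing 1 t (al m) phi = (\<integral>p. abs_kernel t (al m) p * phi p \<partial>lebesgue)"
  using Op_kernel_on_abs_kernel[OF b] phi unfolding Op_kernel_on_def by blast
 then show ?thesis
  unfolding Op_pairing_eq_integral_Phi[OF c(1) test_function_vcoord_power[OF phi]] Op_pairing_eq_integral_Phi[OF c(2) phi]
  using Phi_xi_parts_iterated[OF ch s z, where t=t] by (simp add: mult_ac)
qed

lemma integrable_test_function_mult:
 assumes k: "continuous_on U k" and phi: "test_function U (phi :: 'v::euclidean_space => complex)"
 shows "integrable lebesgue (%p. k p * phi p)"
proof -
 obtain K A B where K: "smooth phi" "compact K" "K \<subseteq> U" "!!p. p ~: K ==> phi p = 0" using test_functionE[OF phi] by metis
 show ?thesis
  by (rule integrable_compact_support(2)[OF K(2)])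
   (auto intro!: continuous_on_mult continuous_on_subset[OF k K(3)] continuous_on_subset[OF smooth_continuous[OF K(1)]] K(4))
qed

text \<open>Both sides have the same pairings with test functions supported in \<open>U\<close>.\<close>

lemma kernel_division:
 fixes U :: "('v::euclidean_space \<times> 'v) set"
 assumes U: "open U" and k: "Op_kernel_on U 1 t (al 0) k" and ch: "xi_chain m i al" and b: "dominated (al m)" and p: "p \<in> U"
 shows "vcoord i p ^ m * k p = \<i> ^ m * abs_kernel t (al m) p"
proof -
 have kc: "continuous_on U k" using k by (simp add: Op_kernel_on_def)
 have c: "continuous_on U (abs_kernel t (al m))" by (rule continuous_on_subset[OF continuous_on_abs_kernel[OF b]]) simp
 have vc: "continuous_on U (%p. vcoord i p ^ m)"
  by (rule continuous_on_subset[OF smooth_continuous[OF smooth_power[OF smooth_vcoord]]]) simp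
 have "vcoord i p ^ m * k p - \<i> ^ m * abs_kernel t (al m) p = 0"
 proof (rule du_bois_reymond[OF U _ _ p])
  show "continuous_on U (%p. vcoord i p ^ m * k p - \<i> ^ m * abs_kernel t (al m) p)"
   by (intro continuous_on_diff continuous_on_mult vc kc c continuous_on_const)
  fix phi assume phi: "test_function U phi"
  have t2: "test_function U (%p. vcoord i p ^ m * phi p)" by (rule test_function_vcoord_power[OF phi])
  have "(\<integral>p. k p * (vcoord i p ^ m * phi p) \<partial>lebesgue) = Op_pairing 1 t (al 0) (%p. vcoord i p ^ m * phi p)"
   using k t2 by (simp add: Op_kernel_on_def)
  also have "... = \<i> ^ m * (\<integral>p. abs_kernel t (al m) p * phi p \<partial>lebesgue)"
   by (rule Op_pairing_vcoord_power[OF ch b test_function_mono[OF phi]]) simp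
  finally have eq: "(\<integral>p. k p * (vcoord i p ^ m * phi p) \<partial>lebesgue) = \<i> ^ m * (\<integral>p. abs_kernel t (al m) p * phi p \<partial>lebesgue)" .
  have "(\<integral>p. (vcoord i p ^ m * k p - \<i> ^ m * abs_kernel t (al m) p) * phi p \<partial>lebesgue)
    = (\<integral>p. k p * (vcoord i p ^ m * phi p) - \<i> ^ m * (abs_kernel t (al m) p * phi p) \<partial>lebesgue)"
   by (rule Bochner_Integration.integral_cong) (simp_all add: algebra_simps)
  also have "... = (\<integral>p. k p * (vcoord i p ^ m * phi p) \<partial>lebesgue) - (\<integral>p. \<i> ^ m * (abs_kernel t (al m) p * phi p) \<partial>lebesgue)"
   by (rule Bochner_Integration.integral_diff[OF integrable_test_function_mult[OF kc t2]
    integrable_mult_right[OF integrable_test_function_mult[OF c phi]]])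
  finally show "(\<integral>p. (vcoord i p ^ m * k p - \<i> ^ m * abs_kernel t (al m) p) * phi p \<partial>lebesgue) = 0"
   by (simp only: eq integral_mult_right_zero right_minus_eq)
 qed
 then show ?thesis by simp
qed

text \<open>With \<open>D = (\<Sum>i. (x - y)\<^sub>i ^ (2 m))\<close> a test function supported off the diagonal splits as
 \<open>phi = (\<Sum>i. (x - y)\<^sub>i ^ m * phi\<^sub>i)\<close> with test functions \<open>phi\<^sub>i = (x - y)\<^sub>i ^ m * phi / D\<close>, and \<open>m\<close> integrations by
 parts apply to each term.\<close>

lemma Op_kernel_on_off_diagonal:
 fixes a :: "'v::euclidean_space \<times> 'v => complex"
 assumes ch: "!!i. i \<in> Basis ==> xi_chain m i (al i)" and a: "!!i. i \<in> Basis ==> al i 0 = a"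
  and b: "!!i. i \<in> Basis ==> dominated (al i m)"
 shows "\<exists>k. Op_kernel_on {p. fst p ~= snd p} 1 t a k"
proof -
 define U where "U = {p::'v \<times> 'v. fst p ~= snd p}"
 define D where "D p = (\<Sum>i\<in>Basis. vcoord i p ^ m * vcoord i p ^ m)" for p :: "'v \<times> 'v"
 define k where "k p = (\<Sum>i\<in>Basis. \<i> ^ m * (abs_kernel t (al i m) p * (vcoord i p ^ m / D p)))" for p
 have sD: "smooth D" unfolding D_def[abs_def] by (intro smooth_sum smooth_mult smooth_power smooth_vcoord)
 have D0: "D p ~= 0" if "p \<in> U" for p
 proof -
  have "fst p - snd p ~= 0" using that by (simp add: U_def)
  then obtain j where j: "j \<in> Basis" "(fst p - snd p) \<bullet> j ~= 0" using euclidean_all_zero_iff by blast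
  have "0 < (\<Sum>i\<in>Basis. ((fst p - snd p) \<bullet> i) ^ m * ((fst p - snd p) \<bullet> i) ^ m)"
  proof (rule sum_pos2[OF finite_Basis j(1)])
   show "0 < ((fst p - snd p) \<bullet> j) ^ m * ((fst p - snd p) \<bullet> j) ^ m"
    unfolding power2_eq_square[symmetric] zero_less_power2 using j(2) by simp
  qed simp
  moreover have "D p = of_real (\<Sum>i\<in>Basis. ((fst p - snd p) \<bullet> i) ^ m * ((fst p - snd p) \<bullet> i) ^ m)"
   by (simp add: D_def vcoord_def)
  ultimately show ?thesis by (simp only: of_real_eq_0_iff)
 qed
 obtain i0 :: 'v where i0: "i0 \<in> Basis" using nonempty_Basis by blast
 have ac: "continuous_on UNIV a" "growth a" using ch[OF i0] a[OF i0] by (auto simp: xi_chain_def)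
 have kc: "continuous_on UNIV (abs_kernel t (al i m))" if "i \<in> Basis" for i
  by (rule continuous_on_abs_kernel[OF b[OF that]])
 have "Op_kernel_on U 1 t a k"
  unfolding Op_kernel_on_def
 proof (intro conjI allI impI)
  show "continuous_on U k"
   unfolding k_def[abs_def] using D0
   by (intro continuous_on_sum continuous_on_mult continuous_on_divide continuous_on_const
    continuous_on_subset[OF kc] continuous_on_subset[OF smooth_continuous[OF sD]]
    continuous_on_subset[OF smooth_continuous[OF smooth_power[OF smooth_vcoord]]]) auto
  fix phi assume phi: "test_function U phi"
  obtain K A B where K: "smooth phi" "compact K" "K \<subseteq> U" "!!p. p ~: K ==> phi p = 0" and z: "!!p. p ~: cbox A B ==> phi p = 0"
   using test_functionE[OF phi] by metis
  have I: "integrable lborel (Phi t a phi)" by (rule integrable_Phi[OF ac K(1) z])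
  have phic: "continuous_on UNIV phi" by (rule smooth_continuous[OF K(1)])
  show "integrable lebesgue (Op_phase_integral 1 t a phi)"
   unfolding Op_phase_integral_eq_Phi[OF ac(1) phic]
   using I by (simp add: integrable_completion borel_measurable_integrable)
  define f where "f i p = vcoord i p ^ m * (phi p / D p)" for i p
  have "smooth (%p. phi p / D p)"
   by (rule smooth_divide[OF K(1) sD compact_imp_closed[OF K(2)] K(4)]) (use D0 K(3) in auto)
  then have "test_function UNIV (%p. phi p / D p)"
   unfolding test_function_iff using K by auto
  then have ft: "test_function UNIV (f i)" for i unfolding f_def by (rule test_function_vcoord_power)
  have fs: "smooth (%p. vcoord i p ^ m * f i p)" for i
   using test_function_vcoord_power[OF ft] by (simp add: test_function_iff)
  have fz: "vcoord i p ^ m * f i p = 0" if "p ~: cbox A B" for i p using z[OF that] by (simp add: f_def)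
  have phieq: "phi p = (\<Sum>i\<in>Basis. vcoord i p ^ m * f i p)" for p
  proof (cases "p \<in> U")
   case True
   have "(\<Sum>i\<in>Basis. vcoord i p ^ m * f i p) = D p * (phi p / D p)"
    by (simp add: f_def D_def sum_distrib_right mult.assoc flip: sum_divide_distrib)
   then show ?thesis using D0[OF True] by simp
  next
   case False
   then have "phi p = 0" using K by blast
   then show ?thesis by (simp add: f_def)
  qed
  let ?c = "complex_of_real ((1 / (2 * pi)) ^ DIM('v))"
  have "Op_pairing 1 t a phi = ?c * (\<integral>xi. Phi t a phi xi \<partial>lborel)"
   by (rule Op_pairing_eq_integral_Phi[OF ac(1) phi])
  also have "Phi t a phi = (%xi. \<Sum>i\<in>Basis. Phi t a (%p. vcoord i p ^ m * f i p) xi)"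
  proof
   fix xi
   have "Phi t a (%p. \<Sum>i\<in>Basis. vcoord i p ^ m * f i p) xi = (\<Sum>i\<in>Basis. Phi t a (%p. vcoord i p ^ m * f i p) xi)"
    by (rule Phi_sum[OF ac(1) smooth_continuous[OF fs] fz])
   then show "Phi t a phi xi = (\<Sum>i\<in>Basis. Phi t a (%p. vcoord i p ^ m * f i p) xi)"
    by (simp only: phieq[symmetric])
  qed
  also have "(\<integral>xi. (\<Sum>i\<in>Basis. Phi t a (%p. vcoord i p ^ m * f i p) xi) \<partial>lborel)
    = (\<Sum>i\<in>Basis. \<integral>xi. Phi t a (%p. vcoord i p ^ m * f i p) xi \<partial>lborel)"
   by (rule Bochner_Integration.integral_sum) (rule integrable_Phi[OF ac fs fz])
  also have "?c * ... = (\<Sum>i\<in>Basis. Op_pairing 1 t a (%p. vcoord i p ^ m * f i p))"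
   by (simp only: sum_distrib_left Op_pairing_eq_integral_Phi[OF ac(1) test_function_vcoord_power[OF ft]])
  also have "... = (\<Sum>i\<in>Basis. \<i> ^ m * (\<integral>p. abs_kernel t (al i m) p * f i p \<partial>lebesgue))"
  proof (rule sum.cong[OF refl])
   fix i :: 'v assume i: "i \<in> Basis"
   show "Op_pairing 1 t a (%p. vcoord i p ^ m * f i p) = \<i> ^ m * (\<integral>p. abs_kernel t (al i m) p * f i p \<partial>lebesgue)"
    using Op_pairing_vcoord_power[OF ch[OF i] b[OF i] ft] by (simp only: a[OF i])
  qed
  also have "... = (\<Sum>i\<in>Basis. (\<integral>p. \<i> ^ m * (abs_kernel t (al i m) p * f i p) \<partial>lebesgue))"
   by (simp only: integral_mult_right_zero)
  also have "... = (\<integral>p. (\<Sum>i\<in>Basis. \<i> ^ m * (abs_kernel t (al i m) p * f i p)) \<partial>lebesgue)"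
   by (rule Bochner_Integration.integral_sum[symmetric])
    (intro integrable_mult_right integrable_test_function_mult[OF kc ft])
  also have "(%p. \<Sum>i\<in>Basis. \<i> ^ m * (abs_kernel t (al i m) p * f i p)) = (%p. k p * phi p)"
   by (rule ext) (simp add: k_def f_def sum_distrib_left sum_distrib_right mult_ac)
  finally show "Op_pairing 1 t a phi = (\<integral>p. k p * phi p \<partial>lebesgue)" .
 qed
 then show ?thesis unfolding U_def by blast
qed

section \<open>Chains of derivatives and local bounds\<close>

text \<open>Derivatives of \<open>b\<close> up to order \<open>n\<close> in each coordinate direction of the first variable, bounded by \<open>F\<close>.\<close>

definition w_chain :: "nat => ('v::euclidean_space \<times> 'v => complex) => ('v \<times> 'v => real) => bool" where
 "w_chain n b F \<longleftrightarrow> continuous_on UNIV F & (\<exists>G. \<forall>e\<in>Basis. G e 0 = b &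
   (\<forall>k\<le>n. continuous_on UNIV (G e k) & (\<forall>p. norm (G e k p) <= F p)) &
   (\<forall>k<n. deriv_along (e, 0) (G e k) (G e (Suc k))))"

lemma integrable_box_mult:
 fixes f :: "'v::euclidean_space => real"
 assumes "continuous_on UNIV f"
 shows "integrable lborel (%w. indicator (cbox A B) w * f w)"
 using borel_integrable_compact[OF compact_cbox continuous_on_subset[OF assms subset_UNIV], of A B] by simp

lemma continuous_on_slice:
 fixes F :: "'v::euclidean_space \<times> 'v => 'b::topological_space"
 assumes "continuous_on UNIV F"
 shows "continuous_on S (%w. F (c + w, xi))"
 by (rule continuous_on_compose2[OF assms]) (auto intro!: continuous_intros)

lemma w_chain_expansion:
 assumes eps: "0 < eps" and n: "DIM('v::euclidean_space) < n"
 shows "\<exists>C>0. \<forall>(b :: 'v \<times> 'v => complex) F c xi. w_chain n b F -->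
  (\<forall>mu\<in>int_lattice. norm (fcoef eps (%w. b (c + w, xi)) mu) <= C * (1 + infnorm mu) powr (- real n) *
    (\<integral>w. indicator (kbox eps) w * F (c + w, xi) \<partial>lborel)) &
  (\<forall>w. (\<forall>e\<in>Basis. \<bar>w \<bullet> e\<bar> <= eps) -->
    ((%mu. fcoef eps (%w. b (c + w, xi)) mu * char (6 * eps) mu w) has_sum b (c + w, xi)) int_lattice)"
proof -
 obtain C where C: "0 < C" and C1: "!!(f::'v => complex) G mu. direction_chain (obox eps) n f G ==> mu \<in> int_lattice ==>
   norm (fcoef eps f mu) <= C * (1 + infnorm mu) powr (- real n) *
    (\<Sum>b\<in>Basis. \<Sum>k\<le>n. \<integral>w. indicator (kbox eps) w * norm (G b k w) \<partial>lborel)"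
  and C2: "!!(f::'v => complex) G w. direction_chain (obox eps) n f G ==> (\<forall>b\<in>Basis. \<bar>w \<bullet> b\<bar> <= eps) ==>
   ((%mu. fcoef eps f mu * char (6 * eps) mu w) has_sum f w) int_lattice"
  using fourier_expansion[OF eps n] by blast
 define C' where "C' = C * (DIM('v) * Suc n)"
 show ?thesis
 proof (intro exI[of _ C'] conjI allI impI ballI)
  show "0 < C'" unfolding C'_def using C by (auto intro!: mult_pos_pos add_pos_nonneg)
  fix b :: "'v \<times> 'v => complex" and F c xi assume "w_chain n b F"
  then obtain G where F: "continuous_on UNIV F" and G: "!!e. e \<in> Basis ==> G e 0 = b"
   "!!e k. e \<in> Basis ==> k <= n ==> continuous_on UNIV (G e k)" "!!e k p. e \<in> Basis ==> k <= n ==> norm (G e k p) <= F p"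
   "!!e k. e \<in> Basis ==> k < n ==> deriv_along (e, 0) (G e k) (G e (Suc k))"
   unfolding w_chain_def by blast
  have ch: "direction_chain (obox eps) n (%w. b (c + w, xi)) (%e k w. G e k (c + w, xi))"
   unfolding direction_chain_def
  proof (intro ballI conjI allI impI)
   fix e :: 'v and k p assume e: "e \<in> Basis"
   show "(%w. G e 0 (c + w, xi)) = (%w. b (c + w, xi))" by (simp add: G(1)[OF e])
   show "k <= n ==> continuous_on (obox eps) (%w. G e k (c + w, xi))"
    by (rule continuous_on_slice[OF G(2)[OF e]])
   assume "k < n"
   from G(4)[OF e this] have "((%s. G e k ((c + p, xi) + s *\<^sub>R (e, 0))) has_vector_derivative G e (Suc k) (c + p, xi)) (at 0)"
    unfolding deriv_along_def by blast
   then show "((%s. G e k (c + (p + s *\<^sub>R e), xi)) has_vector_derivative G e (Suc k) (c + p, xi)) (at 0)"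
    by (simp add: add.assoc)
  qed
  let ?I = "\<integral>w. indicator (kbox eps) w * F (c + w, xi) \<partial>lborel"
  show "norm (fcoef eps (%w. b (c + w, xi)) mu) <= C' * (1 + infnorm mu) powr (- real n) * ?I" if mu: "mu \<in> int_lattice" for mu
  proof -
   have "(\<Sum>e\<in>(Basis::'v set). \<Sum>k\<le>n. \<integral>w. indicator (kbox eps) w * norm (G e k (c + w, xi)) \<partial>lborel)
    <= (\<Sum>e\<in>(Basis::'v set). \<Sum>k\<le>n. ?I)"
   proof (intro sum_mono integral_mono integrable_box_mult)
    fix e :: 'v and k assume e: "e \<in> Basis" "k \<in> {..n}"
    show "continuous_on UNIV (%w. norm (G e k (c + w, xi)))" using e by (intro continuous_on_norm continuous_on_slice G(2)) auto
    show "continuous_on UNIV (%w. F (c + w, xi))" by (rule continuous_on_slice[OF F])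
    show "indicator (kbox eps) w * norm (G e k (c + w, xi)) <= indicator (kbox eps) w * F (c + w, xi)" for w
    using e by (intro mult_left_mono G(3)) auto
   qed
   also have "... = (DIM('v) * Suc n) * ?I" by (simp add: distrib_left)
   finally have "C * (1 + infnorm mu) powr (- real n) * (\<Sum>e\<in>(Basis::'v set). \<Sum>k\<le>n. \<integral>w. indicator (kbox eps) w * norm (G e k (c + w, xi)) \<partial>lborel)
    <= C * (1 + infnorm mu) powr (- real n) * ((DIM('v) * Suc n) * ?I)"
    using C by (intro mult_left_mono) auto
   from order_trans[OF C1[OF ch mu] this] show ?thesis unfolding C'_def by (simp only: mult.assoc mult.left_commute)
  qed
  show "((%mu. fcoef eps (%w. b (c + w, xi)) mu * char (6 * eps) mu w) has_sum b (c + w, xi)) int_lattice"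
   if "\<forall>e\<in>Basis. \<bar>w \<bullet> e\<bar> <= eps" for w by (rule C2[OF ch that])
 qed
qed

text \<open>A Sobolev inequality: the Fourier series at the centre of the box converges absolutely as \<open>n > d\<close>.\<close>

lemma w_chain_sup_bound:
 assumes n: "DIM('v::euclidean_space) < n"
 shows "\<exists>C>0. \<forall>(b :: 'v \<times> 'v => complex) F c xi. w_chain n b F -->
  norm (b (c, xi)) <= C * (\<integral>w. indicator (kbox 1) w * F (c + w, xi) \<partial>lborel)"
proof -
 obtain C where C: "0 < C" and C1: "!!(b :: 'v \<times> 'v => complex) F c xi mu. w_chain n b F ==> mu \<in> int_lattice ==>
   norm (fcoef 1 (%w. b (c + w, xi)) mu) <= C * (1 + infnorm mu) powr (- real n) * (\<integral>w. indicator (kbox 1) w * F (c + w, xi) \<partial>lborel)"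
  and C2: "!!(b :: 'v \<times> 'v => complex) F c xi w. w_chain n b F ==> (\<forall>e\<in>Basis. \<bar>w \<bullet> e\<bar> <= 1) ==>
    ((%mu. fcoef 1 (%w. b (c + w, xi)) mu * char (6 * 1) mu w) has_sum b (c + w, xi)) int_lattice"
  using w_chain_expansion[OF zero_less_one n] by blast
 define B where "B = (2 * (1 + 1 / (real n / DIM('v) - 1))) ^ DIM('v) * 1 ^ DIM('v)"
 have B: "0 < B" unfolding B_def using n by (intro mult_pos_pos zero_less_power add_pos_nonneg) auto
 have B1: "(\<Sum>mu\<in>T. (1 + infnorm mu) powr (- real n)) <= B" if "finite T" "T \<subseteq> int_lattice" for T :: "'v set"
  using finite_sum_lattice_weight_le[of "real n" 1 T] n that by (simp add: B_def)
 show ?thesis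
 proof (intro exI[of _ "C * B"] conjI allI impI)
  show "0 < C * B" using C B by simp
  fix b :: "'v \<times> 'v => complex" and F c xi assume ch: "w_chain n b F"
  let ?I = "\<integral>w. indicator (kbox 1) w * F (c + w, xi) \<partial>lborel"
  have "0 <= norm (b p)" for p by simp
  have F0: "0 <= F p" for p
  proof -
   obtain e :: 'v where "e \<in> Basis" using nonempty_Basis by blast
   then have "norm (b p) <= F p" using ch unfolding w_chain_def by (metis le0)
   then show ?thesis using norm_ge_zero order_trans by blast
  qed
  have I0: "0 <= ?I" by (intro Bochner_Integration.integral_nonneg) (simp add: F0)
  have "((%mu. fcoef 1 (%w. b (c + w, xi)) mu * char (6 * 1) mu 0) has_sum b (c + 0, xi)) int_lattice"
   by (rule C2[OF ch]) simp
  then have lim: "((%T. \<Sum>mu\<in>T. fcoef 1 (%w. b (c + w, xi)) mu * char (6 * 1) mu 0) \<longlongrightarrow> b (c, xi)) (finite_subsets_at_top int_lattice)"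
   by (simp add: has_sum_def)
  show "norm (b (c, xi)) <= C * B * ?I"
  proof (rule Lim_norm_ubound[OF finite_subsets_at_top_neq_bot lim], rule eventually_finite_subsets_at_top_weakI)
   fix T :: "'v set" assume T: "finite T" "T \<subseteq> int_lattice"
   have "norm (\<Sum>mu\<in>T. fcoef 1 (%w. b (c + w, xi)) mu * char (6 * 1) mu 0) <= (\<Sum>mu\<in>T. norm (fcoef 1 (%w. b (c + w, xi)) mu))"
    by (rule order_trans[OF norm_sum]) (simp add: norm_mult)
   also have "... <= (\<Sum>mu\<in>T. C * (1 + infnorm mu) powr (- real n) * ?I)"
    using T by (intro sum_mono C1[OF ch]) auto
   also have "... = C * ?I * (\<Sum>mu\<in>T. (1 + infnorm mu) powr (- real n))" by (simp add: sum_distrib_left sum_distrib_right mult_ac)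
   also have "... <= C * ?I * B" using B1[OF T] C I0 by (intro mult_left_mono) auto
   finally show "norm (\<Sum>mu\<in>T. fcoef 1 (%w. b (c + w, xi)) mu * char (6 * 1) mu 0) <= C * B * ?I" by (simp add: mult_ac)
  qed
 qed
qed

lemma step_bounds: "0 <= step x & step x <= 1"
 using flat_nonneg[of x] flat_nonneg[of "1 - x"] step_denominator_pos[of x] by (simp add: step_def divide_simps)

lemma plateau_bounds: "0 <= plateau eps w & plateau eps w <= 1"
 unfolding plateau_def using step_bounds by (auto intro!: prod_nonneg prod_le_1 mult_le_one)

lemma continuous_on_plateau: "continuous_on S (plateau eps)"
proof -
 have "continuous_on UNIV (%w. Re (complex_of_real (plateau eps w)))"
  by (intro continuous_on_Re smooth_continuous[OF smooth_plateau])
 then show ?thesis using continuous_on_subset by (simp, blast)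
qed

lemma dominated_of_w_chain:
 fixes b :: "'v::euclidean_space \<times> 'v => complex"
 assumes n: "DIM('v) < n" and ch: "w_chain n b F" and F: "integrable lborel F" and F0: "!!p. 0 <= F p"
 shows "dominated b"
 unfolding dominated_def
proof (intro conjI allI impI)
 obtain e :: 'v where "e \<in> Basis" using nonempty_Basis by blast
 then show "continuous_on UNIV b" using ch unfolding w_chain_def by (metis le0)
 have Fc: "continuous_on UNIV F" using ch by (simp add: w_chain_def)
 fix K :: "'v set" assume "compact K"
 then obtain R0 where R0: "!!w. w \<in> K ==> norm w <= R0" using compact_imp_bounded bounded_iff by metis
 obtain C where C: "0 < C" "!!c xi. norm (b (c, xi)) <= C * (\<integral>w. indicator (kbox 1) w * F (c + w, xi) \<partial>lborel)"
  using w_chain_sup_bound[OF n] ch by blast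
 define R where "R = max 0 R0 + 2"
 have R: "0 < R" by (simp add: R_def)
 define h where "h xi w = plateau R w * F (w, xi)" for xi w
 have hc: "continuous_on UNIV (%z. h (fst z) (snd z))"
  unfolding h_def by (intro continuous_on_mult continuous_on_compose2[OF continuous_on_plateau] continuous_on_compose2[OF Fc] continuous_intros) auto
 have h0: "h xi w = 0" if "w ~: kbox R" for xi w
 proof -
  obtain e :: 'v where "e \<in> Basis" "\<not> (- (2 * R) <= w \<bullet> e & w \<bullet> e <= 2 * R)" using \<open>w ~: kbox R\<close> by (auto simp: mem_box)
  then show ?thesis unfolding h_def using R by (subst plateau_zero[of R e]) auto
 qed
 have hn: "0 <= h xi w" for xi w using plateau_bounds[of R w] F0 by (simp add: h_def)
 have hsc: "continuous_on UNIV (h xi)" for xi by (rule continuous_on_param_slice[OF hc])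
 have hi: "integrable lborel (h xi)" for xi
 proof -
  have "h xi w = indicator (kbox R) w * h xi w" for w using h0[of w xi] by (cases "w \<in> kbox R") simp_all
  then have "h xi = (%w. indicator (kbox R) w * h xi w)" by (rule ext)
  then show ?thesis using integrable_box_mult[OF hsc[of xi]] by metis
 qed
 define M where "M xi = C * (\<integral>w. h xi w \<partial>lborel)" for xi
 show "\<exists>M. continuous_on UNIV M & (\<forall>xi. 0 <= M xi) & (\<forall>w\<in>K. \<forall>xi. norm (b (w, xi)) <= M xi) & integrable lborel M"
 proof (intro exI[of _ M] conjI allI ballI)
  show "continuous_on UNIV M" unfolding M_def
   by (intro continuous_on_mult continuous_on_const continuous_on_integral_param[OF hc h0])
  show "0 <= M xi" for xi unfolding M_def using C(1) hn by (intro mult_nonneg_nonneg Bochner_Integration.integral_nonneg) auto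
  show "norm (b (c, xi)) <= M xi" if c: "c \<in> K" for c xi
  proof -
   have "(\<integral>w. indicator (kbox 1) w * F (c + w, xi) \<partial>lborel) <= (\<integral>w. h xi (w + c) \<partial>lborel)"
   proof (rule integral_mono[OF integrable_box_mult[OF continuous_on_slice[OF Fc]]])
    show "integrable lborel (%w. h xi (w + c))"
    proof -
    have A: "continuous_on UNIV (%w. h xi (w + c))" by (rule continuous_on_compose2[OF hsc[of xi] continuous_on_add[OF continuous_on_id continuous_on_const]]) simp
    have B: "(%w. indicator (cbox (- ((2 * R) *\<^sub>R One) - c) ((2 * R) *\<^sub>R One - c)) w * h xi (w + c)) = (%w. h xi (w + c))"
    proof
    fix w
    have "w + c \<in> kbox R ==> w \<in> cbox (- ((2 * R) *\<^sub>R One) - c) ((2 * R) *\<^sub>R One - c)"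
    by (auto simp: mem_box inner_add_left inner_diff_left le_diff_eq diff_le_eq)
    then show "indicator (cbox (- ((2 * R) *\<^sub>R One) - c) ((2 * R) *\<^sub>R One - c)) w * h xi (w + c) = h xi (w + c)"
    using h0[of "w + c" xi] by (cases "w + c \<in> kbox R") simp_all
    qed
    show ?thesis using integrable_box_mult[OF A, of "- ((2 * R) *\<^sub>R One) - c" "(2 * R) *\<^sub>R One - c"] unfolding B .
    qed
    fix w :: 'v
    show "indicator (kbox 1) w * F (c + w, xi) <= h xi (w + c)"
    proof (cases "w \<in> kbox 1")
    case True
    have "plateau R (w + c) = 1"
    proof (rule plateau_one[OF R])
    fix e :: 'v assume e: "e \<in> Basis"
    have "\<bar>w \<bullet> e\<bar> <= 2" using True e by (auto simp: mem_box abs_le_iff dest!: bspec)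
    moreover have "\<bar>c \<bullet> e\<bar> <= R0" using Basis_le_norm[OF e, of c] R0[OF c] by simp
    ultimately show "\<bar>(w + c) \<bullet> e\<bar> <= R" by (simp add: inner_add_left R_def)
    qed
    then show ?thesis using True by (simp add: h_def add.commute)
    qed (simp add: hn)
   qed
   also have "... = (\<integral>w. h xi w \<partial>lborel)" by (rule lborel_integral_translate[OF borel_measurable_continuous_onI[OF hsc[of xi]]])
   finally have "C * (\<integral>w. indicator (kbox 1) w * F (c + w, xi) \<partial>lborel) <= M xi"
    unfolding M_def using C(1) by (intro mult_left_mono) auto
   then show ?thesis using C(2) order_trans by blast
  qed
  have pa: "\<bar>plateau R w\<bar> <= 1" for w :: 'v using plateau_bounds[of R w] by simp
  have "integrable (lborel \<Otimes>\<^sub>M lborel) (%(w, xi). h xi w)"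
  proof (rule Bochner_Integration.integrable_bound)
   show "integrable (lborel \<Otimes>\<^sub>M lborel) F" using F by (simp add: lborel_prod)
   have "continuous_on UNIV (%p. h (snd p) (fst p))"
    unfolding h_def by (intro continuous_on_mult continuous_on_compose2[OF continuous_on_plateau] continuous_on_compose2[OF Fc] continuous_intros) auto
   from borel_measurable_continuous_onI[OF this]
   show "(%(w, xi). h xi w) \<in> borel_measurable (lborel \<Otimes>\<^sub>M lborel)" by (simp add: lborel_prod case_prod_beta')
   show "AE p in lborel \<Otimes>\<^sub>M lborel. norm (case p of (w, xi) => h xi w) <= norm (F p)"
    using pa F0 by (intro AE_I2) (auto simp: h_def abs_mult abs_of_nonneg intro!: mult_left_le_one_le split: prod.split)
  qed
  from lborel_pair.integrable_snd[OF this] show "integrable lborel M"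
   unfolding M_def by (intro integrable_mult_right)
 qed
qed

section \<open>Derivatives of symbols\<close>

lemma cont_deriv_ConsD:
 assumes "cont_deriv (e # es) f"
 shows "deriv_along e (iter_deriv es f) (iter_deriv (e # es) f)" "continuous_on UNIV (iter_deriv (e # es) f)"
proof -
 show "continuous_on UNIV (iter_deriv (e # es) f)" using assms by (simp add: cont_deriv_def)
 have "iter_deriv (e # es) f = dir_deriv e (iter_deriv es f)" by (simp add: iter_deriv_def)
 then show "deriv_along e (iter_deriv es f) (iter_deriv (e # es) f)"
  using assms by (simp add: cont_deriv_def differentiable_deriv_along)
qed

lemma finite_basis_lists: "finite (basis_lists k :: 'v::euclidean_space list set)"
proof -
 have "basis_lists k = {xs. set xs \<subseteq> (Basis :: 'v set) & length xs = k}" by (auto simp: basis_lists_def)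
 then show ?thesis using finite_lists_length_eq[OF finite_Basis[where 'a='v], of k] by simp
qed

lemma norm_iter_deriv_le:
 fixes a :: "'v::euclidean_space \<times> 'v => complex"
 assumes "bs \<in> basis_lists k" "cs \<in> basis_lists m" "k <= n"
 shows "norm (iter_deriv (mixed_dirs bs cs) a p) <= F_circ n m a p"
proof -
 have "norm (iter_deriv (mixed_dirs bs cs) a p) = sqrt ((norm (iter_deriv (mixed_dirs bs cs) a p))\<^sup>2)" by simp
 also have "... <= mixed_deriv_norm k m a p"
  unfolding mixed_deriv_norm_def
 proof (rule real_sqrt_le_mono)
  have "(norm (iter_deriv (mixed_dirs bs cs) a p))\<^sup>2 <= (\<Sum>cs\<in>basis_lists m. (norm (iter_deriv (mixed_dirs bs cs) a p))\<^sup>2)"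
   by (rule member_le_sum[OF assms(2)]) (simp_all add: finite_basis_lists)
  also have "... <= (\<Sum>bs\<in>basis_lists k. \<Sum>cs\<in>basis_lists m. (norm (iter_deriv (mixed_dirs bs cs) a p))\<^sup>2)"
   by (rule member_le_sum[OF assms(1)]) (simp_all add: finite_basis_lists sum_nonneg)
  finally show "(norm (iter_deriv (mixed_dirs bs cs) a p))\<^sup>2 <= ..." .
 qed
 also have "... <= F_circ n m a p"
  unfolding F_circ_def using assms(3)
  by (intro member_le_sum[of k "{..n}" "%k. mixed_deriv_norm k m a p"]) (auto simp: mixed_deriv_norm_def intro!: sum_nonneg)
 finally show ?thesis .
qed

lemma continuous_on_F_circ:
 assumes "!!k. k <= n ==> symbol_cont_derivs k m a"
 shows "continuous_on UNIV (F_circ n m a)"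
proof -
 have "continuous_on UNIV (iter_deriv (mixed_dirs bs cs) a)" if "k <= n" "bs \<in> basis_lists k" "cs \<in> basis_lists m" for k bs cs
  using assms[OF that(1)] that(2,3) by (simp add: symbol_cont_derivs_def cont_deriv_def)
 then show ?thesis
  unfolding F_circ_def[abs_def] mixed_deriv_norm_def by (intro continuous_intros) auto
qed

lemma F_circ_nonneg: "0 <= F_circ n m a p"
 unfolding F_circ_def mixed_deriv_norm_def by (intro sum_nonneg real_sqrt_ge_zero) simp

lemma F_circ_le_F_full: "l <= m ==> F_circ n l a p <= F_full n m a p"
 unfolding F_full_def by (intro member_le_sum[of l "{..m}" "%l. F_circ n l a p"]) (auto simp: F_circ_nonneg)

lemma w_chain_iter_deriv:
 assumes s: "!!k. k <= n ==> symbol_cont_derivs k m a" and cs: "cs \<in> basis_lists m"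
  and F: "continuous_on UNIV F" "!!p. F_circ n m a p <= F p"
 shows "w_chain n (iter_deriv (mixed_dirs [] cs) a) F"
 unfolding w_chain_def
proof (intro conjI F(1) exI[of _ "%e k. iter_deriv (mixed_dirs (replicate k e) cs) a"] ballI allI impI)
 fix e :: 'a and k p assume e: "e \<in> Basis"
 have bl: "replicate k e \<in> basis_lists k" for k using e by (auto simp: basis_lists_def)
 have cd: "cont_deriv (mixed_dirs (replicate k e) cs) a" if "k <= n" for k
  using s[OF that] bl[of k] cs by (simp add: symbol_cont_derivs_def)
 show "iter_deriv (mixed_dirs (replicate 0 e) cs) a = iter_deriv (mixed_dirs [] cs) a" by simp
 show "k <= n ==> continuous_on UNIV (iter_deriv (mixed_dirs (replicate k e) cs) a)"
  using cd[of k] by (simp add: cont_deriv_def)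
 show "k <= n ==> norm (iter_deriv (mixed_dirs (replicate k e) cs) a p) <= F p"
  using norm_iter_deriv_le[OF bl cs] F(2) order_trans by blast
 assume "k < n"
 then have "cont_deriv ((e, 0) # mixed_dirs (replicate k e) cs) a" using cd[of "Suc k"] by (simp add: mixed_dirs_def)
 from cont_deriv_ConsD(1)[OF this]
 show "deriv_along (e, 0) (iter_deriv (mixed_dirs (replicate k e) cs) a) (iter_deriv (mixed_dirs (replicate (Suc k) e) cs) a)"
  by (simp add: mixed_dirs_def)
qed

abbreviation xi_deriv :: "('v::euclidean_space \<times> 'v => complex) => 'v list => 'v \<times> 'v => complex" where
 "xi_deriv a cs \<equiv> iter_deriv (mixed_dirs [] cs) a"

lemma growth_xi_deriv:
 assumes s: "!!l. l <= m ==> symbol_cont_derivs 0 l a" and top: "!!cs. cs \<in> basis_lists m ==> growth (xi_deriv a cs)"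
  and l: "l <= m" and cs: "cs \<in> basis_lists l"
 shows "growth (xi_deriv a cs)"
 using l cs
proof (induction l arbitrary: cs rule: inc_induct)
 case base
 then show ?case by (rule top)
next
 case (step l)
 have cd: "cont_deriv (mixed_dirs [] cs) a" if "cs \<in> basis_lists l" "l <= m" for cs l
  using s[OF that(2)] that(1) by (simp add: symbol_cont_derivs_def basis_lists_def)
 have c: "i # cs \<in> basis_lists (Suc l)" if "i \<in> Basis" for i
  using step.prems that by (auto simp: basis_lists_def)
 have eq: "mixed_dirs [] (i # cs) = (0, i) # mixed_dirs [] cs" for i by (simp add: mixed_dirs_def)
 have cd2: "cont_deriv ((0, i) # mixed_dirs [] cs) a" if "i \<in> Basis" for i
  using cd[OF c[OF that]] step.hyps by (simp add: eq)
 show ?case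
 proof (rule growth_antideriv[where a' = "%i. xi_deriv a (i # cs)"])
  show "continuous_on UNIV (xi_deriv a cs)" using cd[OF step.prems] step.hyps by (simp add: cont_deriv_def)
  fix i :: 'a assume i: "i \<in> Basis"
  show "deriv_along (0, i) (xi_deriv a cs) (xi_deriv a (i # cs))" "continuous_on UNIV (xi_deriv a (i # cs))"
   using cont_deriv_ConsD[OF cd2[OF i]] by (simp_all add: eq)
  show "growth (xi_deriv a (i # cs))" by (rule step.IH[OF c[OF i]])
 qed
qed

text \<open>Derivatives of order \<open>m\<close> in \<open>xi\<close> are dominated; growth of the lower ones follows by descending induction
 on the order.\<close>

lemma symbol_chains:
 fixes a :: "'v::euclidean_space \<times> 'v => complex"
 assumes n: "DIM('v) < n"
  and s0: "!!l. l <= m ==> symbol_cont_derivs 0 l a" and sm: "!!k. k <= n ==> symbol_cont_derivs k m a"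
  and F: "continuous_on UNIV F" "!!p. F_circ n m a p <= F p" "integrable lborel F" and i: "i \<in> Basis"
 shows "xi_chain m i (%l. xi_deriv a (replicate l i))" "dominated (xi_deriv a (replicate m i))"
  "w_chain n (xi_deriv a (replicate m i)) F"
proof -
 have F0: "0 <= F p" for p using F(2)[of p] F_circ_nonneg[of n m a p] by linarith
 have bl: "replicate l i \<in> basis_lists l" for l using i by (auto simp: basis_lists_def)
 have dom: "dominated (xi_deriv a cs)" if "cs \<in> basis_lists m" for cs
  by (rule dominated_of_w_chain[OF n w_chain_iter_deriv[OF sm that F(1,2)] F(3) F0])
 show "dominated (xi_deriv a (replicate m i))" by (rule dom[OF bl])
 show "w_chain n (xi_deriv a (replicate m i)) F" by (rule w_chain_iter_deriv[OF sm bl F(1,2)])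
 have cd: "cont_deriv (mixed_dirs [] (replicate l i)) a" if "l <= m" for l
  using s0[OF that] bl[of l] by (simp add: symbol_cont_derivs_def basis_lists_def)
 show "xi_chain m i (%l. xi_deriv a (replicate l i))"
  unfolding xi_chain_def
 proof (intro conjI allI impI)
  fix l
  show "l <= m ==> continuous_on UNIV (xi_deriv a (replicate l i))" using cd by (simp add: cont_deriv_def)
  show "l <= m ==> growth (xi_deriv a (replicate l i))"
   by (rule growth_xi_deriv[OF s0 dominated_growth[OF dom] _ bl])
  assume "l < m"
  then have "cont_deriv ((0, i) # mixed_dirs [] (replicate l i)) a" using cd[of "Suc l"] by (simp add: mixed_dirs_def)
  from cont_deriv_ConsD(1)[OF this]
  show "deriv_along (0, i) (xi_deriv a (replicate l i)) (xi_deriv a (replicate (Suc l) i))" by (simp add: mixed_dirs_def)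
 qed
qed

section \<open>Lattice sums of a continuous weight\<close>

abbreviation cube_mass :: "('v::euclidean_space => real) => 'v => real" where
 "cube_mass F u \<equiv> \<integral>p. indicator (unit_cube u) p * F p \<partial>lborel"

lemma cube_norm_1:
 fixes F :: "'v::euclidean_space => real"
 assumes F: "continuous_on UNIV F" "!!p. 0 <= F p"
 shows "cube_norm 1 F u = cube_mass F u"
proof -
 have m: "(%p. indicator (unit_cube u) p * F p) \<in> borel_measurable lborel"
  unfolding unit_cube_def by (rule borel_measurable_integrable[OF integrable_box_mult[OF F(1)]])
 have "0 <= cube_mass F u" by (intro Bochner_Integration.integral_nonneg) (simp add: F)
 moreover have "(\<integral>p. indicator (unit_cube u) p *\<^sub>R (norm (F p) powr 1) \<partial>lebesgue) = cube_mass F u"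
  using integral_completion[OF m] by (simp add: F)
 ultimately show ?thesis by (simp add: cube_norm_def set_lebesgue_integral_def)
qed

lemma cube_cover: obtains u :: "'v::euclidean_space" where "u \<in> int_lattice" "p \<in> unit_cube u"
proof
 define u where "u = (\<Sum>b\<in>Basis. of_int (round (p \<bullet> b)) *\<^sub>R b)"
 have ub: "u \<bullet> b = of_int (round (p \<bullet> b))" if "b \<in> Basis" for b
  using that by (simp add: u_def)
 show "u \<in> int_lattice" by (simp add: int_lattice_def ub)
 show "p \<in> unit_cube u"
  unfolding unit_cube_def mem_box
 proof
  fix b :: 'v assume b: "b \<in> Basis"
  have "\<bar>of_int (round (p \<bullet> b)) - p \<bullet> b\<bar> <= 1 / 2" by (rule of_int_round_abs_le)
  then show "(u - (1/2) *\<^sub>R One) \<bullet> b <= p \<bullet> b & p \<bullet> b <= (u + (1/2) *\<^sub>R One) \<bullet> b"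
   using b by (simp only: abs_diff_le_iff) (simp add: inner_diff_left inner_add_left ub)
 qed
qed

lemma finite_sum_cube_mass_le:
 fixes F :: "'v::euclidean_space => real"
 assumes F: "continuous_on UNIV F" "!!p. 0 <= F p" and q: "0 < q" and L: "in_lattice_space 1 q F"
  and N: "finite N" "N \<subseteq> int_lattice"
 shows "(\<Sum>u\<in>N. cube_mass F u powr q) <= lattice_norm 1 q F powr q"
proof -
 have s: "(%u. cube_mass F u powr q) summable_on int_lattice"
  using L by (simp add: in_lattice_space_def cube_norm_1[OF F])
 have n: "0 <= (\<Sum>\<^sub>\<infinity>u\<in>int_lattice. cube_mass F u powr q)" by (rule infsum_nonneg) simp
 have "(\<Sum>u\<in>N. cube_mass F u powr q) <= (\<Sum>\<^sub>\<infinity>u\<in>int_lattice. cube_mass F u powr q)"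
  by (rule finite_sum_le_infsum[OF s N]) simp
 also have "... = lattice_norm 1 q F powr q"
  using q n by (simp add: lattice_norm_def cube_norm_1[OF F] powr_powr)
 finally show ?thesis .
qed

text \<open>For \<open>q <= 1\<close> summability of the \<open>q\<close>-th powers of the cube masses implies that of the masses themselves.\<close>

lemma integrable_of_lattice_space:
 fixes F :: "'v::euclidean_space => real"
 assumes F: "continuous_on UNIV F" "!!p. 0 <= F p" and q: "0 < q" "q <= 1" and L: "in_lattice_space 1 q F"
 shows "integrable lborel F"
proof -
 obtain e :: "nat => 'v" where e: "bij_betw e UNIV int_lattice"
  using bij_betw_from_nat_into[OF countable_int_lattice infinite_int_lattice] by blast
 have J0: "0 <= cube_mass F u" for u by (intro Bochner_Integration.integral_nonneg) (simp add: F)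
 have "summable (%i. cube_mass F (e i) powr q)"
 proof (rule summableI_nonneg_bounded)
  fix k
  have "inj_on e {..<k}" using bij_betw_imp_inj_on[OF e] by (rule inj_on_subset) simp
  then have "(\<Sum>i<k. cube_mass F (e i) powr q) = (\<Sum>u\<in>e ` {..<k}. cube_mass F u powr q)" by (simp add: sum.reindex)
  also have "... <= lattice_norm 1 q F powr q"
   using bij_betw_imp_surj_on[OF e] by (intro finite_sum_cube_mass_le[OF F q(1) L]) auto
  finally show "(\<Sum>i<k. cube_mass F (e i) powr q) <= lattice_norm 1 q F powr q" .
 qed simp
 from summable_of_summable_powr[OF q _ this]
 have S: "summable (%i. cube_mass F (e i))" by (simp add: J0)
 have Fm: "F \<in> borel_measurable lborel" using borel_measurable_continuous_onI[OF F(1)] by simp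
 have Ji: "integrable lborel (%p. indicator (unit_cube (e i)) p * F p)" for i
  unfolding unit_cube_def by (rule integrable_box_mult[OF F(1)])
 show ?thesis
 proof (rule integrableI_nonneg[OF Fm])
  have "(\<integral>\<^sup>+p. ennreal (F p) \<partial>lborel) <= (\<integral>\<^sup>+p. (\<Sum>i. ennreal (indicator (unit_cube (e i)) p * F p)) \<partial>lborel)"
  proof (rule nn_integral_mono)
   fix p :: 'v
   obtain u where u: "u \<in> int_lattice" "p \<in> unit_cube u" by (rule cube_cover)
   then have "u \<in> range e" using bij_betw_imp_surj_on[OF e] by simp
   then obtain i where i: "e i = u" by auto
   have "ennreal (F p) = (\<Sum>j\<in>{i}. ennreal (indicator (unit_cube (e j)) p * F p))" using u i by simp
   also have "... <= (\<Sum>i. ennreal (indicator (unit_cube (e i)) p * F p))" by (rule sum_le_suminf) auto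
   finally show "ennreal (F p) <= (\<Sum>i. ennreal (indicator (unit_cube (e i)) p * F p))" .
  qed
  also have "... = (\<Sum>i. \<integral>\<^sup>+p. ennreal (indicator (unit_cube (e i)) p * F p) \<partial>lborel)"
   by (intro nn_integral_suminf measurable_compose[OF borel_measurable_integrable[OF Ji] measurable_ennreal])
  also have "... = (\<Sum>i. ennreal (cube_mass F (e i)))"
   by (rule arg_cong[of _ _ suminf], rule ext, rule nn_integral_eq_integral[OF Ji]) (simp add: F)
  also have "... = ennreal (\<Sum>i. cube_mass F (e i))" by (rule suminf_ennreal2[OF J0 S])
  also have "... < \<infinity>" by simp
  finally show "(\<integral>\<^sup>+p. ennreal (F p) \<partial>lborel) < \<infinity>" .
 qed (simp add: F)
qed

section \<open>Fourier expansion of the phase factor\<close>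

text \<open>The \<open>k\<close>-th derivative of \<open>F 0 * H 0\<close>, when \<open>F i\<close> and \<open>H i\<close> are the \<open>i\<close>-th derivatives; the recursion
 avoids binomial coefficients.\<close>

fun leibniz :: "nat => (nat => 'v => complex) => (nat => 'v => complex) => 'v => complex" where
 "leibniz 0 F H = (%z. F 0 z * H 0 z)"
| "leibniz (Suc k) F H = (%z. leibniz k (%i. F (Suc i)) H z + leibniz k F (%i. H (Suc i)) z)"

definition chain_on :: "'v::real_normed_vector set => 'v => (nat => 'v => complex) => bool" where
 "chain_on O' b F \<longleftrightarrow> (\<forall>k. continuous_on O' (F k) &
   (\<forall>p\<in>O'. ((%s. F k (p + s *\<^sub>R b)) has_vector_derivative F (Suc k) p) (at 0)))"

lemma chain_on_shift: "chain_on O' b F ==> chain_on O' b (%i. F (Suc i))"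
 by (simp add: chain_on_def)

lemma continuous_on_leibniz:
 "chain_on O' b F ==> chain_on O' b H ==> continuous_on O' (leibniz k F H)"
proof (induction k arbitrary: F H)
 case 0
 then show ?case by (simp add: chain_on_def continuous_on_mult)
next
 case (Suc k)
 then show ?case by (simp add: continuous_on_add chain_on_shift)
qed

lemma leibniz_deriv:
 assumes "p \<in> O'"
 shows "chain_on O' b F ==> chain_on O' b H ==>
  ((%s. leibniz k F H (p + s *\<^sub>R b)) has_vector_derivative leibniz (Suc k) F H p) (at 0)"
proof (induction k arbitrary: F H)
 case 0
 then have "((%s. F 0 (p + s *\<^sub>R b)) has_vector_derivative F (Suc 0) p) (at 0)"
  "((%s. H 0 (p + s *\<^sub>R b)) has_vector_derivative H (Suc 0) p) (at 0)"
  using assms by (simp_all add: chain_on_def)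
 from has_vector_derivative_mult[OF this] show ?case by (simp add: add.commute)
next
 case (Suc k)
 from has_vector_derivative_add[OF Suc.IH[OF chain_on_shift[OF Suc.prems(1)] Suc.prems(2)]
   Suc.IH[OF Suc.prems(1) chain_on_shift[OF Suc.prems(2)]]]
 show ?case by simp
qed

lemma norm_leibniz_le:
 assumes "0 <= A" "0 <= B"
 shows "(!!i. i <= k ==> norm (F i z) <= A) ==> (!!i. i <= k ==> norm (H i z) <= B) ==> norm (leibniz k F H z) <= 2 ^ k * (A * B)"
proof (induction k arbitrary: F H)
 case 0
 then show ?case using assms by (simp add: norm_mult mult_mono)
next
 case (Suc k)
 have "norm (leibniz k (%i. F (Suc i)) H z) <= 2 ^ k * (A * B)" by (rule Suc.IH) (use Suc.prems in auto)
 moreover have "norm (leibniz k F (%i. H (Suc i)) z) <= 2 ^ k * (A * B)" by (rule Suc.IH) (use Suc.prems in auto)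
 ultimately show ?case using norm_triangle_ineq[of "leibniz k (%i. F (Suc i)) H z" "leibniz k F (%i. H (Suc i)) z"] by simp
qed

text \<open>The phase \<open>e^(i z eta)\<close> together with the factor \<open>(1 + rho z\<^sub>j)^(-m)\<close> left over from dividing by
 \<open>(x - y)\<^sub>j ^ m\<close>.\<close>

definition phase :: "real => 'v::euclidean_space => nat => 'v => 'v => complex" where
 "phase rho j m eta z = cis (z \<bullet> eta) * of_real (inverse (1 + rho * (z \<bullet> j)) ^ m)"

lemma chain_on_cis: "chain_on O' b (%k z. (\<i> * of_real (b \<bullet> eta)) ^ k * cis (z \<bullet> eta))"
 unfolding chain_on_def
proof (intro allI conjI ballI)
 fix k and p :: 'a
 show "continuous_on O' (%z. (\<i> * of_real (b \<bullet> eta)) ^ k * cis (z \<bullet> eta))"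
  by (intro continuous_on_mult continuous_on_const continuous_on_compose2[OF continuous_on_cis[OF continuous_on_id]] continuous_intros) auto
 have "((%s. (\<i> * of_real (b \<bullet> eta)) ^ k * exp (\<i> * of_real (p \<bullet> eta) + \<i> * of_real (b \<bullet> eta) * s)) has_field_derivative
   (\<i> * of_real (b \<bullet> eta)) ^ Suc k * cis (p \<bullet> eta)) (at (of_real 0))"
  by (auto intro!: derivative_eq_intros simp: cis_conv_exp)
 from has_vector_derivative_real_field[OF this]
 show "((%s. (\<i> * of_real (b \<bullet> eta)) ^ k * cis ((p + s *\<^sub>R b) \<bullet> eta)) has_vector_derivative
   (\<i> * of_real (b \<bullet> eta)) ^ Suc k * cis (p \<bullet> eta)) (at 0)"
  by (simp add: cis_conv_exp inner_add_left distrib_left mult_ac)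
qed

lemma chain_on_inverse_power:
 fixes j b :: "'v::euclidean_space"
 assumes nz: "!!z. z \<in> O' ==> 1 + rho * (z \<bullet> j) ~= 0"
 shows "chain_on O' b (%k z. complex_of_real ((- (rho * (b \<bullet> j))) ^ k * pochhammer (real m) k * inverse (1 + rho * (z \<bullet> j)) ^ (m + k)))"
 unfolding chain_on_def
proof (intro allI conjI ballI)
 fix k and p :: 'v
 show "continuous_on O' (%z. complex_of_real ((- (rho * (b \<bullet> j))) ^ k * pochhammer (real m) k * inverse (1 + rho * (z \<bullet> j)) ^ (m + k)))"
  using nz by (intro continuous_intros) auto
 assume p: "p \<in> O'"
 define u r where "u = 1 + rho * (p \<bullet> j)" and "r = rho * (b \<bullet> j)"
 have u: "u ~= 0" using nz[OF p] by (simp add: u_def)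
 have inv: "((%s. inverse (u + s * r)) has_real_derivative - (r * inverse u ^ 2)) (at 0)"
  using u by (auto intro!: derivative_eq_intros simp: power2_eq_square field_simps)
 have "((%s. inverse (u + s * r) ^ N) has_real_derivative - real N * r * inverse u ^ Suc N) (at 0)" for N
 proof (cases N)
  case (Suc N')
  have "((%s. inverse (u + s * r) ^ N) has_real_derivative real N * (- (r * inverse u ^ 2) * inverse (u + 0 * r) ^ (N - 1))) (at 0)"
   using DERIV_power[OF inv, of N] by simp
  then show ?thesis by (rule DERIV_cong) (simp add: Suc power2_eq_square algebra_simps)
 qed simp
 from DERIV_cmult[OF this, of "(- r) ^ k * pochhammer (real m) k" "m + k"]
 have "((%s. (- r) ^ k * pochhammer (real m) k * inverse (u + s * r) ^ (m + k)) has_real_derivative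
   (- r) ^ Suc k * pochhammer (real m) (Suc k) * inverse u ^ (m + Suc k)) (at 0)"
  by (simp add: pochhammer_Suc algebra_simps)
 then have "((%s. complex_of_real ((- r) ^ k * pochhammer (real m) k * inverse (u + s * r) ^ (m + k))) has_vector_derivative
   complex_of_real ((- r) ^ Suc k * pochhammer (real m) (Suc k) * inverse u ^ (m + Suc k))) (at 0)"
  by (intro has_vector_derivative_of_real) (simp add: has_real_derivative_iff_has_vector_derivative)
 moreover have "u + s * r = 1 + rho * ((p + s *\<^sub>R b) \<bullet> j)" for s
  by (simp add: u_def r_def inner_add_left algebra_simps)
 ultimately show "((%s. complex_of_real ((- (rho * (b \<bullet> j))) ^ k * pochhammer (real m) k * inverse (1 + rho * ((p + s *\<^sub>R b) \<bullet> j)) ^ (m + k))) has_vector_derivative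
   complex_of_real ((- (rho * (b \<bullet> j))) ^ Suc k * pochhammer (real m) (Suc k) * inverse (1 + rho * (p \<bullet> j)) ^ (m + Suc k))) (at 0)"
  by (simp only: u_def r_def)
qed

lemma phase_denominator:
 assumes "j \<in> Basis" "0 < eps" "\<bar>rho\<bar> * (6 * eps) <= 1" "z \<in> obox eps"
 shows "1 / 2 <= 1 + rho * (z \<bullet> j)"
proof -
 have "\<bar>z \<bullet> j\<bar> <= 3 * eps" using assms(1,4) by (auto simp: mem_box abs_le_iff dest!: bspec)
 then have "\<bar>rho * (z \<bullet> j)\<bar> <= \<bar>rho\<bar> * (3 * eps)" by (simp add: abs_mult mult_left_mono)
 then show ?thesis using assms(3) by linarith
qed

lemma pochhammer_real_nonneg: "0 <= pochhammer (real m) k"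
 using pochhammer_of_nat[of m k, where 'a = real] by simp

text \<open>The constant is uniform in \<open>rho\<close> and \<open>eta\<close> because \<open>1 + rho z\<^sub>j \<ge> 1 / 2\<close> on \<open>obox eps\<close> and all derivatives of
 the phase are bounded for bounded \<open>rho\<close> and \<open>eta\<close>.\<close>

lemma phase_expansion:
 assumes eps: "0 < eps" and n: "DIM('v::euclidean_space) < n"
 shows "\<exists>C>0. \<forall>(j::'v)\<in>Basis. \<forall>rho eta. \<bar>rho\<bar> * (6 * eps) <= 1 --> (\<forall>b\<in>Basis. \<bar>eta \<bullet> b\<bar> <= 1) -->
  (\<forall>nu\<in>int_lattice. norm (fcoef eps (phase rho j m eta) nu) <= C * (1 + infnorm nu) powr (- real n)) &
  (\<forall>z. (\<forall>b\<in>Basis. \<bar>z \<bullet> b\<bar> <= eps) -->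
    ((%nu. fcoef eps (phase rho j m eta) nu * char (6 * eps) nu z) has_sum phase rho j m eta z) int_lattice)"
proof -
 obtain C where C: "0 < C" and C1: "!!(f::'v => complex) G mu. direction_chain (obox eps) n f G ==> mu \<in> int_lattice ==>
   norm (fcoef eps f mu) <= C * (1 + infnorm mu) powr (- real n) *
    (\<Sum>b\<in>Basis. \<Sum>k\<le>n. \<integral>w. indicator (kbox eps) w * norm (G b k w) \<partial>lborel)"
  and C2: "!!(f::'v => complex) G w. direction_chain (obox eps) n f G ==> (\<forall>b\<in>Basis. \<bar>w \<bullet> b\<bar> <= eps) ==>
   ((%mu. fcoef eps f mu * char (6 * eps) mu w) has_sum f w) int_lattice"
  using fourier_expansion[OF eps n] by blast
 define B where "B = (\<Sum>k\<le>n. (1 / (6 * eps)) ^ k * pochhammer (real m) k * 2 ^ (m + k))"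
 have Bt: "0 <= (1 / (6 * eps)) ^ k * pochhammer (real m) k * 2 ^ (m + k)" for k
  using eps by (intro mult_nonneg_nonneg pochhammer_real_nonneg) auto
 have B0: "0 <= B" unfolding B_def by (intro sum_nonneg Bt)
 define A where "A = (\<Sum>b\<in>(Basis::'v set). \<Sum>k\<le>n. \<integral>w. indicator (kbox eps) (w::'v) * (2 ^ n * B) \<partial>lborel)"
 have A0: "0 <= A" unfolding A_def using B0 by (intro sum_nonneg Bochner_Integration.integral_nonneg) auto
 have kobox: "kbox eps \<subseteq> (obox eps :: 'v set)" using eps by (auto simp: mem_box dest!: bspec)
 show ?thesis
 proof (intro exI[of _ "C * A + 1"] conjI ballI allI impI)
  show "0 < C * A + 1" using C A0 by (intro add_nonneg_pos) auto
  fix j eta :: 'v and rho assume j: "j \<in> Basis" and rho: "\<bar>rho\<bar> * (6 * eps) <= 1" and eta: "\<forall>b\<in>Basis. \<bar>eta \<bullet> b\<bar> <= 1"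
  define F where "F b k z = (\<i> * of_real (b \<bullet> eta)) ^ k * cis (z \<bullet> eta)" for b :: 'v and k and z :: 'v
  define H where "H b k z = complex_of_real ((- (rho * (b \<bullet> j))) ^ k * pochhammer (real m) k * inverse (1 + rho * (z \<bullet> j)) ^ (m + k))" for b :: 'v and k and z :: 'v
  define G where "G b k = leibniz k (F b) (H b)" for b :: 'v and k
  have den: "1 / 2 <= 1 + rho * (z \<bullet> j)" if "z \<in> obox eps" for z by (rule phase_denominator[OF j eps rho that])
  have Fc: "chain_on (obox eps) b (F b)" for b unfolding F_def by (rule chain_on_cis)
  have Hc: "chain_on (obox eps) b (H b)" for b unfolding H_def by (rule chain_on_inverse_power) (use den in force)
  have ch: "direction_chain (obox eps) n (phase rho j m eta) G"
   unfolding direction_chain_def G_def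
  proof (intro ballI conjI allI impI)
   fix b p :: 'v and k
   show "leibniz 0 (F b) (H b) = phase rho j m eta" by (simp add: F_def H_def phase_def fun_eq_iff)
   show "continuous_on (obox eps) (leibniz k (F b) (H b))" by (rule continuous_on_leibniz[OF Fc Hc])
   assume "p \<in> obox eps"
   then show "((%s. leibniz k (F b) (H b) (p + s *\<^sub>R b)) has_vector_derivative leibniz (Suc k) (F b) (H b) p) (at 0)"
    by (rule leibniz_deriv[OF _ Fc Hc])
  qed
  have Gb: "norm (G b k z) <= 2 ^ n * B" if b: "b \<in> Basis" and k: "k <= n" and z: "z \<in> kbox eps" for b k z
  proof -
   have 1: "norm (F b i z) <= 1" if "i <= k" for i
   proof -
    have "\<bar>b \<bullet> eta\<bar> <= 1" using bspec[OF eta b] by (simp add: inner_commute[of b])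
    then show ?thesis by (simp add: F_def norm_mult norm_power power_le_one)
   qed
   have 2: "norm (H b i z) <= B" if "i <= k" for i
   proof -
    define y where "y = 1 + rho * (z \<bullet> j)"
    have y: "1 / 2 <= y" unfolding y_def using den z kobox by blast
    have "\<bar>b \<bullet> j\<bar> <= 1" using b j by (simp add: inner_Basis)
    then have "\<bar>rho * (b \<bullet> j)\<bar> <= \<bar>rho\<bar>" by (simp add: abs_mult mult_left_le)
    also have "... <= 1 / (6 * eps)" using rho eps by (simp add: pos_le_divide_eq)
    finally have r: "\<bar>rho * (b \<bullet> j)\<bar> <= 1 / (6 * eps)" .
    have iy: "inverse y <= 2" using le_imp_inverse_le[OF y] by simp
    have "norm (H b i z) = \<bar>rho * (b \<bullet> j)\<bar> ^ i * pochhammer (real m) i * inverse y ^ (m + i)"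
    using y pochhammer_real_nonneg[of m i]
    by (simp only: H_def y_def[symmetric] norm_of_real abs_mult power_abs abs_minus_cancel abs_of_nonneg abs_inverse)
    also have "... <= (1 / (6 * eps)) ^ i * pochhammer (real m) i * 2 ^ (m + i)"
    using r iy y eps by (intro mult_mono power_mono mult_nonneg_nonneg pochhammer_real_nonneg order_refl) auto
    also have "... <= B"
    unfolding B_def using \<open>i <= k\<close> k
    by (intro member_le_sum[of i "{..n}" "%k. (1 / (6 * eps)) ^ k * pochhammer (real m) k * 2 ^ (m + k)"] Bt) auto
    finally show ?thesis .
   qed
   have "norm (G b k z) <= 2 ^ k * (1 * B)" unfolding G_def by (rule norm_leibniz_le) (auto simp: 1 2 B0)
   also have "... <= 2 ^ n * B" using B0 k by (simp add: mult_right_mono power_increasing)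
   finally show ?thesis .
  qed
  show "norm (fcoef eps (phase rho j m eta) nu) <= (C * A + 1) * (1 + infnorm nu) powr (- real n)" if nu: "nu \<in> int_lattice" for nu
  proof -
   have "(\<Sum>b\<in>(Basis::'v set). \<Sum>k\<le>n. \<integral>w. indicator (kbox eps) w * norm (G b k w) \<partial>lborel) <= A"
    unfolding A_def
   proof (intro sum_mono integral_mono)
    fix b :: 'v and k assume b: "b \<in> Basis" and k: "k \<in> {..n}"
    have "continuous_on (kbox eps) (%w. norm (G b k w))" unfolding G_def
    by (intro continuous_on_norm continuous_on_subset[OF continuous_on_leibniz[OF Fc Hc] kobox])
    from borel_integrable_compact[OF compact_cbox this]
    show "integrable lborel (%w. indicator (kbox eps) w * norm (G b k w))" by simp
    show "integrable lborel (%w::'v. indicator (kbox eps) w * (2 ^ n * B))"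
    by (rule integrable_box_mult) (rule continuous_on_const)
    show "indicator (kbox eps) w * norm (G b k w) <= indicator (kbox eps) w * (2 ^ n * B)" for w
    using Gb[OF b, of k w] k by (cases "w \<in> kbox eps") auto
   qed
   then have "C * (1 + infnorm nu) powr (- real n) * (\<Sum>b\<in>(Basis::'v set). \<Sum>k\<le>n. \<integral>w. indicator (kbox eps) w * norm (G b k w) \<partial>lborel)
    <= C * (1 + infnorm nu) powr (- real n) * A" using C by (intro mult_left_mono) auto
   also have "... <= (C * A + 1) * (1 + infnorm nu) powr (- real n)" by (simp add: algebra_simps)
   finally show ?thesis using C1[OF ch nu] by linarith
  qed
  show "((%nu. fcoef eps (phase rho j m eta) nu * char (6 * eps) nu z) has_sum phase rho j m eta z) int_lattice"
   if "\<forall>b\<in>Basis. \<bar>z \<bullet> b\<bar> <= eps" for z by (rule C2[OF ch that])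
 qed
qed

section \<open>Sums of integrals and lattice cells\<close>

lemma integral_has_sum:
 fixes f :: "'i => 'x => complex"
 assumes I: "countable I" "infinite I" and f: "!!i. i \<in> I ==> integrable M (f i)"
  and s: "(%i. \<integral>x. norm (f i x) \<partial>M) summable_on I" and g: "!!x. ((%i. f i x) has_sum g x) I"
 shows "((%i. \<integral>x. f i x \<partial>M) has_sum (\<integral>x. g x \<partial>M)) I"
proof -
 obtain e :: "nat => 'i" where e: "bij_betw e UNIV I" using bij_betw_from_nat_into[OF I] by blast
 have eI: "e k \<in> I" for k using bij_betwE[OF e] by simp
 have inj: "inj e" and img: "range e = I" using e by (auto simp: bij_betw_def)
 have re: "((%k. h (e k)) has_sum y) UNIV \<longleftrightarrow> (h has_sum y) I" for h :: "'i => complex" and y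
  using has_sum_reindex[OF inj, of h y] by (simp add: img o_def)
 have sI: "(%k. \<integral>x. norm (f (e k) x) \<partial>M) summable_on UNIV"
  using summable_on_reindex[OF inj, of "%i. \<integral>x. norm (f i x) \<partial>M"] s by (simp add: img o_def)
 then have sN: "summable (%k. \<integral>x. norm (f (e k) x) \<partial>M)" by (rule summable_on_UNIV_nonneg_real_iff[THEN iffD1, rotated]) simp
 have gx: "((%k. f (e k) x) has_sum g x) UNIV" for x using g[of x] re[of "%i. f i x" "g x"] by simp
 have ax: "summable (%k. norm (f (e k) x))" for x
 proof -
  have "(%k. f (e k) x) summable_on UNIV" using gx summable_on_def by blast
  then have "(%k. norm (f (e k) x)) summable_on UNIV" by (simp add: summable_on_iff_abs_summable_on_complex)
  then show ?thesis by (rule summable_on_UNIV_nonneg_real_iff[THEN iffD1, rotated]) simp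
 qed
 have "(%k. \<integral>x. f (e k) x \<partial>M) sums (\<integral>x. (\<Sum>k. f (e k) x) \<partial>M)"
  by (rule sums_integral[OF f[OF eI] _ sN]) (simp add: ax)
 moreover have "(\<Sum>k. f (e k) x) = g x" for x using has_sum_imp_sums[OF gx] by (simp add: sums_iff)
 ultimately have "(%k. \<integral>x. f (e k) x \<partial>M) sums (\<integral>x. g x \<partial>M)" by simp
 moreover have "summable (%k. norm (\<integral>x. f (e k) x \<partial>M))"
  by (rule summable_comparison_test'[OF sN]) (simp add: integral_norm_bound)
 ultimately have "((%k. \<integral>x. f (e k) x \<partial>M) has_sum (\<integral>x. g x \<partial>M)) UNIV" by (rule norm_summable_imp_has_sum[rotated])
 then show ?thesis by (simp add: re[of "%i. \<integral>x. f i x \<partial>M"])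
qed

text \<open>The label \<open>p\<close> of the half-open cube \<open>dlt (p + [0, 1)^d)\<close> that contains \<open>x\<close>.\<close>

definition cell :: "real => 'v::euclidean_space => 'v" where
 "cell dlt x = (\<Sum>b\<in>Basis. of_int \<lfloor>x \<bullet> b / dlt\<rfloor> *\<^sub>R b)"

lemma cell_inner: "b \<in> Basis ==> cell dlt x \<bullet> b = of_int \<lfloor>x \<bullet> b / dlt\<rfloor>"
 by (simp add: cell_def)

lemma cell_lattice: "cell dlt x \<in> int_lattice"
 by (simp add: int_lattice_def cell_inner)

lemma cell_bounds:
 assumes "0 < dlt" "b \<in> Basis"
 shows "0 <= (x - dlt *\<^sub>R cell dlt x) \<bullet> b" "(x - dlt *\<^sub>R cell dlt x) \<bullet> b < dlt"
proof -
 have "of_int \<lfloor>x \<bullet> b / dlt\<rfloor> <= x \<bullet> b / dlt" "x \<bullet> b / dlt < of_int \<lfloor>x \<bullet> b / dlt\<rfloor> + 1" by linarith+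
 then have "of_int \<lfloor>x \<bullet> b / dlt\<rfloor> * dlt <= x \<bullet> b" "x \<bullet> b < (of_int \<lfloor>x \<bullet> b / dlt\<rfloor> + 1) * dlt"
  using assms(1) by (simp_all only: pos_le_divide_eq pos_divide_less_eq)
 then show "0 <= (x - dlt *\<^sub>R cell dlt x) \<bullet> b" "(x - dlt *\<^sub>R cell dlt x) \<bullet> b < dlt"
  using assms(2) by (simp_all add: inner_diff_left cell_inner algebra_simps)
qed

lemma cell_measurable [measurable]: "{x. cell dlt x = p} \<in> sets borel"
proof -
 have "cell dlt \<in> borel_measurable borel"
  unfolding cell_def[abs_def] by (intro borel_measurable_sum borel_measurable_scaleR borel_measurable_const measurable_compose[OF _ borel_measurable_real_floor]) measurable
 then have "cell dlt -` {p} \<inter> space borel \<in> sets borel" by (rule measurable_sets) simp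
 moreover have "cell dlt -` {p} \<inter> space borel = {x. cell dlt x = p}" by auto
 ultimately show ?thesis by simp
qed

text \<open>Differences with one fixed member of \<open>T\<close> are lattice points of size at most \<open>2 R\<close>, whose number is
 controlled by a convergent lattice sum.\<close>

lemma lattice_count:
 "\<exists>K\<ge>0. \<forall>(v::'v::euclidean_space) T. finite T --> T \<subseteq> {s \<in> int_lattice. infnorm (s - v) <= R} --> real (card T) <= K"
proof -
 define p where "p = real DIM('v) + 1"
 define B where "B = (2 * (1 + 1 / (p / DIM('v) - 1))) ^ DIM('v) * 1 ^ DIM('v)"
 define w where "w = (1 + 2 * max 0 R) powr (- p)"
 have w: "0 < w" by (simp add: w_def add_pos_nonneg)
 have B: "0 <= B" unfolding B_def p_def by (intro mult_nonneg_nonneg zero_le_power add_nonneg_nonneg) auto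
 show ?thesis
 proof (intro exI[of _ "B / w"] conjI allI impI)
  show "0 <= B / w" using B w by simp
  fix v :: 'v and T assume T: "finite T" "T \<subseteq> {s \<in> int_lattice. infnorm (s - v) <= R}"
  show "real (card T) <= B / w"
  proof (cases "T = {}")
   case False
   then obtain s0 where s0: "s0 \<in> T" by blast
   have inj: "inj_on (%s. s - s0) T" by (auto simp: inj_on_def)
   have "real (card T) * w = (\<Sum>s\<in>T. w)" by simp
   also have "... <= (\<Sum>s\<in>T. (1 + infnorm (s - s0) / 1) powr (- p))"
   proof (rule sum_mono)
    fix s assume s: "s \<in> T"
    have "infnorm (s - s0) <= infnorm (s - v) + infnorm (v - s0)"
    using infnorm_triangle[of "s - v" "v - s0"] by simp
    also have "... <= 2 * max 0 R"
    proof -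
    have "infnorm (s - v) <= R" "infnorm (s0 - v) <= R" using T s s0 by auto
    then show ?thesis unfolding infnorm_sub[of v s0] by linarith
    qed
    finally show "w <= (1 + infnorm (s - s0) / 1) powr (- p)"
    unfolding w_def using infnorm_pos_le[of "s - s0"] by (intro powr_mono2') (auto simp: p_def)
   qed
   also have "... = (\<Sum>mu\<in>(%s. s - s0) ` T. (1 + infnorm mu / 1) powr (- p))" by (simp add: sum.reindex[OF inj])
   also have "... <= B"
    unfolding B_def using T s0 by (intro finite_sum_lattice_weight_le) (auto simp: p_def intro!: int_lattice_diff)
   finally show ?thesis using w by (simp add: pos_le_divide_eq)
  qed (use B w in simp)
 qed
qed

lemma sum_powr_subadditive:
 assumes "finite N" "0 < q" "q <= 1" "!!u. u \<in> N ==> 0 <= (c u :: real)"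
 shows "(\<Sum>u\<in>N. c u) powr q <= (\<Sum>u\<in>N. c u powr q)"
proof (cases "(\<Sum>u\<in>N. c u) = 0")
 case True
 then show ?thesis by (simp add: sum_nonneg)
next
 case False
 define S where "S = (\<Sum>u\<in>N. c u)"
 have S: "0 < S" using False sum_nonneg[of N c] assms(4) by (simp add: S_def less_le)
 have "1 = (\<Sum>u\<in>N. c u / S)" using S by (simp add: S_def flip: sum_divide_distrib)
 also have "... <= (\<Sum>u\<in>N. (c u / S) powr q)"
 proof (rule sum_mono)
  fix u assume u: "u \<in> N"
  have "c u <= S" unfolding S_def by (rule member_le_sum) (use assms u in auto)
  then have x: "0 <= c u / S" "c u / S <= 1" using S assms(4)[OF u] by auto
  show "c u / S <= (c u / S) powr q"
  proof (cases "c u / S = 0")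
   case False
   then have "(c u / S) powr 1 <= (c u / S) powr q" using x assms(2,3) by (intro powr_mono') auto
   then show ?thesis unfolding powr_one[OF x(1)] .
  next
   case True
   then show ?thesis unfolding True by simp
  qed
 qed
 also have "... = (\<Sum>u\<in>N. c u powr q) / S powr q"
  using assms(4) S by (simp add: powr_divide sum_divide_distrib)
 finally show ?thesis using S by (simp add: S_def pos_le_divide_eq)
qed

lemma finite_sum_dependent_product_le:
 fixes f :: "'a => real"
 assumes f0: "!!x. x \<in> A ==> 0 <= f x" and g0: "!!x y. x \<in> A ==> y \<in> B ==> 0 <= g x y"
  and f: "!!S. finite S ==> S \<subseteq> A ==> sum f S <= Mf"
  and g: "!!x S. x \<in> A ==> finite S ==> S \<subseteq> B ==> sum (g x) S <= Mg"
  and T: "finite T" "T \<subseteq> A \<times> B" and M: "0 <= Mg"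
 shows "(\<Sum>(x, y)\<in>T. f x * g x y) <= Mf * Mg"
proof -
 have s: "fst ` T \<subseteq> A" "snd ` T \<subseteq> B" "finite (fst ` T)" "finite (snd ` T)" using T by auto
 have "(\<Sum>(x, y)\<in>T. f x * g x y) <= (\<Sum>(x, y)\<in>fst ` T \<times> snd ` T. f x * g x y)"
 proof (rule sum_mono2)
  show "finite (fst ` T \<times> snd ` T)" using s by simp
  show "T \<subseteq> fst ` T \<times> snd ` T" by (auto simp: rev_image_eqI)
  fix p assume "p \<in> fst ` T \<times> snd ` T - T"
  then have "fst p \<in> A" "snd p \<in> B" using s by auto
  then show "0 <= (case p of (x, y) => f x * g x y)" by (auto simp: case_prod_beta f0 g0)
 qed
 also have "... = (\<Sum>x\<in>fst ` T. f x * (\<Sum>y\<in>snd ` T. g x y))" by (simp add: sum.cartesian_product[symmetric] sum_distrib_left)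
 also have "... <= (\<Sum>x\<in>fst ` T. f x * Mg)"
  using s f0 by (intro sum_mono mult_left_mono g) auto
 also have "... = (\<Sum>x\<in>fst ` T. f x) * Mg" by (simp add: sum_distrib_right)
 also have "... <= Mf * Mg" using s f M by (intro mult_right_mono) auto
 finally show ?thesis .
qed

lemma has_sum_product:
 fixes f :: "'a => complex" and g :: "'b => complex"
 assumes f: "(f has_sum a) A" and g: "(g has_sum b) B"
 shows "((%(x, y). f x * g y) has_sum a * b) (A \<times> B)"
proof -
 have fs: "(%x. norm (f x)) summable_on A" and gs: "(%y. norm (g y)) summable_on B"
  using has_sum_imp_summable[OF f] has_sum_imp_summable[OF g] by (simp_all add: summable_on_iff_abs_summable_on_complex)
 have "(%p. norm (case p of (x, y) => f x * g y)) summable_on A \<times> B"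
 proof (rule nonneg_bdd_above_summable_on, goal_cases)
  case 2
  have "(\<Sum>p\<in>T. norm (case p of (x, y) => f x * g y)) <= infsum (%x. norm (f x)) A * infsum (%y. norm (g y)) B"
   if "T \<subseteq> A \<times> B" "finite T" for T
  proof -
   have "(\<Sum>(x, y)\<in>T. norm (f x) * norm (g y)) <= infsum (%x. norm (f x)) A * infsum (%y. norm (g y)) B"
    by (rule finite_sum_dependent_product_le[OF _ _ _ _ that(2,1)])
    (auto intro!: finite_sum_le_infsum[OF fs] finite_sum_le_infsum[OF gs] infsum_nonneg)
   then show ?thesis by (simp add: case_prod_beta norm_mult)
  qed
  then show ?case by (intro bdd_aboveI2[where M = "infsum (%x. norm (f x)) A * infsum (%y. norm (g y)) B"]) auto
 qed simp
 then have s: "(%(x, y). f x * g y) summable_on A \<times> B" by (rule abs_summable_summable)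
 have "infsum (%(x, y). f x * g y) (A \<times> B) = infsum (%x. infsum (%y. f x * g y) B) A"
  using infsum_Sigma'_banach[OF s] by simp
 also have "... = a * b"
 proof -
  have "infsum (%y. f x * g y) B = f x * b" for x
   by (rule infsumI[OF has_sum_cmult_right[OF g]])
  moreover have "infsum (%x. f x * b) A = a * b"
   by (rule infsumI[OF has_sum_cmult_left[OF f]])
  ultimately show ?thesis by simp
 qed
 finally show ?thesis using has_sum_infsum[OF s] by simp
qed

lemma norm_kernel_constant: "norm (complex_of_real ((1 / (2 * pi)) ^ k)) <= 1"
proof -
 have "(1 / (2 * pi)) ^ k <= 1" using pi_gt3 by (intro power_le_one) (auto simp: field_simps)
 then show ?thesis unfolding norm_of_real by simp
qed

lemma plateau_outside:
 assumes "0 < eps" "w ~: kbox eps"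
 shows "plateau eps w = 0"
proof -
 obtain e :: 'a where "e \<in> Basis" "\<not> (- (2 * eps) <= w \<bullet> e & w \<bullet> e <= 2 * eps)" using assms(2) by (auto simp: mem_box)
 then show ?thesis using assms(1) by (intro plateau_zero[of eps e]) auto
qed

section \<open>Separation of variables in a cell\<close>

text \<open>For each difference \<open>V\<close> of cell labels there are a symbol \<open>b V\<close>, a direction \<open>j V\<close> and a parameter
 \<open>rho V\<close> for the phase. The constants \<open>A1\<close>, \<open>A2\<close> of the Fourier expansions and \<open>K1\<close>, \<open>K2\<close> of the lattice counts are
 parameters, so that bounds proved here are explicit in them and hence uniform in the family.\<close>

locale cell_family =
 fixes eps q t :: real and n m :: nat and F :: "'v::euclidean_space \<times> 'v => real"
  and rho :: "'v => real" and j :: "'v => 'v" and b :: "'v => 'v \<times> 'v => complex" and A1 A2 K1 K2 :: real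
 assumes eps: "0 < eps" "eps <= 1 / 4" and q: "0 < q" "q <= 1" and n: "real DIM('v) < n * q" and t: "0 <= t" "t <= 1"
  and F: "continuous_on UNIV F" "!!p. 0 <= F p" "in_lattice_space 1 q F"
  and b: "!!V. continuous_on UNIV (b V)"
  and A: "0 <= A1" "0 <= A2" "0 <= K1" "0 <= K2"
  and j: "!!V. j V \<in> Basis" and rho: "!!V. \<bar>rho V\<bar> * (6 * eps) <= 1"
  and phase_coef: "!!V eta nu. nu \<in> int_lattice ==> (\<forall>e\<in>Basis. \<bar>eta \<bullet> e\<bar> <= 1) ==>
    norm (fcoef eps (phase (rho V) (j V) m eta) nu) <= A1 * (1 + infnorm nu) powr (- real n)"
  and phase_sum: "!!V eta z. (\<forall>e\<in>Basis. \<bar>eta \<bullet> e\<bar> <= 1) ==> (\<forall>e\<in>Basis. \<bar>z \<bullet> e\<bar> <= eps) ==>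
    ((%nu. fcoef eps (phase (rho V) (j V) m eta) nu * char (6 * eps) nu z) has_sum phase (rho V) (j V) m eta z) int_lattice"
  and w_coef: "!!V c xi mu. mu \<in> int_lattice ==> norm (fcoef eps (%w. b V (c + w, xi)) mu)
    <= A2 * (1 + infnorm mu) powr (- real n) * (\<integral>w. indicator (kbox eps) w * F (c + w, xi) \<partial>lborel)"
  and w_sum: "!!V c xi w. (\<forall>e\<in>Basis. \<bar>w \<bullet> e\<bar> <= eps) ==>
    ((%mu. fcoef eps (%w. b V (c + w, xi)) mu * char (6 * eps) mu w) has_sum b V (c + w, xi)) int_lattice"
  and K1: "!!(v::'v) T. finite T ==> T \<subseteq> {s \<in> int_lattice. infnorm (s - v) <= 1 / eps} ==> real (card T) <= K1"
  and K2: "!!(v::'v) T. finite T ==> T \<subseteq> {s \<in> int_lattice. infnorm (s - v) <= 2} ==> real (card T) <= K2"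
begin

text \<open>The value of \<open>(1 - t) x + t y\<close> at the corners \<open>x = eps (s + V)\<close>, \<open>y = eps s\<close> of the two cells.\<close>

definition corner :: "'v => 'v => 'v" where
 "corner V s = eps *\<^sub>R (s + (1 - t) *\<^sub>R V)"

definition slice :: "'v => 'v => 'v => real" where
 "slice V s xi = (\<integral>w. indicator (kbox eps) w * F (corner V s + w, xi) \<partial>lborel)"

text \<open>The integral of \<open>F\<close> over the part of phase space that influences the cell.\<close>

definition mass :: "'v => 'v => 'v => real" where
 "mass V s sg = (\<integral>xi. slice V s xi * indicator {xi. cell 1 xi = sg} xi \<partial>lborel)"

text \<open>Unit cubes of the lattice that can meet this part of phase space.\<close>

definition cubes :: "'v => 'v => 'v => ('v \<times> 'v) set" where
 "cubes V s sg = {u \<in> int_lattice. infnorm (fst u - corner V s) <= 1 & infnorm (snd u - sg) <= 2}"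

lemma slice_nonneg: "0 <= slice V s xi"
 unfolding slice_def by (intro Bochner_Integration.integral_nonneg) (simp add: F)

lemma mass_nonneg: "0 <= mass V s sg"
 unfolding mass_def by (intro Bochner_Integration.integral_nonneg) (simp add: slice_nonneg)

lemma finite_cubes: "finite (cubes V s sg)"
proof -
 obtain K where K: "!!(v::'v \<times> 'v) T. finite T ==> T \<subseteq> {s \<in> int_lattice. infnorm (s - v) <= 2} ==> real (card T) <= K"
  using lattice_count[of 2] by blast
 have sub: "cubes V s sg \<subseteq> {u \<in> int_lattice. infnorm (u - (corner V s, sg)) <= 2}"
 proof
  fix u assume u: "u \<in> cubes V s sg"
  have "infnorm (u - (corner V s, sg)) <= 2"
  proof (rule infnorm_leI)
   fix e :: "'v \<times> 'v" assume "e \<in> Basis"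
   then consider i where "i \<in> Basis" "e = (i, 0)" | i where "i \<in> Basis" "e = (0, i)" by (auto simp: Basis_prod_def)
   then show "\<bar>(u - (corner V s, sg)) \<bullet> e\<bar> <= 2"
   proof cases
    case 1
    have "\<bar>(fst u - corner V s) \<bullet> i\<bar> <= infnorm (fst u - corner V s)" by (rule component_le_infnorm'[OF 1(1)])
    moreover have "(u - (corner V s, sg)) \<bullet> e = (fst u - corner V s) \<bullet> i" unfolding 1(2) by (simp add: inner_prod_def)
    ultimately show ?thesis using u by (simp add: cubes_def)
   next
    case 2
    have "\<bar>(snd u - sg) \<bullet> i\<bar> <= infnorm (snd u - sg)" by (rule component_le_infnorm'[OF 2(1)])
    moreover have "(u - (corner V s, sg)) \<bullet> e = (snd u - sg) \<bullet> i" unfolding 2(2) by (simp add: inner_prod_def)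
    ultimately show ?thesis using u by (simp add: cubes_def)
   qed
  qed
  then show "u \<in> {u \<in> int_lattice. infnorm (u - (corner V s, sg)) <= 2}" using u by (simp add: cubes_def)
 qed
 have "card G <= nat \<lceil>K\<rceil>" if "G \<subseteq> cubes V s sg" "finite G" for G
 proof -
  have "real (card G) <= K" by (rule K[OF that(2)]) (use that(1) sub in blast)
  then show ?thesis by linarith
 qed
 then show ?thesis using finite_if_finite_subsets_card_bdd by blast
qed

lemma slice_cell:
 shows integrable_slice_cell: "integrable lborel (%xi. slice V s xi * indicator {xi. cell 1 xi = sg} xi)"
  and mass_le: "mass V s sg <= (\<Sum>u\<in>cubes V s sg. cube_mass F u)"
proof -
 define c where "c = corner V s"
 define g where "g p = indicator (kbox eps) (fst p) * F (c + fst p, snd p) * indicator {xi. cell 1 xi = sg} (snd p)" for p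
 have fm: "{p :: 'v \<times> 'v. fst p \<in> kbox eps} \<in> sets borel" "{p :: 'v \<times> 'v. cell 1 (snd p) = sg} \<in> sets borel"
 proof -
  have "fst -` (kbox eps) \<inter> space (borel :: ('v \<times> 'v) measure) \<in> sets borel"
   by (rule measurable_sets[OF borel_measurable_continuous_onI[OF continuous_on_fst[OF continuous_on_id]]]) simp
  then show "{p :: 'v \<times> 'v. fst p \<in> kbox eps} \<in> sets borel" by (simp add: vimage_def)
  have "snd -` {xi. cell 1 xi = sg} \<inter> space (borel :: ('v \<times> 'v) measure) \<in> sets borel"
   by (rule measurable_sets[OF borel_measurable_continuous_onI[OF continuous_on_snd[OF continuous_on_id]] cell_measurable])
  then show "{p :: 'v \<times> 'v. cell 1 (snd p) = sg} \<in> sets borel" by (simp add: vimage_def)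
 qed
 have Fc: "continuous_on UNIV (%p. F (c + fst p, snd p))"
  by (rule continuous_on_compose2[OF F(1)]) (auto intro!: continuous_intros)
 have gm: "g \<in> borel_measurable borel"
 proof -
  have "(%p. indicator {p. fst p \<in> kbox eps} p * F (c + fst p, snd p) * indicator {p. cell 1 (snd p) = sg} p) \<in> borel_measurable borel"
   by (intro borel_measurable_times borel_measurable_indicator fm borel_measurable_continuous_onI[OF Fc])
  then show ?thesis by (simp add: g_def[abs_def] indicator_def)
 qed
 have sgb: "\<forall>e\<in>Basis. sg \<bullet> e <= xi \<bullet> e & xi \<bullet> e <= (sg + One) \<bullet> e" if "cell 1 xi = sg" for xi
 proof
  fix e :: 'v assume e: "e \<in> Basis"
  show "sg \<bullet> e <= xi \<bullet> e & xi \<bullet> e <= (sg + One) \<bullet> e"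
   using cell_bounds[OF zero_less_one e, of xi] that e by (simp add: inner_diff_left inner_add_left)
 qed
 have gi: "integrable lborel g"
 proof (rule Bochner_Integration.integrable_bound[OF integrable_box_mult[OF Fc]])
  show "g \<in> borel_measurable lborel" using gm by simp
  show "AE p in lborel. norm (g p) <= norm (indicator (cbox (- ((2 * eps) *\<^sub>R One), sg) ((2 * eps) *\<^sub>R One, sg + One)) p * F (c + fst p, snd p))"
  proof (rule AE_I2)
   fix p :: "'v \<times> 'v"
   have "p \<in> cbox (- ((2 * eps) *\<^sub>R One), sg) ((2 * eps) *\<^sub>R One, sg + One)" if "fst p \<in> kbox eps" "cell 1 (snd p) = sg"
    unfolding cbox_Pair_eq using that(1) sgb[OF that(2)] by (cases p) (auto simp: mem_box)
   then show "norm (g p) <= norm (indicator (cbox (- ((2 * eps) *\<^sub>R One), sg) ((2 * eps) *\<^sub>R One, sg + One)) p * F (c + fst p, snd p))"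
    by (cases "fst p \<in> kbox eps & cell 1 (snd p) = sg") (auto simp: g_def F(2))
  qed
 qed
 then have gi': "integrable (lborel \<Otimes>\<^sub>M lborel) (%(w, xi). g (w, xi))" by (simp add: lborel_prod)
 have sl: "(\<integral>w. g (w, xi) \<partial>lborel) = slice V s xi * indicator {xi. cell 1 xi = sg} xi" for xi
  by (simp add: g_def slice_def c_def)
 show "integrable lborel (%xi. slice V s xi * indicator {xi. cell 1 xi = sg} xi)"
  using lborel_pair.integrable_snd[OF gi'] by (simp add: sl)
 have "mass V s sg = (\<integral>p. g p \<partial>lborel)"
  using lborel_pair.integral_snd[OF gi'] by (simp add: sl mass_def lborel_prod)
 also have "... = (\<integral>p. g (p + (- c, 0)) \<partial>lborel)" by (rule lborel_integral_translate(1)[OF gm, symmetric])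
 also have "... <= (\<integral>p. (\<Sum>u\<in>cubes V s sg. indicator (unit_cube u) p * F p) \<partial>lborel)"
 proof (rule integral_mono')
  show "integrable lborel (%p. \<Sum>u\<in>cubes V s sg. indicator (unit_cube u) p * F p)"
   unfolding unit_cube_def by (intro Bochner_Integration.integrable_sum integrable_box_mult F)
  fix p :: "'v \<times> 'v"
  show nn: "0 <= (\<Sum>u\<in>cubes V s sg. indicator (unit_cube u) p * F p)" by (intro sum_nonneg) (simp add: F)
  show "g (p + (- c, 0)) <= (\<Sum>u\<in>cubes V s sg. indicator (unit_cube u) p * F p)"
  proof (cases "fst p - c \<in> kbox eps & cell 1 (snd p) = sg")
   case True
   obtain u where u: "u \<in> int_lattice" "p \<in> unit_cube u" by (rule cube_cover)
   have close: "\<bar>(fst p - fst u) \<bullet> e\<bar> <= 1 / 2 & \<bar>(snd p - snd u) \<bullet> e\<bar> <= 1 / 2" if e: "e \<in> Basis" for e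
   proof -
    have m: "!!i. i \<in> Basis ==> (u - (1/2) *\<^sub>R One) \<bullet> i <= p \<bullet> i & p \<bullet> i <= (u + (1/2) *\<^sub>R One) \<bullet> i"
    using u(2) unfolding unit_cube_def mem_box by blast
    have "u \<bullet> i - 1 / 2 <= p \<bullet> i & p \<bullet> i <= u \<bullet> i + 1 / 2" if "i \<in> Basis" for i
    using m[OF that] that by (simp add: inner_diff_left inner_add_left)
    from this[OF pair_Basis(1)[OF e]] this[OF pair_Basis(2)[OF e]]
    have "fst u \<bullet> e - 1 / 2 <= fst p \<bullet> e" "fst p \<bullet> e <= fst u \<bullet> e + 1 / 2"
    "snd u \<bullet> e - 1 / 2 <= snd p \<bullet> e" "snd p \<bullet> e <= snd u \<bullet> e + 1 / 2" by (simp_all add: inner_prod_def)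
    then show ?thesis unfolding inner_diff_left abs_le_iff by (intro conjI) linarith+
   qed
   have "u \<in> cubes V s sg"
    unfolding cubes_def c_def[symmetric]
   proof (intro CollectI conjI u(1) infnorm_leI)
    fix e :: 'v assume e: "e \<in> Basis"
    have "- (2 * eps) <= (fst p - c) \<bullet> e" "(fst p - c) \<bullet> e <= 2 * eps" using True e by (auto simp: mem_box)
    then have "\<bar>(fst p - c) \<bullet> e\<bar> <= 1 / 2" using eps by (simp only: abs_le_iff) linarith
    moreover have "(fst u - c) \<bullet> e = (fst p - c) \<bullet> e - (fst p - fst u) \<bullet> e" by (simp add: inner_diff_left)
    ultimately show "\<bar>(fst u - c) \<bullet> e\<bar> <= 1" using close[OF e] by linarith
    have "\<bar>(snd p - sg) \<bullet> e\<bar> <= 1" using cell_bounds[OF zero_less_one e, of "snd p"] True by (simp add: abs_le_iff)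
    moreover have "(snd u - sg) \<bullet> e = (snd p - sg) \<bullet> e - (snd p - snd u) \<bullet> e" by (simp add: inner_diff_left)
    ultimately show "\<bar>(snd u - sg) \<bullet> e\<bar> <= 2" using close[OF e] by linarith
   qed
   then have "indicator (unit_cube u) p * F p <= (\<Sum>u\<in>cubes V s sg. indicator (unit_cube u) p * F p)"
    by (intro member_le_sum[where f = "%u. indicator (unit_cube u) p * F p"] finite_cubes) (auto simp: F(2))
   moreover have "g (p + (- c, 0)) = F p" using True by (simp add: g_def)
   ultimately show ?thesis using u(2) by simp
  next
   case False
   then have "g (p + (- c, 0)) = 0" by (auto simp: g_def)
   with nn show ?thesis by simp
  qed
 qed
 also have "... = (\<Sum>u\<in>cubes V s sg. cube_mass F u)"
  by (rule Bochner_Integration.integral_sum) (unfold unit_cube_def, intro integrable_box_mult F)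
 finally show "mass V s sg <= (\<Sum>u\<in>cubes V s sg. cube_mass F u)" .
qed

lemma cube_mass_nonneg: "0 <= cube_mass F u"
 by (intro Bochner_Integration.integral_nonneg) (simp add: F)

text \<open>For fixed \<open>V\<close> each lattice cube occurs in \<open>cubes V s sg\<close> for at most \<open>K1 * K2\<close> pairs \<open>(s, sg)\<close>.\<close>

lemma sum_mass_powr_le:
 assumes T: "finite T" "T \<subseteq> int_lattice \<times> int_lattice"
 shows "(\<Sum>(s, sg)\<in>T. mass V s sg powr q) <= K1 * K2 * lattice_norm 1 q F powr q"
proof -
 define J where "J u = cube_mass F u powr q" for u
 define N where "N x = cubes V (fst x) (snd x)" for x
 define U where "U = (\<Union>x\<in>T. N x)"
 have U: "finite U" "U \<subseteq> int_lattice" using T(1) finite_cubes by (auto simp: U_def N_def cubes_def)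
 have "(\<Sum>(s, sg)\<in>T. mass V s sg powr q) <= (\<Sum>x\<in>T. \<Sum>u\<in>N x. J u)"
  unfolding case_prod_beta
 proof (rule sum_mono)
  fix x
  have "mass V (fst x) (snd x) powr q <= (\<Sum>u\<in>N x. cube_mass F u) powr q"
   unfolding N_def using q by (intro powr_mono2 mass_le mass_nonneg) auto
  also have "... <= (\<Sum>u\<in>N x. J u)"
   unfolding J_def by (rule sum_powr_subadditive) (use q cube_mass_nonneg finite_cubes in \<open>auto simp: N_def\<close>)
  finally show "mass V (fst x) (snd x) powr q <= (\<Sum>u\<in>N x. J u)" .
 qed
 also have "... = (\<Sum>x\<in>T. \<Sum>u | u \<in> U & u \<in> N x. J u)"
  by (intro sum.cong refl) (auto simp: U_def)
 also have "... = (\<Sum>u\<in>U. \<Sum>x | x \<in> T & u \<in> N x. J u)" by (rule sum.swap_restrict[OF T(1) U(1)])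
 also have "... = (\<Sum>u\<in>U. real (card {x \<in> T. u \<in> N x}) * J u)" by simp
 also have "... <= (\<Sum>u\<in>U. K1 * K2 * J u)"
 proof (intro sum_mono mult_right_mono)
  fix u :: "'v \<times> 'v"
  define S1 where "S1 = {s \<in> fst ` T. infnorm (s - ((1 / eps) *\<^sub>R fst u - (1 - t) *\<^sub>R V)) <= 1 / eps}"
  define S2 where "S2 = {sg \<in> snd ` T. infnorm (sg - snd u) <= 2}"
  have fin: "finite S1" "finite S2" using T(1) by (auto simp: S1_def S2_def)
  have sub: "{x \<in> T. u \<in> N x} \<subseteq> S1 \<times> S2"
  proof
   fix x assume x: "x \<in> {x \<in> T. u \<in> N x}"
   have "infnorm (fst x - ((1 / eps) *\<^sub>R fst u - (1 - t) *\<^sub>R V)) = infnorm ((- (1 / eps)) *\<^sub>R (fst u - corner V (fst x)))"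
    using eps(1) by (intro arg_cong[of _ _ infnorm]) (simp add: corner_def algebra_simps)
   also have "... = (1 / eps) * infnorm (fst u - corner V (fst x))" using eps(1) by (simp only: infnorm_mul) simp
   also have "... <= (1 / eps) * 1" using x eps(1) by (intro mult_left_mono) (auto simp: N_def cubes_def)
   finally have 1: "infnorm (fst x - ((1 / eps) *\<^sub>R fst u - (1 - t) *\<^sub>R V)) <= 1 / eps" by simp
   have 2: "infnorm (snd x - snd u) <= 2" using x by (simp add: N_def cubes_def infnorm_sub[of "snd x"])
   show "x \<in> S1 \<times> S2" using x 1 2 by (auto simp: S1_def S2_def mem_Times_iff)
  qed
  have "real (card {x \<in> T. u \<in> N x}) <= real (card (S1 \<times> S2))"
   using card_mono[OF finite_cartesian_product[OF fin] sub] by (simp only: of_nat_le_iff)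
  also have "... = real (card S1) * real (card S2)" by (simp add: card_cartesian_product)
  also have "... <= K1 * K2"
  proof (rule mult_mono)
   show "real (card S1) <= K1" using T(2) by (intro K1[OF fin(1), of "(1 / eps) *\<^sub>R fst u - (1 - t) *\<^sub>R V"]) (auto simp: S1_def)
   show "real (card S2) <= K2" using T(2) by (intro K2[OF fin(2), of "snd u"]) (auto simp: S2_def)
  qed (use A in auto)
  finally show "real (card {x \<in> T. u \<in> N x}) <= K1 * K2" .
 qed (simp add: J_def)
 also have "... = K1 * K2 * (\<Sum>u\<in>U. J u)" by (simp add: sum_distrib_left)
 also have "... <= K1 * K2 * lattice_norm 1 q F powr q"
  unfolding J_def using A by (intro mult_left_mono finite_sum_cube_mass_le[OF F(1,2) q(1) F(3) U]) auto
 finally show ?thesis .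
qed

definition piece :: "'v => 'v => 'v => 'v => 'v => 'v => complex" where
 "piece V s sg mu nu xi = indicator {xi. cell 1 xi = sg} xi * (cis (eps * (V \<bullet> (xi - sg))) *
   (fcoef eps (%w. b V (corner V s + w, xi)) mu * fcoef eps (phase (rho V) (j V) m (xi - sg)) nu))"

definition coef :: "'v => 'v => 'v => 'v => 'v => complex" where
 "coef V s sg mu nu = of_real ((1 / (2 * pi)) ^ DIM('v)) * (\<integral>xi. piece V s sg mu nu xi \<partial>lborel)"

definition left_factor :: "'v => 'v => 'v => 'v => 'v => complex" where
 "left_factor p sg mu nu x = cis (x \<bullet> sg) * (char (6 * eps) mu ((1 - t) *\<^sub>R (x - eps *\<^sub>R p)) * char (6 * eps) nu (x - eps *\<^sub>R p))"

definition right_factor :: "'v => 'v => 'v => 'v => 'v => complex" where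
 "right_factor s sg mu nu y = cis (- (y \<bullet> sg)) * (char (6 * eps) mu (t *\<^sub>R (y - eps *\<^sub>R s)) * char (6 * eps) nu (- (y - eps *\<^sub>R s)))"

definition weight :: "'v => real" where
 "weight mu = (1 + infnorm mu) powr (- real n)"

lemma weight_nonneg: "0 <= weight mu" by (simp add: weight_def)

lemma continuous_on_w_coef: "continuous_on UNIV (%xi. fcoef eps (%w. b V (c + w, xi)) mu)"
proof -
 have pc: "continuous_on UNIV (%z. complex_of_real (plateau eps (snd z)) * b V (c + snd z, fst z) * char (6 * eps) (- mu) (snd z))"
  by (intro continuous_on_mult continuous_on_compose2[OF smooth_continuous[OF smooth_plateau]] continuous_on_compose2[OF b]
    continuous_on_compose2[OF continuous_on_char] continuous_intros) auto
 have "continuous_on UNIV (%xi. \<integral>w. complex_of_real (plateau eps w) * b V (c + w, xi) * char (6 * eps) (- mu) w \<partial>lborel)"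
  by (rule continuous_on_integral_param[OF pc, of "- ((2 * eps) *\<^sub>R One)" "(2 * eps) *\<^sub>R One"])
   (simp add: plateau_outside[OF eps(1)])
 then show ?thesis unfolding fcoef_def using eps by (intro continuous_on_divide continuous_on_const) auto
qed

lemma continuous_on_phase_coef: "continuous_on UNIV (%xi. fcoef eps (phase (rho V) (j V) m (xi - sg)) nu)"
proof -
 define X where "X w = complex_of_real (plateau eps w) * of_real (inverse (1 + rho V * (w \<bullet> j V)) ^ m)" for w
 have Xc: "continuous_on UNIV X" unfolding X_def[abs_def]
 proof (rule continuous_on_mult_cutoff[where K = "kbox eps" and O' = "obox eps"])
  show "kbox eps \<subseteq> (obox eps :: 'v set)" using eps by (auto simp: mem_box dest!: bspec)
  have "1 + rho V * (w \<bullet> j V) ~= 0" if "w \<in> obox eps" for w using phase_denominator[OF j[of V] eps(1) rho[of V] that] by linarith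
  then show "continuous_on (obox eps) (%w. complex_of_real (inverse (1 + rho V * (w \<bullet> j V)) ^ m))"
   by (intro continuous_intros) auto
 qed (auto simp: plateau_outside[OF eps(1)] continuous_on_plateau)
 have pc: "continuous_on UNIV (%z. X (snd z) * cis (snd z \<bullet> (fst z - sg)) * char (6 * eps) (- nu) (snd z))"
  by (intro continuous_on_mult continuous_on_compose2[OF Xc] continuous_on_compose2[OF continuous_on_cis[OF continuous_on_id]]
    continuous_on_compose2[OF continuous_on_char] continuous_intros) auto
 have "continuous_on UNIV (%xi. \<integral>w. X w * cis (w \<bullet> (xi - sg)) * char (6 * eps) (- nu) w \<partial>lborel)"
  by (rule continuous_on_integral_param[OF pc, of "- ((2 * eps) *\<^sub>R One)" "(2 * eps) *\<^sub>R One"])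
   (simp add: X_def plateau_outside[OF eps(1)])
 moreover have eq: "complex_of_real (plateau eps w) * phase (rho V) (j V) m (xi - sg) w * char (6 * eps) (- nu) w
   = X w * cis (w \<bullet> (xi - sg)) * char (6 * eps) (- nu) w" for xi w by (simp add: X_def phase_def mult_ac)
 ultimately show ?thesis unfolding fcoef_def eq using eps by (intro continuous_on_divide continuous_on_const) auto
qed

lemma norm_piece_le:
 assumes "mu \<in> int_lattice" "nu \<in> int_lattice"
 shows "norm (piece V s sg mu nu xi) <= (A1 * A2 * weight mu * weight nu) * (slice V s xi * indicator {xi. cell 1 xi = sg} xi)"
proof (cases "cell 1 xi = sg")
 case True
 have eta: "\<forall>e\<in>Basis. \<bar>(xi - sg) \<bullet> e\<bar> <= 1"
  using cell_bounds[OF zero_less_one, of _ xi] True by (auto simp: abs_le_iff less_imp_le)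
 have "norm (piece V s sg mu nu xi) = norm (fcoef eps (%w. b V (corner V s + w, xi)) mu) * norm (fcoef eps (phase (rho V) (j V) m (xi - sg)) nu)"
  using True by (simp add: piece_def norm_mult)
 also have "... <= (A2 * weight mu * slice V s xi) * (A1 * weight nu)"
  unfolding slice_def weight_def
  by (intro mult_mono w_coef phase_coef assms eta mult_nonneg_nonneg A Bochner_Integration.integral_nonneg) (auto simp: F)
 finally show ?thesis using True by (simp add: mult_ac)
qed (simp add: piece_def)

lemma piece_measurable: "piece V s sg mu nu \<in> borel_measurable lborel"
proof -
 have "(%xi. cis (eps * (V \<bullet> (xi - sg))) * (fcoef eps (%w. b V (corner V s + w, xi)) mu * fcoef eps (phase (rho V) (j V) m (xi - sg)) nu)) \<in> borel_measurable borel"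
  by (intro borel_measurable_continuous_onI continuous_on_mult continuous_on_w_coef continuous_on_phase_coef
    continuous_on_compose2[OF continuous_on_cis[OF continuous_on_id]] continuous_intros) auto
 from borel_measurable_times[OF borel_measurable_indicator[OF cell_measurable[of 1 sg]] this]
 show ?thesis by (simp add: piece_def[abs_def])
qed

lemma integrable_piece:
 assumes "mu \<in> int_lattice" "nu \<in> int_lattice"
 shows "integrable lborel (piece V s sg mu nu)"
  and "(\<integral>xi. norm (piece V s sg mu nu xi) \<partial>lborel) <= A1 * A2 * weight mu * weight nu * mass V s sg"
proof -
 note I = integrable_mult_right[OF integrable_slice_cell, of "A1 * A2 * weight mu * weight nu" V s sg]
 show i: "integrable lborel (piece V s sg mu nu)"
  by (rule Bochner_Integration.integrable_bound[OF I piece_measurable])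
   (rule AE_I2, rule order_trans[OF norm_piece_le[OF assms]], simp)
 have "(\<integral>xi. norm (piece V s sg mu nu xi) \<partial>lborel) <= (\<integral>xi. (A1 * A2 * weight mu * weight nu) * (slice V s xi * indicator {xi. cell 1 xi = sg} xi) \<partial>lborel)"
  by (rule integral_mono[OF integrable_norm[OF i] I norm_piece_le[OF assms]])
 also have "... = A1 * A2 * weight mu * weight nu * mass V s sg" by (simp only: integral_mult_right_zero mass_def)
 finally show "(\<integral>xi. norm (piece V s sg mu nu xi) \<partial>lborel) <= A1 * A2 * weight mu * weight nu * mass V s sg" .
qed

lemma norm_coef_le:
 assumes "mu \<in> int_lattice" "nu \<in> int_lattice"
 shows "norm (coef V s sg mu nu) <= A1 * A2 * weight mu * weight nu * mass V s sg"
proof -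
 have "norm (coef V s sg mu nu) <= norm (\<integral>xi. piece V s sg mu nu xi \<partial>lborel)"
  unfolding coef_def norm_mult by (rule mult_left_le_one_le[OF _ _ norm_kernel_constant]) simp_all
 also have "... <= (\<integral>xi. norm (piece V s sg mu nu xi) \<partial>lborel)" by (rule integral_norm_bound)
 also note integrable_piece(2)[OF assms]
 finally show ?thesis .
qed

lemma norm_factors [simp]: "norm (left_factor p sg mu nu x) = 1" "norm (right_factor s sg mu nu y) = 1"
 by (simp_all add: left_factor_def right_factor_def norm_mult)

definition weight_sum :: real where
 "weight_sum = (2 * (1 + 1 / (n * q / DIM('v) - 1))) ^ DIM('v)"

lemma weight_sum_pos: "0 < weight_sum"
 unfolding weight_sum_def using n by (intro zero_less_power mult_pos_pos add_pos_nonneg) auto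

lemma sum_weight_powr_le:
 assumes "finite T" "T \<subseteq> int_lattice"
 shows "(\<Sum>mu\<in>T. weight mu powr q) <= weight_sum"
 using finite_sum_lattice_weight_le[OF n, of 1 T] assms
 by (simp add: weight_def weight_sum_def powr_powr)

lemma sum_term_powr_le:
 assumes T: "finite T" "T \<subseteq> (int_lattice \<times> int_lattice) \<times> (int_lattice \<times> int_lattice)"
 shows "(\<Sum>((s, sg), (mu, nu))\<in>T. (A1 * A2 * weight mu * weight nu * mass V s sg) powr q)
  <= K1 * K2 * lattice_norm 1 q F powr q * ((A1 * A2) powr q * (weight_sum * weight_sum))"
proof -
 have "(\<Sum>((s, sg), (mu, nu))\<in>T. (A1 * A2 * weight mu * weight nu * mass V s sg) powr q)
   = (\<Sum>(x, y)\<in>T. mass V (fst x) (snd x) powr q * ((A1 * A2) powr q * (weight (fst y) powr q * weight (snd y) powr q)))"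
  using A weight_nonneg mass_nonneg by (intro sum.cong refl) (auto simp: powr_mult mult_ac)
 also have "... <= (K1 * K2 * lattice_norm 1 q F powr q) * ((A1 * A2) powr q * (weight_sum * weight_sum))"
 proof (rule finite_sum_dependent_product_le[OF _ _ _ _ T])
  show "(\<Sum>x\<in>S. mass V (fst x) (snd x) powr q) <= K1 * K2 * lattice_norm 1 q F powr q"
   if "finite S" "S \<subseteq> int_lattice \<times> int_lattice" for S
   using sum_mass_powr_le[OF that] by (simp add: case_prod_beta)
  show "(\<Sum>y\<in>S. (A1 * A2) powr q * (weight (fst y) powr q * weight (snd y) powr q)) <= (A1 * A2) powr q * (weight_sum * weight_sum)"
   if S: "finite S" "S \<subseteq> int_lattice \<times> int_lattice" for S
  proof -
   have "(\<Sum>(x, y)\<in>S. weight x powr q * weight y powr q) <= weight_sum * weight_sum"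
    by (rule finite_sum_dependent_product_le[OF _ _ _ _ S]) (use sum_weight_powr_le weight_sum_pos in auto)
   then show ?thesis by (simp add: sum_distrib_left[symmetric] case_prod_beta mult_left_mono)
  qed
 qed (use weight_sum_pos in auto)
 finally show ?thesis .
qed

definition cell_kernel :: "'v => 'v => 'v => complex" where
 "cell_kernel V x y = of_real (inverse (1 + rho V * ((x - y - eps *\<^sub>R V) \<bullet> j V)) ^ m) * abs_kernel t (b V) (x, y)"

text \<open>For each \<open>xi\<close> in the frequency cube \<open>sg\<close> multiply the two Fourier series, in \<open>w\<close> for the symbol and in \<open>z\<close>
 for the phase at \<open>xi - sg\<close>. As the bounds are summable over all indices, the sum may be exchanged with
 the integral.\<close>

lemma coef_expansion:
 assumes x: "cell eps x = s + V" and y: "cell eps y = s"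
 shows "((%(sg, mu, nu). coef V s sg mu nu * (left_factor (s + V) sg mu nu x * right_factor s sg mu nu y)) has_sum
   cell_kernel V x y) (int_lattice \<times> (int_lattice \<times> int_lattice))"
proof -
 define x' y' z w where "x' = x - eps *\<^sub>R (s + V)" and "y' = y - eps *\<^sub>R s" and "z = x' - y'" and "w = (1 - t) *\<^sub>R x' + t *\<^sub>R y'"
 have zz: "x - y - eps *\<^sub>R V = z" by (simp add: z_def x'_def y'_def algebra_simps)
 have ww: "(1 - t) *\<^sub>R x + t *\<^sub>R y = corner V s + w" by (simp add: w_def x'_def y'_def corner_def algebra_simps)
 have x'b: "0 <= x' \<bullet> e & x' \<bullet> e < eps" and y'b: "0 <= y' \<bullet> e & y' \<bullet> e < eps" if "e \<in> Basis" for e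
  using cell_bounds[OF eps(1) that, of x] cell_bounds[OF eps(1) that, of y] by (auto simp: x'_def y'_def x y)
 have zb: "\<forall>e\<in>Basis. \<bar>z \<bullet> e\<bar> <= eps"
 proof
  fix e :: 'v assume e: "e \<in> Basis"
  show "\<bar>z \<bullet> e\<bar> <= eps" using x'b[OF e] y'b[OF e] by (simp only: z_def inner_diff_left abs_le_iff) linarith
 qed
 have wb: "\<forall>e\<in>Basis. \<bar>w \<bullet> e\<bar> <= eps"
 proof
  fix e :: 'v assume e: "e \<in> Basis"
  have "(1 - t) * (x' \<bullet> e) <= (1 - t) * eps" "t * (y' \<bullet> e) <= t * eps" using x'b[OF e] y'b[OF e] t by (auto intro!: mult_left_mono)
  moreover have "0 <= (1 - t) * (x' \<bullet> e)" "0 <= t * (y' \<bullet> e)" using x'b[OF e] y'b[OF e] t by auto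
  ultimately show "\<bar>w \<bullet> e\<bar> <= eps" by (simp add: w_def inner_add_left algebra_simps)
 qed
 define c where "c = complex_of_real ((1 / (2 * pi)) ^ DIM('v))"
 define r where "r = complex_of_real (inverse (1 + rho V * (z \<bullet> j V)) ^ m)"
 define L where "L sg mu nu = left_factor (s + V) sg mu nu x * right_factor s sg mu nu y" for sg mu nu
 have L1: "norm (L sg mu nu) = 1" for sg mu nu by (simp add: L_def norm_mult)
 have Leq: "L sg mu nu = cis ((x - y) \<bullet> sg) * (char (6 * eps) mu w * char (6 * eps) nu z)" for sg mu nu
 proof -
  have "L sg mu nu = (cis (x \<bullet> sg) * cis (- (y \<bullet> sg))) * ((char (6 * eps) mu ((1 - t) *\<^sub>R x') * char (6 * eps) mu (t *\<^sub>R y')) *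
    (char (6 * eps) nu x' * char (6 * eps) nu (- y')))"
   by (simp add: L_def left_factor_def right_factor_def x'_def y'_def mult_ac)
  moreover have "cis (x \<bullet> sg) * cis (- (y \<bullet> sg)) = cis ((x - y) \<bullet> sg)" by (simp add: cis_mult inner_diff_left)
  moreover have "char (6 * eps) mu ((1 - t) *\<^sub>R x') * char (6 * eps) mu (t *\<^sub>R y') = char (6 * eps) mu w"
   by (simp add: char_def cis_mult w_def inner_add_right distrib_left)
  moreover have "char (6 * eps) nu x' * char (6 * eps) nu (- y') = char (6 * eps) nu z"
   unfolding char_def cis_mult z_def inner_diff_right inner_minus_right by (simp add: right_diff_distrib)
  ultimately show ?thesis by simp
 qed
 define I where "I = (int_lattice :: 'v set) \<times> ((int_lattice :: 'v set) \<times> (int_lattice :: 'v set))"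
 define f where "f = (%(sg, mu, nu) xi. c * L sg mu nu * piece V s sg mu nu xi)"
 define g where "g xi = c * (r * (cis ((x - y) \<bullet> xi) * b V ((1 - t) *\<^sub>R x + t *\<^sub>R y, xi)))" for xi
 have pointwise: "((%i. f i xi) has_sum g xi) I" for xi
 proof -
  define sg0 where "sg0 = cell 1 xi"
  have eta: "\<forall>e\<in>Basis. \<bar>(xi - sg0) \<bullet> e\<bar> <= 1"
  proof
   fix e :: 'v assume e: "e \<in> Basis"
   show "\<bar>(xi - sg0) \<bullet> e\<bar> <= 1" using cell_bounds[OF zero_less_one e, of xi] by (simp add: sg0_def abs_le_iff)
  qed
  define k where "k = c * cis ((x - y) \<bullet> sg0) * cis (eps * (V \<bullet> (xi - sg0)))"
  have "((%(mu, nu). (fcoef eps (%w. b V (corner V s + w, xi)) mu * char (6 * eps) mu w) *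
    (fcoef eps (phase (rho V) (j V) m (xi - sg0)) nu * char (6 * eps) nu z))
   has_sum (b V (corner V s + w, xi) * phase (rho V) (j V) m (xi - sg0) z)) (int_lattice \<times> int_lattice)"
   by (rule has_sum_product[OF w_sum[OF wb] phase_sum[OF eta zb]])
  from has_sum_cmult_right[OF this, of k]
  have 1: "((%y. k * (case y of (mu, nu) => (fcoef eps (%w. b V (corner V s + w, xi)) mu * char (6 * eps) mu w) *
    (fcoef eps (phase (rho V) (j V) m (xi - sg0)) nu * char (6 * eps) nu z)))
   has_sum (k * (b V (corner V s + w, xi) * phase (rho V) (j V) m (xi - sg0) z))) (int_lattice \<times> int_lattice)" .
  have inj: "inj_on (Pair sg0) (int_lattice \<times> int_lattice)" by (simp add: inj_on_def)
  have 2: "((%i. f i xi) \<circ> Pair sg0) = (%y. k * (case y of (mu, nu) => (fcoef eps (%w. b V (corner V s + w, xi)) mu * char (6 * eps) mu w) *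
    (fcoef eps (phase (rho V) (j V) m (xi - sg0)) nu * char (6 * eps) nu z)))"
   by (auto simp: fun_eq_iff f_def Leq piece_def k_def sg0_def[symmetric] mult_ac)
  have 3: "k * (b V (corner V s + w, xi) * phase (rho V) (j V) m (xi - sg0) z) = g xi"
  proof -
   have "cis ((x - y) \<bullet> sg0) * cis (eps * (V \<bullet> (xi - sg0))) * cis (z \<bullet> (xi - sg0)) = cis ((x - y) \<bullet> xi)"
    unfolding cis_mult zz[symmetric] by (rule arg_cong[of _ _ cis]) (simp add: inner_diff_left inner_diff_right algebra_simps)
   then show ?thesis unfolding g_def k_def phase_def r_def ww by (simp add: mult_ac)
  qed
  from 1 have "((%i. f i xi) has_sum g xi) (Pair sg0 ` (int_lattice \<times> int_lattice))"
   unfolding has_sum_reindex[OF inj] 2 3 .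
  moreover have "((%i. f i xi) has_sum g xi) (Pair sg0 ` (int_lattice \<times> int_lattice)) \<longleftrightarrow> ((%i. f i xi) has_sum g xi) I"
  proof (rule has_sum_cong_neutral)
   show "f i xi = 0" if "i \<in> I - Pair sg0 ` (int_lattice \<times> int_lattice)" for i
   proof -
    obtain sg mu nu where i: "i = (sg, mu, nu)" by (rule prod_cases3)
    have "sg ~= sg0" using that by (auto simp: I_def i)
    then show ?thesis by (simp add: f_def i piece_def sg0_def)
   qed
  qed (auto simp: I_def sg0_def cell_lattice)
  ultimately show ?thesis by simp
 qed
 have fi: "integrable lborel (f i)" if "i \<in> I" for i
  using that by (auto simp: I_def f_def intro!: integrable_mult_right integrable_piece)
 have sum: "(%i. \<integral>xi. norm (f i xi) \<partial>lborel) summable_on I"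
 proof (rule nonneg_bdd_above_summable_on)
  define B where "B = (K1 * K2 * lattice_norm 1 q F powr q * ((A1 * A2) powr q * (weight_sum * weight_sum))) powr (1 / q)"
  define d where "d = (%(sg, mu, nu). A1 * A2 * weight mu * weight nu * mass V s sg)"
  have c1: "norm c <= 1" unfolding c_def by (rule norm_kernel_constant)
  have d0: "0 <= d i" for i by (auto simp: d_def A weight_nonneg mass_nonneg split: prod.split)
  have bd: "(\<integral>xi. norm (f i xi) \<partial>lborel) <= d i" if "i \<in> I" for i
  proof -
   obtain sg mu nu where i: "i = (sg, mu, nu)" "mu \<in> int_lattice" "nu \<in> int_lattice" using \<open>i \<in> I\<close> by (auto simp: I_def)
   have "(\<integral>xi. norm (f i xi) \<partial>lborel) = norm c * (\<integral>xi. norm (piece V s sg mu nu xi) \<partial>lborel)"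
    by (simp add: i f_def norm_mult L1)
   also have "... <= (\<integral>xi. norm (piece V s sg mu nu xi) \<partial>lborel)" using c1 by (intro mult_left_le_one_le) auto
   also have "... <= d i" using integrable_piece(2)[OF i(2,3)] by (simp add: d_def i(1))
   finally show ?thesis .
  qed
  have "(\<Sum>i\<in>T. \<integral>xi. norm (f i xi) \<partial>lborel) <= B" if T: "T \<subseteq> I" "finite T" for T
  proof -
   define T' where "T' = (%(sg, mu, nu). ((s, sg), (mu, nu))) ` T"
   have "(\<Sum>i\<in>T. \<integral>xi. norm (f i xi) \<partial>lborel) <= (\<Sum>i\<in>T. d i)" using T by (intro sum_mono bd) auto
   also have "... = ((\<Sum>i\<in>T. d i) powr q) powr (1 / q)" using q d0 by (simp add: powr_powr sum_nonneg)
   also have "... <= (\<Sum>i\<in>T. d i powr q) powr (1 / q)"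
    using q d0 T by (intro powr_mono2 sum_powr_subadditive) auto
   also have "(\<Sum>i\<in>T. d i powr q) = (\<Sum>((s, sg), (mu, nu))\<in>T'. (A1 * A2 * weight mu * weight nu * mass V s sg) powr q)"
    unfolding T'_def by (subst sum.reindex) (auto simp: inj_on_def d_def intro!: sum.cong)
   also have "... powr (1 / q) <= B"
    unfolding B_def using q T cell_lattice[of eps y] y
    by (intro powr_mono2 sum_term_powr_le sum_nonneg) (auto simp: T'_def I_def)
   finally show ?thesis .
  qed
  then show "bdd_above (sum (%i. \<integral>xi. norm (f i xi) \<partial>lborel) ` {T. T \<subseteq> I & finite T})"
   by (intro bdd_aboveI2[where M = B]) auto
 qed simp
 have "countable I" "infinite I"
  unfolding I_def using countable_int_lattice[where 'v='v] infinite_int_lattice[where 'v='v]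
  by (auto simp: finite_cartesian_product_iff intro: int_lattice_0)
 from integral_has_sum[OF this fi sum pointwise]
 have "((%i. \<integral>xi. f i xi \<partial>lborel) has_sum (\<integral>xi. g xi \<partial>lborel)) I" .
 moreover have "(\<integral>xi. g xi \<partial>lborel) = r * abs_kernel t (b V) (x, y)"
  unfolding g_def integral_mult_right_zero by (simp add: abs_kernel_def c_def)
 moreover have "(%i. \<integral>xi. f i xi \<partial>lborel) = (%(sg, mu, nu). coef V s sg mu nu * L sg mu nu)"
  by (rule ext) (simp add: f_def coef_def c_def case_prod_beta mult_ac)
 ultimately show ?thesis by (simp add: I_def L_def zz r_def cell_kernel_def)
qed

end

section \<open>Operators assembled from the cells\<close>

lemma localized_L2:
 fixes h :: "'v::euclidean_space => complex"
 assumes h: "in_lattice_space_inf 2 h" and eps: "0 < eps" "eps <= 1 / 4"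
  and g: "continuous_on UNIV g" "!!x. norm (g x) <= 1"
 shows "sq_integrable (%x. h x * indicator {x. cell eps x = p} x * g x)"
  and "norm (abs_L2 (%x. h x * indicator {x. cell eps x = p} x * g x)) <= lattice_norm_inf 2 h"
proof -
 define f where "f x = h x * indicator {x. cell eps x = p} x * g x" for x
 define u where "u = eps *\<^sub>R p"
 have hm: "h \<in> borel_measurable lebesgue" and hi: "set_integrable lebesgue (unit_cube u) (%x. norm (h x) powr 2)"
  and bdd: "bdd_above (range (cube_norm 2 h))"
  using h by (auto simp: in_lattice_space_inf_def loc_Lp_def)
 have "{x. cell eps x = p} \<in> sets lebesgue" by (rule sets_completionI_sets) simp
 moreover have "g \<in> borel_measurable lebesgue"
  by (rule measurable_completion) (simp add: borel_measurable_continuous_onI[OF g(1)])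
 ultimately have fm: "f \<in> borel_measurable lebesgue"
  unfolding f_def[abs_def] by (intro borel_measurable_times hm borel_measurable_indicator)
 have sub: "x \<in> unit_cube u" if "cell eps x = p" for x
  unfolding unit_cube_def mem_box
 proof
  fix e :: 'v assume e: "e \<in> Basis"
  have "0 <= (x - u) \<bullet> e" "(x - u) \<bullet> e < eps" using cell_bounds[OF eps(1) e, of x] that by (auto simp: u_def)
  then show "(u - (1/2) *\<^sub>R One) \<bullet> e <= x \<bullet> e & x \<bullet> e <= (u + (1/2) *\<^sub>R One) \<bullet> e"
   using e eps by (simp add: inner_diff_left inner_add_left)
 qed
 have hi': "integrable lebesgue (%x. indicator (unit_cube u) x * (norm (h x))\<^sup>2)"
  using hi by (simp add: set_integrable_def powr_numeral)
 have le: "(norm (f x))\<^sup>2 <= indicator (unit_cube u) x * (norm (h x))\<^sup>2" for x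
 proof (cases "cell eps x = p")
  case True
  have "norm (f x) <= norm (h x)" using True g(2)[of x] by (simp add: f_def norm_mult mult_left_le)
  then show ?thesis using sub[OF True] by (simp add: power_mono)
 qed (simp add: f_def)
 have fi: "integrable lebesgue (%x. (norm (f x))\<^sup>2)"
  by (rule Bochner_Integration.integrable_bound[OF hi'])
   (use fm in measurable, use le in \<open>auto intro!: AE_I2 order_trans[OF le]\<close>)
 show sq: "sq_integrable (%x. h x * indicator {x. cell eps x = p} x * g x)"
  using fm fi unfolding f_def[abs_def] by (simp add: sq_integrable_def)
 define I where "I = (\<integral>x. indicator (unit_cube u) x * (norm (h x))\<^sup>2 \<partial>lebesgue)"
 have I0: "0 <= I" unfolding I_def by (intro Bochner_Integration.integral_nonneg) simp
 have "(norm (abs_L2 f))\<^sup>2 = (\<integral>x. (norm (f x))\<^sup>2 \<partial>lebesgue)"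
  using norm_abs_L2[OF sq] by (simp add: f_def[abs_def])
 also have "... <= I" unfolding I_def by (rule integral_mono[OF fi hi' le])
 also have "I = (cube_norm 2 h u)\<^sup>2"
  using I0 by (simp add: cube_norm_def set_lebesgue_integral_def powr_numeral I_def powr_half_sqrt)
 finally have "norm (abs_L2 f) <= cube_norm 2 h u"
  by (rule power2_le_imp_le) (simp add: cube_norm_def)
 also have "... <= lattice_norm_inf 2 h" unfolding lattice_norm_inf_def by (rule cSUP_upper[OF _ bdd]) simp
 finally show "norm (abs_L2 (%x. h x * indicator {x. cell eps x = p} x * g x)) <= lattice_norm_inf 2 h"
  by (simp add: f_def[abs_def])
qed

context cell_family
begin

definition bound :: real where
 "bound = K1 * K2 * lattice_norm 1 q F powr q * ((A1 * A2) powr q * (weight_sum * weight_sum))"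

lemma bound_nonneg: "0 <= bound"
 unfolding bound_def using A weight_sum_pos by simp

text \<open>The factors are \<open>h1\<close> and \<open>h2\<close> cut to a cell times unimodular functions, so their norms are at most the
 lattice norms of \<open>h1\<close> and \<open>h2\<close>; the operator depends only on the almost everywhere class of its kernel.\<close>

theorem weighted_operator:
 fixes om :: "'v => complex"
 assumes h: "in_lattice_space_inf 2 h1" "in_lattice_space_inf 2 h2"
  and W: "!!T. finite T ==> T \<subseteq> int_lattice ==> (\<Sum>V\<in>T. norm (om V) powr q) <= W0"
 defines "H \<equiv> lattice_norm_inf 2 h1 * lattice_norm_inf 2 h2"
 shows "\<exists>T\<in>schatten_class q. schatten_norm q T <= (2 * (H powr q * (W0 * bound))) powr (1 / q) &
  (\<forall>kap. (AE x in lebesgue. AE y in lebesgue. kap x y = h1 x * (om (cell eps x - cell eps y) * cell_kernel (cell eps x - cell eps y) x y) * h2 y) --> is_integral_operator kap T)"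
proof -
 define I where "I = (int_lattice :: 'v set) \<times> (((int_lattice :: 'v set) \<times> (int_lattice :: 'v set)) \<times> ((int_lattice :: 'v set) \<times> (int_lattice :: 'v set)))"
 define Phi0 where "Phi0 = (%(V, (s, sg), (mu, nu)) x. (om V * coef V s sg mu nu) * (h1 x * indicator {x. cell eps x = s + V} x * left_factor (s + V) sg mu nu x))"
 define Psi0 where "Psi0 = (%(V :: 'v, (s, sg), (mu, nu)) y. h2 y * indicator {y. cell eps y = s} y * right_factor s sg mu nu y)"
 define c where "c i = norm (abs_L2 (Phi0 i)) * norm (abs_L2 (Psi0 i))" for i
 have lc: "continuous_on UNIV (left_factor p sg mu nu)" "continuous_on UNIV (right_factor p sg mu nu)" for p sg mu nu
  unfolding left_factor_def[abs_def] right_factor_def[abs_def] char_def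
  by (intro continuous_on_mult continuous_on_cis continuous_intros)+
 note L = localized_L2[OF h(1) eps lc(1)] and R = localized_L2[OF h(2) eps lc(2)]
 have sq: "sq_integrable (Phi0 i)" "sq_integrable (Psi0 i)" for i
  by (cases i; auto simp: Phi0_def Psi0_def split: prod.split intro!: sq_integrable_scale L(1) R(1))+
 have c0: "0 <= c i" for i by (simp add: c_def)
 have H0: "0 <= H"
 proof -
  have "0 <= lattice_norm_inf 2 h1" "0 <= lattice_norm_inf 2 h2"
   using order_trans[OF norm_ge_zero L(2)] order_trans[OF norm_ge_zero R(2)] by simp_all
  then show ?thesis by (simp add: H_def)
 qed
 define D where "D V = (%((s, sg), (mu, nu)). (A1 * A2 * weight mu * weight nu * mass V s sg) powr q)" for V
 have cq: "c i powr q <= H powr q * (norm (om (fst i)) powr q * D (fst i) (snd i))" if "i \<in> I" for i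
 proof -
  obtain V s sg mu nu where i: "i = (V, (s, sg), (mu, nu))" "mu \<in> int_lattice" "nu \<in> int_lattice" using \<open>i \<in> I\<close> by (auto simp: I_def)
  define d where "d = A1 * A2 * weight mu * weight nu * mass V s sg"
  have d0: "0 <= d" by (simp add: d_def A weight_nonneg mass_nonneg)
  have Phi0i: "Phi0 i = (%x. (om V * coef V s sg mu nu) * (h1 x * indicator {x. cell eps x = s + V} x * left_factor (s + V) sg mu nu x))"
   by (simp add: Phi0_def i)
  have n1: "norm (abs_L2 (Phi0 i)) = norm (om V * coef V s sg mu nu) * norm (abs_L2 (%x. h1 x * indicator {x. cell eps x = s + V} x * left_factor (s + V) sg mu nu x))"
   unfolding Phi0i by (subst scaleC_abs_L2[symmetric]) (simp_all add: L(1))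
  have "c i <= (norm (om V * coef V s sg mu nu) * lattice_norm_inf 2 h1) * lattice_norm_inf 2 h2"
   unfolding c_def n1 using L(2) R(2) order_trans[OF norm_ge_zero L(2)]
   by (intro mult_mono mult_left_mono) (auto simp: Psi0_def i)
  also have "... = (norm (om V) * norm (coef V s sg mu nu)) * H" by (simp add: H_def norm_mult)
  also have "... <= (norm (om V) * d) * H"
   unfolding d_def using H0 by (intro mult_right_mono mult_left_mono norm_coef_le i) auto
  finally have "c i powr q <= ((norm (om V) * d) * H) powr q" using q c0 by (intro powr_mono2) auto
  also have "... = H powr q * (norm (om V) powr q * d powr q)" using H0 d0 by (simp add: powr_mult mult_ac)
  finally show ?thesis by (simp add: i D_def d_def)
 qed
 define B where "B = H powr q * (W0 * bound)"
 have sumI: "(\<Sum>i\<in>T. c i powr q) <= B" if T: "finite T" "T \<subseteq> I" for T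
 proof -
  have "(\<Sum>i\<in>T. c i powr q) <= (\<Sum>i\<in>T. H powr q * (norm (om (fst i)) powr q * D (fst i) (snd i)))" using T by (intro sum_mono cq) auto
  also have "... = H powr q * (\<Sum>(V, y)\<in>T. norm (om V) powr q * D V y)" by (simp add: sum_distrib_left case_prod_beta)
  also have "... <= B" unfolding B_def
  proof (rule mult_left_mono)
   show "(\<Sum>(V, y)\<in>T. norm (om V) powr q * D V y) <= W0 * bound"
   proof (rule finite_sum_dependent_product_le[OF _ _ W _ T(1) _ bound_nonneg])
    show "T \<subseteq> int_lattice \<times> ((int_lattice \<times> int_lattice) \<times> (int_lattice \<times> int_lattice))" using T by (simp add: I_def)
    show "sum (D V) S <= bound" if "finite S" "S \<subseteq> (int_lattice \<times> int_lattice) \<times> (int_lattice \<times> int_lattice)" for V S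
    using sum_term_powr_le[OF that, of V] by (simp add: D_def bound_def case_prod_beta')
    show "0 <= D V y" for V y by (simp add: D_def split: prod.split)
   qed auto
  qed simp
  finally show ?thesis .
 qed
 have cI: "countable I" "infinite I"
  unfolding I_def using countable_int_lattice[where 'v='v] infinite_int_lattice[where 'v='v]
  by (auto simp: finite_cartesian_product_iff intro: int_lattice_0)
 obtain e :: "nat => 'v \<times> ('v \<times> 'v) \<times> ('v \<times> 'v)" where e: "bij_betw e UNIV I" using bij_betw_from_nat_into[OF cI] by blast
 have inj: "inj e" and img: "range e = I" using e by (auto simp: bij_betw_def)
 have part: "(\<Sum>k<N. c (e k) powr q) <= B" for N
 proof -
  have "(\<Sum>k<N. c (e k) powr q) = (\<Sum>i\<in>e ` {..<N}. c i powr q)" by (simp add: sum.reindex inj_on_subset[OF inj])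
  also have "... <= B" using img by (intro sumI) auto
  finally show ?thesis .
 qed
 have sc: "summable (%k. c (e k) powr q)" by (rule summableI_nonneg_bounded[OF _ part]) simp
 have sB: "(\<Sum>k. c (e k) powr q) <= B" by (rule suminf_le_const[OF sc part])
 interpret N: nuclear_family "%k. Phi0 (e k)" "%k. Psi0 (e k)"
 proof
  show "summable (%k. norm (abs_L2 (Phi0 (e k))) * norm (abs_L2 (Psi0 (e k))))"
   using summable_of_summable_powr[OF q _ sc] c0 by (simp add: c_def)
 qed (rule sq)+
 let ?T = "nuc (%k. Phi0 (e k)) (%k. Psi0 (e k))"
 have sc': "summable (%k. (norm (abs_L2 (Phi0 (e k))) * norm (abs_L2 (Psi0 (e k)))) powr q)" using sc by (simp add: c_def)
 have sB': "(\<Sum>k. (norm (abs_L2 (Phi0 (e k))) * norm (abs_L2 (Psi0 (e k)))) powr q) <= B" using sB by (simp add: c_def)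
 show ?thesis
 proof (intro bexI[of _ ?T] conjI allI impI)
  show "?T \<in> schatten_class q" by (rule N.nuc_schatten(1)[OF q sc'])
  have "schatten_norm q ?T <= (2 * (\<Sum>k. (norm (abs_L2 (Phi0 (e k))) * norm (abs_L2 (Psi0 (e k)))) powr q)) powr (1 / q)"
   by (rule N.nuc_schatten(2)[OF q sc'])
  also have "... <= (2 * B) powr (1 / q)"
   using q sB' suminf_nonneg[OF sc'] by (intro powr_mono2) auto
  finally show "schatten_norm q ?T <= (2 * (H powr q * (W0 * bound))) powr (1 / q)" by (simp add: B_def)
  fix kap
  assume kap: "AE x in lebesgue. AE y in lebesgue. kap x y = h1 x * (om (cell eps x - cell eps y) * cell_kernel (cell eps x - cell eps y) x y) * h2 y"
  have main: "summable (%k. norm (Phi0 (e k) x * Psi0 (e k) y)) & h1 x * (om (cell eps x - cell eps y) * cell_kernel (cell eps x - cell eps y) x y) * h2 y = (\<Sum>k. Phi0 (e k) x * Psi0 (e k) y)" for x y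
  proof -
   define s V where "s = cell eps y" and "V = cell eps x - cell eps y"
   have cx: "cell eps x = s + V" and cy: "cell eps y = s" by (simp_all add: s_def V_def)
   define K where "K = cell_kernel V x y"
   define G where "G = (%(sg, mu, nu). (V, (s, sg), (mu, nu)) :: 'v \<times> ('v \<times> 'v) \<times> ('v \<times> 'v))"
   define J where "J = (int_lattice :: 'v set) \<times> ((int_lattice :: 'v set) \<times> (int_lattice :: 'v set))"
   have injG: "inj_on G J" by (auto simp: inj_on_def G_def)
   have 1: "((%i. (h1 x * om V * h2 y) * (case i of (sg, mu, nu) => coef V s sg mu nu * (left_factor (s + V) sg mu nu x * right_factor s sg mu nu y))) has_sum
    ((h1 x * om V * h2 y) * K)) J"
    unfolding K_def J_def by (rule has_sum_cmult_right[OF coef_expansion[OF cx cy]])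
   have 2: "((%i. Phi0 i x * Psi0 i y) \<circ> G) = (%i. (h1 x * om V * h2 y) * (case i of (sg, mu, nu) => coef V s sg mu nu * (left_factor (s + V) sg mu nu x * right_factor s sg mu nu y)))"
    by (auto simp: fun_eq_iff G_def Phi0_def Psi0_def cx cy mult_ac)
   from 1 have "((%i. Phi0 i x * Psi0 i y) has_sum ((h1 x * om V * h2 y) * K)) (G ` J)"
    unfolding has_sum_reindex[OF injG] 2 .
   moreover have "((%i. Phi0 i x * Psi0 i y) has_sum ((h1 x * om V * h2 y) * K)) (G ` J) \<longleftrightarrow> ((%i. Phi0 i x * Psi0 i y) has_sum ((h1 x * om V * h2 y) * K)) I"
   proof (rule has_sum_cong_neutral)
    show "Phi0 i x * Psi0 i y = 0" if "i \<in> I - G ` J" for i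
    proof -
    obtain V' s' sg mu nu where i: "i = (V', (s', sg), (mu, nu))" "sg \<in> int_lattice" "mu \<in> int_lattice" "nu \<in> int_lattice" using \<open>i \<in> I - G ` J\<close> by (auto simp: I_def)
    have "\<not> (V' = V & s' = s)"
    proof
    assume "V' = V & s' = s"
    then have "i = G (sg, mu, nu)" by (simp add: i G_def)
    then have "i \<in> G ` J" using i by (auto simp: J_def)
    with that show False by simp
    qed
    then have "cell eps x ~= s' + V' \<or> cell eps y ~= s'" by (auto simp: cx cy)
    then show ?thesis by (auto simp: Phi0_def Psi0_def i)
    qed
   next
    have VL: "V \<in> int_lattice" "s \<in> int_lattice" by (simp_all add: V_def s_def cell_lattice int_lattice_diff)
    show "Phi0 i x * Psi0 i y = 0" if "i \<in> G ` J - I" for i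
    using that VL by (auto simp: G_def J_def I_def)
   qed simp
   ultimately have "((%i. Phi0 i x * Psi0 i y) has_sum ((h1 x * om V * h2 y) * K)) (range e)" by (simp add: img)
   then have hs: "((%k. Phi0 (e k) x * Psi0 (e k) y) has_sum ((h1 x * om V * h2 y) * K)) UNIV"
    unfolding has_sum_reindex[OF inj] by (simp add: o_def)
   have "(%k. norm (Phi0 (e k) x * Psi0 (e k) y)) summable_on UNIV"
    using has_sum_imp_summable[OF hs] unfolding summable_on_iff_abs_summable_on_complex .
   then have "summable (%k. norm (Phi0 (e k) x * Psi0 (e k) y))"
    by (rule summable_on_UNIV_nonneg_real_iff[THEN iffD1, rotated]) simp
   moreover have "(\<Sum>k. Phi0 (e k) x * Psi0 (e k) y) = (h1 x * om V * h2 y) * K"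
    using has_sum_imp_sums[OF hs] by (simp add: sums_iff)
   ultimately show ?thesis by (simp add: K_def V_def[symmetric] mult_ac)
  qed
  show "is_integral_operator kap ?T"
  proof (rule N.nuc_integral_operator)
   show "AE x in lebesgue. AE y in lebesgue. summable (%k. norm (Phi0 (e k) x * Psi0 (e k) y)) & kap x y = (\<Sum>k. Phi0 (e k) x * Psi0 (e k) y)"
    using kap
   proof eventually_elim
    case (elim x)
    then show ?case
    proof eventually_elim
    case (elim y)
    then show ?case using main[of x y] by simp
    qed
   qed
  qed
 qed
qed

end

text \<open>Lindelof: countably many of the open null sets cover the complement.\<close>

lemma AE_ess_support: "AE x in lebesgue. h x = 0 \<or> x \<in> ess_support (h :: 'v::euclidean_space => complex)"
proof -
 define \<V> where "\<V> = {V. open V & (AE x\<in>V in lebesgue. h x = 0)}"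
 obtain \<V>' where V': "\<V>' \<subseteq> \<V>" "countable \<V>'" "\<Union>\<V>' = \<Union>\<V>"
  using Lindelof[of \<V>] unfolding \<V>_def by blast
 have "AE x in lebesgue. \<forall>V\<in>\<V>'. x \<in> V --> h x = 0"
  using V' by (subst AE_ball_countable) (auto simp: \<V>_def)
 then show ?thesis
 proof eventually_elim
  case (elim x)
  then show ?case using V'(3) unfolding ess_support_def \<V>_def[symmetric] by blast
 qed
qed

lemma is_weighted_Op_formula:
 assumes eq: "!!x y. x \<in> ess_support h1 ==> y \<in> ess_support h2 ==> k (x, y) = kap x y"
 shows "AE x in lebesgue. AE y in lebesgue. h1 x * k (x, y) * h2 y = h1 x * kap x y * h2 y"
 using AE_ess_support[of h1]
proof eventually_elim
 case (elim x)
 show ?case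
  using AE_ess_support[of h2]
 proof eventually_elim
  case (elim y)
  with \<open>h1 x = 0 \<or> x \<in> ess_support h1\<close> eq[of x y] show ?case by auto
 qed
qed

section \<open>The estimate for weighted operators\<close>

text \<open>With \<open>eps = 1 / (12 d)\<close> the threshold \<open>6 r\<close> keeps \<open>\<bar>rho\<bar> * 6 eps <= 1\<close>, and cells that contain points at
 distance at least \<open>r\<close> are far.\<close>

definition far :: "real => 'v::euclidean_space => bool" where
 "far r V \<longleftrightarrow> 6 * r <= infnorm V"

definition main_dir :: "'v::euclidean_space => 'v" where
 "main_dir V = (SOME e. e \<in> Basis & \<bar>V \<bullet> e\<bar> = infnorm V)"

lemma main_dir: "main_dir V \<in> Basis" "\<bar>V \<bullet> main_dir V\<bar> = infnorm V"
proof -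
 have "\<exists>e. e \<in> Basis & \<bar>V \<bullet> e\<bar> = infnorm V" by (metis infnorm_attained)
 from someI_ex[OF this] show "main_dir V \<in> Basis" "\<bar>V \<bullet> main_dir V\<bar> = infnorm V" by (simp_all add: main_dir_def)
qed

definition far_rate :: "real => real => 'v::euclidean_space => real" where
 "far_rate eps r V = (if far r V then 1 / (eps * (V \<bullet> main_dir V)) else 0)"

definition cell_weight :: "real => real => nat => complex => 'v::euclidean_space => complex" where
 "cell_weight eps r m om0 V = (if far r V then (\<i> * of_real (far_rate eps r V)) ^ m else om0)"

lemma far_rate_bound:
 assumes "0 < eps" "1 <= r"
 shows "\<bar>far_rate eps r V\<bar> * (6 * eps) <= 1"
proof (cases "far r V")
 case True
 then have V: "6 <= infnorm V" using assms(2) by (simp add: far_def)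
 have "\<bar>far_rate eps r V\<bar> * (6 * eps) = 6 / infnorm V"
  using assms(1) True by (simp add: far_rate_def abs_mult main_dir(2))
 then show ?thesis using V by simp
qed (simp add: far_rate_def)

lemma norm_cell_weight_le:
 assumes eps: "0 < eps" "eps <= 1 / 4" and r: "1 <= r" and om0: "om0 = 0 \<or> om0 = 1 & r = 1"
 shows "norm (cell_weight eps r m om0 V) <= (2 / eps) ^ m * r powr (- real m) * (1 + infnorm V / r) powr (- real m)"
proof -
 have y: "1 <= 1 + infnorm V / r" using infnorm_pos_le[of V] r by simp
 have eq: "(2 / eps) ^ m * r powr (- real m) * (1 + infnorm V / r) powr (- real m) = (2 / (eps * (r + infnorm V))) ^ m"
 proof -
  have "r * (1 + infnorm V / r) = r + infnorm V" using r by (simp add: distrib_left)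
  then have "r powr (- real m) * (1 + infnorm V / r) powr (- real m) = (1 / (r + infnorm V)) ^ m"
   using r y by (simp add: powr_minus powr_realpow power_mult_distrib[symmetric] inverse_eq_divide power_one_over[symmetric])
  then show ?thesis by (simp add: mult.assoc power_mult_distrib[symmetric])
 qed
 have pos: "0 < r + infnorm V" using r infnorm_pos_le[of V] by linarith
 show ?thesis
 proof (cases "far r V")
  case True
  then have V: "6 * r <= infnorm V" by (simp add: far_def)
  have "norm (\<i> * complex_of_real (far_rate eps r V)) = 1 / (eps * infnorm V)"
   unfolding norm_mult norm_of_real using eps(1) True by (simp add: far_rate_def abs_mult main_dir(2))
  then have "norm (cell_weight eps r m om0 V) = (1 / (eps * infnorm V)) ^ m"
   using True by (simp only: cell_weight_def if_True norm_power)
  also have "... <= (2 / (eps * (r + infnorm V))) ^ m"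
  proof (rule power_mono)
   have "1 / (eps * infnorm V) = 2 / (eps * (infnorm V + infnorm V))" using V r eps(1) by (simp add: field_simps)
   also have "... <= 2 / (eps * (r + infnorm V))"
    using V r eps(1) pos by (intro divide_left_mono mult_left_mono mult_pos_pos) auto
   finally show "1 / (eps * infnorm V) <= 2 / (eps * (r + infnorm V))" .
  qed (use eps(1) V r in auto)
  finally show ?thesis unfolding eq .
 next
  case False
  show ?thesis
  proof (cases "om0 = 0")
   case True
   then show ?thesis using False eps(1) by (simp add: cell_weight_def)
  next
   case nz: False
   then have "om0 = 1" "r = 1" using om0 by auto
   then have "r + infnorm V <= 7" using False by (simp add: far_def)
   then have "eps * (r + infnorm V) <= 1 / 4 * 7" using eps pos by (intro mult_mono) auto
   then have "1 <= 2 / (eps * (r + infnorm V))" using eps(1) pos by (subst pos_le_divide_eq) auto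
   then show ?thesis unfolding eq using False \<open>om0 = 1\<close> by (simp add: cell_weight_def one_le_power)
  qed
 qed
qed

text \<open>Only about \<open>r ^ d\<close> of the weights are of the maximal size \<open>r ^ (- m)\<close>; the others decay with exponent
 \<open>m q > d\<close>. The near weight \<open>1\<close> occurs for \<open>r = 1\<close> only.\<close>

lemma sum_cell_weight_le:
 fixes T :: "'v::euclidean_space set"
 assumes eps: "0 < eps" "eps <= 1 / 4" and r: "1 <= r" and om0: "om0 = 0 \<or> om0 = 1 & r = 1" and q: "0 < q"
  and m: "real DIM('v) < m * q" and T: "finite T" "T \<subseteq> int_lattice"
 shows "(\<Sum>V\<in>T. norm (cell_weight eps r m om0 V) powr q)
  <= ((2 / eps) ^ m * r powr (- real m)) powr q * ((2 * (1 + 1 / (m * q / DIM('v) - 1))) ^ DIM('v) * r ^ DIM('v))"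
proof -
 define G where "G = ((2 / eps) ^ m * r powr (- real m)) powr q"
 have "norm (cell_weight eps r m om0 V) powr q <= G * (1 + infnorm V / r) powr (- (m * q))" for V :: 'v
 proof -
  have "norm (cell_weight eps r m om0 V) powr q <= ((2 / eps) ^ m * r powr (- real m) * (1 + infnorm V / r) powr (- real m)) powr q"
   using q by (intro powr_mono2 norm_cell_weight_le[OF eps r om0]) auto
  also have "... = G * (1 + infnorm V / r) powr (- (m * q))"
   using eps(1) by (simp add: G_def powr_mult powr_powr)
  finally show ?thesis .
 qed
 then have "(\<Sum>V\<in>T. norm (cell_weight eps r m om0 V) powr q) <= (\<Sum>V\<in>T. G * (1 + infnorm V / r) powr (- (m * q)))"
  by (intro sum_mono)
 also have "... = G * (\<Sum>V\<in>T. (1 + infnorm V / r) powr (- (m * q)))" by (simp add: sum_distrib_left)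
 also have "... <= G * ((2 * (1 + 1 / (m * q / DIM('v) - 1))) ^ DIM('v) * r ^ DIM('v))"
  by (intro mult_left_mono finite_sum_lattice_weight_le m r T) (simp add: G_def)
 finally show ?thesis by (simp add: G_def)
qed

text \<open>Write \<open>(x - y)\<^sub>j = (1 + rho z\<^sub>j) / rho\<close> and divide.\<close>

lemma kernel_far:
 fixes x y V :: "'v::euclidean_space"
 assumes U: "open U" "Op_kernel_on U 1 t (al 0) k" "(x, y) \<in> U" and ch: "xi_chain m (main_dir V) al" "dominated (al m)"
  and far: "far r V" and eps: "0 < eps" and r: "1 <= r" and z: "\<bar>(x - y - eps *\<^sub>R V) \<bullet> main_dir V\<bar> <= eps"
 shows "k (x, y) = (\<i> * of_real (far_rate eps r V)) ^ m *
  (of_real (inverse (1 + far_rate eps r V * ((x - y - eps *\<^sub>R V) \<bullet> main_dir V)) ^ m) * abs_kernel t (al m) (x, y))"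
proof -
 define rho v z' where "rho = far_rate eps r V" and "v = V \<bullet> main_dir V" and "z' = (x - y - eps *\<^sub>R V) \<bullet> main_dir V"
 have "6 <= \<bar>v\<bar>" using far r main_dir(2)[of V] by (simp add: far_def v_def)
 then have v0: "v ~= 0" by auto
 have rho: "rho = 1 / (eps * v)" using far by (simp add: rho_def far_rate_def v_def)
 have rho0: "rho ~= 0" using v0 eps by (simp add: rho)
 have "\<bar>rho * z'\<bar> <= \<bar>rho\<bar> * eps" using z by (simp add: abs_mult z'_def mult_left_mono)
 then have u0: "1 + rho * z' ~= 0" using far_rate_bound[OF eps r, of V] by (simp add: rho_def)
 have vc: "vcoord (main_dir V) (x, y) = of_real ((1 + rho * z') / rho)"
 proof -
  have "(x - y) \<bullet> main_dir V = eps * v + z'" by (simp add: z'_def v_def inner_diff_left)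
  moreover have "(1 + rho * z') / rho = 1 / rho + z'" using rho0 by (simp add: add_divide_distrib)
  moreover have "1 / rho = eps * v" by (simp add: rho)
  ultimately show ?thesis by (simp only: vcoord_def fst_conv snd_conv)
 qed
 have "vcoord (main_dir V) (x, y) ^ m * k (x, y) = \<i> ^ m * abs_kernel t (al m) (x, y)"
  by (rule kernel_division[OF U(1,2) ch U(3)])
 then have e1: "of_real ((1 + rho * z') / rho) ^ m * k (x, y) = \<i> ^ m * abs_kernel t (al m) (x, y)" by (simp only: vc)
 have "complex_of_real (rho * inverse (1 + rho * z')) ^ m * of_real ((1 + rho * z') / rho) ^ m = 1"
  unfolding power_mult_distrib[symmetric] of_real_mult[symmetric] using rho0 u0 by simp
 then have "k (x, y) = complex_of_real (rho * inverse (1 + rho * z')) ^ m * (of_real ((1 + rho * z') / rho) ^ m * k (x, y))"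
  by (simp only: mult.assoc[symmetric] mult_1_left)
 also have "... = complex_of_real (rho * inverse (1 + rho * z')) ^ m * (\<i> ^ m * abs_kernel t (al m) (x, y))" by (simp only: e1)
 also have "... = (\<i> * of_real rho) ^ m * (of_real (inverse (1 + rho * z') ^ m) * abs_kernel t (al m) (x, y))"
  by (simp add: power_mult_distrib mult_ac)
 finally show ?thesis by (simp add: rho_def z'_def)
qed

lemma norm_le_DIM_infnorm: "norm (x :: 'v::euclidean_space) <= real DIM('v) * infnorm x"
proof -
 have "norm x <= (\<Sum>e\<in>Basis. \<bar>x \<bullet> e\<bar>)" by (rule norm_le_l1)
 also have "... <= (\<Sum>e\<in>(Basis::'v set). infnorm x)" by (intro sum_mono component_le_infnorm')
 finally show ?thesis by simp
qed

lemma cell_difference_bound: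
 assumes "0 < eps" "e \<in> Basis"
 shows "\<bar>(x - y - eps *\<^sub>R (cell eps x - cell eps y)) \<bullet> e\<bar> <= eps"
proof -
 have "(x - y - eps *\<^sub>R (cell eps x - cell eps y)) \<bullet> e = (x - eps *\<^sub>R cell eps x) \<bullet> e - (y - eps *\<^sub>R cell eps y) \<bullet> e"
  by (simp add: inner_diff_left algebra_simps)
 then show ?thesis using cell_bounds[OF assms, of x] cell_bounds[OF assms, of y] by linarith
qed

text \<open>Both parts of the theorem at once: \<open>om0 = 1\<close> with \<open>r = 1\<close> is the case without separation, where near cells are
 treated with \<open>a\<close> itself, and \<open>om0 = 0\<close> is the case of separated supports, where near cells are discarded.\<close>

definition schatten_estimate :: "'v::euclidean_space itself => real => nat => nat => real => bool" where
 "schatten_estimate (_ :: 'v itself) q n m C \<longleftrightarrow> (\<forall>(h1 :: 'v => complex) h2 a t r F B b0 (om0::complex).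
  in_lattice_space_inf 2 h1 --> in_lattice_space_inf 2 h2 --> 0 <= t --> t <= 1 --> 1 <= r -->
  (\<forall>p. 0 <= F p) --> in_lattice_space 1 q F -->
  (\<forall>i\<in>Basis. xi_chain m i (B i) & B i 0 = a & dominated (B i m) & w_chain n (B i m) F) --> w_chain n b0 F -->
  (om0 = 0 & (\<forall>x\<in>ess_support h1. \<forall>y\<in>ess_support h2. r <= dist x y) \<or> om0 = 1 & r = 1 & b0 = a & dominated a) -->
  (\<exists>T. is_weighted_Op 1 t h1 a h2 T) &
  (\<forall>T. is_weighted_Op 1 t h1 a h2 T --> T \<in> schatten_class q &
   schatten_norm q T <= C * r powr (real DIM('v) / q - real m) * lattice_norm_inf 2 h1 * lattice_norm_inf 2 h2 * lattice_norm 1 q F))"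

text \<open>The constructed operator is the only one, since \<open>kernel_division\<close> determines the values of every
 admissible kernel on the product of the essential supports.\<close>

theorem weighted_Op_bound:
 fixes q :: real and n m :: nat
 assumes q: "0 < q" "q <= 1" and n: "real DIM('v::euclidean_space) < n * q" and mn: "n <= m"
 shows "\<exists>C>0. schatten_estimate TYPE('v) q n m C"
proof -
 define d where "d = real DIM('v)"
 have d: "1 <= d" by (simp add: d_def Suc_leI)
 \<comment> \<open>If \<open>|x - y| \<ge> r\<close>, then \<open>infnorm (eps V) \<ge> r / d - eps \<ge> 6 eps r\<close>, as \<open>r \<ge> 1\<close>.\<close>
 define eps where "eps = 1 / (12 * d)"
 have eps: "0 < eps" "eps <= 1 / 4" using d by (auto simp: eps_def field_simps)
 have "real n * q <= real n * 1" using q by (intro mult_left_mono) auto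
 then have n': "DIM('v) < n" using n by simp
 have "real n * q <= real m * q" using mn q by (intro mult_right_mono) auto
 then have m: "real DIM('v) < m * q" using n by simp
 obtain A1 where A1: "0 < A1" and P: "\<forall>(j::'v)\<in>Basis. \<forall>rho eta. \<bar>rho\<bar> * (6 * eps) <= 1 --> (\<forall>b\<in>Basis. \<bar>eta \<bullet> b\<bar> <= 1) -->
  (\<forall>nu\<in>int_lattice. norm (fcoef eps (phase rho j m eta) nu) <= A1 * (1 + infnorm nu) powr (- real n)) &
  (\<forall>z. (\<forall>b\<in>Basis. \<bar>z \<bullet> b\<bar> <= eps) --> ((%nu. fcoef eps (phase rho j m eta) nu * char (6 * eps) nu z) has_sum phase rho j m eta z) int_lattice)"
  using phase_expansion[OF eps(1) n', of m] by blast
 obtain A2 where A2: "0 < A2" and Q: "\<forall>(b :: 'v \<times> 'v => complex) F c xi. w_chain n b F -->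
  (\<forall>mu\<in>int_lattice. norm (fcoef eps (%w. b (c + w, xi)) mu) <= A2 * (1 + infnorm mu) powr (- real n) *
    (\<integral>w. indicator (kbox eps) w * F (c + w, xi) \<partial>lborel)) &
  (\<forall>w. (\<forall>e\<in>Basis. \<bar>w \<bullet> e\<bar> <= eps) --> ((%mu. fcoef eps (%w. b (c + w, xi)) mu * char (6 * eps) mu w) has_sum b (c + w, xi)) int_lattice)"
  using w_chain_expansion[OF eps(1) n'] by blast
 obtain K1 where K1: "0 <= K1" "!!(v::'v) T. finite T ==> T \<subseteq> {s \<in> int_lattice. infnorm (s - v) <= 1 / eps} ==> real (card T) <= K1"
  using lattice_count[of "1 / eps"] by blast
 obtain K2 where K2: "0 <= K2" "!!(v::'v) T. finite T ==> T \<subseteq> {s \<in> int_lattice. infnorm (s - v) <= 2} ==> real (card T) <= K2"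
  using lattice_count[of 2] by blast
 define S where "S = (2 * (1 + 1 / (m * q / DIM('v) - 1))) ^ DIM('v)"
 define R where "R = (2 * (1 + 1 / (n * q / DIM('v) - 1))) ^ DIM('v)"
 have S0: "0 <= S" unfolding S_def using m by (intro zero_le_power mult_nonneg_nonneg add_nonneg_nonneg) auto
 define C where "C = (2 * (S * (K1 * K2 * (R * R)))) powr (1 / q) * (2 / eps) ^ m * (A1 * A2)"
 have C0: "0 <= C" unfolding C_def using A1 A2 eps by (intro mult_nonneg_nonneg) auto
 show ?thesis
  unfolding schatten_estimate_def
 proof (intro exI[of _ "C + 1"] conjI[of "0 < C + 1"] allI impI)
  show "0 < C + 1" using C0 by linarith
  fix h1 h2 :: "'v => complex" and a b0 :: "'v \<times> 'v => complex" and t r :: real and F :: "'v \<times> 'v => real"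
   and B :: "'v => nat => 'v \<times> 'v => complex" and om0 :: complex
  assume h: "in_lattice_space_inf 2 h1" "in_lattice_space_inf 2 h2" and t: "0 <= t" "t <= 1" and r: "1 <= r"
   and F: "\<forall>p. 0 <= F p" "in_lattice_space 1 q F"
   and B: "\<forall>i\<in>Basis. xi_chain m i (B i) & B i 0 = a & dominated (B i m) & w_chain n (B i m) F" and b0: "w_chain n b0 F"
   and cs: "om0 = 0 & (\<forall>x\<in>ess_support h1. \<forall>y\<in>ess_support h2. r <= dist x y) \<or> om0 = 1 & r = 1 & b0 = a & dominated a"
  define j where "j = (main_dir :: 'v => 'v)"
  define rho where "rho = (far_rate eps r :: 'v => real)"
  define b where "b V = (if far r V then B (j V) m else b0)" for V
  define om where "om = (cell_weight eps r m om0 :: 'v => complex)"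
  have jB: "j V \<in> Basis" for V by (simp add: j_def main_dir)
  have wc: "w_chain n (b V) F" for V using B b0 jB by (simp add: b_def)
  have bc: "continuous_on UNIV (b V)" for V
  proof -
   obtain i0 :: 'v where "i0 \<in> Basis" using nonempty_Basis by blast
   then show ?thesis using wc[of V] unfolding w_chain_def by (metis le0)
  qed
  have rhob: "\<bar>rho V\<bar> * (6 * eps) <= 1" for V unfolding rho_def by (rule far_rate_bound[OF eps(1) r])
  interpret cell_family eps q t n m F rho j b A1 A2 K1 K2
  proof
   show "norm (fcoef eps (phase (rho V) (j V) m eta) nu) <= A1 * (1 + infnorm nu) powr (- real n)"
    if "nu \<in> int_lattice" "\<forall>e\<in>Basis. \<bar>eta \<bullet> e\<bar> <= 1" for V eta nu
    using P[rule_format, OF jB rhob] that by blast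
   show "((%nu. fcoef eps (phase (rho V) (j V) m eta) nu * char (6 * eps) nu z) has_sum phase (rho V) (j V) m eta z) int_lattice"
    if "\<forall>e\<in>Basis. \<bar>eta \<bullet> e\<bar> <= 1" "\<forall>e\<in>Basis. \<bar>z \<bullet> e\<bar> <= eps" for V eta z
    using P[rule_format, OF jB rhob] that by blast
   show "norm (fcoef eps (%w. b V (c + w, xi)) mu) <= A2 * (1 + infnorm mu) powr (- real n) * (\<integral>w. indicator (kbox eps) w * F (c + w, xi) \<partial>lborel)"
    if "mu \<in> int_lattice" for V c xi mu using Q wc that by blast
   show "((%mu. fcoef eps (%w. b V (c + w, xi)) mu * char (6 * eps) mu w) has_sum b V (c + w, xi)) int_lattice"
    if "\<forall>e\<in>Basis. \<bar>w \<bullet> e\<bar> <= eps" for V c xi w using Q wc that by blast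
   show "continuous_on UNIV F" using b0 by (simp add: w_chain_def)
  qed (use eps q n t F bc jB rhob K1 K2 A1 A2 in auto)
  define H where "H = lattice_norm_inf 2 h1 * lattice_norm_inf 2 h2"
  define L where "L = lattice_norm 1 q F"
  define kap where "kap x y = om (cell eps x - cell eps y) * cell_kernel (cell eps x - cell eps y) x y" for x y
  define W0 where "W0 = ((2 / eps) ^ m * r powr (- real m)) powr q * (S * r ^ DIM('v))"
  have W: "(\<Sum>V\<in>T. norm (om V) powr q) <= W0" if "finite T" "T \<subseteq> int_lattice" for T
   unfolding om_def W0_def S_def using cs by (intro sum_cell_weight_le[OF eps r _ q(1) m that]) auto
  obtain T0 where T0: "T0 \<in> schatten_class q" "schatten_norm q T0 <= (2 * (H powr q * (W0 * bound))) powr (1 / q)"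
   and op: "!!kap'. (AE x in lebesgue. AE y in lebesgue. kap' x y = h1 x * kap x y * h2 y) ==> is_integral_operator kap' T0"
   using weighted_operator[OF h W] unfolding H_def kap_def by blast
  have formula: "k (x, y) = kap x y"
   if U: "open U" "ess_support h1 \<times> ess_support h2 \<subseteq> U" "Op_kernel_on U 1 t a k"
    and x: "x \<in> ess_support h1" and y: "y \<in> ess_support h2" for U k x y
  proof -
   define V where "V = cell eps x - cell eps y"
   have xy: "(x, y) \<in> U" using U(2) x y by blast
   show ?thesis
   proof (cases "far r V")
    case True
    have Bj: "xi_chain m (main_dir V) (B (j V))" "B (j V) 0 = a" "dominated (B (j V) m)" using B jB[of V] by (auto simp: j_def)
    have "k (x, y) = (\<i> * of_real (far_rate eps r V)) ^ m *
    (of_real (inverse (1 + far_rate eps r V * ((x - y - eps *\<^sub>R V) \<bullet> main_dir V)) ^ m) * abs_kernel t (B (j V) m) (x, y))"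
    proof (rule kernel_far[OF U(1) _ xy Bj(1,3) True eps(1) r])
    show "Op_kernel_on U 1 t (B (j V) 0) k" using U(3) by (simp add: Bj(2))
    show "\<bar>(x - y - eps *\<^sub>R V) \<bullet> main_dir V\<bar> <= eps" unfolding V_def by (rule cell_difference_bound[OF eps(1) main_dir(1)])
    qed
    then show ?thesis unfolding kap_def cell_kernel_def V_def[symmetric] using True by (simp add: om_def cell_weight_def rho_def j_def b_def)
   next
    case False
    have "om0 = 1 & r = 1 & b0 = a & dominated a"
    proof (rule ccontr)
    assume "\<not> ?thesis"
    then have "r <= dist x y" using cs x y by blast
    also have "... <= d * infnorm (x - y)" unfolding d_def dist_norm by (rule norm_le_DIM_infnorm)
    finally have 1: "r <= d * infnorm (x - y)" .
    have "infnorm (x - y) <= infnorm (x - y - eps *\<^sub>R V) + infnorm (eps *\<^sub>R V)"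
    using infnorm_triangle[of "x - y - eps *\<^sub>R V" "eps *\<^sub>R V"] by simp
    also have "infnorm (x - y - eps *\<^sub>R V) <= eps" unfolding V_def by (rule infnorm_leI) (rule cell_difference_bound[OF eps(1)])
    also have "infnorm (eps *\<^sub>R V) = eps * infnorm V" using eps(1) by (simp add: infnorm_mul)
    finally have "d * infnorm (x - y) <= d * (eps + eps * infnorm V)" using d by (intro mult_left_mono) auto
    also have "... = (1 + infnorm V) / 12" using d by (simp add: eps_def field_simps)
    finally have "12 * (d * infnorm (x - y)) <= 1 + infnorm V" by simp
    then have "12 * r <= 1 + infnorm V" using 1 by linarith
    then show False using False r by (simp add: far_def)
    qed
    then have a: "om0 = 1" "b0 = a" "dominated a" by auto
    \<comment> \<open>Division by the zeroth power: the kernel is the absolutely convergent integral.\<close>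
    have "xi_chain 0 i0 (%_. a)" for i0 using dominated_growth[OF a(3)] a(3) by (simp add: xi_chain_def dominated_def)
    from kernel_division[OF U(1) _ this _ xy] have "k (x, y) = abs_kernel t a (x, y)" using U(3) a(3) by fastforce
    then show ?thesis unfolding kap_def cell_kernel_def V_def[symmetric] using False a by (simp add: om_def cell_weight_def rho_def far_rate_def b_def)
   qed
  qed
  have op': "is_integral_operator (%x y. h1 x * k (x, y) * h2 y) T0"
   if U: "open U" "ess_support h1 \<times> ess_support h2 \<subseteq> U" "Op_kernel_on U 1 t a k" for U k
   by (rule op, rule is_weighted_Op_formula, rule formula[OF U])
  have ex: "is_weighted_Op 1 t h1 a h2 T0"
  proof (cases "om0 = 1 & dominated a")
   case True
   have U: "open (UNIV :: ('v \<times> 'v) set)" "ess_support h1 \<times> ess_support h2 \<subseteq> UNIV" "Op_kernel_on UNIV 1 t a (abs_kernel t a)"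
    using True Op_kernel_on_abs_kernel by auto
   show ?thesis unfolding is_weighted_Op_def using U op'[OF U] by blast
  next
   case False
   then have sep: "\<forall>x\<in>ess_support h1. \<forall>y\<in>ess_support h2. r <= dist x y" using cs by blast
   obtain k where k: "Op_kernel_on {p. fst p ~= snd p} 1 t a k"
    using Op_kernel_on_off_diagonal[of m B a t] B by blast
   have U: "open {p :: 'v \<times> 'v. fst p ~= snd p}" by (intro open_Collect_neq continuous_intros)
   have sub: "ess_support h1 \<times> ess_support h2 \<subseteq> {p. fst p ~= snd p}" using sep r by fastforce
   show ?thesis unfolding is_weighted_Op_def using U sub k op'[OF U sub k] by blast
  qed
  have uniq: "T = T0" if "is_weighted_Op 1 t h1 a h2 T" for T
  proof -
   obtain U k where U: "open U" "ess_support h1 \<times> ess_support h2 \<subseteq> U" "Op_kernel_on U 1 t a k"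
    and T: "is_integral_operator (%x y. h1 x * k (x, y) * h2 y) T" using \<open>is_weighted_Op 1 t h1 a h2 T\<close> unfolding is_weighted_Op_def by blast
   show ?thesis by (rule is_integral_operator_cong[OF T op'[OF U]]) simp
  qed
  have nonneg: "0 <= H" "0 <= L"
  proof -
   have "0 <= lattice_norm_inf 2 h1" "0 <= lattice_norm_inf 2 h2"
    using order_trans[OF norm_ge_zero localized_L2(2)[OF h(1) eps, of "%_. 1"]]
    order_trans[OF norm_ge_zero localized_L2(2)[OF h(2) eps, of "%_. 1"]] by simp_all
   then show "0 <= H" by (simp add: H_def)
   show "0 <= L" by (simp add: L_def lattice_norm_def)
  qed
  have "(2 * (H powr q * (W0 * bound))) powr (1 / q)
   = (2 * (S * (K1 * K2 * (R * R))) * (H * ((2 / eps) ^ m * r powr (- real m) * r powr (d / q)) * L * (A1 * A2)) powr q) powr (1 / q)"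
  proof -
   have "r ^ DIM('v) = (r powr (d / q)) powr q" using r q by (simp add: powr_powr d_def powr_realpow)
   then show ?thesis
    using nonneg A1 A2 eps r by (simp add: W0_def bound_def weight_sum_def R_def L_def powr_mult mult_ac)
  qed
  also have "... = (2 * (S * (K1 * K2 * (R * R)))) powr (1 / q) * (H * ((2 / eps) ^ m * r powr (- real m) * r powr (d / q)) * L * (A1 * A2))"
   using nonneg A1 A2 eps S0 K1(1) K2(1) q by (simp add: powr_mult powr_powr)
  also have "... = C * r powr (d / q - real m) * H * L"
   by (simp add: C_def powr_diff powr_minus divide_inverse mult_ac)
  also have "... <= (C + 1) * r powr (d / q - real m) * H * L"
   using nonneg by (intro mult_right_mono) auto
  finally have bd: "schatten_norm q T0 <= (C + 1) * r powr (real DIM('v) / q - real m) * lattice_norm_inf 2 h1 * lattice_norm_inf 2 h2 * lattice_norm 1 q F"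
   using T0(2) by (simp add: H_def L_def d_def mult.assoc)
  show "(\<exists>T. is_weighted_Op 1 t h1 a h2 T) &
   (\<forall>T. is_weighted_Op 1 t h1 a h2 T --> T \<in> schatten_class q &
    schatten_norm q T <= (C + 1) * r powr (real DIM('v) / q - real m) * lattice_norm_inf 2 h1 * lattice_norm_inf 2 h2 * lattice_norm 1 q F)"
   using ex uniq T0(1) bd by blast
 qed
qed

theorem theorem2p6:
  fixes q :: real and n :: nat
  assumes "0 < q" and "q \<le> 1"
    and "n = nat \<lfloor>real CARD('d::finite) / q\<rfloor> + 1"
  shows
    "(\<exists>C>0. \<forall>(h\<^sub>1::real^'d \<Rightarrow> complex) (h\<^sub>2::real^'d \<Rightarrow> complex)
        (a::(real^'d) \<times> (real^'d) \<Rightarrow> complex) (t::real).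
        in_lattice_space_inf 2 h\<^sub>1 \<longrightarrow> in_lattice_space_inf 2 h\<^sub>2 \<longrightarrow>
        (\<forall>k\<le>n. \<forall>l\<le>n. symbol_cont_derivs k l a) \<longrightarrow>
        in_lattice_space 1 q (F_full n n a) \<longrightarrow>
        0 \<le> t \<longrightarrow> t \<le> 1 \<longrightarrow>
        (\<exists>T. is_weighted_Op 1 t h\<^sub>1 a h\<^sub>2 T) \<and>
        (\<forall>T. is_weighted_Op 1 t h\<^sub>1 a h\<^sub>2 T \<longrightarrow>
           T \<in> schatten_class q \<and>
           schatten_norm q T
             \<le> C * lattice_norm_inf 2 h\<^sub>1 * lattice_norm_inf 2 h\<^sub>2 * lattice_norm 1 q (F_full n n a)))
     \<and>
     (\<forall>m\<ge>n. \<exists>C>0. \<forall>(h\<^sub>1::real^'d \<Rightarrow> complex) (h\<^sub>2::real^'d \<Rightarrow> complex)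
        (a::(real^'d) \<times> (real^'d) \<Rightarrow> complex) (t::real) (r::real).
        in_lattice_space_inf 2 h\<^sub>1 \<longrightarrow> in_lattice_space_inf 2 h\<^sub>2 \<longrightarrow>
        1 \<le> r \<longrightarrow> (\<forall>x\<in>ess_support h\<^sub>1. \<forall>y\<in>ess_support h\<^sub>2. r \<le> dist x y) \<longrightarrow>
        (\<forall>l\<le>m. symbol_cont_derivs 0 l a) \<longrightarrow> (\<forall>k\<le>n. symbol_cont_derivs k m a) \<longrightarrow>
        in_lattice_space 1 q (F_circ n m a) \<longrightarrow>
        0 \<le> t \<longrightarrow> t \<le> 1 \<longrightarrow>
        (\<exists>T. is_weighted_Op 1 t h\<^sub>1 a h\<^sub>2 T) \<and>
        (\<forall>T. is_weighted_Op 1 t h\<^sub>1 a h\<^sub>2 T \<longrightarrow>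
           T \<in> schatten_class q \<and>
           schatten_norm q T
             \<le> C * r powr (real CARD('d) / q - real m) *
                lattice_norm_inf 2 h\<^sub>1 * lattice_norm_inf 2 h\<^sub>2 * lattice_norm 1 q (F_circ n m a)))"
proof -
 have "real CARD('d) / q < real n" unfolding assms(3) by linarith
 then have n: "real DIM(real^'d) < n * q" using assms(1) by (simp add: pos_divide_less_eq)
 have "real n * q <= real n * 1" using assms by (intro mult_left_mono) auto
 then have n': "DIM(real^'d) < n" using n by simp
 show ?thesis
 proof (intro conjI allI impI, goal_cases)
  case 1
  obtain C where C: "0 < C" and main: "schatten_estimate TYPE(real^'d) q n n C"
   using weighted_Op_bound[OF assms(1,2) n order_refl] by blast
  show ?case
  proof (intro exI[of _ C] conjI[of "0 < C"] C allI impI, goal_cases)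
   case (1 h1 h2 a t)
   note s = 1(3)
   have Fc: "continuous_on UNIV (F_full n n a)"
    unfolding F_full_def[abs_def] using s by (intro continuous_on_sum continuous_on_F_circ) auto
   have F0: "0 <= F_full n n a p" for p unfolding F_full_def by (intro sum_nonneg F_circ_nonneg)
   have Fi: "integrable lborel (F_full n n a)" by (rule integrable_of_lattice_space[OF Fc F0 assms(1,2) 1(4)])
   have ch: "xi_chain n i (%l. xi_deriv a (replicate l i)) & xi_deriv a (replicate 0 i) = a &
    dominated (xi_deriv a (replicate n i)) & w_chain n (xi_deriv a (replicate n i)) (F_full n n a)" if "i \<in> Basis" for i
    using symbol_chains[OF n' _ _ Fc F_circ_le_F_full[OF order_refl] Fi that] s by (simp add: mixed_dirs_def iter_deriv_def)
   have "w_chain n (xi_deriv a []) (F_full n n a)"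
    using s by (intro w_chain_iter_deriv[where m = 0] Fc F_circ_le_F_full) (auto simp: basis_lists_def)
   then have w0: "w_chain n a (F_full n n a)" by (simp add: mixed_dirs_def iter_deriv_def)
   have "dominated a" by (rule dominated_of_w_chain[OF n' w0 Fi F0])
   with main[unfolded schatten_estimate_def, rule_format, where r = 1 and F = "F_full n n a" and B = "%i l. xi_deriv a (replicate l i)"
    and ?b0.0 = a and ?om0.0 = 1, OF 1(1,2,5,6) order_refl F0 1(4) ch w0]
   show ?case by simp
  qed
 next
  case (2 m)
  obtain C where C: "0 < C" and main: "schatten_estimate TYPE(real^'d) q n m C"
   using weighted_Op_bound[OF assms(1,2) n 2] by blast
  show ?case
  proof (intro exI[of _ C] conjI[of "0 < C"] C allI impI, goal_cases)
   case (1 h1 h2 a t r)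
   have Fc: "continuous_on UNIV (F_circ n m a)" using 1(6) by (intro continuous_on_F_circ) auto
   have Fi: "integrable lborel (F_circ n m a)" by (rule integrable_of_lattice_space[OF Fc F_circ_nonneg assms(1,2) 1(7)])
   have ch: "xi_chain m i (%l. xi_deriv a (replicate l i)) & xi_deriv a (replicate 0 i) = a &
    dominated (xi_deriv a (replicate m i)) & w_chain n (xi_deriv a (replicate m i)) (F_circ n m a)" if "i \<in> Basis" for i
    using symbol_chains[OF n' _ _ Fc order_refl Fi that] 1(5,6) by (simp add: mixed_dirs_def iter_deriv_def)
   obtain i0 :: "real^'d" where i0: "i0 \<in> Basis" using nonempty_Basis by blast
   have w0: "w_chain n (xi_deriv a (replicate m i0)) (F_circ n m a)" using ch[OF i0] by blast
   from main[unfolded schatten_estimate_def, rule_format, where r = r and F = "F_circ n m a" and B = "%i l. xi_deriv a (replicate l i)"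
    and ?om0.0 = 0, OF 1(1,2,8,9,3) F_circ_nonneg 1(7) ch w0] 1(4)
   show ?case by simp
  qed
 qed
qed

end
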